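(* Let $\Omega\subset\mathbb{R}^3$ be a simply connected bounded smooth domain whose boundary $\partial\Omega$ has a finite number of 2-dimensional connected components. Let $M>0$, $q\in(3,6)$, $\hat\rho>2$, $\hat\theta>1$, and suppose that $(\rho_0,u_0,\theta_0)$, with $\frac1{|\Omega|}\int_\Omega\rho_0dx=1$, satisfies $$\rho_0\in W^{2,q},\quad u_0\in H^2_\omega,\quad\theta_0\in\{f\in H^1:\nabla f\cdot n=0\text{ on }\partial\Omega\},$$ $$0\le\inf\rho_0\le\sup\rho_0<\hat\rho,\quad0\le\inf\theta_0\le\sup\theta_0\le\hat\theta,\quad\|\nabla u_0\|_{L^2}\le M,$$ $$-\mu\Delta u_0-(\mu+\lambda)\nabla\mathrm{div}u_0+R\nabla(\rho_0\theta_0)=\sqrt{\rho_0}g\ \text{ with }g\in L^2,$$ and $C_0\le\varepsilon$, where $\varepsilon$ is the constant described in the context. Assume further that there exists some point $x_0\in\Omega$ such that $\rho_0(x_0)=0$. Then for any $\hat p>3$ there exists some positive constant $C$ depending on $\mu,\lambda,\kappa,R,\gamma,\hat\rho,\hat\theta,\Omega,\hat p$ and $M$ such that the unique global classical solution $(\rho,u,\theta)$ to the problem (NS) described in the context satisfies, for any $t\ge1$, $$\|\nabla\rho(\cdot,t)\|_{L^{\hat p}}\ge Ce^{Ct}.$$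
   Context: Constants: $\mu>0$, $2\mu+3\lambda\ge0$, $\kappa>0$, $R>0$, $\gamma>1$. $n$ is the unit outward normal on $\partial\Omega$. Problem (NS): find $(\rho,u,\theta)$ with $$\rho_t+\mathrm{div}(\rho u)=0,\qquad\rho(u_t+u\cdot\nabla u)=\mu\Delta u+(\mu+\lambda)\nabla(\mathrm{div}u)-\nabla P,$$ $$\tfrac R{\gamma-1}\rho(\theta_t+u\cdot\nabla\theta)=\kappa\Delta\theta-P\,\mathrm{div}u+\lambda(\mathrm{div}u)^2+2\mu|\mathfrak D(u)|^2,$$ $P=R\rho\theta$, $\mathfrak D(u)=(\nabla u+(\nabla u)^{\mathrm{tr}})/2$, initial data $(\rho,\rho u,\rho\theta)|_{t=0}=(\rho_0,\rho_0u_0,\rho_0\theta_0)$ in $\Omega$, boundary conditions $u\cdot n=0$, $\mathrm{curl}u\times n=0$, $\nabla\theta\cdot n=0$ on $\partial\Omega$. $L^p,W^{k,p},H^k$ are the usual spaces on $\Omega$; $H^2_\omega=\{f\in H^2:f\cdot n=0,\ \mathrm{curl}f\times n=0\text{ on }\partial\Omega\}$. Initial energy: $$C_0=\frac12\int_\Omega\rho_0|u_0|^2dx+R\int_\Omega(1+\rho_0\log\rho_0-\rho_0)dx+\frac R{\gamma-1}\int_\Omega\rho_0(\theta_0-\log\theta_0-1)dx$$ (with $0\log0=0$, last integrand read as $0$ where $\rho_0=0$). The constant $\varepsilon>0$, depending only on $\mu,\lambda,\kappa,R,\gamma,\hat\rho,\hat\theta,\Omega,M$, is a constant (known to exist) with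 the following property. Let $\Omega\subset\mathbb{R}^3$ be a simply connected bounded smooth domain whose boundary has a finite number of 2-dimensional connected components, and let $M>0$, $q\in(3,6)$, $\hat\rho>2$, $\hat\theta>1$. Then for all data $(\rho_0,u_0,\theta_0)$ with $\frac1{|\Omega|}\int_\Omega\rho_0dx=1$ satisfying $\rho_0\in W^{2,q}$, $u_0\in H^2_\omega$, $\theta_0\in\{f\in H^1:\nabla f\cdot n=0\text{ on }\partial\Omega\}$, $0\le\inf\rho_0\le\sup\rho_0<\hat\rho$, $0\le\inf\theta_0\le\sup\theta_0\le\hat\theta$, $\|\nabla u_0\|_{L^2}\le M$, the compatibility condition $-\mu\Delta u_0-(\mu+\lambda)\nabla\mathrm{div}u_0+R\nabla(\rho_0\theta_0)=\sqrt{\rho_0}g$ with some $g\in L^2$, and $C_0\le\varepsilon$ (no point $x_0$ with $\rho_0(x_0)=0$ being required), problem (NS) has a unique global classical solution in $\Omega\times(0,\infty)$ with $0\le\rho\le2\hat\rho$, $\theta\ge0$ and, for any $0<\tau<T<\infty$, $\tilde p\in[1,6)$: $\rho\in C([0,T];W^{2,q})$; $u\in C([0,T];W^{1,\tilde p})\cap L^\infty(0,T;H^2)\cap L^\infty(\tau,T;W^{3,q})$; $\theta\in L^\infty(\tau,T;H^4)\cap C([\tau,T];W^{3,\tilde p})$; $u_t\in L^2(0,T;H^1)\cap L^\infty(\tau,T;H^2)\cap H^1(\tau,T;H^1)$; $\theta_t\in L^\infty(\tau,T;H^2)\cap H^1(\tau,T;H^1)$; and for any $p\in[1,\infty)$,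 $r\in[1,6]$ there are positive constants $C,\alpha_0$ depending only on $\mu,\lambda,\kappa,R,\gamma,\hat\rho,\hat\theta,\Omega,p,r,M$ and a constant $\theta_\infty>0$ with $\|\rho-1\|_{L^p}+\|u\|_{W^{1,r}}^2+\|\theta-\theta_\infty\|_{H^2}^2\le Ce^{-\alpha_0t}$ for $t\ge1$. This solution is the one referred to in the claim. *)

theory Defs
  imports "HOL-Analysis.Analysis"
begin

section \<open>Differential operators and smooth functions\<close>

definition pd :: "3 \<Rightarrow> (real^3 \<Rightarrow> 'b::real_normed_vector) \<Rightarrow> real^3 \<Rightarrow> 'b" where
  "pd i f x = frechet_derivative f (at x) (axis i 1)"

text \<open>The first-order operators take the partial derivative \<open>D\<close> as an argument: below they are used both
  with the classical derivative \<open>pd\<close> and with the weak derivative \<open>wpd \<Omega>\<close>.\<close>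

definition grad :: "(3 \<Rightarrow> (real^3 \<Rightarrow> real) \<Rightarrow> real^3 \<Rightarrow> real) \<Rightarrow> (real^3 \<Rightarrow> real) \<Rightarrow> real^3 \<Rightarrow> real^3" where
  "grad D f x = (\<chi> i. D i f x)"

definition divg :: "(3 \<Rightarrow> (real^3 \<Rightarrow> real^3) \<Rightarrow> real^3 \<Rightarrow> real^3) \<Rightarrow> (real^3 \<Rightarrow> real^3) \<Rightarrow> real^3 \<Rightarrow> real" where
  "divg D u x = (\<Sum>i\<in>UNIV. D i u x $ i)"

definition curl :: "(3 \<Rightarrow> (real^3 \<Rightarrow> real^3) \<Rightarrow> real^3 \<Rightarrow> real^3) \<Rightarrow> (real^3 \<Rightarrow> real^3) \<Rightarrow> real^3 \<Rightarrow> real^3" where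
  "curl D u x = vector [D 2 u x $ 3 - D 3 u x $ 2, D 3 u x $ 1 - D 1 u x $ 3, D 1 u x $ 2 - D 2 u x $ 1]"

definition lap :: "(3 \<Rightarrow> (real^3 \<Rightarrow> 'b::real_normed_vector) \<Rightarrow> real^3 \<Rightarrow> 'b) \<Rightarrow> (real^3 \<Rightarrow> 'b) \<Rightarrow> real^3 \<Rightarrow> 'b" where
  "lap D f x = (\<Sum>i\<in>UNIV. D i (D i f) x)"

definition adv :: "(real^3 \<Rightarrow> real^3) \<Rightarrow> (real^3 \<Rightarrow> 'b::real_normed_vector) \<Rightarrow> real^3 \<Rightarrow> 'b" where
  "adv u f x = (\<Sum>i\<in>UNIV. u x $ i *\<^sub>R pd i f x)"

text \<open>\<open>|\<DD>(u)|\<^sup>2\<close>, with \<open>\<DD>(u)\<close> the symmetric part of the velocity gradient.\<close>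
definition deform_sq :: "(real^3 \<Rightarrow> real^3) \<Rightarrow> real^3 \<Rightarrow> real" where
  "deform_sq u x = (\<Sum>i\<in>UNIV. \<Sum>j\<in>UNIV. ((pd i u x $ j + pd j u x $ i) / 2)\<^sup>2)"

definition Dt :: "(real \<Rightarrow> real^3 \<Rightarrow> 'b::real_normed_vector) \<Rightarrow> real \<Rightarrow> real^3 \<Rightarrow> 'b" where
  "Dt f t x = vector_derivative (\<lambda>s. f s x) (at t)"

text \<open>\<open>Ck_on k S f\<close>, used for open \<open>S\<close>, is \<open>f \<in> C\<^sup>k(S)\<close>.\<close>
primrec Ck_on :: "nat \<Rightarrow> (real^3) set \<Rightarrow> (real^3 \<Rightarrow> 'b::real_normed_vector) \<Rightarrow> bool" where
  "Ck_on 0 S f \<longleftrightarrow> continuous_on S f"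
| "Ck_on (Suc k) S f \<longleftrightarrow> (\<forall>x\<in>S. f differentiable (at x)) \<and> (\<forall>i. Ck_on k S (pd i f))"

definition smooth_on :: "(real^3) set \<Rightarrow> (real^3 \<Rightarrow> 'b::real_normed_vector) \<Rightarrow> bool" where
  "smooth_on S f \<longleftrightarrow> (\<forall>k. Ck_on k S f)"

definition test_fun :: "(real^3) set \<Rightarrow> (real^3 \<Rightarrow> real) set" where
  "test_fun \<Omega> = {\<phi>. smooth_on UNIV \<phi> \<and> compact (closure {x. \<phi> x \<noteq> 0}) \<and> closure {x. \<phi> x \<noteq> 0} \<subseteq> \<Omega>}"

definition time_test_fun :: "real \<Rightarrow> real \<Rightarrow> (real \<Rightarrow> real) set" where
  "time_test_fun a b = {\<eta>. (\<forall>k t. (deriv ^^ k) \<eta> field_differentiable (at t)) \<and>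
     compact (closure {t. \<eta> t \<noteq> 0}) \<and> closure {t. \<eta> t \<noteq> 0} \<subseteq> {a<..<b}}"

section \<open>Lebesgue and Sobolev spaces\<close>

text \<open>Elements of these spaces are represented by functions, of which only the values on \<open>\<Omega>\<close> matter and
  only up to null sets. The norms are meaningful for members of the corresponding space only, so membership
  is always required alongside.\<close>

definition Lp :: "(real^3) set \<Rightarrow> real \<Rightarrow> (real^3 \<Rightarrow> 'b::euclidean_space) set" where
  "Lp \<Omega> p = {f. f \<in> borel_measurable (lebesgue_on \<Omega>) \<and> integrable (lebesgue_on \<Omega>) (\<lambda>x. norm (f x) powr p)}"

definition Lp_norm :: "(real^3) set \<Rightarrow> real \<Rightarrow> (real^3 \<Rightarrow> 'b::euclidean_space) \<Rightarrow> real" where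
  "Lp_norm \<Omega> p f = (LINT x|lebesgue_on \<Omega>. norm (f x) powr p) powr (1 / p)"

definition loc_integrable :: "(real^3) set \<Rightarrow> (real^3 \<Rightarrow> 'b::euclidean_space) \<Rightarrow> bool" where
  "loc_integrable \<Omega> f \<longleftrightarrow> (\<forall>K. compact K \<and> K \<subseteq> \<Omega> \<longrightarrow> f absolutely_integrable_on K)"

text \<open>Multi-indices are elements \<open>\<alpha>\<close> of \<open>nat^3\<close>; the first-order ones are \<open>axis i 1\<close>.\<close>

definition mi_order :: "nat^3 \<Rightarrow> nat" where
  "mi_order \<alpha> = (\<Sum>i\<in>UNIV. \<alpha> $ i)"

lemma finite_mi_order_le: "finite {\<alpha>. mi_order \<alpha> \<le> k}"
proof -
  have "{\<alpha>. mi_order \<alpha> \<le> k} \<subseteq> vec_lambda ` (PiE UNIV (\<lambda>_. {..k}))"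
  proof
    fix \<alpha> :: "nat^3" assume a: "\<alpha> \<in> {\<alpha>. mi_order \<alpha> \<le> k}"
    have "\<alpha> $ i \<le> k" for i
      using a member_le_sum[of i UNIV "\<lambda>i. \<alpha> $ i"] by (auto simp: mi_order_def)
    then have "vec_nth \<alpha> \<in> PiE UNIV (\<lambda>_. {..k})" by auto
    then show "\<alpha> \<in> vec_lambda ` (PiE UNIV (\<lambda>_. {..k}))"
      by (metis image_eqI vec_nth_inverse)
  qed
  then show ?thesis
    by (rule finite_subset) (auto intro!: finite_imageI finite_PiE)
qed

definition pd_multi :: "nat^3 \<Rightarrow> (real^3 \<Rightarrow> real) \<Rightarrow> real^3 \<Rightarrow> real" where
  "pd_multi \<alpha> \<phi> = (pd 1 ^^ (\<alpha> $ 1)) ((pd 2 ^^ (\<alpha> $ 2)) ((pd 3 ^^ (\<alpha> $ 3)) \<phi>))"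

definition has_weak_deriv ::
  "(real^3) set \<Rightarrow> nat^3 \<Rightarrow> (real^3 \<Rightarrow> 'b::euclidean_space) \<Rightarrow> (real^3 \<Rightarrow> 'b) \<Rightarrow> bool" where
  "has_weak_deriv \<Omega> \<alpha> f g \<longleftrightarrow> loc_integrable \<Omega> f \<and> loc_integrable \<Omega> g \<and>
     (\<forall>\<phi>\<in>test_fun \<Omega>. (LINT x|lebesgue_on \<Omega>. pd_multi \<alpha> \<phi> x *\<^sub>R f x) =
        (-1) ^ mi_order \<alpha> *\<^sub>R (LINT x|lebesgue_on \<Omega>. \<phi> x *\<^sub>R g x))"

definition wderiv :: "(real^3) set \<Rightarrow> nat^3 \<Rightarrow> (real^3 \<Rightarrow> 'b::euclidean_space) \<Rightarrow> real^3 \<Rightarrow> 'b" where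
  "wderiv \<Omega> \<alpha> f = (SOME g. has_weak_deriv \<Omega> \<alpha> f g)"

definition wpd :: "(real^3) set \<Rightarrow> 3 \<Rightarrow> (real^3 \<Rightarrow> 'b::euclidean_space) \<Rightarrow> real^3 \<Rightarrow> 'b" where
  "wpd \<Omega> i f = wderiv \<Omega> (axis i 1) f"

text \<open>\<open>W\<^sup>k\<^sup>,\<^sup>p(\<Omega>)\<close>, and \<open>H\<^sup>k(\<Omega>)\<close> for \<open>p = 2\<close>.\<close>
definition Sob :: "(real^3) set \<Rightarrow> nat \<Rightarrow> real \<Rightarrow> (real^3 \<Rightarrow> 'b::euclidean_space) set" where
  "Sob \<Omega> k p = {f \<in> Lp \<Omega> p. \<forall>\<alpha>. mi_order \<alpha> \<le> k \<longrightarrow> (\<exists>g\<in>Lp \<Omega> p. has_weak_deriv \<Omega> \<alpha> f g)}"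

definition sob_norm :: "(real^3) set \<Rightarrow> nat \<Rightarrow> real \<Rightarrow> (real^3 \<Rightarrow> 'b::euclidean_space) \<Rightarrow> real" where
  "sob_norm \<Omega> k p f =
     (\<Sum>\<alpha> | mi_order \<alpha> \<le> k. LINT x|lebesgue_on \<Omega>. norm (wderiv \<Omega> \<alpha> f x) powr p) powr (1 / p)"

section \<open>Spaces of functions of time with values in Sobolev spaces\<close>

text \<open>Since the Sobolev spaces that occur are separable and reflexive, strong measurability of
  \<open>t \<mapsto> f t\<close> amounts to joint measurability of \<open>(t, x) \<mapsto> f t x\<close>.\<close>
definition jointly_measurable :: "(real^3) set \<Rightarrow> real \<Rightarrow> real \<Rightarrow> (real \<Rightarrow> real^3 \<Rightarrow> 'b::euclidean_space) \<Rightarrow> bool" where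
  "jointly_measurable \<Omega> a b f \<longleftrightarrow> (\<lambda>(t, x). f t x) \<in> borel_measurable (lebesgue_on ({a<..<b} \<times> \<Omega>))"

text \<open>\<open>C([a,b]; W\<^sup>k\<^sup>,\<^sup>p)\<close>\<close>
definition C_Sob :: "(real^3) set \<Rightarrow> real \<Rightarrow> real \<Rightarrow> nat \<Rightarrow> real \<Rightarrow> (real \<Rightarrow> real^3 \<Rightarrow> 'b::euclidean_space) set" where
  "C_Sob \<Omega> a b k p = {f. \<forall>t\<in>{a..b}. f t \<in> Sob \<Omega> k p \<and>
     ((\<lambda>s. sob_norm \<Omega> k p (\<lambda>x. f s x - f t x)) \<longlongrightarrow> 0) (at t within {a..b})}"

text \<open>\<open>L\<^sup>\<infinity>(a,b; W\<^sup>k\<^sup>,\<^sup>p)\<close>\<close>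
definition Linf_Sob :: "(real^3) set \<Rightarrow> real \<Rightarrow> real \<Rightarrow> nat \<Rightarrow> real \<Rightarrow> (real \<Rightarrow> real^3 \<Rightarrow> 'b::euclidean_space) set" where
  "Linf_Sob \<Omega> a b k p = {f. jointly_measurable \<Omega> a b f \<and>
     (\<exists>B. AE t in lebesgue_on {a<..<b}. f t \<in> Sob \<Omega> k p \<and> sob_norm \<Omega> k p (f t) \<le> B)}"

text \<open>\<open>L\<^sup>2(a,b; W\<^sup>k\<^sup>,\<^sup>p)\<close>\<close>
definition L2_Sob :: "(real^3) set \<Rightarrow> real \<Rightarrow> real \<Rightarrow> nat \<Rightarrow> real \<Rightarrow> (real \<Rightarrow> real^3 \<Rightarrow> 'b::euclidean_space) set" where
  "L2_Sob \<Omega> a b k p = {f. jointly_measurable \<Omega> a b f \<and>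
     (AE t in lebesgue_on {a<..<b}. f t \<in> Sob \<Omega> k p) \<and>
     integrable (lebesgue_on {a<..<b}) (\<lambda>t. (sob_norm \<Omega> k p (f t))\<^sup>2)}"

text \<open>\<open>H\<^sup>1(a,b; W\<^sup>k\<^sup>,\<^sup>p)\<close>\<close>
definition H1_Sob :: "(real^3) set \<Rightarrow> real \<Rightarrow> real \<Rightarrow> nat \<Rightarrow> real \<Rightarrow> (real \<Rightarrow> real^3 \<Rightarrow> 'b::euclidean_space) set" where
  "H1_Sob \<Omega> a b k p = {f \<in> L2_Sob \<Omega> a b k p. \<exists>g\<in>L2_Sob \<Omega> a b k p.
     \<forall>\<eta>\<in>time_test_fun a b. \<forall>\<phi>\<in>test_fun \<Omega>.
       (LINT t|lebesgue_on {a<..<b}. LINT x|lebesgue_on \<Omega>. (deriv \<eta> t * \<phi> x) *\<^sub>R f t x) =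
       - (LINT t|lebesgue_on {a<..<b}. LINT x|lebesgue_on \<Omega>. (\<eta> t * \<phi> x) *\<^sub>R g t x)}"

section \<open>Smooth bounded domains and boundary conditions\<close>

definition boundary_chart :: "(real^3) set \<Rightarrow> real^3 \<Rightarrow> (real^3) set \<Rightarrow> (real^3 \<Rightarrow> real) \<Rightarrow> bool" where
  "boundary_chart \<Omega> x U \<psi> \<longleftrightarrow> open U \<and> x \<in> U \<and> smooth_on U \<psi> \<and> (\<forall>y\<in>U. grad pd \<psi> y \<noteq> 0) \<and>
     \<Omega> \<inter> U = {y \<in> U. \<psi> y < 0}"

text \<open>In particular the boundary is an embedded smooth surface, so that all its components are
  2-dimensional.\<close>
definition smooth_bounded_domain :: "(real^3) set \<Rightarrow> bool" where
  "smooth_bounded_domain \<Omega> \<longleftrightarrow> open \<Omega> \<and> connected \<Omega> \<and> bounded \<Omega> \<and> \<Omega> \<noteq> {} \<and>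
     (\<forall>x\<in>frontier \<Omega>. \<exists>U \<psi>. boundary_chart \<Omega> x U \<psi>)"

text \<open>The unit outward normal, which does not depend on the chart.\<close>
definition nrml :: "(real^3) set \<Rightarrow> real^3 \<Rightarrow> real^3" where
  "nrml \<Omega> x = (THE n. \<exists>U \<psi>. boundary_chart \<Omega> x U \<psi> \<and> n = grad pd \<psi> x /\<^sub>R norm (grad pd \<psi> x))"

text \<open>Sets of vanishing two-dimensional Hausdorff (equivalently, surface) measure.\<close>
definition surface_null :: "(real^3) set \<Rightarrow> bool" where
  "surface_null N \<longleftrightarrow> (\<forall>e>0. \<exists>V :: nat \<Rightarrow> (real^3) set. N \<subseteq> (\<Union>i. V i) \<and> (\<forall>i. bounded (V i)) \<and>
     summable (\<lambda>i. (diameter (V i))\<^sup>2) \<and> (\<Sum>i. (diameter (V i))\<^sup>2) < e)"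

text \<open>Boundary condition in the sense of traces, for functions defined almost everywhere in \<open>\<Omega>\<close>: the trace
  of \<open>G x\<close> at \<open>x \<in> \<partial>\<Omega>\<close> is zero for almost every \<open>x\<close>, where the trace is the Lebesgue
  boundary value, i.e. the limit of averages over \<open>\<Omega> \<inter> ball x r\<close> as \<open>r\<close> tends to 0. For Sobolev functions this
  is the usual trace; it is also meaningful for the gradient of an \<open>H\<^sup>1\<close> function, which is only in \<open>L\<^sup>2\<close>.
  The dependence of \<open>G\<close> on \<open>x\<close> accommodates products with the normal at \<open>x\<close>.\<close>
definition trace_zero :: "(real^3) set \<Rightarrow> (real^3 \<Rightarrow> real^3 \<Rightarrow> 'b::euclidean_space) \<Rightarrow> bool" where
  "trace_zero \<Omega> G \<longleftrightarrow> (\<exists>N. surface_null N \<and> (\<forall>x\<in>frontier \<Omega> - N.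
     ((\<lambda>r. (LINT y|lebesgue_on (\<Omega> \<inter> ball x r). norm (G x y)) / measure lebesgue (\<Omega> \<inter> ball x r)) \<longlongrightarrow> 0)
       (at_right 0)))"

definition H2_omega :: "(real^3) set \<Rightarrow> (real^3 \<Rightarrow> real^3) set" where
  "H2_omega \<Omega> = {f \<in> Sob \<Omega> 2 2. trace_zero \<Omega> (\<lambda>x y. f y \<bullet> nrml \<Omega> x) \<and>
     trace_zero \<Omega> (\<lambda>x y. cross3 (curl (wpd \<Omega>) f y) (nrml \<Omega> x))}"

definition H1_neumann :: "(real^3) set \<Rightarrow> (real^3 \<Rightarrow> real) set" where
  "H1_neumann \<Omega> = {f \<in> Sob \<Omega> 1 2. trace_zero \<Omega> (\<lambda>x y. grad (wpd \<Omega>) f y \<bullet> nrml \<Omega> x)}"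

section \<open>The initial data\<close>

text \<open>The three integrands are nonnegative for \<open>\<rho>0, \<theta>0 \<ge> 0\<close>. The last one is \<open>\<infinity>\<close> where
  \<open>\<theta>0 = 0 < \<rho>0\<close>, because \<open>- log 0 = \<infinity>\<close> there (whereas \<open>ln 0 = 0\<close> in HOL).\<close>
definition initial_energy ::
  "real \<Rightarrow> real \<Rightarrow> (real^3) set \<Rightarrow> (real^3 \<Rightarrow> real) \<Rightarrow> (real^3 \<Rightarrow> real^3) \<Rightarrow> (real^3 \<Rightarrow> real) \<Rightarrow> ennreal" where
  "initial_energy R \<gamma> \<Omega> \<rho>0 u0 \<theta>0 =
     ennreal (1 / 2) * (\<integral>\<^sup>+ x. ennreal (\<rho>0 x * (norm (u0 x))\<^sup>2) \<partial>lebesgue_on \<Omega>) +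
     ennreal R * (\<integral>\<^sup>+ x. ennreal (1 + \<rho>0 x * ln (\<rho>0 x) - \<rho>0 x) \<partial>lebesgue_on \<Omega>) +
     ennreal (R / (\<gamma> - 1)) *
       (\<integral>\<^sup>+ x. (if \<rho>0 x = 0 then 0 else if \<theta>0 x \<le> 0 then \<infinity>
               else ennreal (\<rho>0 x * (\<theta>0 x - ln (\<theta>0 x) - 1))) \<partial>lebesgue_on \<Omega>)"

text \<open>\<open>\<rho>0 \<in> W\<^sup>2\<^sup>,\<^sup>q\<close>, \<open>q > 3\<close>, is represented by its continuous version, so that pointwise values make sense.\<close>
definition admissible_data ::
  "real \<Rightarrow> real \<Rightarrow> real \<Rightarrow> (real^3) set \<Rightarrow> real \<Rightarrow> real \<Rightarrow> real \<Rightarrow> real \<Rightarrow>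
   (real^3 \<Rightarrow> real) \<Rightarrow> (real^3 \<Rightarrow> real^3) \<Rightarrow> (real^3 \<Rightarrow> real) \<Rightarrow> bool" where
  "admissible_data \<mu> lam R \<Omega> M \<rho>hat \<theta>hat q \<rho>0 u0 \<theta>0 \<longleftrightarrow>
     (LINT x|lebesgue_on \<Omega>. \<rho>0 x) / measure lebesgue \<Omega> = 1 \<and>
     \<rho>0 \<in> Sob \<Omega> 2 q \<and> continuous_on \<Omega> \<rho>0 \<and> u0 \<in> H2_omega \<Omega> \<and> \<theta>0 \<in> H1_neumann \<Omega> \<and>
     (\<forall>x\<in>\<Omega>. 0 \<le> \<rho>0 x) \<and> bdd_above (\<rho>0 ` \<Omega>) \<and> (SUP x\<in>\<Omega>. \<rho>0 x) < \<rho>hat \<and>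
     (AE x in lebesgue_on \<Omega>. 0 \<le> \<theta>0 x \<and> \<theta>0 x \<le> \<theta>hat) \<and>
     Lp_norm \<Omega> 2 (\<lambda>x. sqrt (\<Sum>i\<in>UNIV. (norm (wpd \<Omega> i u0 x))\<^sup>2)) \<le> M \<and>
     (\<exists>g\<in>Lp \<Omega> 2. AE x in lebesgue_on \<Omega>.
        - (\<mu> *\<^sub>R lap (wpd \<Omega>) u0 x) - (\<mu> + lam) *\<^sub>R grad (wpd \<Omega>) (divg (wpd \<Omega>) u0) x
          + R *\<^sub>R grad (wpd \<Omega>) (\<lambda>y. \<rho>0 y * \<theta>0 y) x = sqrt (\<rho>0 x) *\<^sub>R g x)"

section \<open>Global classical solutions\<close>

definition cont_tx :: "(real^3) set \<Rightarrow> (real \<Rightarrow> real^3 \<Rightarrow> 'b::real_normed_vector) \<Rightarrow> bool" where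
  "cont_tx \<Omega> f \<longleftrightarrow> continuous_on ({0<..} \<times> \<Omega>) (\<lambda>(t, x). f t x)"

text \<open>\<open>f \<in> C\<^sup>1(\<Omega> \<times> (0,\<infinity>))\<close>\<close>
definition C1_tx :: "(real^3) set \<Rightarrow> (real \<Rightarrow> real^3 \<Rightarrow> 'b::real_normed_vector) \<Rightarrow> bool" where
  "C1_tx \<Omega> f \<longleftrightarrow>
     (\<forall>t>0. \<forall>x\<in>\<Omega>. (\<lambda>s. f s x) differentiable (at t) \<and> f t differentiable (at x)) \<and>
     cont_tx \<Omega> f \<and> cont_tx \<Omega> (Dt f) \<and> (\<forall>i. cont_tx \<Omega> (\<lambda>t. pd i (f t)))"

text \<open>\<open>C\<^sup>1\<close> in time and \<open>C\<^sup>2\<close> in space\<close>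
definition C12_tx :: "(real^3) set \<Rightarrow> (real \<Rightarrow> real^3 \<Rightarrow> 'b::real_normed_vector) \<Rightarrow> bool" where
  "C12_tx \<Omega> f \<longleftrightarrow> C1_tx \<Omega> f \<and>
     (\<forall>t>0. \<forall>x\<in>\<Omega>. \<forall>i. pd i (f t) differentiable (at x)) \<and>
     (\<forall>i j. cont_tx \<Omega> (\<lambda>t. pd j (pd i (f t))))"

definition NS_equations ::
  "real \<Rightarrow> real \<Rightarrow> real \<Rightarrow> real \<Rightarrow> real \<Rightarrow> (real^3) set \<Rightarrow>
   (real \<Rightarrow> real^3 \<Rightarrow> real) \<Rightarrow> (real \<Rightarrow> real^3 \<Rightarrow> real^3) \<Rightarrow> (real \<Rightarrow> real^3 \<Rightarrow> real) \<Rightarrow> bool" where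
  "NS_equations \<mu> lam \<kappa> R \<gamma> \<Omega> \<rho> u \<theta> \<longleftrightarrow> (\<forall>t>0. \<forall>x\<in>\<Omega>.
     Dt \<rho> t x + divg pd (\<lambda>y. \<rho> t y *\<^sub>R u t y) x = 0 \<and>
     \<rho> t x *\<^sub>R (Dt u t x + adv (u t) (u t) x) =
       \<mu> *\<^sub>R lap pd (u t) x + (\<mu> + lam) *\<^sub>R grad pd (divg pd (u t)) x - grad pd (\<lambda>y. R * \<rho> t y * \<theta> t y) x \<and>
     R / (\<gamma> - 1) * \<rho> t x * (Dt \<theta> t x + adv (u t) (\<theta> t) x) =
       \<kappa> * lap pd (\<theta> t) x - R * \<rho> t x * \<theta> t x * divg pd (u t) x
       + lam * (divg pd (u t) x)\<^sup>2 + 2 * \<mu> * deform_sq (u t) x)"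

text \<open>For \<open>t > 0\<close> the boundary conditions hold pointwise, as limits from inside \<open>\<Omega>\<close>.\<close>
definition NS_boundary ::
  "(real^3) set \<Rightarrow> (real \<Rightarrow> real^3 \<Rightarrow> real^3) \<Rightarrow> (real \<Rightarrow> real^3 \<Rightarrow> real) \<Rightarrow> bool" where
  "NS_boundary \<Omega> u \<theta> \<longleftrightarrow> (\<forall>t>0. \<forall>x\<in>frontier \<Omega>.
     ((\<lambda>y. u t y \<bullet> nrml \<Omega> x) \<longlongrightarrow> 0) (at x within \<Omega>) \<and>
     ((\<lambda>y. cross3 (curl pd (u t) y) (nrml \<Omega> x)) \<longlongrightarrow> 0) (at x within \<Omega>) \<and>
     ((\<lambda>y. grad pd (\<theta> t) y \<bullet> nrml \<Omega> x) \<longlongrightarrow> 0) (at x within \<Omega>))"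

definition attains_initially :: "(real^3) set \<Rightarrow> (real \<Rightarrow> real^3 \<Rightarrow> 'b::euclidean_space) \<Rightarrow> (real^3 \<Rightarrow> 'b) \<Rightarrow> bool" where
  "attains_initially \<Omega> f f0 \<longleftrightarrow> (\<forall>\<^sub>F t in at_right 0. (\<lambda>x. f t x - f0 x) \<in> Lp \<Omega> 2) \<and>
     ((\<lambda>t. Lp_norm \<Omega> 2 (\<lambda>x. f t x - f0 x)) \<longlongrightarrow> 0) (at_right 0)"

text \<open>Only \<open>\<rho>, \<rho>u, \<rho>\<theta>\<close> have prescribed initial values: where \<open>\<rho>0\<close> vanishes, \<open>u\<close> and \<open>\<theta>\<close> have none.\<close>
definition NS_initial ::
  "(real^3) set \<Rightarrow> (real^3 \<Rightarrow> real) \<Rightarrow> (real^3 \<Rightarrow> real^3) \<Rightarrow> (real^3 \<Rightarrow> real) \<Rightarrow>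
   (real \<Rightarrow> real^3 \<Rightarrow> real) \<Rightarrow> (real \<Rightarrow> real^3 \<Rightarrow> real^3) \<Rightarrow> (real \<Rightarrow> real^3 \<Rightarrow> real) \<Rightarrow> bool" where
  "NS_initial \<Omega> \<rho>0 u0 \<theta>0 \<rho> u \<theta> \<longleftrightarrow>
     attains_initially \<Omega> \<rho> \<rho>0 \<and>
     attains_initially \<Omega> (\<lambda>t x. \<rho> t x *\<^sub>R u t x) (\<lambda>x. \<rho>0 x *\<^sub>R u0 x) \<and>
     attains_initially \<Omega> (\<lambda>t x. \<rho> t x * \<theta> t x) (\<lambda>x. \<rho>0 x * \<theta>0 x)"

definition NS_regularity ::
  "(real^3) set \<Rightarrow> real \<Rightarrow>
   (real \<Rightarrow> real^3 \<Rightarrow> real) \<Rightarrow> (real \<Rightarrow> real^3 \<Rightarrow> real^3) \<Rightarrow> (real \<Rightarrow> real^3 \<Rightarrow> real) \<Rightarrow> bool" where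
  "NS_regularity \<Omega> q \<rho> u \<theta> \<longleftrightarrow> (\<forall>\<tau> T p. 0 < \<tau> \<and> \<tau> < T \<and> 1 \<le> p \<and> p < 6 \<longrightarrow>
     \<rho> \<in> C_Sob \<Omega> 0 T 2 q \<and>
     u \<in> C_Sob \<Omega> 0 T 1 p \<inter> Linf_Sob \<Omega> 0 T 2 2 \<inter> Linf_Sob \<Omega> \<tau> T 3 q \<and>
     \<theta> \<in> Linf_Sob \<Omega> \<tau> T 4 2 \<inter> C_Sob \<Omega> \<tau> T 3 p \<and>
     Dt u \<in> L2_Sob \<Omega> 0 T 1 2 \<inter> Linf_Sob \<Omega> \<tau> T 2 2 \<inter> H1_Sob \<Omega> \<tau> T 1 2 \<and>
     Dt \<theta> \<in> Linf_Sob \<Omega> \<tau> T 2 2 \<inter> H1_Sob \<Omega> \<tau> T 1 2)"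

definition global_classical_solution ::
  "real \<Rightarrow> real \<Rightarrow> real \<Rightarrow> real \<Rightarrow> real \<Rightarrow> (real^3) set \<Rightarrow> real \<Rightarrow> real \<Rightarrow>
   (real^3 \<Rightarrow> real) \<Rightarrow> (real^3 \<Rightarrow> real^3) \<Rightarrow> (real^3 \<Rightarrow> real) \<Rightarrow>
   (real \<Rightarrow> real^3 \<Rightarrow> real) \<Rightarrow> (real \<Rightarrow> real^3 \<Rightarrow> real^3) \<Rightarrow> (real \<Rightarrow> real^3 \<Rightarrow> real) \<Rightarrow> bool" where
  "global_classical_solution \<mu> lam \<kappa> R \<gamma> \<Omega> \<rho>hat q \<rho>0 u0 \<theta>0 \<rho> u \<theta> \<longleftrightarrow>
     C1_tx \<Omega> \<rho> \<and> C12_tx \<Omega> u \<and> C12_tx \<Omega> \<theta> \<and>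
     NS_equations \<mu> lam \<kappa> R \<gamma> \<Omega> \<rho> u \<theta> \<and> NS_boundary \<Omega> u \<theta> \<and> NS_initial \<Omega> \<rho>0 u0 \<theta>0 \<rho> u \<theta> \<and>
     NS_regularity \<Omega> q \<rho> u \<theta> \<and>
     (\<forall>t>0. \<forall>x\<in>\<Omega>. 0 \<le> \<rho> t x \<and> \<rho> t x \<le> 2 * \<rho>hat \<and> 0 \<le> \<theta> t x)"

section \<open>The smallness constant\<close>

text \<open>\<open>\<epsilon>\<close> is a constant for which the global existence theorem holds: whenever the initial energy is at most
  \<open>\<epsilon>\<close>, there is exactly one global classical solution, and it decays exponentially with constants that are
  uniform in the data and in \<open>q\<close>.\<close>
definition smallness_constant ::
  "real \<Rightarrow> real \<Rightarrow> real \<Rightarrow> real \<Rightarrow> real \<Rightarrow> (real^3) set \<Rightarrow> real \<Rightarrow> real \<Rightarrow> real \<Rightarrow> real \<Rightarrow> bool" where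
  "smallness_constant \<mu> lam \<kappa> R \<gamma> \<Omega> M \<rho>hat \<theta>hat \<epsilon> \<longleftrightarrow> 0 < \<epsilon> \<and>
     (\<forall>q \<rho>0 u0 \<theta>0. 3 < q \<and> q < 6 \<and> admissible_data \<mu> lam R \<Omega> M \<rho>hat \<theta>hat q \<rho>0 u0 \<theta>0 \<and>
        initial_energy R \<gamma> \<Omega> \<rho>0 u0 \<theta>0 \<le> ennreal \<epsilon> \<longrightarrow>
        (\<exists>\<rho> u \<theta>. global_classical_solution \<mu> lam \<kappa> R \<gamma> \<Omega> \<rho>hat q \<rho>0 u0 \<theta>0 \<rho> u \<theta>) \<and>
        (\<forall>\<rho> u \<theta> \<rho>' u' \<theta>'.
           global_classical_solution \<mu> lam \<kappa> R \<gamma> \<Omega> \<rho>hat q \<rho>0 u0 \<theta>0 \<rho> u \<theta> \<and>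
           global_classical_solution \<mu> lam \<kappa> R \<gamma> \<Omega> \<rho>hat q \<rho>0 u0 \<theta>0 \<rho>' u' \<theta>' \<longrightarrow>
           (\<forall>t>0. \<forall>x\<in>\<Omega>. \<rho> t x = \<rho>' t x \<and> u t x = u' t x \<and> \<theta> t x = \<theta>' t x))) \<and>
     (\<forall>p r. 1 \<le> p \<and> 1 \<le> r \<and> r \<le> 6 \<longrightarrow>
        (\<exists>C>0. \<exists>\<alpha>0>0. \<forall>q \<rho>0 u0 \<theta>0 \<rho> u \<theta>.
           3 < q \<and> q < 6 \<and> admissible_data \<mu> lam R \<Omega> M \<rho>hat \<theta>hat q \<rho>0 u0 \<theta>0 \<and>
           initial_energy R \<gamma> \<Omega> \<rho>0 u0 \<theta>0 \<le> ennreal \<epsilon> \<and>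
           global_classical_solution \<mu> lam \<kappa> R \<gamma> \<Omega> \<rho>hat q \<rho>0 u0 \<theta>0 \<rho> u \<theta> \<longrightarrow>
           (\<exists>\<theta>inf>0. \<forall>t\<ge>1.
              (\<lambda>x. \<rho> t x - 1) \<in> Lp \<Omega> p \<and> u t \<in> Sob \<Omega> 1 r \<and> (\<lambda>x. \<theta> t x - \<theta>inf) \<in> Sob \<Omega> 2 2 \<and>
              Lp_norm \<Omega> p (\<lambda>x. \<rho> t x - 1) + (sob_norm \<Omega> 1 r (u t))\<^sup>2
                + (sob_norm \<Omega> 2 2 (\<lambda>x. \<theta> t x - \<theta>inf))\<^sup>2 \<le> C * exp (- \<alpha>0 * t))))"

end

theory Submission
  imports Defs
begin

text \<open>
  Vacuum is transported by the flow, which is tangential to the boundary, so \<open>inf \<rho>(t) = 0\<close> for all later times,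
  whereas \<open>\<rho>(t) - 1\<close> decays exponentially in \<open>L\<^sup>1\<close>. A Morrey-type interpolation
  \<open>\<parallel>v\<parallel>\<^sub>\<infinity> \<le> C s powr (1 - 3/p) \<parallel>\<nabla>v\<parallel>\<^sub>p + C s powr (-3) \<parallel>v\<parallel>\<^sub>1\<close> for \<open>v = \<rho>(t) - 1\<close> then forces the gradient to grow exponentially.
  The delicate point is that vacuum survives from \<open>t = 0\<close> on, where \<open>u\<close> is not regular: there a lower bound on
  \<open>div u\<close>, integrable in time, is obtained from the effective viscous flux.
\<close>

text \<open>A flow map would ask for a velocity that is Lipschitz up to the boundary and up to t =
  0. Instead, minima of \<rho> plus a penalty are followed: at such a point the gradient of \<rho>
  is minus that of the penalty, and the continuity equation turns into an ordinary differential
  inequality with rate - div u. Hence near t = 0 a one-sided bound on div u and boundedness of u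
  suffice. On [\<tau>, T] the penalty is a small multiple of minus the logarithm of a boundary
  barrier; the multiple is arbitrarily small, so the outcome is inf \<rho> = 0 without a vacuum
  point, which is all that the interpolation needs. On (0, \<tau>] the penalty is a bump function of
  the distance to x0; minimisers stay in a fixed compact ball, and a genuine vacuum point at time
  \<tau> results. The viscous flux is estimated in the interior only, through averages at scale s,
  so no elliptic regularity theory enters. Conservation of mass serves the times at which the decay
  is not yet small: a density of mean 1 with values near 0 oscillates by a fixed amount, and this
  bounds its gradient below.\<close>

section \<open>Calculus of the partial derivatives \<open>pd\<close>\<close>

lemma pd_eqI: "(f has_derivative f') (at x) \<Longrightarrow> pd i f x = f' (axis i 1)"
  unfolding pd_def by (metis frechet_derivative_at)

lemma has_derivative_pd: "f differentiable at x \<Longrightarrow> (f has_derivative frechet_derivative f (at x)) (at x)"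
  by (simp add: frechet_derivative_works)

lemma frechet_derivative_pd:
  fixes f :: "real^3 \<Rightarrow> 'b::real_normed_vector"
  assumes "f differentiable at x"
  shows "frechet_derivative f (at x) h = (\<Sum>i\<in>UNIV. h $ i *\<^sub>R pd i f x)"
proof -
  have l: "linear (frechet_derivative f (at x))"
    using assms by (simp add: linear_frechet_derivative)
  have "h = (\<Sum>i\<in>UNIV. h $ i *\<^sub>R axis i 1)"
    by (simp add: vec_eq_iff axis_def if_distrib cong: if_cong)
  then have "frechet_derivative f (at x) h = frechet_derivative f (at x) (\<Sum>i\<in>UNIV. h $ i *\<^sub>R axis i 1)"
    by simp
  also have "\<dots> = (\<Sum>i\<in>UNIV. h $ i *\<^sub>R pd i f x)"
    by (simp add: linear_sum[OF l] linear_cmul[OF l] pd_def)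
  finally show ?thesis .
qed

lemma has_derivative_pd_sum:
  fixes f :: "real^3 \<Rightarrow> 'b::real_normed_vector"
  assumes "f differentiable at x"
  shows "(f has_derivative (\<lambda>h. \<Sum>i\<in>UNIV. h $ i *\<^sub>R pd i f x)) (at x)"
proof -
  have "frechet_derivative f (at x) = (\<lambda>h. \<Sum>i\<in>UNIV. h $ i *\<^sub>R pd i f x)"
    using frechet_derivative_pd[OF assms] by blast
  with has_derivative_pd[OF assms] show ?thesis by simp
qed

lemma pd_add: "f differentiable at x \<Longrightarrow> g differentiable at x \<Longrightarrow> pd i (\<lambda>x. f x + g x) x = pd i f x + pd i g x"
  by (rule pd_eqI[OF has_derivative_add[OF has_derivative_pd has_derivative_pd], THEN trans]) (auto simp: pd_def)

lemma pd_diff: "f differentiable at x \<Longrightarrow> g differentiable at x \<Longrightarrow> pd i (\<lambda>x. f x - g x) x = pd i f x - pd i g x"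
  by (rule pd_eqI[OF has_derivative_diff[OF has_derivative_pd has_derivative_pd], THEN trans]) (auto simp: pd_def)

lemma pd_sum:
  assumes "finite I" "\<And>k. k \<in> I \<Longrightarrow> f k differentiable at x"
  shows "pd i (\<lambda>x. \<Sum>k\<in>I. f k x) x = (\<Sum>k\<in>I. pd i (f k) x)"
  by (rule pd_eqI[OF has_derivative_sum[OF has_derivative_pd], THEN trans]) (use assms in \<open>auto simp: pd_def\<close>)

lemma pd_scaleR:
  fixes f :: "real^3 \<Rightarrow> real"
  assumes "f differentiable at x" "g differentiable at x"
  shows "pd i (\<lambda>x. f x *\<^sub>R g x) x = f x *\<^sub>R pd i g x + pd i f x *\<^sub>R g x"
  by (rule pd_eqI[OF has_derivative_scaleR[OF has_derivative_pd has_derivative_pd], THEN trans])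
    (use assms in \<open>auto simp: pd_def\<close>)

lemma pd_mult:
  fixes f :: "real^3 \<Rightarrow> real"
  assumes "f differentiable at x" "g differentiable at x"
  shows "pd i (\<lambda>x. f x * g x) x = f x * pd i g x + pd i f x * g x"
  using pd_scaleR[OF assms] by simp

lemma pd_const [simp]: "pd i (\<lambda>x. c) x = 0"
  by (rule pd_eqI[THEN trans, OF has_derivative_const]) simp

lemma pd_cmult:
  fixes f :: "real^3 \<Rightarrow> real"
  assumes "f differentiable at x"
  shows "pd i (\<lambda>x. c * f x) x = c * pd i f x"
  using pd_mult[of "\<lambda>_. c" x f i] assms by simp

lemma pd_bounded_linear:
  assumes "bounded_linear T" "f differentiable at x"
  shows "pd i (\<lambda>x. T (f x)) x = T (pd i f x)"
  by (rule pd_eqI[OF bounded_linear.has_derivative[OF assms(1) has_derivative_pd[OF assms(2)]], THEN trans])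
    (simp add: pd_def)

lemma pd_nth:
  fixes f :: "real^3 \<Rightarrow> real^3"
  assumes "f differentiable at x"
  shows "pd i (\<lambda>x. f x $ k) x = pd i f x $ k"
  using pd_bounded_linear[OF bounded_linear_vec_nth assms] .

lemma differentiable_nth:
  fixes f :: "'a::real_normed_vector \<Rightarrow> real^3"
  assumes "f differentiable at x"
  shows "(\<lambda>x. f x $ k) differentiable at x"
  using bounded_linear.has_derivative[OF bounded_linear_vec_nth] assms
  unfolding differentiable_def by blast

lemma pd_compose:
  fixes f :: "real^3 \<Rightarrow> real"
  assumes "f differentiable at x" "(H has_real_derivative H') (at (f x))"
  shows "(\<lambda>x. H (f x)) differentiable at x" "pd i (\<lambda>x. H (f x)) x = H' * pd i f x"
proof -
  have "((\<lambda>x. H (f x)) has_derivative (\<lambda>h. frechet_derivative f (at x) h * H')) (at x)"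
    using has_derivative_compose[OF has_derivative_pd[OF assms(1)] assms(2)[unfolded has_field_derivative_def]]
    by (simp add: mult.commute)
  then show "(\<lambda>x. H (f x)) differentiable at x" "pd i (\<lambda>x. H (f x)) x = H' * pd i f x"
    using pd_eqI by (fastforce simp: differentiable_def pd_def[of i f])+
qed

lemma pd_affine:
  fixes f :: "real^3 \<Rightarrow> real"
  assumes "f differentiable at (a + c *\<^sub>R x)"
  shows "(\<lambda>x. f (a + c *\<^sub>R x)) differentiable at x" "pd i (\<lambda>x. f (a + c *\<^sub>R x)) x = c * pd i f (a + c *\<^sub>R x)"
proof -
  have l: "linear (frechet_derivative f (at (a + c *\<^sub>R x)))"
    using assms by (simp add: linear_frechet_derivative)
  have "((\<lambda>x. a + c *\<^sub>R x) has_derivative (\<lambda>h. c *\<^sub>R h)) (at x)"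
    by (auto intro!: derivative_eq_intros)
  from has_derivative_compose[OF this has_derivative_pd[OF assms]]
  have "((\<lambda>x. f (a + c *\<^sub>R x)) has_derivative (\<lambda>h. frechet_derivative f (at (a + c *\<^sub>R x)) (c *\<^sub>R h))) (at x)" .
  then show "(\<lambda>x. f (a + c *\<^sub>R x)) differentiable at x" "pd i (\<lambda>x. f (a + c *\<^sub>R x)) x = c * pd i f (a + c *\<^sub>R x)"
    using pd_eqI by (fastforce simp: differentiable_def pd_def[of i f] linear_cmul[OF l])+
qed

text \<open>\<open>frechet_derivative\<close> is a choice among all derivatives, so the two choices
  agree as soon as the predicates \<open>has_derivative\<close> do; differentiability is not asked
  for.\<close>

lemma pd_cong:
  assumes "open S" "x \<in> S" "\<And>y. y \<in> S \<Longrightarrow> f y = g y"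
  shows "pd i f x = pd i g x"
proof -
  have "(f has_derivative f') (at x) = (g has_derivative f') (at x)" for f'
    using assms has_derivative_transform_within_open[of f f' x UNIV S g]
      has_derivative_transform_within_open[of g f' x UNIV S f] by fastforce
  then show ?thesis by (simp add: pd_def frechet_derivative_def)
qed

lemma pd_nth_coord: "pd i (\<lambda>x. x $ k) x = (if i = k then 1 else 0)"
proof -
  have "((\<lambda>x::real^3. x $ k) has_derivative (\<lambda>h. h $ k)) (at x)"
    by (rule bounded_linear_imp_has_derivative) (rule bounded_linear_vec_nth)
  then show ?thesis by (subst pd_eqI[where f' = "\<lambda>h. h $ k"]) (auto simp: axis_def)
qed

lemma nth_differentiable [simp]: "(\<lambda>x::real^3. x $ k) differentiable at x"
  using bounded_linear_imp_has_derivative[OF bounded_linear_vec_nth] unfolding differentiable_def by blast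

subsection \<open>Smooth functions\<close>

lemma Ck_on_cong:
  assumes "open S" "\<And>x. x \<in> S \<Longrightarrow> f x = g x" "Ck_on k S f"
  shows "Ck_on k S g"
  using assms(2,3)
proof (induction k arbitrary: f g)
  case 0 then show ?case using continuous_on_cong[of S S f g] by simp
next
  case (Suc k)
  have "g differentiable at x" if "x \<in> S" for x
  proof -
    have "(f has_derivative frechet_derivative f (at x)) (at x)"
      using Suc.prems that by (auto simp: frechet_derivative_works)
    then have "(g has_derivative frechet_derivative f (at x)) (at x)"
      using assms(1) that Suc.prems(1) by (elim has_derivative_transform_within_open) auto
    then show ?thesis by (auto simp: differentiable_def)
  qed
  moreover have "Ck_on k S (pd i g)" for i
  proof (rule Suc.IH[of "pd i f"])
    show "pd i f x = pd i g x" if "x \<in> S" for x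
      by (rule pd_cong[OF assms(1) that]) (rule Suc.prems)
    show "Ck_on k S (pd i f)" using Suc.prems by simp
  qed
  ultimately show ?case by simp
qed

lemma Ck_on_Suc_imp: "Ck_on (Suc k) S f \<Longrightarrow> Ck_on k S f"
proof (induction k arbitrary: f)
  case 0 then show ?case
    by (auto intro!: continuous_at_imp_continuous_on differentiable_imp_continuous_within)
next
  case (Suc k)
  have *: "Ck_on (Suc k) S (pd i f)" for i
    using Suc.prems unfolding Ck_on.simps(2)[of "Suc k"] by blast
  have "Ck_on k S (pd i f)" for i
    by (rule Suc.IH[OF *])
  with Suc.prems show ?case unfolding Ck_on.simps(2) by blast
qed

lemma Ck_on_add:
  assumes "open S" "Ck_on k S f" "Ck_on k S g"
  shows "Ck_on k S (\<lambda>x. f x + g x)"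
  using assms(2,3)
proof (induction k arbitrary: f g)
  case 0 then show ?case by (simp add: continuous_on_add continuous_on_scaleR)
next
  case (Suc k)
  have "Ck_on k S (pd i (\<lambda>x. f x + g x))" for i
  proof (rule Ck_on_cong[OF assms(1)])
    show "Ck_on k S (\<lambda>x. pd i f x + pd i g x)"
      using Suc by (intro Suc.IH) auto
    show "pd i f x + pd i g x = pd i (\<lambda>x. f x + g x) x" if "x \<in> S" for x
      using Suc.prems that by (intro pd_add[symmetric]) auto
  qed
  with Suc.prems show ?case by simp
qed

lemma Ck_on_scaleR:
  fixes f :: "real^3 \<Rightarrow> real"
  assumes "open S" "Ck_on k S f" "Ck_on k S g"
  shows "Ck_on k S (\<lambda>x. f x *\<^sub>R g x)"
  using assms(2,3)
proof (induction k arbitrary: f g)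
  case 0 then show ?case by (simp add: continuous_on_add continuous_on_scaleR)
next
  case (Suc k)
  have 1: "Ck_on k S f" "Ck_on k S g" using Suc.prems Ck_on_Suc_imp by blast+
  have "Ck_on k S (pd i (\<lambda>x. f x *\<^sub>R g x))" for i
  proof (rule Ck_on_cong[OF assms(1)])
    show "Ck_on k S (\<lambda>x. f x *\<^sub>R pd i g x + pd i f x *\<^sub>R g x)"
      using Suc 1 by (intro Ck_on_add Suc.IH assms(1)) auto
    show "f x *\<^sub>R pd i g x + pd i f x *\<^sub>R g x = pd i (\<lambda>x. f x *\<^sub>R g x) x" if "x \<in> S" for x
      using Suc.prems that by (intro pd_scaleR[symmetric]) auto
  qed
  with Suc.prems show ?case by simp
qed

lemma Ck_on_mult:
  fixes f :: "real^3 \<Rightarrow> real"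
  assumes "open S" "Ck_on k S f" "Ck_on k S g"
  shows "Ck_on k S (\<lambda>x. f x * g x)"
  using Ck_on_scaleR[OF assms] by simp

lemma Ck_on_const: "Ck_on k S (\<lambda>x. c)"
proof (induction k arbitrary: c)
  case (Suc k)
  have "pd i (\<lambda>x. c) = (\<lambda>x. 0)" for i by (auto simp: fun_eq_iff)
  with Suc show ?case by simp
qed simp

lemma Ck_on_nth: "Ck_on k S (\<lambda>x. x $ j)"
proof (cases k)
  case 0
  then show ?thesis by (auto intro!: continuous_intros)
next
  case (Suc m)
  have "pd i (\<lambda>x. x $ j) = (\<lambda>x. if i = j then 1 else 0)" for i by (auto simp: pd_nth_coord)
  then show ?thesis using Suc by (auto simp: Ck_on_const)
qed

lemma Ck_on_affine:
  fixes f :: "real^3 \<Rightarrow> real"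
  assumes "Ck_on k UNIV f"
  shows "Ck_on k UNIV (\<lambda>x. f (a + c *\<^sub>R x))"
  using assms
proof (induction k arbitrary: f)
  case 0 then show ?case
    by (auto intro!: continuous_on_compose2[of UNIV f] continuous_intros)
next
  case (Suc k)
  have "Ck_on k UNIV (pd i (\<lambda>x. f (a + c *\<^sub>R x)))" for i
  proof (rule Ck_on_cong[OF open_UNIV])
    show "Ck_on k UNIV (\<lambda>x. c * pd i f (a + c *\<^sub>R x))"
      using Suc by (intro Ck_on_mult Ck_on_const) auto
    show "c * pd i f (a + c *\<^sub>R x) = pd i (\<lambda>x. f (a + c *\<^sub>R x)) x" for x
      using Suc.prems by (intro pd_affine(2)[symmetric]) auto
  qed
  moreover have "(\<lambda>x. f (a + c *\<^sub>R x)) differentiable at x" for x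
    using Suc.prems by (intro pd_affine(1)) auto
  ultimately show ?case by simp
qed

lemma smooth_on_Ck: "smooth_on S f \<Longrightarrow> Ck_on k S f"
  by (simp add: smooth_on_def)

lemma smooth_on_differentiable: "smooth_on S f \<Longrightarrow> x \<in> S \<Longrightarrow> f differentiable at x"
  using smooth_on_Ck[of S f "Suc 0"] by simp

lemma smooth_on_pd: "smooth_on S f \<Longrightarrow> smooth_on S (pd i f)"
  unfolding smooth_on_def by (metis Ck_on.simps(2))

lemma smooth_on_continuous: "smooth_on S f \<Longrightarrow> continuous_on S f"
  using smooth_on_Ck[of S f 0] by simp

lemma smooth_on_add: "open S \<Longrightarrow> smooth_on S f \<Longrightarrow> smooth_on S g \<Longrightarrow> smooth_on S (\<lambda>x. f x + g x)"
  by (simp add: smooth_on_def Ck_on_add)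

lemma smooth_on_mult:
  fixes f :: "real^3 \<Rightarrow> real"
  shows "open S \<Longrightarrow> smooth_on S f \<Longrightarrow> smooth_on S g \<Longrightarrow> smooth_on S (\<lambda>x. f x * g x)"
  by (simp add: smooth_on_def Ck_on_mult)

lemma smooth_on_const: "smooth_on S (\<lambda>x. c)"
  by (simp add: smooth_on_def Ck_on_const)

lemma smooth_on_nth: "smooth_on S (\<lambda>x. x $ j)"
  by (simp add: smooth_on_def Ck_on_nth)

lemma smooth_on_affine:
  fixes f :: "real^3 \<Rightarrow> real"
  shows "smooth_on UNIV f \<Longrightarrow> smooth_on UNIV (\<lambda>x. f (a + c *\<^sub>R x))"
  by (simp add: smooth_on_def Ck_on_affine)

section \<open>Smooth cutoffs built from exp (-1/t)\<close>

text \<open>The derivatives come as one explicit sequence \<open>D\<close>, so the induction for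
  compositions can be generalised over the index \<open>n\<close>.\<close>

definition smooth_real :: "(real \<Rightarrow> real) \<Rightarrow> bool" where
  "smooth_real H \<longleftrightarrow> (\<exists>D. D 0 = H \<and> (\<forall>n t. (D n has_real_derivative D (Suc n) t) (at t)))"

lemma smooth_on_compose_real:
  fixes f :: "real^3 \<Rightarrow> real"
  assumes "smooth_real H" "smooth_on UNIV f"
  shows "smooth_on UNIV (\<lambda>x. H (f x))"
proof -
  obtain D where D: "D 0 = H" "\<And>n t. (D n has_real_derivative D (Suc n) t) (at t)"
    using assms(1) by (auto simp: smooth_real_def)
  have "Ck_on k UNIV (\<lambda>x. D n (f x))" for k n
  proof (induction k arbitrary: n)
    case 0
    have "continuous_on UNIV (D n)"
      using D(2) by (meson DERIV_continuous continuous_at_imp_continuous_on)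
    then show ?case
      using continuous_on_compose2[OF _ smooth_on_continuous[OF assms(2)]] by (metis Ck_on.simps(1) top_greatest)
  next
    case (Suc k)
    have d: "f differentiable at x" for x by (rule smooth_on_differentiable[OF assms(2)]) simp
    have "Ck_on k UNIV (pd i (\<lambda>x. D n (f x)))" for i
    proof (rule Ck_on_cong[OF open_UNIV])
      show "Ck_on k UNIV (\<lambda>x. D (Suc n) (f x) * pd i f x)"
        using Suc smooth_on_Ck[OF smooth_on_pd[OF assms(2)]] by (intro Ck_on_mult) auto
      show "D (Suc n) (f x) * pd i f x = pd i (\<lambda>x. D n (f x)) x" for x
        by (rule pd_compose(2)[OF d D(2), symmetric])
    qed
    moreover have "(\<lambda>x. D n (f x)) differentiable at x" for x
      by (rule pd_compose(1)[OF d D(2)])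
    ultimately show ?case by simp
  qed
  then show ?thesis using D(1) by (auto simp: smooth_on_def)
qed

text \<open>The family p(1/t) exp(-1/t), extended by 0, is closed under differentiation; smoothness
  of exp(-1/t) at 0 follows for all orders at once.\<close>

definition expinv :: "real poly \<Rightarrow> real \<Rightarrow> real" where
  "expinv p t = (if t > 0 then poly p (1 / t) * exp (- (1 / t)) else 0)"

lemma poly_div_exp_tendsto_0:
  fixes p :: "real poly"
  shows "((\<lambda>x. poly p x * exp (- x)) \<longlongrightarrow> 0) at_top"
proof -
  have *: "((\<lambda>x::real. coeff p i * (x ^ i / exp x)) \<longlongrightarrow> coeff p i * 0) at_top" for i
    by (rule tendsto_mult[OF tendsto_const tendsto_power_div_exp_0])
  have "((\<lambda>x. \<Sum>i\<le>degree p. coeff p i * (x ^ i / exp x)) \<longlongrightarrow> (\<Sum>i\<le>degree p. coeff p i * 0)) at_top"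
    by (rule tendsto_sum) (rule *)
  moreover have "(\<lambda>x. \<Sum>i\<le>degree p. coeff p i * (x ^ i / exp x)) = (\<lambda>x. poly p x * exp (- x))"
  proof
    fix x :: real
    have "x ^ i / exp x = x ^ i * exp (- x)" for i by (simp only: exp_minus divide_inverse)
    then show "(\<Sum>i\<le>degree p. coeff p i * (x ^ i / exp x)) = poly p x * exp (- x)"
      by (simp only: poly_altdef sum_distrib_right mult.assoc)
  qed
  ultimately show ?thesis by (simp only: mult_zero_right sum.neutral_const)
qed

text \<open>The derivative of p(1/t) exp(-1/t) is (1/t)^2 (p - p')(1/t) exp(-1/t), and the two
  \<open>pCons 0\<close> multiply by the square of the variable. Only t = 0 needs a limit.\<close>

lemma expinv_derivative:
  "(expinv p has_real_derivative expinv (pCons 0 (pCons 0 (p - pderiv p))) t) (at t)"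
proof -
  consider "t > 0" | "t < 0" | "t = 0" by linarith
  then show ?thesis
  proof cases
    case 1
    have H: "((\<lambda>u. poly p u * exp (- u)) has_real_derivative
        (poly (pderiv p) u - poly p u) * exp (- u)) (at u)" for u
      by (auto intro!: derivative_eq_intros simp: algebra_simps)
    have I: "((\<lambda>t. 1 / t) has_real_derivative - (1 / t) * (1 / t)) (at t)"
      using 1 by (auto intro!: derivative_eq_intros)
    have "((\<lambda>t. poly p (1 / t) * exp (- (1 / t))) has_real_derivative
       expinv (pCons 0 (pCons 0 (p - pderiv p))) t) (at t)"
      using DERIV_chain2[OF H I] 1 by (simp add: expinv_def algebra_simps)
    then show ?thesis
      by (rule has_field_derivative_transform_within_open[of _ _ _ "{0<..}"]) (use 1 in \<open>auto simp: expinv_def\<close>)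
  next
    case 2
    have "((\<lambda>t. 0) has_real_derivative 0) (at t)" by simp
    then have "(expinv p has_real_derivative 0) (at t)"
      by (rule has_field_derivative_transform_within_open[of _ _ _ "{..<0}"]) (use 2 in \<open>auto simp: expinv_def\<close>)
    then show ?thesis using 2 by (simp add: expinv_def)
  next
    case 3
    \<comment> \<open>Dividing by h multiplies the polynomial by its variable, so the difference
      quotient at 0 is again of the form polynomial times exponential and tends to 0.\<close>
    have "((\<lambda>h. poly (pCons 0 p) (inverse h) * exp (- inverse h)) \<longlongrightarrow> 0) (at_right 0)"
      using filterlim_compose[OF poly_div_exp_tendsto_0 filterlim_inverse_at_top_right] .
    then have r: "((\<lambda>h. expinv p h / h) \<longlongrightarrow> 0) (at_right 0)"
      by (rule Lim_transform_eventually)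
         (auto simp: expinv_def eventually_at_right_field divide_inverse algebra_simps intro!: exI[of _ 1])
    have l: "((\<lambda>h. expinv p h / h) \<longlongrightarrow> 0) (at_left 0)"
      by (rule Lim_transform_eventually[OF tendsto_const])
         (auto simp: expinv_def eventually_at_filter)
    have "((\<lambda>h. expinv p h / h) \<longlongrightarrow> 0) (at 0)"
      using r l by (simp add: filterlim_split_at)
    then have "(expinv p has_real_derivative 0) (at 0)"
      by (simp add: has_field_derivative_iff) (simp add: expinv_def)
    then show ?thesis using 3 by (simp add: expinv_def)
  qed
qed

definition bump1 :: "real \<Rightarrow> real" where "bump1 = expinv 1"

lemma bump1_simps: "t \<le> 0 \<Longrightarrow> bump1 t = 0" "0 < t \<Longrightarrow> 0 < bump1 t" "0 \<le> bump1 t" "bump1 t \<le> 1"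
  by (auto simp: bump1_def expinv_def)

lemma smooth_real_expinv: "smooth_real (expinv p)"
proof -
  define D where "D n = expinv (((\<lambda>p. pCons 0 (pCons 0 (p - pderiv p))) ^^ n) p)" for n
  have "D 0 = expinv p" "(D n has_real_derivative D (Suc n) t) (at t)" for n t
    using expinv_derivative by (auto simp: D_def)
  then show ?thesis unfolding smooth_real_def by blast
qed

text \<open>With the squared norm the argument of \<open>bump1\<close> is a polynomial in x, so the
  function is smooth at the centre too.\<close>

definition bump :: "real^3 \<Rightarrow> real \<Rightarrow> real^3 \<Rightarrow> real" where
  "bump a r x = bump1 (r\<^sup>2 - (norm (x - a))\<^sup>2)"

lemma smooth_on_normsq: "smooth_on UNIV (\<lambda>x::real^3. r - (norm (x - a))\<^sup>2)"
proof -
  have "(\<lambda>x::real^3. r - (norm (x - a))\<^sup>2) =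
     (\<lambda>x. r + (- 1) * ((x $ 1 + (- (a $ 1))) * (x $ 1 + (- (a $ 1))) +
         ((x $ 2 + (- (a $ 2))) * (x $ 2 + (- (a $ 2))) + (x $ 3 + (- (a $ 3))) * (x $ 3 + (- (a $ 3))))))"
    by (auto simp: fun_eq_iff power2_norm_eq_inner inner_vec_def sum_3 algebra_simps)
  moreover have "smooth_on UNIV \<dots>"
    by (intro smooth_on_add smooth_on_mult smooth_on_const smooth_on_nth open_UNIV)
  ultimately show ?thesis by simp
qed

lemma smooth_bump: "smooth_on UNIV (bump a r)"
  unfolding bump_def[abs_def] bump1_def
  by (rule smooth_on_compose_real[OF smooth_real_expinv smooth_on_normsq])

lemma bump_props:
  shows "0 \<le> bump a r x" "bump a r x \<le> 1" "norm (x - a) < r \<Longrightarrow> 0 < bump a r x"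
    "r > 0 \<Longrightarrow> r \<le> norm (x - a) \<Longrightarrow> bump a r x = 0"
proof -
  show "0 \<le> bump a r x" "bump a r x \<le> 1" unfolding bump_def by (rule bump1_simps)+
  show "0 < bump a r x" if "norm (x - a) < r"
  proof -
    have "(norm (x - a))\<^sup>2 < r\<^sup>2" using that by (intro power_strict_mono) auto
    then show ?thesis unfolding bump_def by (intro bump1_simps(2)) simp
  qed
  show "bump a r x = 0" if "r > 0" "r \<le> norm (x - a)"
  proof -
    have "r\<^sup>2 \<le> (norm (x - a))\<^sup>2" using that by (intro power_mono) auto
    then show ?thesis unfolding bump_def by (intro bump1_simps(1)) simp
  qed
qed

subsection \<open>Integrals of compactly supported functions\<close>

lemma integrable_compact_support:
  fixes f :: "'a::euclidean_space \<Rightarrow> 'b::euclidean_space"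
  assumes "continuous_on UNIV f" "compact K" "\<And>x. x \<notin> K \<Longrightarrow> f x = 0"
  shows "integrable lebesgue f" "integrable lborel f"
proof -
  have "integrable lborel (\<lambda>x. indicator K x *\<^sub>R f x)"
    using assms by (intro borel_integrable_compact) (auto intro: continuous_on_subset)
  moreover have "(\<lambda>x. indicator K x *\<^sub>R f x) = f"
    using assms(3) by (auto simp: fun_eq_iff indicator_def)
  ultimately show "integrable lborel f" by simp
  then show "integrable lebesgue f" by (rule integrable_completion[THEN iffD2, rotated]) (use assms in \<open>auto intro: borel_measurable_continuous_onI\<close>)
qed

lemma integral_eq_cbox:
  fixes f :: "'a::euclidean_space \<Rightarrow> 'b::euclidean_space"
  assumes "continuous_on UNIV f" "\<And>x. x \<notin> cbox a b \<Longrightarrow> f x = 0"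
  shows "integral\<^sup>L lebesgue f = integral (cbox a b) f"
proof -
  have i: "integrable lebesgue f"
    by (rule integrable_compact_support(1)[OF assms(1) compact_cbox assms(2)])
  then have "integral\<^sup>L lebesgue f = integral UNIV f"
    using lebesgue_integral_eq_integral[of UNIV f] by (simp add: lebesgue_on_UNIV_eq)
  also have "\<dots> = integral (cbox a b) f"
  proof -
    have "f = (\<lambda>x. if x \<in> cbox a b then f x else 0)" using assms(2) by auto
    then show ?thesis using integral_restrict_UNIV[of "cbox a b" f] by simp
  qed
  finally show ?thesis .
qed

lemma integral_lebesgue_on_support:
  fixes f :: "'a::euclidean_space \<Rightarrow> 'b::euclidean_space"
  assumes "\<Omega> \<in> sets lebesgue" "\<And>x. x \<notin> \<Omega> \<Longrightarrow> f x = 0"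
  shows "integral\<^sup>L (lebesgue_on \<Omega>) f = integral\<^sup>L lebesgue f"
proof -
  have "(\<lambda>x. indicator \<Omega> x *\<^sub>R f x) = f"
    using assms(2) by (auto simp: fun_eq_iff indicator_def)
  then show ?thesis using assms(1) by (simp add: integral_restrict_space)
qed

lemma integrable_lebesgue_on_support:
  fixes f :: "'a::euclidean_space \<Rightarrow> 'b::euclidean_space"
  assumes "\<Omega> \<in> sets lebesgue" "\<And>x. x \<notin> \<Omega> \<Longrightarrow> f x = 0"
  shows "integrable (lebesgue_on \<Omega>) f \<longleftrightarrow> integrable lebesgue f"
proof -
  have "(\<lambda>x. indicator \<Omega> x *\<^sub>R f x) = f"
    using assms(2) by (auto simp: fun_eq_iff indicator_def)
  then show ?thesis using assms(1) by (simp add: integrable_restrict_space)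
qed

lemma open_sets_lebesgue: "open \<Omega> \<Longrightarrow> \<Omega> \<in> sets lebesgue"
  by (rule sets_completionI_sets) simp

text \<open>\<open>T \<times> \<Omega>\<close> and \<open>T \<times> - K\<close> are relatively
  open, cover everything, and the function is continuous on each. The parameter t is carried along
  because differentiation under the integral asks for joint continuity.\<close>

lemma continuous_on_zero_extension:
  fixes F :: "'a::topological_space \<Rightarrow> 'b::t2_space \<Rightarrow> 'c::real_normed_vector"
  assumes "open \<Omega>" "compact K" "K \<subseteq> \<Omega>" "continuous_on (T \<times> \<Omega>) (\<lambda>(t, x). F t x)"
    and "\<And>t x. t \<in> T \<Longrightarrow> x \<notin> K \<Longrightarrow> F t x = 0"
  shows "continuous_on (T \<times> UNIV) (\<lambda>(t, x). F t x)"
proof -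
  have "continuous_on (T \<times> \<Omega> \<union> T \<times> (- K)) (\<lambda>(t, x). F t x)"
  proof (rule continuous_on_Un_local_open)
    have "T \<times> \<Omega> \<union> T \<times> - K = T \<times> UNIV" using assms(3) by auto
    then show "openin (top_of_set (T \<times> \<Omega> \<union> T \<times> - K)) (T \<times> \<Omega>)"
       "openin (top_of_set (T \<times> \<Omega> \<union> T \<times> - K)) (T \<times> - K)"
      using assms by (auto intro!: openin_Times open_Compl simp: compact_imp_closed)
    have "continuous_on (T \<times> - K) (\<lambda>(t, x). F t x) = continuous_on (T \<times> - K) (\<lambda>_. 0 :: 'c)"
      using assms(5) by (intro continuous_on_cong) auto
    then show "continuous_on (T \<times> - K) (\<lambda>(t, x). F t x)" by simp
  qed (use assms in auto)
  moreover have "T \<times> \<Omega> \<union> T \<times> - K = T \<times> UNIV" using assms(3) by auto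
  ultimately show ?thesis by simp
qed

lemma continuous_on_Pair1: "continuous_on S (Pair t)"
  using continuous_on_Pair[OF continuous_on_const[of S t] continuous_on_id] by simp

lemma continuous_on_zero_extension1:
  fixes f :: "'b::t2_space \<Rightarrow> 'c::real_normed_vector"
  assumes "open \<Omega>" "compact K" "K \<subseteq> \<Omega>" "continuous_on \<Omega> f"
    and "\<And>x. x \<notin> K \<Longrightarrow> f x = 0"
  shows "continuous_on UNIV f"
proof -
  have "continuous_on ({0::real} \<times> UNIV) (\<lambda>(t, x). f x)"
    by (rule continuous_on_zero_extension[OF assms(1-3)])
       (use assms in \<open>auto simp: split_beta intro!: continuous_on_compose2[OF assms(4)] continuous_intros\<close>)
  from continuous_on_compose2[OF this continuous_on_Pair1[of UNIV 0]] show ?thesis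
    by auto
qed

lemma DERIV_transform_set:
  fixes f g :: "real \<Rightarrow> real"
  assumes "x \<in> S" "\<And>y. y \<in> S \<Longrightarrow> g y = f y" "(f has_real_derivative D) (at x within S)"
  shows "(g has_real_derivative D) (at x within S)"
  unfolding has_field_derivative_def
  by (rule has_derivative_transform[OF assms(1) _ assms(3)[unfolded has_field_derivative_def]]) (rule assms(2))

text \<open>One compact K contains all supports, so the integral over space is an integral over a
  fixed box. The derivative within \<open>U\<close> also covers endpoints of time intervals.\<close>

lemma leibniz_compact_support:
  fixes F F' :: "real \<Rightarrow> 'a::euclidean_space \<Rightarrow> real"
  assumes "\<And>t x. t \<in> U \<Longrightarrow> ((\<lambda>t. F t x) has_real_derivative F' t x) (at t within U)"
    and "\<And>t. t \<in> U \<Longrightarrow> continuous_on UNIV (F t)"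
    and "continuous_on (U \<times> UNIV) (\<lambda>(t, x). F' t x)"
    and "compact K" "\<And>t x. t \<in> U \<Longrightarrow> x \<notin> K \<Longrightarrow> F t x = 0" "\<And>t x. t \<in> U \<Longrightarrow> x \<notin> K \<Longrightarrow> F' t x = 0"
    and "t0 \<in> U" "convex U"
  shows "((\<lambda>t. integral\<^sup>L lebesgue (F t)) has_real_derivative integral\<^sup>L lebesgue (F' t0)) (at t0 within U)"
proof -
  obtain a b where K: "K \<subseteq> cbox a b"
    using bounded_subset_cbox_symmetric[OF compact_imp_bounded[OF assms(4)]] by blast
  have c': "continuous_on UNIV (F' t)" if "t \<in> U" for t
    using continuous_on_compose2[OF assms(3) continuous_on_Pair1[of UNIV t]] that by auto
  have Kz: "x \<notin> K" if "x \<notin> cbox a b" for x using K that by blast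
  have "((\<lambda>t. integral (cbox a b) (F t)) has_real_derivative integral (cbox a b) (F' t0)) (at t0 within U)"
  proof (rule leibniz_rule_field_derivative[OF assms(1)])
    show "F t integrable_on cbox a b" if "t \<in> U" for t
      using assms(2)[OF that] by (intro integrable_continuous) (auto intro: continuous_on_subset)
    show "continuous_on (U \<times> cbox a b) (\<lambda>(t, x). F' t x)"
      by (rule continuous_on_subset[OF assms(3)]) auto
  qed (use assms in auto)
  moreover have "integral (cbox a b) (F' t0) = integral\<^sup>L lebesgue (F' t0)"
    by (rule integral_eq_cbox[symmetric]) (use Kz assms c' in auto)
  moreover have "integral (cbox a b) (F t) = integral\<^sup>L lebesgue (F t)" if "t \<in> U" for t
    by (rule integral_eq_cbox[symmetric]) (use Kz assms that in auto)
  ultimately show ?thesis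
    using DERIV_transform_set[OF assms(7), of "\<lambda>t. integral\<^sup>L lebesgue (F t)" "\<lambda>t. integral (cbox a b) (F t)"] by simp
qed

lemma integral_affine:
  fixes f :: "real^3 \<Rightarrow> real"
  assumes "continuous_on UNIV f" "c > 0"
  shows "integral\<^sup>L lebesgue f = c ^ 3 * integral\<^sup>L lebesgue (\<lambda>x. f (t + c *\<^sub>R x))"
proof -
  have m: "f \<in> borel_measurable borel" using assms by (simp add: borel_measurable_continuous_onI)
  have m2: "(\<lambda>x. f (t + c *\<^sub>R x)) \<in> borel_measurable borel"
    by (intro borel_measurable_continuous_onI continuous_on_compose2[OF assms(1)] continuous_intros) auto
  have "integral\<^sup>L lborel f = integral\<^sup>L (density (distr lborel borel (\<lambda>x. t + c *\<^sub>R x)) (\<lambda>_. \<bar>c\<bar>^3)) f"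
    using lborel_affine[of c t] assms(2) by simp
  also have "\<dots> = c ^ 3 * integral\<^sup>L lborel (\<lambda>x. f (t + c *\<^sub>R x))"
    using assms(2) m by (subst integral_density) (auto simp: integral_distr)
  finally show ?thesis using m m2 by (simp add: integral_completion)
qed

section \<open>Integration by parts for compactly supported C1 functions\<close>

text \<open>Only C1, since the cutoffs made later from the boundary barrier are no smoother. K may
  be larger than the support.\<close>

definition C1c :: "(real^3) set \<Rightarrow> (real^3 \<Rightarrow> real) \<Rightarrow> bool" where
  "C1c K \<phi> \<longleftrightarrow> compact K \<and> (\<forall>x. \<phi> differentiable (at x)) \<and> (\<forall>i. continuous_on UNIV (pd i \<phi>)) \<and>
     (\<forall>x. x \<notin> K \<longrightarrow> \<phi> x = 0)"

lemma C1c_pd_zero: "C1c K \<phi> \<Longrightarrow> x \<notin> K \<Longrightarrow> pd i \<phi> x = 0"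
  using pd_cong[of "- K" x \<phi> "\<lambda>_. 0" i] by (auto simp: C1c_def compact_imp_closed open_Compl)

lemma C1c_continuous: "C1c K \<phi> \<Longrightarrow> continuous_on UNIV \<phi>"
  by (auto simp: C1c_def intro!: continuous_at_imp_continuous_on differentiable_imp_continuous_within)

text \<open>The integral of h(x + t e) does not depend on t, by translation invariance; its
  derivative at t = 0 is the integral of \<open>pd i h\<close>.\<close>

lemma integral_pd_zero:
  assumes "C1c K h"
  shows "integral\<^sup>L lebesgue (pd i h) = 0"
proof -
  define e :: "real^3" where "e = axis i 1"
  \<comment> \<open>All translates with |t| at most 1 are supported in this one compact set.\<close>
  define K' where "K' = (\<lambda>(k, t). k - t *\<^sub>R e) ` (K \<times> {-1..1})"
  have K: "compact K" and d: "\<And>x. h differentiable at x" and c: "continuous_on UNIV (pd i h)"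
    and z: "\<And>x. x \<notin> K \<Longrightarrow> h x = 0"
    using assms by (auto simp: C1c_def)
  have ch: "continuous_on UNIV h" by (rule C1c_continuous[OF assms])
  have K': "compact K'"
    unfolding K'_def by (intro compact_continuous_image compact_Times K)
      (auto intro!: continuous_intros simp: split_beta)
  have zz: "x + t *\<^sub>R e \<notin> K" if "t \<in> {-1..1}" "x \<notin> K'" for x t
  proof
    assume "x + t *\<^sub>R e \<in> K"
    then have "(\<lambda>(k, t). k - t *\<^sub>R e) (x + t *\<^sub>R e, t) \<in> K'"
      unfolding K'_def using that by (intro imageI) auto
    then show False using that by simp
  qed
  have "((\<lambda>t. integral\<^sup>L lebesgue (\<lambda>x. h (x + t *\<^sub>R e))) has_real_derivative
      integral\<^sup>L lebesgue (\<lambda>x. pd i h (x + 0 *\<^sub>R e))) (at 0 within {-1..1})"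
  proof (rule leibniz_compact_support[OF _ _ _ K'])
    fix t :: real and x
    show "((\<lambda>t. h (x + t *\<^sub>R e)) has_real_derivative pd i h (x + t *\<^sub>R e)) (at t within {-1..1})"
    proof -
      have "((\<lambda>t. x + t *\<^sub>R e) has_derivative (\<lambda>s. s *\<^sub>R e)) (at t within {-1..1})"
        by (auto intro!: derivative_eq_intros)
      from has_derivative_compose[OF this has_derivative_pd[OF d]]
      show ?thesis
        using linear_cmul[OF linear_frechet_derivative[OF d]]
        by (simp add: has_field_derivative_def pd_def e_def mult.commute[of _ "frechet_derivative _ _ _"])
    qed
    show "continuous_on UNIV (\<lambda>x. h (x + t *\<^sub>R e))"
      by (intro continuous_on_compose2[OF ch] continuous_intros) auto
    show "continuous_on ({-1..1} \<times> UNIV) (\<lambda>(t, x). pd i h (x + t *\<^sub>R e))"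
      unfolding split_beta by (intro continuous_on_compose2[OF c] continuous_intros) auto
    assume "t \<in> {-1..1}" "x \<notin> K'"
    then show "h (x + t *\<^sub>R e) = 0" "pd i h (x + t *\<^sub>R e) = 0"
      using zz z C1c_pd_zero[OF assms] by auto
  qed auto
  moreover have "integral\<^sup>L lebesgue (\<lambda>x. h (x + t *\<^sub>R e)) = integral\<^sup>L lebesgue h" for t
    using integral_affine[OF ch, of 1 "t *\<^sub>R e"] by (simp add: add.commute)
  ultimately have "((\<lambda>t. integral\<^sup>L lebesgue h) has_real_derivative integral\<^sup>L lebesgue (pd i h)) (at 0 within {-1..1})"
    by simp
  moreover have "((\<lambda>t. integral\<^sup>L lebesgue h) has_real_derivative 0) (at (0::real) within {-1..1})" by simp
  moreover have "at (0::real) within {-1..1} = at 0" by (rule at_within_interior) (simp add: interior_atLeastAtMost_real)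
  ultimately show ?thesis using DERIV_unique by metis
qed

lemma C1c_mult:
  assumes "open \<Omega>" "C1c K \<phi>" "K \<subseteq> \<Omega>" "\<And>x. x \<in> \<Omega> \<Longrightarrow> f differentiable (at x)"
    and "\<And>i. continuous_on \<Omega> (pd i f)"
  shows "C1c K (\<lambda>x. \<phi> x * f x)" "pd i (\<lambda>x. \<phi> x * f x) x = \<phi> x * pd i f x + pd i \<phi> x * f x"
proof -
  have K: "compact K" and d: "\<And>x. \<phi> differentiable at x" and c: "\<And>i. continuous_on UNIV (pd i \<phi>)"
    and z: "\<And>x. x \<notin> K \<Longrightarrow> \<phi> x = 0"
    using assms by (auto simp: C1c_def)
  note pz = C1c_pd_zero[OF assms(2)]
  have out: "((\<lambda>x. \<phi> x * f x) has_derivative (\<lambda>_. 0)) (at x)" if "x \<notin> K" for x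
    by (rule has_derivative_transform_within_open[OF has_derivative_const, of "- K"])
       (use that z K in \<open>auto simp: compact_imp_closed\<close>)
  have dd: "(\<lambda>x. \<phi> x * f x) differentiable at x" for x
  proof (cases "x \<in> K")
    case True
    then show ?thesis using assms(3,4) d by (intro differentiable_mult) auto
  next
    case False
    then show ?thesis using out[of x] unfolding differentiable_def by blast
  qed
  show p: "pd i (\<lambda>x. \<phi> x * f x) x = \<phi> x * pd i f x + pd i \<phi> x * f x" for i x
    using pd_mult[OF d assms(4), of x i] pd_eqI[OF out, of x i] pz z assms(3) by (cases "x \<in> K") auto
  have cf: "continuous_on \<Omega> f"
    using assms(4) by (auto intro!: continuous_at_imp_continuous_on differentiable_imp_continuous_within)
  have "continuous_on UNIV (\<lambda>x. \<phi> x * pd i f x + pd i \<phi> x * f x)" for i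
    by (rule continuous_on_zero_extension1[OF assms(1) K assms(3)])
       (use pz z in \<open>auto intro!: continuous_intros assms(5) cf continuous_on_subset[OF c] continuous_on_subset[OF C1c_continuous[OF assms(2)]]\<close>)
  then have "continuous_on UNIV (pd i (\<lambda>x. \<phi> x * f x))" for i
    by (simp add: p[abs_def])
  then show "C1c K (\<lambda>x. \<phi> x * f x)" using K dd z by (auto simp: C1c_def)
qed

lemma integral_by_parts:
  assumes "open \<Omega>" "C1c K \<phi>" "K \<subseteq> \<Omega>" "\<And>x. x \<in> \<Omega> \<Longrightarrow> f differentiable (at x)"
    and "\<And>i. continuous_on \<Omega> (pd i f)"
  shows "(LINT x|lebesgue. pd i \<phi> x * f x) = - (LINT x|lebesgue. \<phi> x * pd i f x)"
proof -
  have K: "compact K" and c: "\<And>i. continuous_on UNIV (pd i \<phi>)"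
    and z: "\<And>x. x \<notin> K \<Longrightarrow> \<phi> x = 0"
    using assms by (auto simp: C1c_def)
  note pz = C1c_pd_zero[OF assms(2)]
  have cf: "continuous_on \<Omega> f"
    using assms(4) by (auto intro!: continuous_at_imp_continuous_on differentiable_imp_continuous_within)
  have 1: "integrable lebesgue (\<lambda>x. \<phi> x * pd i f x)"
    by (rule integrable_compact_support(1)[OF _ K], rule continuous_on_zero_extension1[OF assms(1) K assms(3)])
       (use z in \<open>auto intro!: continuous_intros assms(5) continuous_on_subset[OF C1c_continuous[OF assms(2)]]\<close>)
  have 2: "integrable lebesgue (\<lambda>x. pd i \<phi> x * f x)"
    by (rule integrable_compact_support(1)[OF _ K], rule continuous_on_zero_extension1[OF assms(1) K assms(3)])
       (use pz in \<open>auto intro!: continuous_intros cf continuous_on_subset[OF c]\<close>)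
  have "0 = integral\<^sup>L lebesgue (pd i (\<lambda>x. \<phi> x * f x))"
    by (rule integral_pd_zero[OF C1c_mult(1)[OF assms], symmetric])
  also have "\<dots> = (LINT x|lebesgue. \<phi> x * pd i f x + pd i \<phi> x * f x)"
    by (rule Bochner_Integration.integral_cong[OF refl]) (rule C1c_mult(2)[OF assms])
  also have "\<dots> = (LINT x|lebesgue. \<phi> x * pd i f x) + (LINT x|lebesgue. pd i \<phi> x * f x)"
    by (rule Bochner_Integration.integral_add[OF 1 2])
  finally show ?thesis by simp
qed

subsection \<open>Test functions and weak derivatives\<close>

lemma test_funI:
  assumes "smooth_on UNIV \<phi>" "compact K" "K \<subseteq> \<Omega>" "\<And>x. x \<notin> K \<Longrightarrow> \<phi> x = 0"
  shows "\<phi> \<in> test_fun \<Omega>"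
proof -
  have "closure {x. \<phi> x \<noteq> 0} \<subseteq> K"
    using assms(2,4) by (intro closure_minimal) (auto simp: compact_imp_closed)
  then show ?thesis using assms
    by (auto simp: test_fun_def compact_eq_bounded_closed intro: bounded_subset)
qed

lemma test_fun_obtain:
  assumes "\<phi> \<in> test_fun \<Omega>"
  obtains K where "C1c K \<phi>" "K \<subseteq> \<Omega>"
proof
  show "closure {x. \<phi> x \<noteq> 0} \<subseteq> \<Omega>" using assms by (auto simp: test_fun_def)
  have "smooth_on UNIV \<phi>" using assms by (auto simp: test_fun_def)
  from smooth_on_differentiable[OF this] smooth_on_continuous[OF smooth_on_pd[OF this]]
  show "C1c (closure {x. \<phi> x \<noteq> 0}) \<phi>"
    using assms closure_subset[of "{x. \<phi> x \<noteq> 0}"] by (auto simp: C1c_def test_fun_def)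
qed

lemma test_fun_smooth: "\<phi> \<in> test_fun \<Omega> \<Longrightarrow> smooth_on UNIV \<phi>"
  by (auto simp: test_fun_def)

lemma test_fun_pd: "\<phi> \<in> test_fun \<Omega> \<Longrightarrow> pd i \<phi> \<in> test_fun \<Omega>"
proof -
  assume a: "\<phi> \<in> test_fun \<Omega>"
  then obtain K where "C1c K \<phi>" "K \<subseteq> \<Omega>" by (rule test_fun_obtain)
  then show ?thesis
    using C1c_pd_zero test_fun_smooth[OF a] by (intro test_funI[of _ K] smooth_on_pd) (auto simp: C1c_def)
qed

lemma mi_order_axis: "mi_order (axis i 1) = 1"
  by (simp add: mi_order_def axis_def if_distrib cong: if_cong)

lemma mi_order_axis2: "mi_order (axis i 1 + axis j 1) = 2"
  using mi_order_axis[of i] mi_order_axis[of j] by (simp add: mi_order_def sum.distrib)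

lemma mi_order_axis' [simp]:
  "mi_order (axis i (Suc 0)) = Suc 0" "mi_order (axis i (Suc 0) + axis j (Suc 0)) = 2"
  using mi_order_axis[of i] mi_order_axis2[of i j] by auto

lemma mi_order_0: "mi_order 0 = 0"
  by (simp add: mi_order_def)

lemma pd_multi_axis: "pd_multi (axis i 1) \<phi> = pd i \<phi>"
  using exhaust_3[of i] by (auto simp: pd_multi_def axis_def)

lemma pd_multi_0: "pd_multi 0 \<phi> = \<phi>"
  by (simp add: pd_multi_def)

lemma loc_integrable_continuous:
  fixes f :: "real^3 \<Rightarrow> 'b::euclidean_space"
  assumes "continuous_on \<Omega> f"
  shows "loc_integrable \<Omega> f"
  unfolding loc_integrable_def
proof (intro allI impI)
  fix K assume K: "compact K \<and> K \<subseteq> \<Omega>"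
  then have "integrable lborel (\<lambda>x. indicator K x *\<^sub>R f x)"
    using assms by (intro borel_integrable_compact) (auto intro: continuous_on_subset)
  then show "f absolutely_integrable_on K"
    unfolding set_integrable_def by (subst integrable_completion) auto
qed

lemma classical_weak_deriv:
  assumes "open \<Omega>" "\<And>x. x \<in> \<Omega> \<Longrightarrow> f differentiable (at x)" "\<And>i. continuous_on \<Omega> (pd i f)"
  shows "has_weak_deriv \<Omega> (axis i 1) f (pd i f :: real^3 \<Rightarrow> real)"
  unfolding has_weak_deriv_def
proof (intro conjI ballI)
  have cf: "continuous_on \<Omega> f"
    using assms(2) by (auto intro!: continuous_at_imp_continuous_on differentiable_imp_continuous_within)
  show "loc_integrable \<Omega> f" "loc_integrable \<Omega> (pd i f)"
    using cf assms(3) by (auto intro: loc_integrable_continuous)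
  fix \<phi> assume "\<phi> \<in> test_fun \<Omega>"
  then obtain K where K: "C1c K \<phi>" "K \<subseteq> \<Omega>" by (rule test_fun_obtain)
  have l: "\<Omega> \<in> sets lebesgue" by (rule open_sets_lebesgue[OF assms(1)])
  have "(LINT x|lebesgue_on \<Omega>. pd_multi (axis i 1) \<phi> x *\<^sub>R f x) = (LINT x|lebesgue. pd i \<phi> x * f x)"
    unfolding pd_multi_axis real_scaleR_def
    by (rule integral_lebesgue_on_support[OF l]) (use C1c_pd_zero[OF K(1)] K(2) in auto)
  moreover have "(LINT x|lebesgue_on \<Omega>. \<phi> x *\<^sub>R pd i f x) = (LINT x|lebesgue. \<phi> x * pd i f x)"
    unfolding real_scaleR_def
    by (rule integral_lebesgue_on_support[OF l]) (use K in \<open>auto simp: C1c_def\<close>)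
  ultimately show "(LINT x|lebesgue_on \<Omega>. pd_multi (axis i 1) \<phi> x *\<^sub>R f x) =
      (-1) ^ mi_order (axis i 1) *\<^sub>R (LINT x|lebesgue_on \<Omega>. \<phi> x *\<^sub>R pd i f x)"
    using integral_by_parts[OF assms(1) K assms(2,3)] by (simp add: mi_order_axis)
qed

lemma has_vector_derivative_along_axis:
  fixes \<phi> :: "real^3 \<Rightarrow> real"
  assumes "\<phi> differentiable at (x + t *\<^sub>R axis i 1)"
  shows "((\<lambda>t. \<phi> (x + t *\<^sub>R axis i 1)) has_real_derivative pd i \<phi> (x + t *\<^sub>R axis i 1)) (at t within S)"
proof -
  have "((\<lambda>t. x + t *\<^sub>R axis i 1) has_derivative (\<lambda>s. s *\<^sub>R (axis i 1::real^3))) (at t within S)"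
    by (auto intro!: derivative_eq_intros)
  from has_derivative_compose[OF this has_derivative_pd[OF assms]]
  have "((\<lambda>t. \<phi> (x + t *\<^sub>R axis i 1)) has_derivative
       (\<lambda>s. frechet_derivative \<phi> (at (x + t *\<^sub>R axis i 1)) (s *\<^sub>R axis i 1))) (at t within S)" .
  moreover have "frechet_derivative \<phi> (at (x + t *\<^sub>R axis i 1)) (s *\<^sub>R axis i 1) = pd i \<phi> (x + t *\<^sub>R axis i 1) * s" for s
    using linear_cmul[OF linear_frechet_derivative[OF assms], of s "axis i 1"] by (simp add: pd_def mult.commute)
  ultimately show ?thesis by (simp add: has_field_derivative_def)
qed

text \<open>Schwarz's theorem: differentiating the fundamental theorem along direction i with
  respect to a shift in direction j shows that the increment of \<open>pd j \<phi>\<close> over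
  [0, s] is the integral of \<open>pd j (pd i \<phi>)\<close>. Differentiating in s at 0 exchanges
  the order.\<close>

lemma pd_commute:
  fixes \<phi> :: "real^3 \<Rightarrow> real"
  assumes "smooth_on UNIV \<phi>"
  shows "pd i (pd j \<phi>) = pd j (pd i \<phi>)"
proof
  fix x
  let ?e = "axis i 1 :: real^3" and ?f = "axis j 1 :: real^3"
  have d: "\<phi> differentiable at z" "pd i \<phi> differentiable at z" "pd j \<phi> differentiable at z" for z
    using assms by (auto intro!: smooth_on_differentiable[of UNIV] smooth_on_pd)
  have c: "continuous_on UNIV \<phi>" "continuous_on UNIV (pd i \<phi>)" "continuous_on UNIV (pd j \<phi>)" "continuous_on UNIV (pd j (pd i \<phi>))"
    using assms by (auto intro!: smooth_on_continuous smooth_on_pd)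
  define J where "J s = integral {0..s} (\<lambda>r. pd j (pd i \<phi>) (x + r *\<^sub>R ?e))" for s
  have eq: "pd j \<phi> (x + s *\<^sub>R ?e) - pd j \<phi> x = J s" if s: "0 \<le> s" for s
  proof -
    define A where "A t = integral (cbox 0 s) (\<lambda>r. pd i \<phi> (x + t *\<^sub>R ?f + r *\<^sub>R ?e))" for t
    have A: "A t = \<phi> (x + t *\<^sub>R ?f + s *\<^sub>R ?e) - \<phi> (x + t *\<^sub>R ?f)" for t
    proof -
      have "((\<lambda>r. pd i \<phi> (x + t *\<^sub>R ?f + r *\<^sub>R ?e)) has_integral
         (\<phi> (x + t *\<^sub>R ?f + s *\<^sub>R ?e) - \<phi> (x + t *\<^sub>R ?f + 0 *\<^sub>R ?e))) {0..s}"
        by (rule fundamental_theorem_of_calculus[OF s])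
           (use has_vector_derivative_along_axis[OF d(1)] in \<open>simp add: has_real_derivative_iff_has_vector_derivative\<close>)
      then show ?thesis by (simp add: A_def integral_unique)
    qed
    have "(A has_real_derivative integral (cbox 0 s) (\<lambda>r. pd j (pd i \<phi>) (x + 0 *\<^sub>R ?f + r *\<^sub>R ?e))) (at 0 within UNIV)"
      unfolding A_def
    proof (rule leibniz_rule_field_derivative)
      fix t r :: real
      show "((\<lambda>t. pd i \<phi> (x + t *\<^sub>R ?f + r *\<^sub>R ?e)) has_real_derivative pd j (pd i \<phi>) (x + t *\<^sub>R ?f + r *\<^sub>R ?e)) (at t within UNIV)"
        using has_vector_derivative_along_axis[OF d(2), where x = "x + r *\<^sub>R ?e" and t = t and i = j and S = UNIV] by (simp add: add_ac)
      show "(\<lambda>r. pd i \<phi> (x + t *\<^sub>R ?f + r *\<^sub>R ?e)) integrable_on cbox 0 s"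
        by (intro integrable_continuous continuous_on_compose2[OF c(2)] continuous_intros) auto
    qed (auto simp: split_beta intro!: continuous_on_compose2[OF c(4)] continuous_intros)
    moreover have "(A has_real_derivative pd j \<phi> (x + s *\<^sub>R ?e) - pd j \<phi> x) (at 0)"
      unfolding A[abs_def]
      using DERIV_diff[OF has_vector_derivative_along_axis[OF d(1), where x = "x + s *\<^sub>R ?e" and t = 0 and i = j] has_vector_derivative_along_axis[OF d(1), where x = x and t = 0 and i = j]]
      by (simp add: add_ac)
    ultimately have "pd j \<phi> (x + s *\<^sub>R ?e) - pd j \<phi> x = integral (cbox 0 s) (\<lambda>r. pd j (pd i \<phi>) (x + 0 *\<^sub>R ?f + r *\<^sub>R ?e))"
      by (metis DERIV_unique)
    then show ?thesis by (simp add: J_def)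
  qed
  \<comment> \<open>The formula \<open>eq\<close> is available for s \<ge> 0 only; a one-sided
    derivative at 0 is enough for uniqueness.\<close>
  have J: "(J has_real_derivative pd j (pd i \<phi>) (x + 0 *\<^sub>R ?e)) (at 0 within {0..1})"
    unfolding J_def[abs_def] has_real_derivative_iff_has_vector_derivative
    by (rule integral_has_vector_derivative) (auto intro!: continuous_on_compose2[OF c(4)] continuous_intros)
  have "((\<lambda>s. pd j \<phi> (x + s *\<^sub>R ?e) - pd j \<phi> x) has_real_derivative pd i (pd j \<phi>) (x + 0 *\<^sub>R ?e) - 0) (at 0 within {0..1})"
    by (intro DERIV_diff has_vector_derivative_along_axis d DERIV_const)
  then have "(J has_real_derivative pd i (pd j \<phi>) (x + 0 *\<^sub>R ?e) - 0) (at 0 within {0..1})"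
    by (rule DERIV_transform_set[rotated 2]) (use eq in auto)
  moreover have "at (0::real) within {0..1} \<noteq> bot"
    by (simp add: trivial_limit_within islimpt_Icc)
  ultimately show "pd i (pd j \<phi>) x = pd j (pd i \<phi>) x"
    using has_field_derivative_unique[OF J] by simp
qed

lemma pd_multi_axis2:
  assumes "smooth_on UNIV \<phi>"
  shows "pd_multi (axis i 1 + axis j 1) \<phi> = pd i (pd j \<phi>)"
  using exhaust_3[of i] exhaust_3[of j] pd_commute[OF assms]
  by (auto simp: pd_multi_def axis_def numeral_2_eq_2)

text \<open>One derivative is moved back onto f by classical integration by parts, the other stays
  weak. This makes Morrey estimates applicable to the gradient of a function with weak second
  derivatives.\<close>

lemma weak_deriv_pd:
  fixes f g :: "real^3 \<Rightarrow> real"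
  assumes "open \<Omega>" "\<And>x. x \<in> \<Omega> \<Longrightarrow> f differentiable (at x)" "\<And>i. continuous_on \<Omega> (pd i f)"
    and "has_weak_deriv \<Omega> (axis i 1 + axis j 1) f g"
  shows "has_weak_deriv \<Omega> (axis j 1) (pd i f) g"
  unfolding has_weak_deriv_def
proof (intro conjI ballI)
  show "loc_integrable \<Omega> (pd i f)" "loc_integrable \<Omega> g"
    using assms by (auto intro: loc_integrable_continuous simp: has_weak_deriv_def)
  fix \<phi> assume \<phi>: "\<phi> \<in> test_fun \<Omega>"
  obtain K where K: "C1c K (pd j \<phi>)" "K \<subseteq> \<Omega>" using test_fun_pd[OF \<phi>] by (rule test_fun_obtain)
  have l: "\<Omega> \<in> sets lebesgue" by (rule open_sets_lebesgue[OF assms(1)])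
  have "(LINT x|lebesgue_on \<Omega>. pd_multi (axis j 1) \<phi> x *\<^sub>R pd i f x) = (LINT x|lebesgue. pd j \<phi> x * pd i f x)"
    unfolding pd_multi_axis real_scaleR_def
    by (rule integral_lebesgue_on_support[OF l]) (use K in \<open>auto simp: C1c_def\<close>)
  also have "\<dots> = - (LINT x|lebesgue. pd i (pd j \<phi>) x * f x)"
    using integral_by_parts[OF assms(1) K assms(2,3)] by simp
  also have "(LINT x|lebesgue. pd i (pd j \<phi>) x * f x) = (LINT x|lebesgue_on \<Omega>. pd_multi (axis i 1 + axis j 1) \<phi> x *\<^sub>R f x)"
    unfolding pd_multi_axis2[OF test_fun_smooth[OF \<phi>]] real_scaleR_def
    by (rule integral_lebesgue_on_support[OF l, symmetric]) (use C1c_pd_zero[OF K(1)] K(2) in auto)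
  also have "\<dots> = (LINT x|lebesgue_on \<Omega>. \<phi> x *\<^sub>R g x)"
    using assms(4) \<phi> by (simp add: has_weak_deriv_def mi_order_axis2)
  finally show "(LINT x|lebesgue_on \<Omega>. pd_multi (axis j 1) \<phi> x *\<^sub>R pd i f x) =
      (-1) ^ mi_order (axis j 1) *\<^sub>R (LINT x|lebesgue_on \<Omega>. \<phi> x *\<^sub>R g x)"
    by (simp add: mi_order_axis)
qed

subsection \<open>Uniqueness of weak derivatives\<close>

lemma prod_UNIV_3: "(\<Prod>k\<in>(UNIV :: 3 set). f k) = f 1 * f 2 * (f 3 :: real)"
  unfolding UNIV_3 by (simp add: ac_simps)

lemma continuous_imp_lebesgue_measurable:
  fixes f :: "'a::euclidean_space \<Rightarrow> 'b::euclidean_space"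
  shows "continuous_on UNIV f \<Longrightarrow> f \<in> borel_measurable lebesgue"
  by (rule measurable_completion) (simp add: borel_measurable_continuous_onI)

text \<open>The indicator of the box is no test function, but it is the limit of
  \<open>bump1 (n g)\<close> for a smooth g that is positive exactly in the open box: there
  exp(-1/(n g)) tends to 1. The limit passes under the integral by dominated convergence.\<close>

lemma box_integral_zero:
  fixes w :: "real^3 \<Rightarrow> real"
  assumes "open \<Omega>" "loc_integrable \<Omega> w" "\<And>\<phi>. \<phi> \<in> test_fun \<Omega> \<Longrightarrow> (LINT x|lebesgue_on \<Omega>. \<phi> x * w x) = 0"
    and cd: "cbox c d \<subseteq> \<Omega>"
  shows "(LINT x|lebesgue. indicator (box c d) x * w x) = 0"
proof -
  define g where "g x = (\<Prod>k\<in>UNIV. bump1 (x $ k - c $ k) * bump1 (d $ k - x $ k))" for x :: "real^3"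
  define \<phi> where "\<phi> n x = bump1 (real n * g x)" for n x
  have sb: "smooth_on UNIV (\<lambda>x. bump1 (x $ k + - (c $ k)))" "smooth_on UNIV (\<lambda>x. bump1 (d $ k + (-1) * x $ k))" for k
    unfolding bump1_def
    by (rule smooth_on_compose_real[OF smooth_real_expinv], intro smooth_on_add smooth_on_mult smooth_on_const smooth_on_nth open_UNIV)+
  have sg: "smooth_on UNIV g"
  proof -
    have "smooth_on UNIV (\<lambda>x. (bump1 (x $ 1 + - (c $ 1)) * bump1 (d $ 1 + (-1) * x $ 1)) *
       ((bump1 (x $ 2 + - (c $ 2)) * bump1 (d $ 2 + (-1) * x $ 2)) * (bump1 (x $ 3 + - (c $ 3)) * bump1 (d $ 3 + (-1) * x $ 3))))"
      by (intro smooth_on_mult sb open_UNIV)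
    moreover have "g = (\<lambda>x. (bump1 (x $ 1 + - (c $ 1)) * bump1 (d $ 1 + (-1) * x $ 1)) *
       ((bump1 (x $ 2 + - (c $ 2)) * bump1 (d $ 2 + (-1) * x $ 2)) * (bump1 (x $ 3 + - (c $ 3)) * bump1 (d $ 3 + (-1) * x $ 3))))"
      by (rule ext) (simp add: g_def prod_UNIV_3 mult.assoc)
    ultimately show ?thesis by simp
  qed
  have s\<phi>: "smooth_on UNIV (\<phi> n)" for n
    unfolding \<phi>_def[abs_def] bump1_def[abs_def]
    by (rule smooth_on_compose_real[OF smooth_real_expinv]) (intro smooth_on_mult smooth_on_const sg open_UNIV)
  have gpos: "g x > 0" if "x \<in> box c d" for x
    unfolding g_def using that by (intro prod_pos) (auto simp: mem_box_cart intro!: mult_pos_pos bump1_simps(2))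
  have gz: "g x = 0" if nb: "x \<notin> box c d" for x
  proof -
    obtain k where "x $ k \<le> c $ k \<or> d $ k \<le> x $ k"
      using nb unfolding mem_box_cart by (meson not_less)
    then have "bump1 (x $ k - c $ k) * bump1 (d $ k - x $ k) = 0" by (auto simp: bump1_simps(1))
    then show ?thesis unfolding g_def by (intro prod_zero) auto
  qed
  have \<phi>z: "\<phi> n x = 0" if "x \<notin> box c d" for n x
    using gz[OF that] by (simp add: \<phi>_def bump1_simps(1))
  have t: "\<phi> n \<in> test_fun \<Omega>" for n
    by (rule test_funI[OF s\<phi> compact_cbox cd]) (use \<phi>z box_subset_cbox in blast)
  define w' where "w' x = indicator (cbox c d) x * w x" for x
  have iw: "integrable lebesgue w'"
    using assms(2) cd by (auto simp: w'_def[abs_def] loc_integrable_def set_integrable_def)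
  have z: "(LINT x|lebesgue. \<phi> n x * w' x) = 0" for n
  proof -
    have "(LINT x|lebesgue. \<phi> n x * w' x) = (LINT x|lebesgue. \<phi> n x * w x)"
      by (rule Bochner_Integration.integral_cong[OF refl]) (use \<phi>z box_subset_cbox[of c d] in \<open>auto simp: w'_def indicator_def\<close>)
    also have "\<dots> = (LINT x|lebesgue_on \<Omega>. \<phi> n x * w x)"
      by (rule integral_lebesgue_on_support[symmetric, OF open_sets_lebesgue[OF assms(1)]])
         (use \<phi>z box_subset_cbox[of c d] cd in auto)
    finally show ?thesis using assms(3)[OF t] by simp
  qed
  have "(\<lambda>n. LINT x|lebesgue. \<phi> n x * w' x) \<longlonglongrightarrow> (LINT x|lebesgue. indicator (box c d) x * w' x)"
  proof (rule integral_dominated_convergence)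
    show "integrable lebesgue (\<lambda>x. \<bar>w' x\<bar>)" using iw by simp
    have mw: "w' \<in> borel_measurable lebesgue" using iw by auto
    show "(\<lambda>x. indicator (box c d) x * w' x) \<in> borel_measurable lebesgue"
      by (intro borel_measurable_times mw borel_measurable_indicator open_sets_lebesgue open_box)
    have "\<phi> n \<in> borel_measurable lebesgue" for n
      by (rule continuous_imp_lebesgue_measurable[OF smooth_on_continuous[OF s\<phi>]])
    then show "(\<lambda>x. \<phi> n x * w' x) \<in> borel_measurable lebesgue" for n
      by (intro borel_measurable_times mw)
    show "AE x in lebesgue. norm (\<phi> n x * w' x) \<le> \<bar>w' x\<bar>" for n
      using bump1_simps(3,4) by (auto simp: \<phi>_def abs_mult intro!: mult_left_le_one_le)
    show "AE x in lebesgue. (\<lambda>n. \<phi> n x * w' x) \<longlonglongrightarrow> indicator (box c d) x * w' x"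
    proof (intro AE_I2 tendsto_mult tendsto_const)
      fix x
      show "(\<lambda>n. \<phi> n x) \<longlonglongrightarrow> indicator (box c d) x"
      proof (cases "x \<in> box c d")
        case True
        have "((\<lambda>t. exp (- (inverse t))) \<longlongrightarrow> exp (- 0)) (at_top::real filter)"
          by (intro tendsto_intros tendsto_inverse_0_at_top filterlim_ident)
        then have e: "((\<lambda>t. exp (- (inverse t))) \<longlongrightarrow> 1) (at_top::real filter)" by simp
        have "filterlim (\<lambda>n. real n * g x) at_top sequentially"
          using gpos[OF True] by (intro filterlim_at_top_mult_tendsto_pos[OF tendsto_const _ filterlim_real_sequentially, THEN filterlim_cong[THEN iffD1, rotated -1]]) (auto simp: mult.commute)
        from filterlim_compose[OF e this]
        have "(\<lambda>n. exp (- (inverse (real n * g x)))) \<longlonglongrightarrow> 1" .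
        moreover have "eventually (\<lambda>n. exp (- (inverse (real n * g x))) = \<phi> n x) sequentially"
          using eventually_gt_at_top[of 0] by eventually_elim
            (use gpos[OF True] in \<open>auto simp: \<phi>_def bump1_def expinv_def inverse_eq_divide\<close>)
        ultimately show ?thesis using True by (simp add: Lim_transform_eventually)
      qed (use \<phi>z in auto)
    qed
  qed
  then have "(LINT x|lebesgue. indicator (box c d) x * w' x) = 0"
    unfolding z by (rule LIMSEQ_unique[OF _ tendsto_const])
  moreover have "(\<lambda>x. indicator (box c d) x * w' x) = (\<lambda>x. indicator (box c d) x * w x)"
    using box_subset_cbox[of c d] by (auto simp: w'_def fun_eq_iff indicator_def)
  ultimately show ?thesis by simp
qed

text \<open>Open boxes generate the Borel sets and are stable under intersection, so w restricted to
  the box has integral zero over every Borel set and vanishes almost everywhere.\<close>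

lemma AE_zero_box:
  fixes w :: "real^3 \<Rightarrow> real"
  assumes "open \<Omega>" "loc_integrable \<Omega> w" "\<And>\<phi>. \<phi> \<in> test_fun \<Omega> \<Longrightarrow> (LINT x|lebesgue_on \<Omega>. \<phi> x * w x) = 0"
    and ab: "cbox a b \<subseteq> \<Omega>"
  shows "AE x in lebesgue. x \<in> box a b \<longrightarrow> w x = 0"
proof -
  define v where "v x = indicator (box a b) x * w x" for x
  have "integrable lebesgue (\<lambda>x. indicator (cbox a b) x * w x)"
    using assms(2) ab by (auto simp: loc_integrable_def set_integrable_def)
  from integrable_mult_indicator[OF open_sets_lebesgue[OF open_box[of a b]] this]
  have iv: "integrable lebesgue v"
    by (rule Bochner_Integration.integrable_cong[OF refl, THEN iffD1, rotated])
       (use box_subset_cbox[of a b] in \<open>auto simp: v_def indicator_def\<close>)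
  have P: "(LINT x|lebesgue. indicator A x * v x) = 0" if "A \<in> sets borel" for A :: "(real^3) set"
  proof -
    have 0: "(LINT x|lebesgue. indicator (box c d) x * v x) = 0" for c d :: "real^3"
    proof -
      \<comment> \<open>The closed box \<open>cbox c' d'\<close> has to lie in
        \<open>cbox a b\<close>, not just the open one; an empty intersection is therefore
        represented by corners for which the closed box is empty too.\<close>
      obtain c' d' where *: "box c d \<inter> box a b = box c' d'" "cbox c' d' \<subseteq> cbox a b"
      proof (cases "box c d \<inter> box a b = {}")
        case True
        have "x \<notin> box (1::real^3) 0" "x \<notin> cbox (1::real^3) 0" for x
          by (auto simp: mem_box_cart intro!: exI[of _ 1])
        then have "box (1::real^3) 0 = {}" "cbox (1::real^3) 0 = {}" by blast+
        then show ?thesis using that[of 1 0] True by auto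
      next
        case False
        define c' d' where "c' = (\<chi> k. max (c $ k) (a $ k))" and "d' = (\<chi> k. min (d $ k) (b $ k))"
        have "box c d \<inter> box a b = box c' d'" by (auto simp: c'_def d'_def mem_box_cart)
        moreover have "cbox c' d' \<subseteq> cbox a b" by (auto simp: c'_def d'_def mem_box_cart)
        ultimately show ?thesis using that by blast
      qed
      have "(\<lambda>x. indicator (box c d) x * v x) = (\<lambda>x. indicator (box c' d') x * w x)"
        using *(1) by (auto simp: v_def fun_eq_iff indicator_def)
      then show ?thesis using box_integral_zero[OF assms(1-3), of c' d'] *(2) ab by simp
    qed
    have tot: "(LINT x|lebesgue. v x) = 0"
      using box_integral_zero[OF assms] by (simp add: v_def)
    let ?G = "range (\<lambda>(a, b). box a b) :: (real^3) set set"
    have A: "A \<in> sigma_sets UNIV ?G"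
      using that by (simp add: borel_eq_box)
    have st: "Int_stable ?G"
      unfolding Int_stable_def
    proof (intro ballI)
      fix X Y assume "X \<in> ?G" "Y \<in> ?G"
      then obtain c d c' d' where "X = box c d" "Y = box c' d'" by auto
      then have "X \<inter> Y = box (\<chi> k. max (c $ k) (c' $ k)) (\<chi> k. min (d $ k) (d' $ k))"
        by (auto simp: mem_box_cart)
      then show "X \<inter> Y \<in> ?G" by auto
    qed
    have "?G \<subseteq> Pow UNIV" by simp
    from st this A show ?thesis
    proof (induction rule: sigma_sets_induct_disjoint)
      case (basic A) then show ?case using 0 by auto
    next
      case empty then show ?case by simp
    next
      case (compl A)
      have "A \<in> sets borel" using compl(1) by (simp add: borel_eq_box)
      then have m: "A \<in> sets lebesgue" by auto
      have "(LINT x|lebesgue. indicator (UNIV - A) x * v x) = (LINT x|lebesgue. v x - indicator A x * v x)"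
        by (rule Bochner_Integration.integral_cong) (auto simp: indicator_def)
      also have "\<dots> = (LINT x|lebesgue. v x) - (LINT x|lebesgue. indicator A x * v x)"
        using integrable_mult_indicator[OF m iv] by (intro Bochner_Integration.integral_diff iv) auto
      finally show ?case using compl tot by simp
    next
      case (union A)
      have "A i \<in> sets borel" for i using union(2) by (simp add: borel_eq_box image_subset_iff)
      then have m: "A i \<in> sets lebesgue" for i by auto
      have "set_integrable lebesgue (\<Union>i. A i) v"
        unfolding set_integrable_def using m by (intro integrable_mult_indicator iv) auto
      from lebesgue_integral_countable_add[OF m _ this]
      have "(LINT x:(\<Union>i. A i)|lebesgue. v x) = (\<Sum>i. LINT x:(A i)|lebesgue. v x)"
        using union(1) by (auto simp: disjoint_family_on_def)
      then show ?case using union(3) by (simp add: set_lebesgue_integral_def)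
    qed
  qed
  \<comment> \<open>v is only Lebesgue measurable; a Borel representative carries the argument over
    to \<open>lborel\<close>.\<close>
  obtain v' where v': "v' \<in> borel_measurable lborel" "AE x in lborel. v x = v' x"
    using completion_ex_borel_measurable_real[of v lborel] iv by auto
  have ae: "AE x in lebesgue. v x = v' x" using v'(2) by (rule AE_completion)
  have m': "v' \<in> borel_measurable lebesgue" using v'(1) by (rule measurable_completion)
  have iv': "integrable lborel v'"
    using integrable_cong_AE_imp[OF iv m'] ae v'(1) integrable_completion[of v' lborel] by (simp add: eq_commute)
  have "AE x in lborel. v' x = 0"
  proof (rule sigma_finite_measure.density_zero[OF sigma_finite_lborel iv'])
    fix A :: "(real^3) set" assume "A \<in> sets lborel"
    then have A: "A \<in> sets borel" by simp
    then have Al: "A \<in> sets lebesgue" by auto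
    have "(LINT x:A|lborel. v' x) = (LINT x|lebesgue. indicator A x * v' x)"
      unfolding set_lebesgue_integral_def real_scaleR_def
      by (rule integral_completion[symmetric]) (use v'(1) A in \<open>auto intro!: borel_measurable_times\<close>)
    also have "\<dots> = (LINT x|lebesgue. indicator A x * v x)"
      by (rule integral_cong_AE) (use ae m' iv Al in \<open>auto intro!: borel_measurable_times borel_measurable_integrable\<close>)
    finally show "(LINT x:A|lborel. v' x) = 0" using P[OF A] by simp
  qed
  then have "AE x in lebesgue. v' x = 0" by (rule AE_completion)
  with ae have "AE x in lebesgue. v x = 0" by eventually_elim simp
  then show ?thesis by eventually_elim (auto simp: v_def indicator_def)
qed

lemma AE_lebesgue_on: "\<Omega> \<in> sets lebesgue \<Longrightarrow> (AE x in lebesgue_on \<Omega>. P x) \<longleftrightarrow> (AE x in lebesgue. x \<in> \<Omega> \<longrightarrow> P x)"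
  by (rule AE_restrict_space_iff) simp

text \<open>By Lindelof's theorem countably many boxes with closure in \<Omega> cover \<Omega>, so
  the null sets of \<open>AE_zero_box\<close> can be united.\<close>

lemma fundamental_lemma:
  fixes w :: "real^3 \<Rightarrow> real"
  assumes "open \<Omega>" "loc_integrable \<Omega> w" "\<And>\<phi>. \<phi> \<in> test_fun \<Omega> \<Longrightarrow> (LINT x|lebesgue_on \<Omega>. \<phi> x * w x) = 0"
  shows "AE x in lebesgue_on \<Omega>. w x = 0"
proof -
  define F where "F = {box a b |a b :: real^3. cbox a b \<subseteq> \<Omega>}"
  obtain F' where F': "F' \<subseteq> F" "countable F'" "\<Union>F' = \<Union>F"
    using Lindelof[of F] by (auto simp: F_def)
  have "\<Omega> \<subseteq> \<Union>F"
  proof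
    fix x assume "x \<in> \<Omega>"
    then obtain a b where "x \<in> box a b" "cbox a b \<subseteq> \<Omega>"
      using open_contains_cbox[OF assms(1)] by metis
    then show "x \<in> \<Union>F" by (auto simp: F_def)
  qed
  moreover have "AE x in lebesgue. \<forall>B\<in>F'. x \<in> B \<longrightarrow> w x = 0"
    using F' AE_zero_box[OF assms] by (subst AE_ball_countable) (auto simp: F_def)
  ultimately show ?thesis
    unfolding AE_lebesgue_on[OF open_sets_lebesgue[OF assms(1)]] using F'(3)
    by (elim AE_mp) (auto intro!: AE_I2)
qed

lemma integrable_test_mult:
  fixes f :: "real^3 \<Rightarrow> 'b::euclidean_space"
  assumes "open \<Omega>" "loc_integrable \<Omega> f" "continuous_on UNIV \<phi>" "compact K" "K \<subseteq> \<Omega>" "\<And>x. x \<notin> K \<Longrightarrow> \<phi> x = (0::real)"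
  shows "integrable (lebesgue_on \<Omega>) (\<lambda>x. \<phi> x *\<^sub>R f x)"
proof -
  have i: "integrable lebesgue (\<lambda>x. indicator K x *\<^sub>R f x)"
    using assms by (auto simp: loc_integrable_def set_integrable_def)
  obtain B where B: "\<And>x. x \<in> K \<Longrightarrow> \<bar>\<phi> x\<bar> \<le> B"
    using compact_imp_bounded[OF compact_continuous_image[OF continuous_on_subset[OF assms(3)] assms(4)]]
    by (auto simp: bounded_iff)
  have "integrable lebesgue (\<lambda>x. \<phi> x *\<^sub>R indicator K x *\<^sub>R f x)"
  proof (rule Bochner_Integration.integrable_bound)
    show "integrable lebesgue (\<lambda>x. B *\<^sub>R (indicator K x *\<^sub>R f x))" using i by (intro integrable_scaleR_right)
    have "\<phi> \<in> borel_measurable lebesgue"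
      by (rule continuous_imp_lebesgue_measurable[OF assms(3)])
    then show "(\<lambda>x. \<phi> x *\<^sub>R indicator K x *\<^sub>R f x) \<in> borel_measurable lebesgue"
      by (rule borel_measurable_scaleR[OF _ borel_measurable_integrable[OF i]])
    show "AE x in lebesgue. norm (\<phi> x *\<^sub>R indicator K x *\<^sub>R f x) \<le> norm (B *\<^sub>R indicator K x *\<^sub>R f x)"
      using B by (intro AE_I2) (fastforce simp: indicator_def intro!: mult_right_mono)
  qed
  moreover have "(\<lambda>x. \<phi> x *\<^sub>R indicator K x *\<^sub>R f x) = (\<lambda>x. \<phi> x *\<^sub>R f x)"
    using assms(6) by (auto simp: fun_eq_iff indicator_def)
  ultimately show ?thesis
    using assms by (subst integrable_lebesgue_on_support) (auto intro!: open_sets_lebesgue)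
qed

lemma integrable_test_fun:
  fixes f :: "real^3 \<Rightarrow> 'b::euclidean_space"
  assumes "open \<Omega>" "loc_integrable \<Omega> f" "\<phi> \<in> test_fun \<Omega>"
  shows "integrable (lebesgue_on \<Omega>) (\<lambda>x. \<phi> x *\<^sub>R f x)"
proof -
  obtain K where K: "C1c K \<phi>" "K \<subseteq> \<Omega>" using assms(3) by (rule test_fun_obtain)
  then show ?thesis
    using C1c_continuous[OF K(1)] by (intro integrable_test_mult[OF assms(1,2), of \<phi> K]) (auto simp: C1c_def)
qed

lemma test_fun_pd_multi: "\<phi> \<in> test_fun \<Omega> \<Longrightarrow> pd_multi \<alpha> \<phi> \<in> test_fun \<Omega>"
proof -
  have *: "(pd i ^^ n) \<phi> \<in> test_fun \<Omega>" if "\<phi> \<in> test_fun \<Omega>" for i n \<phi>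
    using that by (induction n) (auto intro: test_fun_pd)
  show "\<phi> \<in> test_fun \<Omega> \<Longrightarrow> pd_multi \<alpha> \<phi> \<in> test_fun \<Omega>"
    unfolding pd_multi_def by (intro *)
qed

lemma loc_integrable_inner:
  fixes f :: "real^3 \<Rightarrow> 'b::euclidean_space"
  assumes "loc_integrable \<Omega> f"
  shows "loc_integrable \<Omega> (\<lambda>x. f x \<bullet> b)"
  using assms unfolding loc_integrable_def
  by (auto intro!: absolutely_integrable_linear[where h = "\<lambda>x. x \<bullet> b", unfolded o_def] bounded_linear_inner_left)

lemma has_weak_deriv_inner:
  fixes f :: "real^3 \<Rightarrow> 'b::euclidean_space"
  assumes "open \<Omega>" "has_weak_deriv \<Omega> \<alpha> f g"
  shows "has_weak_deriv \<Omega> \<alpha> (\<lambda>x. f x \<bullet> b) (\<lambda>x. g x \<bullet> b)"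
  unfolding has_weak_deriv_def
proof (intro conjI ballI)
  have l: "loc_integrable \<Omega> f" "loc_integrable \<Omega> g" using assms by (auto simp: has_weak_deriv_def)
  then show "loc_integrable \<Omega> (\<lambda>x. f x \<bullet> b)" "loc_integrable \<Omega> (\<lambda>x. g x \<bullet> b)" by (auto intro: loc_integrable_inner)
  fix \<phi> assume \<phi>: "\<phi> \<in> test_fun \<Omega>"
  have "(LINT x|lebesgue_on \<Omega>. pd_multi \<alpha> \<phi> x *\<^sub>R (f x \<bullet> b)) = (LINT x|lebesgue_on \<Omega>. pd_multi \<alpha> \<phi> x *\<^sub>R f x) \<bullet> b"
    using integral_bounded_linear[OF bounded_linear_inner_left[of b] integrable_test_fun[OF assms(1) l(1) test_fun_pd_multi[OF \<phi>]]] by simp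
  moreover have "(LINT x|lebesgue_on \<Omega>. \<phi> x *\<^sub>R (g x \<bullet> b)) = (LINT x|lebesgue_on \<Omega>. \<phi> x *\<^sub>R g x) \<bullet> b"
    using integral_bounded_linear[OF bounded_linear_inner_left[of b] integrable_test_fun[OF assms(1) l(2) \<phi>]] by simp
  ultimately show "(LINT x|lebesgue_on \<Omega>. pd_multi \<alpha> \<phi> x *\<^sub>R (f x \<bullet> b)) =
        (-1) ^ mi_order \<alpha> *\<^sub>R (LINT x|lebesgue_on \<Omega>. \<phi> x *\<^sub>R (g x \<bullet> b))"
    using assms(2) \<phi> by (simp add: has_weak_deriv_def)
qed

lemma loc_integrable_diff: "loc_integrable \<Omega> f \<Longrightarrow> loc_integrable \<Omega> g \<Longrightarrow> loc_integrable \<Omega> (\<lambda>x. f x - g x)"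
  unfolding loc_integrable_def by (auto intro!: set_integral_diff(1))

lemma has_weak_deriv_diff:
  fixes f :: "real^3 \<Rightarrow> 'b::euclidean_space"
  assumes "open \<Omega>" "has_weak_deriv \<Omega> \<alpha> f g" "has_weak_deriv \<Omega> \<alpha> f' g'"
  shows "has_weak_deriv \<Omega> \<alpha> (\<lambda>x. f x - f' x) (\<lambda>x. g x - g' x)"
  unfolding has_weak_deriv_def
proof (intro conjI ballI)
  have l: "loc_integrable \<Omega> f" "loc_integrable \<Omega> g" "loc_integrable \<Omega> f'" "loc_integrable \<Omega> g'"
    using assms by (auto simp: has_weak_deriv_def)
  then show "loc_integrable \<Omega> (\<lambda>x. f x - f' x)" "loc_integrable \<Omega> (\<lambda>x. g x - g' x)" by (auto intro: loc_integrable_diff)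
  fix \<phi> assume \<phi>: "\<phi> \<in> test_fun \<Omega>"
  note i = integrable_test_fun[OF assms(1) l(1) test_fun_pd_multi[OF \<phi>]] integrable_test_fun[OF assms(1) l(3) test_fun_pd_multi[OF \<phi>]]
     integrable_test_fun[OF assms(1) l(2) \<phi>] integrable_test_fun[OF assms(1) l(4) \<phi>]
  have e: "(LINT x|lebesgue_on \<Omega>. pd_multi \<alpha> \<phi> x *\<^sub>R f x) = (-1) ^ mi_order \<alpha> *\<^sub>R (LINT x|lebesgue_on \<Omega>. \<phi> x *\<^sub>R g x)"
    "(LINT x|lebesgue_on \<Omega>. pd_multi \<alpha> \<phi> x *\<^sub>R f' x) = (-1) ^ mi_order \<alpha> *\<^sub>R (LINT x|lebesgue_on \<Omega>. \<phi> x *\<^sub>R g' x)"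
    using assms(2,3) \<phi> by (auto simp: has_weak_deriv_def)
  show "(LINT x|lebesgue_on \<Omega>. pd_multi \<alpha> \<phi> x *\<^sub>R (f x - f' x)) =
        (-1) ^ mi_order \<alpha> *\<^sub>R (LINT x|lebesgue_on \<Omega>. \<phi> x *\<^sub>R (g x - g' x))"
    unfolding scaleR_diff_right
    by (simp add: Bochner_Integration.integral_diff[OF i(1,2)] Bochner_Integration.integral_diff[OF i(3,4)] e scaleR_diff_right)
qed

text \<open>The difference is a weak derivative of 0; tested componentwise, it falls under
  \<open>fundamental_lemma\<close>.\<close>

lemma weak_deriv_unique:
  fixes f g g' :: "real^3 \<Rightarrow> 'b::euclidean_space"
  assumes "open \<Omega>" "has_weak_deriv \<Omega> \<alpha> f g" "has_weak_deriv \<Omega> \<alpha> f g'"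
  shows "AE x in lebesgue_on \<Omega>. g x = g' x"
proof -
  have "AE x in lebesgue_on \<Omega>. (g x - g' x) \<bullet> b = 0" if "b \<in> Basis" for b
  proof (rule fundamental_lemma[OF assms(1)])
    from has_weak_deriv_inner[OF assms(1) has_weak_deriv_diff[OF assms], where b = b]
    have h: "has_weak_deriv \<Omega> \<alpha> (\<lambda>x. 0) (\<lambda>x. (g x - g' x) \<bullet> b)" by simp
    then show "loc_integrable \<Omega> (\<lambda>x. (g x - g' x) \<bullet> b)" by (simp add: has_weak_deriv_def)
    fix \<phi> assume "\<phi> \<in> test_fun \<Omega>"
    with h show "(LINT x|lebesgue_on \<Omega>. \<phi> x * ((g x - g' x) \<bullet> b)) = 0"
      by (auto simp: has_weak_deriv_def)
  qed
  then have "AE x in lebesgue_on \<Omega>. \<forall>b\<in>Basis. (g x - g' x) \<bullet> b = 0"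
    by (subst AE_ball_countable) (auto intro: countable_finite)
  then show ?thesis
    by eventually_elim (metis eq_iff_diff_eq_0 euclidean_all_zero_iff)
qed

subsection \<open>Norm bounds\<close>

text \<open>Hoelder's inequality up to the factor 2. It follows from |g| \<le> l + l^(1-p) |g|^p,
  which distinguishes the points where |g| exceeds the level l; then l is optimised.\<close>

lemma int_le_powr:
  fixes g :: "'a \<Rightarrow> real"
  assumes "p > 1" "g \<in> borel_measurable M" "integrable M (\<lambda>x. \<bar>g x\<bar> powr p)" "E \<in> sets M" "emeasure M E < \<infinity>"
    and "(LINT x|M. \<bar>g x\<bar> powr p) \<le> N powr p" "N > 0"
  shows "integrable M (\<lambda>x. indicator E x * \<bar>g x\<bar>)"
    "(LINT x|M. indicator E x * \<bar>g x\<bar>) \<le> 2 * N * measure M E powr (1 - 1 / p)"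
proof -
  have key: "\<bar>g x\<bar> \<le> l + l powr (1 - p) * \<bar>g x\<bar> powr p" if "l > 0" for l x
  proof (cases "\<bar>g x\<bar> \<le> l")
    case True then show ?thesis using that by (simp add: add_increasing2)
  next
    case False
    then have g: "\<bar>g x\<bar> > l" by simp
    have "1 = (\<bar>g x\<bar> / \<bar>g x\<bar>) powr (p - 1)" using g that by auto
    also have "\<dots> \<le> (\<bar>g x\<bar> / l) powr (p - 1)" using g that assms(1) by (intro powr_mono2) (auto intro!: divide_left_mono)
    finally have "\<bar>g x\<bar> * 1 \<le> \<bar>g x\<bar> * (\<bar>g x\<bar> / l) powr (p - 1)" by (intro mult_left_mono) auto
    also have "\<dots> = l powr (1 - p) * \<bar>g x\<bar> powr p"
      using g that by (simp add: powr_divide powr_diff divide_simps)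
    finally show ?thesis using that by simp
  qed
  have ie: "integrable M (indicator E :: 'a \<Rightarrow> real)" using assms(4,5) by simp
  have i: "integrable M (\<lambda>x. indicator E x * l + l powr (1 - p) * \<bar>g x\<bar> powr p)" for l
    using assms(3) ie by (intro Bochner_Integration.integrable_add integrable_mult_left integrable_mult_right)
  have kE: "indicator E x * \<bar>g x\<bar> \<le> indicator E x * l + l powr (1 - p) * \<bar>g x\<bar> powr p" if "l > 0" for l x
    using key[OF that, of x] by (auto simp: indicator_def)
  show I: "integrable M (\<lambda>x. indicator E x * \<bar>g x\<bar>)"
    by (rule Bochner_Integration.integrable_bound[OF i[of 1]])
       (use kE[of 1] assms in \<open>auto intro!: borel_measurable_times simp: abs_mult\<close>)
  have le: "(LINT x|M. indicator E x * \<bar>g x\<bar>) \<le> measure M E * l + l powr (1 - p) * N powr p" if "l > 0" for l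
  proof -
    have "(LINT x|M. indicator E x * \<bar>g x\<bar>) \<le> (LINT x|M. indicator E x * l + l powr (1 - p) * \<bar>g x\<bar> powr p)"
      by (rule integral_mono[OF I i]) (rule kE[OF that])
    also have "\<dots> = measure M E * l + l powr (1 - p) * (LINT x|M. \<bar>g x\<bar> powr p)"
      using assms(3,4) ie sets.sets_into_space[OF assms(4)] by (subst Bochner_Integration.integral_add) (auto simp: Int_absorb2)
    also have "\<dots> \<le> measure M E * l + l powr (1 - p) * N powr p"
      using assms(6) by (intro add_left_mono mult_left_mono) auto
    finally show ?thesis .
  qed
  show "(LINT x|M. indicator E x * \<bar>g x\<bar>) \<le> 2 * N * measure M E powr (1 - 1 / p)"
  proof (cases "measure M E = 0")
    case True
    \<comment> \<open>For a null set E only the second term is left, and it vanishes as l tends to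
      infinity.\<close>
    have "(LINT x|M. indicator E x * \<bar>g x\<bar>) \<le> e" if "e > 0" for e
    proof -
      have "((\<lambda>l. l powr (1 - p) * N powr p) \<longlongrightarrow> 0 * N powr p) at_top"
        by (intro tendsto_mult tendsto_const tendsto_neg_powr filterlim_ident) (use assms in auto)
      then have "eventually (\<lambda>l. l powr (1 - p) * N powr p < e) at_top"
        using that by (auto simp: order_tendsto_iff)
      then obtain l where "l > 0" "l powr (1 - p) * N powr p < e"
        using eventually_conj[OF _ eventually_gt_at_top[of 0]] eventually_happens'[OF trivial_limit_at_top_linorder] by (metis (mono_tags, lifting))
      with le[of l] True show ?thesis by simp
    qed
    then have "(LINT x|M. indicator E x * \<bar>g x\<bar>) \<le> 0" by (meson dense_ge not_le)
    then show ?thesis using True by simp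
  next
    case False
    define V where "V = measure M E"
    have V: "V > 0" using False by (simp add: V_def zero_less_measure_iff)
    \<comment> \<open>This level makes both terms equal to N |E|^(1 - 1/p), whence the factor
      2.\<close>
    define l where "l = N * V powr (- (1 / p))"
    have l: "l > 0" using V assms by (simp add: l_def)
    have "V powr (1 - 1 / p) = V powr 1 * V powr (- (1 / p))"
      unfolding powr_add[symmetric] by simp
    then have 1: "V * l = N * V powr (1 - 1 / p)"
      using V by (simp add: l_def)
    have "l powr (1 - p) * N powr p = N powr (1 - p) * N powr p * (V powr (- (1 / p))) powr (1 - p)"
      using V assms by (simp add: l_def powr_mult)
    also have "\<dots> = N * V powr (1 - 1 / p)"
    proof -
      have e: "- (1 / p) * (1 - p) = 1 - 1 / p" using assms(1) by (simp add: field_simps)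
      show ?thesis using V assms by (simp only: powr_powr e) (simp add: powr_add[symmetric])
    qed
    finally show ?thesis using le[OF l] 1 by (simp add: V_def)
  qed
qed

subsection \<open>Averages at varying scales\<close>

text \<open>The image of the mass \<zeta> under the dilation with centre y and ratio s. Its integral
  is that of \<zeta>; at s = 1 it is \<zeta> itself, whatever y is, and for s tending to 0 it
  concentrates at y.\<close>

definition ker :: "(real^3 \<Rightarrow> real) \<Rightarrow> real^3 \<Rightarrow> real \<Rightarrow> real^3 \<Rightarrow> real" where
  "ker \<zeta> y s w = \<zeta> (y + (1 / s) *\<^sub>R (w - y)) / s ^ 3"

text \<open>Component i of the kernel times (w - y)/s, the velocity with which mass moves when the
  dilation ratio s grows.\<close>

definition xi :: "(real^3 \<Rightarrow> real) \<Rightarrow> real^3 \<Rightarrow> 3 \<Rightarrow> real \<Rightarrow> real^3 \<Rightarrow> real" where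
  "xi \<zeta> y i s w = (w $ i - y $ i) / s * ker \<zeta> y s w"

definition avg :: "(real^3 \<Rightarrow> real) \<Rightarrow> real^3 \<Rightarrow> (real^3 \<Rightarrow> real) \<Rightarrow> real \<Rightarrow> real" where
  "avg \<zeta> y v s = (LINT w|lebesgue. v w * ker \<zeta> y s w)"

text \<open>For \<open>s < s0\<close> the kernel \<open>ker \<zeta> y s\<close> lives in \<open>\<Omega>\<close>, so averages can be followed down to \<open>s = 0\<close>. Near the
  boundary the support \<open>S\<close> has to lie in an interior cone with vertex \<open>y\<close>.\<close>
definition star_kernel :: "(real^3) set \<Rightarrow> real^3 \<Rightarrow> real \<Rightarrow> (real^3) set \<Rightarrow> (real^3 \<Rightarrow> real) \<Rightarrow> bool" where
  "star_kernel \<Omega> y s0 S \<zeta> \<longleftrightarrow> smooth_on UNIV \<zeta> \<and> compact S \<and> (\<forall>z. z \<notin> S \<longrightarrow> \<zeta> z = 0) \<and>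
     (\<forall>z\<in>S. \<forall>s. 0 < s \<and> s < s0 \<longrightarrow> y + s *\<^sub>R (z - y) \<in> \<Omega>)"

text \<open>Differentiating an average in s takes one compact subset of \<Omega> that holds the
  supports of the kernels for a whole interval of scales.\<close>

lemma scaled_support:
  assumes "star_kernel \<Omega> y s0 S \<zeta>" "0 < a" "b < s0"
  defines "K \<equiv> (\<lambda>(r, z). y + r *\<^sub>R (z - y)) ` ({a..b} \<times> S)"
  shows "compact K" "K \<subseteq> \<Omega>" "r \<in> {a..b} \<Longrightarrow> w \<notin> K \<Longrightarrow> y + (1 / r) *\<^sub>R (w - y) \<notin> S"
proof -
  show "compact K"
    unfolding K_def using assms(1) by (intro compact_continuous_image compact_Times)
      (auto intro!: continuous_intros simp: split_beta star_kernel_def)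
  show "K \<subseteq> \<Omega>" using assms by (auto simp: star_kernel_def K_def)
  assume r: "r \<in> {a..b}" and w: "w \<notin> K"
  show "y + (1 / r) *\<^sub>R (w - y) \<notin> S"
  proof
    assume *: "y + (1 / r) *\<^sub>R (w - y) \<in> S"
    have "(\<lambda>(r, z). y + r *\<^sub>R (z - y)) (r, y + (1 / r) *\<^sub>R (w - y)) \<in> K"
      unfolding K_def using * r by (intro imageI) auto
    then show False using w r assms(2) by simp
  qed
qed

lemma affine_arg: "y + (1 / s) *\<^sub>R (w - y) = (y - (1 / s) *\<^sub>R y) + (1 / s) *\<^sub>R (w::real^3)"
  by (simp add: algebra_simps)

lemma smooth_ker: "smooth_on UNIV \<zeta> \<Longrightarrow> smooth_on UNIV (ker \<zeta> y s)"
  unfolding ker_def[abs_def] affine_arg divide_inverse[of _ "s ^ 3"]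
  by (rule smooth_on_mult[OF open_UNIV smooth_on_affine smooth_on_const])

lemma smooth_xi: "smooth_on UNIV \<zeta> \<Longrightarrow> smooth_on UNIV (xi \<zeta> y i s)"
  unfolding xi_def[abs_def] divide_inverse[of _ s] diff_conv_add_uminus[of _ "y $ i"]
  by (intro smooth_on_mult open_UNIV smooth_on_add smooth_on_nth smooth_on_const smooth_ker)

lemma xi_test_fun:
  assumes "star_kernel \<Omega> y s0 S \<zeta>" "0 < s" "s < s0"
  shows "xi \<zeta> y i s \<in> test_fun \<Omega>"
proof (rule test_funI)
  show "smooth_on UNIV (xi \<zeta> y i s)" using assms(1) by (intro smooth_xi) (simp add: star_kernel_def)
  note sc = scaled_support[OF assms(1,2,3)]
  show "compact ((\<lambda>(r, z). y + r *\<^sub>R (z - y)) ` ({s..s} \<times> S))" "((\<lambda>(r, z). y + r *\<^sub>R (z - y)) ` ({s..s} \<times> S)) \<subseteq> \<Omega>"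
    by (rule sc(1), rule sc(2))
  fix w assume "w \<notin> (\<lambda>(r, z). y + r *\<^sub>R (z - y)) ` ({s..s} \<times> S)"
  from sc(3)[OF _ this, of s] show "xi \<zeta> y i s w = 0"
    using assms(1) by (auto simp: xi_def ker_def star_kernel_def)
qed

lemma pd_xi:
  assumes "smooth_on UNIV \<zeta>"
  shows "pd i (xi \<zeta> y i s) w = ker \<zeta> y s w / s + (w $ i - y $ i) / s * (pd i \<zeta> (y + (1 / s) *\<^sub>R (w - y)) / s) / s ^ 3"
proof -
  have dz: "\<zeta> differentiable at z" for z using assms by (auto intro: smooth_on_differentiable)
  have dk: "ker \<zeta> y s differentiable at w"
    using smooth_ker[OF assms] by (auto intro: smooth_on_differentiable)
  have k: "pd i (ker \<zeta> y s) w = pd i \<zeta> (y + (1 / s) *\<^sub>R (w - y)) / s / s ^ 3"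
  proof -
    have "ker \<zeta> y s = (\<lambda>w. (1 / s ^ 3) * \<zeta> ((y - (1 / s) *\<^sub>R y) + (1 / s) *\<^sub>R w))"
      unfolding ker_def[abs_def] affine_arg by simp
    moreover have A: "(\<lambda>w. \<zeta> ((y - (1 / s) *\<^sub>R y) + (1 / s) *\<^sub>R w)) differentiable at w"
      by (rule pd_affine(1)[OF dz])
    moreover have "pd i (\<lambda>w. \<zeta> ((y - (1 / s) *\<^sub>R y) + (1 / s) *\<^sub>R w)) w = (1 / s) * pd i \<zeta> ((y - (1 / s) *\<^sub>R y) + (1 / s) *\<^sub>R w)"
      by (rule pd_affine(2)[OF dz])
    ultimately show ?thesis
      using pd_cmult[OF A, where i = i and c = "1 / s ^ 3"] by (simp add: affine_arg)
  qed
  have dl: "(\<lambda>w. (1 / s) * (w $ i + - (y $ i))) differentiable at w"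
    by (rule smooth_on_differentiable[OF smooth_on_mult[OF open_UNIV smooth_on_const smooth_on_add[OF open_UNIV smooth_on_nth smooth_on_const]]]) simp
  have l: "pd i (\<lambda>w. (1 / s) * (w $ i + - (y $ i))) w = 1 / s"
  proof -
    have d: "(\<lambda>w. w $ i + - (y $ i)) differentiable at w" by (rule differentiable_add[OF nth_differentiable differentiable_const])
    have "pd i (\<lambda>w. w $ i + - (y $ i)) w = 1 + 0"
      unfolding pd_add[OF nth_differentiable differentiable_const] pd_nth_coord pd_const by simp
    then show ?thesis using pd_cmult[OF d, where i = i and c = "1 / s"] by simp
  qed
  have "xi \<zeta> y i s = (\<lambda>w. ((1 / s) * (w $ i + - (y $ i))) * ker \<zeta> y s w)"
    by (auto simp: xi_def fun_eq_iff)
  then show ?thesis using pd_mult[OF dl dk, of i] l k by simp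
qed

text \<open>The conservation law for mass that is moved along w = y + r(z - y): the derivative of
  the density in r is minus the divergence of density times velocity, and that product is
  \<open>xi\<close>.\<close>

lemma ker_derivative:
  assumes "smooth_on UNIV \<zeta>" "r > 0"
  shows "((\<lambda>r. ker \<zeta> y r w) has_real_derivative - (\<Sum>i\<in>UNIV. pd i (xi \<zeta> y i r) w)) (at r within U)"
proof -
  have dz: "\<zeta> differentiable at z" for z using assms by (auto intro: smooth_on_differentiable)
  let ?z = "y + (1 / r) *\<^sub>R (w - y)"
  have "((\<lambda>r. y + (1 / r) *\<^sub>R (w - y)) has_derivative (\<lambda>h. (- (h / r\<^sup>2)) *\<^sub>R (w - y))) (at r within U)"
    using assms(2) by (auto intro!: derivative_eq_intros simp: power2_eq_square divide_simps)
  from has_derivative_compose[OF this has_derivative_pd_sum[OF dz]]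
  have "((\<lambda>r. \<zeta> (y + (1 / r) *\<^sub>R (w - y))) has_derivative
      (\<lambda>h. \<Sum>i\<in>UNIV. ((- (h / r\<^sup>2)) *\<^sub>R (w - y)) $ i *\<^sub>R pd i \<zeta> ?z)) (at r within U)" .
  moreover have "(\<lambda>h. \<Sum>i\<in>UNIV. ((- (h / r\<^sup>2)) *\<^sub>R (w - y)) $ i *\<^sub>R pd i \<zeta> ?z) =
     (\<lambda>d. (\<Sum>i\<in>UNIV. - ((w $ i - y $ i) / r\<^sup>2) * pd i \<zeta> ?z) * d)"
    by (rule ext) (simp add: sum_distrib_left mult_ac)
  ultimately have d: "((\<lambda>r. \<zeta> (y + (1 / r) *\<^sub>R (w - y))) has_real_derivative
     (\<Sum>i\<in>UNIV. - ((w $ i - y $ i) / r\<^sup>2) * pd i \<zeta> ?z)) (at r within U)"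
    by (simp add: has_field_derivative_def)
  have p: "((\<lambda>r. 1 / r ^ 3) has_real_derivative - 3 / r ^ 4) (at r within U)"
    using assms(2) by (auto intro!: derivative_eq_intros simp: divide_simps power_eq_if)
  have "((\<lambda>r. \<zeta> (y + (1 / r) *\<^sub>R (w - y)) * (1 / r ^ 3)) has_real_derivative
     (\<Sum>i\<in>UNIV. - ((w $ i - y $ i) / r\<^sup>2) * pd i \<zeta> ?z) * (1 / r ^ 3) + (- 3 / r ^ 4) * \<zeta> ?z) (at r within U)"
    by (rule DERIV_mult[OF d p])
  moreover have "(\<Sum>i\<in>UNIV. - ((w $ i - y $ i) / r\<^sup>2) * pd i \<zeta> ?z) * (1 / r ^ 3) + (- 3 / r ^ 4) * \<zeta> ?z
     = - (\<Sum>i\<in>UNIV. pd i (xi \<zeta> y i r) w)"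
    unfolding pd_xi[OF assms(1)] sum_3 ker_def using assms(2)
    by (simp add: divide_simps) (simp add: algebra_simps power_eq_if)
  ultimately show ?thesis unfolding ker_def[abs_def] by simp
qed

text \<open>v has a weak gradient only, so the derivative falls on the kernel. By
  \<open>ker_derivative\<close> it is a divergence of the test functions \<open>xi\<close>, and the
  definition of the weak derivative hands it over to \<open>g\<close>.\<close>

lemma avg_derivative:
  assumes "open \<Omega>" "continuous_on \<Omega> v" "\<And>i. has_weak_deriv \<Omega> (axis i 1) v (g i)"
    and sk: "star_kernel \<Omega> y s0 S \<zeta>" and s: "0 < s" "s < s0"
  shows "(avg \<zeta> y v has_real_derivative (\<Sum>i\<in>UNIV. LINT w|lebesgue_on \<Omega>. xi \<zeta> y i s w * g i w)) (at s)"
proof -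
  define a b where "a = s / 2" and "b = (s + s0) / 2"
  have ab: "0 < a" "a < s" "s < b" "b < s0" using s by (auto simp: a_def b_def field_simps)
  define K where "K = (\<lambda>(r, z). y + r *\<^sub>R (z - y)) ` ({a..b} \<times> S)"
  note sc = scaled_support[OF sk ab(1) ab(4), folded K_def]
  have sm: "smooth_on UNIV \<zeta>" and cS: "compact S" and zS: "\<And>z. z \<notin> S \<Longrightarrow> \<zeta> z = 0" using sk by (auto simp: star_kernel_def)
  have c: "continuous_on UNIV \<zeta>" "continuous_on UNIV (pd i \<zeta>)" for i
    using sm by (auto intro: smooth_on_continuous smooth_on_pd)
  have C: "C1c S \<zeta>"
    using cS zS sm by (auto simp: C1c_def intro: smooth_on_differentiable c(2))
  note pz = C1c_pd_zero[OF C]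
  define F' where "F' r w = v w * - (\<Sum>i\<in>UNIV. pd i (xi \<zeta> y i r) w)" for r w
  have kz: "ker \<zeta> y r w = 0" if "r \<in> {a..b}" "w \<notin> K" for r w
    using sc(3)[OF that] zS by (simp add: ker_def)
  have xz: "pd i (xi \<zeta> y i r) w = 0" if "r \<in> {a..b}" "w \<notin> K" for r w i
    unfolding pd_xi[OF sm] kz[OF that] using pz[OF sc(3)[OF that]] by simp
  have cker: "continuous_on UNIV (ker \<zeta> y r)" for r using smooth_ker[OF sm] by (rule smooth_on_continuous)
  have "((\<lambda>r. integral\<^sup>L lebesgue (\<lambda>w. v w * ker \<zeta> y r w)) has_real_derivative integral\<^sup>L lebesgue (F' s)) (at s within {a<..<b})"
  proof (rule leibniz_compact_support[OF _ _ _ sc(1)])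
    fix r w assume r: "r \<in> {a<..<b}"
    show "((\<lambda>r. v w * ker \<zeta> y r w) has_real_derivative F' r w) (at r within {a<..<b})"
      unfolding F'_def using r ab by (intro DERIV_cmult ker_derivative sm) auto
    show "continuous_on UNIV (\<lambda>w. v w * ker \<zeta> y r w)"
      by (rule continuous_on_zero_extension1[OF assms(1) sc(1,2)])
         (use kz r in \<open>auto intro!: continuous_intros assms(2) continuous_on_subset[OF cker]\<close>)
    assume "w \<notin> K"
    then show "v w * ker \<zeta> y r w = 0" "F' r w = 0" using kz xz r by (auto simp: F'_def)
  next
    show "continuous_on ({a<..<b} \<times> UNIV) (\<lambda>(r, w). F' r w)"
    proof (rule continuous_on_zero_extension[OF assms(1) sc(1,2)])
      have 1: "continuous_on ({a<..<b} \<times> \<Omega>) (\<lambda>p. v (snd p))"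
        by (rule continuous_on_compose2[OF assms(2)]) (auto intro!: continuous_intros)
      have 2: "continuous_on ({a<..<b} \<times> \<Omega>) (\<lambda>p. pd i \<zeta> (y + (1 / fst p) *\<^sub>R (snd p - y)))" for i
        using ab by (intro continuous_on_compose2[OF c(2)]) (auto intro!: continuous_intros)
      have 3: "continuous_on ({a<..<b} \<times> \<Omega>) (\<lambda>p. \<zeta> (y + (1 / fst p) *\<^sub>R (snd p - y)))"
        using ab by (intro continuous_on_compose2[OF c(1)]) (auto intro!: continuous_intros)
      show "continuous_on ({a<..<b} \<times> \<Omega>) (\<lambda>(r, w). F' r w)"
        unfolding F'_def pd_xi[OF sm] split_beta ker_def using ab
        by (intro continuous_intros 1 2 3) auto
    qed (use xz in \<open>auto simp: F'_def\<close>)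
  qed (use ab in auto)
  moreover have "at s within {a<..<b} = at s" by (rule at_within_open) (use ab in auto)
  moreover have "integral\<^sup>L lebesgue (F' s) = (\<Sum>i\<in>UNIV. LINT w|lebesgue_on \<Omega>. xi \<zeta> y i s w * g i w)"
  proof -
    have t: "xi \<zeta> y i s \<in> test_fun \<Omega>" for i by (rule xi_test_fun[OF sk s])
    have lv: "loc_integrable \<Omega> v" using assms(2) by (rule loc_integrable_continuous)
    have i: "integrable (lebesgue_on \<Omega>) (\<lambda>w. pd i (xi \<zeta> y i s) w * v w)" for i
      using integrable_test_fun[OF assms(1) lv test_fun_pd[OF t]] by simp
    have "integral\<^sup>L lebesgue (F' s) = (LINT w|lebesgue_on \<Omega>. F' s w)"
      by (rule integral_lebesgue_on_support[symmetric, OF open_sets_lebesgue[OF assms(1)]])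
         (use xz[of s] sc(2) ab in \<open>force simp: F'_def intro!: sum.neutral\<close>)
    also have "\<dots> = (LINT w|lebesgue_on \<Omega>. - (\<Sum>i\<in>UNIV. pd i (xi \<zeta> y i s) w * v w))"
      by (rule Bochner_Integration.integral_cong[OF refl]) (simp add: F'_def sum_distrib_left mult.commute)
    also have "\<dots> = - (\<Sum>i\<in>UNIV. LINT w|lebesgue_on \<Omega>. pd i (xi \<zeta> y i s) w * v w)"
      by (simp add: Bochner_Integration.integral_sum[OF i])
    also have "\<dots> = - (\<Sum>i\<in>UNIV. - (LINT w|lebesgue_on \<Omega>. xi \<zeta> y i s w * g i w))"
    proof -
      have "(LINT w|lebesgue_on \<Omega>. pd i (xi \<zeta> y i s) w * v w) = - (LINT w|lebesgue_on \<Omega>. xi \<zeta> y i s w * g i w)" for i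
        using assms(3)[of i] t[of i] by (simp add: has_weak_deriv_def pd_multi_axis[simplified])
      then show ?thesis by simp
    qed
    finally show ?thesis by (simp add: sum_negf)
  qed
  ultimately show ?thesis by (simp add: avg_def[abs_def])
qed

section \<open>Growth of averages in the scale, in the manner of Morrey\<close>

definition weak_grad_bound :: "(real^3) set \<Rightarrow> real \<Rightarrow> real \<Rightarrow> (real^3 \<Rightarrow> real) \<Rightarrow> bool" where
  "weak_grad_bound \<Omega> p N v \<longleftrightarrow> (\<forall>i. \<exists>g. has_weak_deriv \<Omega> (axis i 1) v g \<and> g \<in> Lp \<Omega> p \<and>
     (LINT x|lebesgue_on \<Omega>. \<bar>g x\<bar> powr p) \<le> N powr p)"

text \<open>6 is 3 components times the factor 2 of \<open>int_le_powr\<close>; R bounds |w - y| /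
  s, Z bounds \<zeta>, and the power of the volume of a ball of radius R is the Hoelder factor at
  scale 1.\<close>

definition morrey_const :: "real \<Rightarrow> real \<Rightarrow> real \<Rightarrow> real" where
  "morrey_const p R Z = 6 * R * Z * (unit_ball_vol 3 * R ^ 3) powr (1 - 1 / p)"

lemma morrey_const_nonneg: "R \<ge> 0 \<Longrightarrow> Z \<ge> 0 \<Longrightarrow> morrey_const p R Z \<ge> 0"
  by (simp add: morrey_const_def)

lemma ker_bound:
  assumes "star_kernel \<Omega> y s0 S \<zeta>" "0 < s" "s < s0" "S \<subseteq> cball y R" "\<And>z. \<bar>\<zeta> z\<bar> \<le> Z"
  shows "w \<notin> cball y (s * R) \<inter> \<Omega> \<Longrightarrow> ker \<zeta> y s w = 0" "\<bar>ker \<zeta> y s w\<bar> \<le> Z / s ^ 3"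
proof -
  show "ker \<zeta> y s w = 0" if "w \<notin> cball y (s * R) \<inter> \<Omega>"
  proof (cases "y + (1 / s) *\<^sub>R (w - y) \<in> S")
    case True
    have "norm ((1 / s) *\<^sub>R (w - y)) \<le> R"
      using assms(4) True by (auto simp: dist_norm)
    then have "(1 / s) * norm (w - y) \<le> R" using assms(2) by simp
    then have "norm (w - y) \<le> s * R" using assms(2) by (simp add: divide_le_eq mult.commute)
    moreover have "y + s *\<^sub>R ((y + (1 / s) *\<^sub>R (w - y)) - y) \<in> \<Omega>"
      using assms(1-3) True unfolding star_kernel_def by blast
    then have "w \<in> \<Omega>" using assms(2) by simp
    ultimately show ?thesis using that by (auto simp: dist_norm norm_minus_commute)
  next
    case False then show ?thesis using assms(1) by (auto simp: ker_def star_kernel_def)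
  qed
  show "\<bar>ker \<zeta> y s w\<bar> \<le> Z / s ^ 3"
    using assms(2,5) by (simp add: ker_def divide_right_mono)
qed

text \<open>The kernel is of size s^(-3) on a set of volume at most a constant times s^3, so Hoelder
  gives s^(-3) times s^(3 - 3/p), that is s^(-3/p).\<close>

lemma xi_integral_bound:
  assumes "open \<Omega>" "star_kernel \<Omega> y s0 S \<zeta>" "0 < s" "s < s0" "S \<subseteq> cball y R" "R > 0" "\<And>z. \<bar>\<zeta> z\<bar> \<le> Z"
    and "p > 1" "N > 0" "g \<in> Lp \<Omega> p" "(LINT x|lebesgue_on \<Omega>. \<bar>g x\<bar> powr p) \<le> N powr p"
  shows "\<bar>LINT w|lebesgue_on \<Omega>. xi \<zeta> y i s w * g w\<bar> \<le> morrey_const p R Z / 3 * N * s powr (- (3 / p))"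
proof -
  define E where "E = cball y (s * R) \<inter> \<Omega>"
  have O: "\<Omega> \<in> sets lebesgue" by (rule open_sets_lebesgue[OF assms(1)])
  have Es: "E \<in> sets (lebesgue_on \<Omega>)"
    unfolding E_def sets_restrict_space by (rule image_eqI[of _ _ "cball y (s * R)"]) auto
  have bm: "measure (lebesgue_on \<Omega>) E \<le> unit_ball_vol 3 * (s * R) ^ 3" and fin: "emeasure (lebesgue_on \<Omega>) E < \<infinity>"
  proof -
    have "measure (lebesgue_on \<Omega>) E = measure lebesgue E" "emeasure (lebesgue_on \<Omega>) E = emeasure lebesgue E"
      using O by (auto simp: E_def intro!: measure_restrict_space emeasure_restrict_space)
    moreover have "measure lebesgue E \<le> measure lebesgue (cball y (s * R))"
      unfolding E_def by (intro measure_mono_fmeasurable) (use O in auto)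
    moreover have "measure lebesgue (cball y (s * R)) = unit_ball_vol 3 * (s * R) ^ 3"
      using content_cball[of "s * R" y] assms(3,6) by simp
    moreover have "emeasure lebesgue E \<le> emeasure lebesgue (cball y (s * R))"
      unfolding E_def by (intro emeasure_mono) auto
    moreover have "emeasure lebesgue (cball y (s * R)) < \<infinity>"
      using lmeasurable_cball[of y "s * R"] by (auto simp: fmeasurable_def)
    ultimately show "measure (lebesgue_on \<Omega>) E \<le> unit_ball_vol 3 * (s * R) ^ 3" "emeasure (lebesgue_on \<Omega>) E < \<infinity>"
      by auto
  qed
  have g: "g \<in> borel_measurable (lebesgue_on \<Omega>)" "integrable (lebesgue_on \<Omega>) (\<lambda>x. \<bar>g x\<bar> powr p)"
    using assms(10) by (auto simp: Lp_def)
  note H = int_le_powr[OF assms(8) g Es fin assms(11,9)]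
  have Z: "Z \<ge> 0" using assms(7)[of 0] by simp
  have pw: "\<bar>xi \<zeta> y i s w * g w\<bar> \<le> R * (Z / s ^ 3) * (indicator E w * \<bar>g w\<bar>)" for w
  proof (cases "w \<in> E")
    case True
    have "\<bar>w $ i - y $ i\<bar> \<le> norm (w - y)" using component_le_norm_cart[of "w - y" i] by simp
    also have "\<dots> \<le> s * R" using True by (auto simp: E_def dist_norm norm_minus_commute)
    finally have "\<bar>(w $ i - y $ i) / s\<bar> \<le> R" using assms(3) by (simp add: field_simps)
    then have "\<bar>xi \<zeta> y i s w\<bar> \<le> R * (Z / s ^ 3)"
      unfolding xi_def abs_mult using ker_bound(2)[OF assms(2-5,7)] assms(6) by (intro mult_mono) auto
    then have "\<bar>xi \<zeta> y i s w\<bar> * \<bar>g w\<bar> \<le> R * (Z / s ^ 3) * \<bar>g w\<bar>" by (rule mult_right_mono) simp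
    then show ?thesis using True by (simp add: abs_mult)
  next
    case False
    then show ?thesis using ker_bound(1)[OF assms(2-5,7), of w] by (simp add: xi_def E_def)
  qed
  have m: "(\<lambda>w. xi \<zeta> y i s w * g w) \<in> borel_measurable (lebesgue_on \<Omega>)"
  proof -
    have "smooth_on UNIV (xi \<zeta> y i s)" using assms(2) by (intro smooth_xi) (simp add: star_kernel_def)
    then have "xi \<zeta> y i s \<in> borel_measurable lebesgue"
      by (intro continuous_imp_lebesgue_measurable smooth_on_continuous)
    then show ?thesis by (intro borel_measurable_times g(1) measurable_restrict_space1)
  qed
  have ii: "integrable (lebesgue_on \<Omega>) (\<lambda>w. R * (Z / s ^ 3) * (indicator E w * \<bar>g w\<bar>))"
    by (rule integrable_mult_right[OF H(1)])
  have "\<bar>LINT w|lebesgue_on \<Omega>. xi \<zeta> y i s w * g w\<bar> \<le> (LINT w|lebesgue_on \<Omega>. R * (Z / s ^ 3) * (indicator E w * \<bar>g w\<bar>))"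
  proof -
    have "integrable (lebesgue_on \<Omega>) (\<lambda>w. xi \<zeta> y i s w * g w)"
      by (rule Bochner_Integration.integrable_bound[OF ii m], rule AE_I2, unfold real_norm_def, rule order_trans[OF pw abs_ge_self])
    then show ?thesis using pw ii
      by (intro order_trans[OF integral_abs_bound] integral_mono integrable_abs) auto
  qed
  also have "\<dots> = R * (Z / s ^ 3) * (LINT w|lebesgue_on \<Omega>. indicator E w * \<bar>g w\<bar>)" by simp
  also have "\<dots> \<le> R * (Z / s ^ 3) * (2 * N * measure (lebesgue_on \<Omega>) E powr (1 - 1 / p))"
    using H(2) assms(3,6) Z by (intro mult_left_mono) auto
  also have "\<dots> \<le> R * (Z / s ^ 3) * (2 * N * (unit_ball_vol 3 * (s * R) ^ 3) powr (1 - 1 / p))"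
    using bm assms(3,6,8,9) Z by (intro mult_left_mono powr_mono2) auto
  also have "(unit_ball_vol 3 * (s * R) ^ 3) powr (1 - 1 / p) = (unit_ball_vol 3 * R ^ 3) powr (1 - 1 / p) * s powr (3 - 3 / p)"
  proof -
    have "unit_ball_vol 3 * (s * R) ^ 3 = (unit_ball_vol 3 * R ^ 3) * s powr 3"
      using assms(3) by (simp add: power_mult_distrib powr_numeral)
    moreover have "3 * (1 - 1 / p) = 3 - 3 / p" by simp
    ultimately show ?thesis using assms(3,6) by (simp only: powr_mult powr_powr)
  qed
  also have "R * (Z / s ^ 3) * (2 * N * ((unit_ball_vol 3 * R ^ 3) powr (1 - 1 / p) * s powr (3 - 3 / p))) =
    morrey_const p R Z / 3 * N * (s powr (3 - 3 / p) / s ^ 3)" by (simp add: morrey_const_def)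
  also have "s powr (3 - 3 / p) / s ^ 3 = s powr (- (3 / p))"
  proof -
    have "s powr (3 - 3 / p) = s powr 3 * s powr (- (3 / p))" unfolding powr_add[symmetric] by simp
    then show ?thesis using assms(3) by (simp add: powr_numeral)
  qed
  finally show ?thesis .
qed

text \<open>The rate s^(-3/p) is integrated between the scales a and b. The exponent 1 - 3/p may
  have either sign: p > 3 yields Morrey's inequality as a tends to 0, p = 2 the admissible blow-up
  rate.\<close>

lemma avg_diff_bound:
  assumes "open \<Omega>" "continuous_on \<Omega> v" "weak_grad_bound \<Omega> p N v" "p > 1" "p \<noteq> 3" "N > 0"
    and sk: "star_kernel \<Omega> y s0 S \<zeta>" "S \<subseteq> cball y R" "R > 0" "\<And>z. \<bar>\<zeta> z\<bar> \<le> Z"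
    and s: "0 < a" "a \<le> b" "b < s0"
  shows "\<bar>avg \<zeta> y v b - avg \<zeta> y v a\<bar> \<le>
    morrey_const p R Z * N / (1 - 3 / p) * b powr (1 - 3 / p) - morrey_const p R Z * N / (1 - 3 / p) * a powr (1 - 3 / p)"
proof (cases "a = b")
  case False
  then have "a < b" using s by simp
  obtain g where g: "\<And>i. has_weak_deriv \<Omega> (axis i 1) v (g i)" "\<And>i. g i \<in> Lp \<Omega> p"
     "\<And>i. (LINT x|lebesgue_on \<Omega>. \<bar>g i x\<bar> powr p) \<le> N powr p"
    using assms(3) unfolding weak_grad_bound_def by metis
  let ?c = "morrey_const p R Z * N"
  define D where "D s = (\<Sum>i\<in>UNIV. LINT w|lebesgue_on \<Omega>. xi \<zeta> y i s w * g i w)" for s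
  have d: "(avg \<zeta> y v has_vector_derivative D s) (at s)" if "a \<le> s" "s \<le> b" for s
    using avg_derivative[OF assms(1,2) g(1) sk(1), of s] that s
    by (simp add: D_def has_real_derivative_iff_has_vector_derivative)
  have e: "1 - 3 / p \<noteq> 0" using assms(4,5) by (simp add: field_simps)
  have d\<Phi>: "((\<lambda>s. ?c / (1 - 3 / p) * s powr (1 - 3 / p)) has_vector_derivative ?c * s powr (- (3 / p))) (at s)" if "a \<le> s" for s
  proof -
    have "((\<lambda>s. s powr (1 - 3 / p)) has_real_derivative (1 - 3 / p) * s powr (1 - 3 / p - 1)) (at s)"
      using that s by (intro has_real_derivative_powr) auto
    from DERIV_cmult[OF this, of "?c / (1 - 3 / p)"]
    have "((\<lambda>s. ?c / (1 - 3 / p) * s powr (1 - 3 / p)) has_real_derivative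
       ?c / (1 - 3 / p) * ((1 - 3 / p) * s powr (1 - 3 / p - 1))) (at s)" .
    moreover have "?c / (1 - 3 / p) * ((1 - 3 / p) * s powr (1 - 3 / p - 1)) = ?c * s powr (- (3 / p))"
    proof -
      have "1 - 3 / p - 1 = - (3 / p)" by simp
      then show ?thesis using e by (metis (no_types, opaque_lifting) mult.assoc nonzero_eq_divide_eq)
    qed
    ultimately show ?thesis
      by (simp only: has_real_derivative_iff_has_vector_derivative)
  qed
  have "norm (avg \<zeta> y v b - avg \<zeta> y v a) \<le> ?c / (1 - 3 / p) * b powr (1 - 3 / p) - ?c / (1 - 3 / p) * a powr (1 - 3 / p)"
  proof (rule differentiable_bound_general[OF \<open>a < b\<close>])
    show "continuous_on {a..b} (avg \<zeta> y v)"
      using d by (auto intro!: continuous_at_imp_continuous_on has_vector_derivative_continuous)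
    show "continuous_on {a..b} (\<lambda>s. ?c / (1 - 3 / p) * s powr (1 - 3 / p))"
      using d\<Phi> by (auto intro!: continuous_at_imp_continuous_on has_vector_derivative_continuous)
    fix s assume s': "a < s" "s < b"
    show "(avg \<zeta> y v has_vector_derivative D s) (at s)" using d s' by auto
    show "((\<lambda>s. ?c / (1 - 3 / p) * s powr (1 - 3 / p)) has_vector_derivative ?c * s powr (- (3 / p))) (at s)"
      using d\<Phi> s' by auto
    have "\<bar>D s\<bar> \<le> (\<Sum>i\<in>(UNIV::3 set). morrey_const p R Z / 3 * N * s powr (- (3 / p)))"
      unfolding D_def using s s'
      by (intro order_trans[OF sum_abs] sum_mono xi_integral_bound[OF assms(1) sk(1) _ _ sk(2,3,4) assms(4,6) g(2,3)]) auto
    then show "norm (D s) \<le> ?c * s powr (- (3 / p))" by simp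
  qed
  then show ?thesis by simp
qed simp

lemma avg_affine:
  assumes "open \<Omega>" "continuous_on \<Omega> v" and sk: "star_kernel \<Omega> y s0 S \<zeta>" "0 < s" "s < s0"
  shows "avg \<zeta> y v s = (LINT z|lebesgue. v (y + s *\<^sub>R (z - y)) * \<zeta> z)"
    "integrable lebesgue (\<lambda>z. v (y + s *\<^sub>R (z - y)) * \<zeta> z)"
proof -
  define K where "K = (\<lambda>(r, z). y + r *\<^sub>R (z - y)) ` ({s..s} \<times> S)"
  note sc = scaled_support[OF sk, folded K_def]
  have sm: "smooth_on UNIV \<zeta>" and z: "\<And>z. z \<notin> S \<Longrightarrow> \<zeta> z = 0" using sk by (auto simp: star_kernel_def)
  define f where "f w = v w * ker \<zeta> y s w" for w
  have c: "continuous_on UNIV f" unfolding f_def[abs_def]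
  proof (rule continuous_on_zero_extension1[OF assms(1) sc(1,2)])
    show "continuous_on \<Omega> (\<lambda>w. v w * ker \<zeta> y s w)"
      by (intro continuous_on_mult assms(2) continuous_on_subset[OF smooth_on_continuous[OF smooth_ker[OF sm]]]) simp
    show "v w * ker \<zeta> y s w = 0" if "w \<notin> K" for w
      using sc(3)[OF _ that, of s] z by (simp add: ker_def)
  qed
  have *: "y - s *\<^sub>R y + s *\<^sub>R z = y + s *\<^sub>R (z - y)" for z by (simp add: algebra_simps)
  have f: "s ^ 3 * f (y + s *\<^sub>R (z - y)) = v (y + s *\<^sub>R (z - y)) * \<zeta> z" for z
    using sk(2) by (simp add: f_def ker_def)
  have "avg \<zeta> y v s = integral\<^sup>L lebesgue f" by (simp add: avg_def f_def[abs_def])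
  also have "\<dots> = (LINT z|lebesgue. s ^ 3 * f (y + s *\<^sub>R (z - y)))"
    using integral_affine[OF c sk(2), of "y - s *\<^sub>R y"] by (simp add: *)
  finally show "avg \<zeta> y v s = (LINT z|lebesgue. v (y + s *\<^sub>R (z - y)) * \<zeta> z)"
    unfolding f .
  have "continuous_on UNIV (\<lambda>z. s ^ 3 * f (y + s *\<^sub>R (z - y)))"
    by (intro continuous_intros continuous_on_compose2[OF c]) auto
  then show "integrable lebesgue (\<lambda>z. v (y + s *\<^sub>R (z - y)) * \<zeta> z)"
    unfolding f using sk(1) z by (intro integrable_compact_support(1)[of _ S]) (auto simp: star_kernel_def)
qed

lemma kernel_integrable:
  assumes "star_kernel \<Omega> y s0 S \<zeta>"
  shows "integrable lebesgue \<zeta>"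
  using assms by (intro integrable_compact_support(1)[of _ S]) (auto simp: star_kernel_def smooth_on_continuous)

lemma avg_tendsto:
  assumes "open \<Omega>" "continuous_on \<Omega> v" "y \<in> \<Omega>" and sk: "star_kernel \<Omega> y s0 S \<zeta>" "0 < s0"
  shows "(avg \<zeta> y v \<longlongrightarrow> v y * integral\<^sup>L lebesgue \<zeta>) (at_right 0)"
proof (rule tendstoI)
  fix e :: real assume e: "e > 0"
  define I where "I = (LINT z|lebesgue. \<bar>\<zeta> z\<bar>)"
  have I: "I \<ge> 0" by (simp add: I_def)
  define e' where "e' = e / (I + 1)"
  have e': "e' > 0" "e' * I < e" using e I by (auto simp: e'_def field_simps)
  obtain R where R: "R > 0" "S \<subseteq> cball y R"
  proof -
    have "bounded S" using sk(1) by (auto simp: star_kernel_def compact_imp_bounded)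
    from bounded_subset_ballD[OF this, of y] obtain r where r: "0 < r" "S \<subseteq> ball y r" by auto
    then show ?thesis using that[of r] ball_subset_cball[of y r] by (meson order_trans)
  qed
  obtain d where d: "d > 0" "\<And>x. x \<in> \<Omega> \<Longrightarrow> dist x y < d \<Longrightarrow> dist (v x) (v y) < e'"
    using assms(2,3) e'(1) unfolding continuous_on_iff by metis
  have "eventually (\<lambda>s. 0 < s \<and> s < min s0 (d / R)) (at_right 0)"
    unfolding eventually_at_right_field using sk(2) d R by (intro exI[of _ "min s0 (d / R)"]) auto
  then show "eventually (\<lambda>s. dist (avg \<zeta> y v s) (v y * integral\<^sup>L lebesgue \<zeta>) < e) (at_right 0)"
  proof eventually_elim
    case (elim s)
    note A = avg_affine[OF assms(1,2) sk(1), of s]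
    have i: "integrable lebesgue (\<lambda>z. v y * \<zeta> z)" using kernel_integrable[OF sk(1)] by simp
    have pw: "\<bar>v (y + s *\<^sub>R (z - y)) * \<zeta> z - v y * \<zeta> z\<bar> \<le> e' * \<bar>\<zeta> z\<bar>" for z
    proof (cases "z \<in> S")
      case True
      have "y + s *\<^sub>R (z - y) \<in> \<Omega>" using True sk(1) elim by (auto simp: star_kernel_def)
      moreover have "dist (y + s *\<^sub>R (z - y)) y < d"
      proof -
        have "norm (z - y) \<le> R" using True R(2) by (auto simp: dist_norm norm_minus_commute)
        then have "s * norm (z - y) \<le> s * R" using elim by simp
        also have "\<dots> < d" using elim R(1) by (simp add: field_simps)
        finally show ?thesis using elim by (simp add: dist_norm)
      qed
      ultimately have "\<bar>v (y + s *\<^sub>R (z - y)) - v y\<bar> \<le> e'" using d(2) by (force simp: dist_real_def)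
      then have "\<bar>v (y + s *\<^sub>R (z - y)) - v y\<bar> * \<bar>\<zeta> z\<bar> \<le> e' * \<bar>\<zeta> z\<bar>" by (intro mult_right_mono) auto
      then show ?thesis by (simp add: left_diff_distrib[symmetric] abs_mult)
    next
      case False then show ?thesis using sk(1) by (auto simp: star_kernel_def)
    qed
    have "\<bar>avg \<zeta> y v s - v y * integral\<^sup>L lebesgue \<zeta>\<bar> = \<bar>LINT z|lebesgue. v (y + s *\<^sub>R (z - y)) * \<zeta> z - v y * \<zeta> z\<bar>"
      using A elim i by (subst Bochner_Integration.integral_diff) auto
    also have "\<dots> \<le> (LINT z|lebesgue. e' * \<bar>\<zeta> z\<bar>)"
      using A elim i pw kernel_integrable[OF sk(1)]
      by (intro order_trans[OF integral_abs_bound] integral_mono) (auto intro!: Bochner_Integration.integrable_diff)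
    also have "\<dots> = e' * I" by (simp add: I_def)
    also have "\<dots> < e" by (rule e'(2))
    finally show ?case by (simp add: dist_real_def)
  qed
qed

lemma morrey_pointwise:
  assumes "open \<Omega>" "continuous_on \<Omega> v" "y \<in> \<Omega>" "weak_grad_bound \<Omega> p N v" "p > 3" "N > 0"
    and sk: "star_kernel \<Omega> y s0 S \<zeta>" "S \<subseteq> cball y R" "R > 0" "\<And>z. \<bar>\<zeta> z\<bar> \<le> Z"
    and s: "0 < s" "s < s0"
  shows "\<bar>avg \<zeta> y v s - v y * integral\<^sup>L lebesgue \<zeta>\<bar> \<le> morrey_const p R Z * N / (1 - 3 / p) * s powr (1 - 3 / p)"
proof (rule tendsto_upperbound)
  show "((\<lambda>a. \<bar>avg \<zeta> y v s - avg \<zeta> y v a\<bar>) \<longlongrightarrow> \<bar>avg \<zeta> y v s - v y * integral\<^sup>L lebesgue \<zeta>\<bar>) (at_right 0)"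
    using s by (intro tendsto_intros avg_tendsto[OF assms(1-3) sk(1)]) auto
  have Z: "Z \<ge> 0" using sk(4)[of 0] by simp
  show "eventually (\<lambda>a. \<bar>avg \<zeta> y v s - avg \<zeta> y v a\<bar> \<le> morrey_const p R Z * N / (1 - 3 / p) * s powr (1 - 3 / p)) (at_right 0)"
    unfolding eventually_at_right_field
  proof (intro exI[of _ s] conjI allI impI s)
    fix a assume a: "0 < a" "a < s"
    have "0 \<le> morrey_const p R Z * N / (1 - 3 / p) * a powr (1 - 3 / p)"
      using morrey_const_nonneg[of R Z p] Z sk(3) assms(5,6) by (intro mult_nonneg_nonneg divide_nonneg_nonneg) auto
    then show "\<bar>avg \<zeta> y v s - avg \<zeta> y v a\<bar> \<le> morrey_const p R Z * N / (1 - 3 / p) * s powr (1 - 3 / p)"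
      using avg_diff_bound[OF assms(1,2,4) _ _ assms(6) sk(1-4), of a s] a s assms(5) by force
  qed
qed simp

text \<open>A function with gradient in L2 need not have bounded averages as s tends to 0, but they
  grow at most like s^(-1/2), which is integrable in s. This is what is available for the time
  derivative of u.\<close>

lemma avg_bound_p2:
  assumes "open \<Omega>" "continuous_on \<Omega> v" "weak_grad_bound \<Omega> 2 N v" "N > 0"
    and sk: "star_kernel \<Omega> y s0 S \<zeta>" "S \<subseteq> cball y R" "R > 0" "\<And>z. \<bar>\<zeta> z\<bar> \<le> Z"
    and s: "0 < s" "s \<le> b" "b < s0"
  shows "\<bar>avg \<zeta> y v s\<bar> \<le> \<bar>avg \<zeta> y v b\<bar> + 2 * morrey_const 2 R Z * N * s powr (- (1 / 2))"
proof -
  have Z: "Z \<ge> 0" using sk(4)[of 0] by simp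
  have "0 \<le> morrey_const 2 R Z * N * 2 * b powr (- (1 / 2))"
    using morrey_const_nonneg[of R Z 2] Z sk(3) assms(4) by (intro mult_nonneg_nonneg) auto
  moreover have "\<bar>avg \<zeta> y v b - avg \<zeta> y v s\<bar> \<le>
     morrey_const 2 R Z * N / (1 - 3 / 2) * b powr (1 - 3 / 2) - morrey_const 2 R Z * N / (1 - 3 / 2) * s powr (1 - 3 / 2)"
    by (rule avg_diff_bound[OF assms(1-3) _ _ assms(4) sk(1-4) s]) auto
  then have "\<bar>avg \<zeta> y v b - avg \<zeta> y v s\<bar> \<le>
     morrey_const 2 R Z * N * 2 * s powr (- (1 / 2)) - morrey_const 2 R Z * N * 2 * b powr (- (1 / 2))" by simp
  moreover have "2 * morrey_const 2 R Z * N * s powr (- (1 / 2)) = morrey_const 2 R Z * N * 2 * s powr (- (1 / 2))" by simp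
  ultimately show ?thesis by linarith
qed

subsection \<open>Boundary charts\<close>

lemma grad_inner: "w \<bullet> grad pd f y = (\<Sum>i\<in>UNIV. w $ i * pd i f y)"
  by (simp add: inner_vec_def grad_def)

lemma continuous_on_grad:
  assumes "\<And>i. continuous_on S (pd i f)"
  shows "continuous_on S (grad pd f)"
  unfolding grad_def[abs_def] by (intro continuous_on_vec_lambda assms)

lemma has_derivative_line:
  fixes f :: "real^3 \<Rightarrow> real"
  assumes "f differentiable (at (x + s *\<^sub>R w))"
  shows "((\<lambda>s. f (x + s *\<^sub>R w)) has_real_derivative w \<bullet> grad pd f (x + s *\<^sub>R w)) (at s within S)"
proof -
  have "((\<lambda>s. x + s *\<^sub>R w) has_derivative (\<lambda>h. h *\<^sub>R w)) (at s within S)"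
    by (auto intro!: derivative_eq_intros)
  from has_derivative_compose[OF this has_derivative_pd_sum[OF assms]]
  have "((\<lambda>s. f (x + s *\<^sub>R w)) has_derivative (\<lambda>h. \<Sum>i\<in>UNIV. (h *\<^sub>R w) $ i *\<^sub>R pd i f (x + s *\<^sub>R w))) (at s within S)" .
  moreover have "(\<lambda>h. \<Sum>i\<in>UNIV. (h *\<^sub>R w) $ i *\<^sub>R pd i f (x + s *\<^sub>R w)) = (\<lambda>d. (w \<bullet> grad pd f (x + s *\<^sub>R w)) * d)"
    by (rule ext) (simp add: grad_inner sum_distrib_left mult_ac)
  ultimately show ?thesis
    by (simp add: has_field_derivative_def)
qed

lemma mvt_segment:
  fixes f :: "real^3 \<Rightarrow> real"
  assumes "t > 0" "\<And>s. 0 \<le> s \<Longrightarrow> s \<le> t \<Longrightarrow> f differentiable (at (x + s *\<^sub>R w))"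
  obtains s where "0 < s" "s < t" "f (x + t *\<^sub>R w) - f x = t * (w \<bullet> grad pd f (x + s *\<^sub>R w))"
proof -
  have "\<exists>s. 0 < s \<and> s < t \<and> f (x + t *\<^sub>R w) - f (x + 0 *\<^sub>R w) = (t - 0) * (w \<bullet> grad pd f (x + s *\<^sub>R w))"
    by (rule MVT2[OF assms(1)]) (use assms(2) has_derivative_line[where S = UNIV] in auto)
  then show ?thesis using that by auto
qed

text \<open>By continuity of the gradient, \<psi> grows at a fixed rate in every direction w close
  to the unit gradient e at x. This cone of directions replaces a flattening of the
  boundary.\<close>

lemma chart_local:
  assumes "boundary_chart \<Omega> x U \<psi>"
  obtains R m e where "R > 0" "m > 0" "norm e = 1" "cball x (4 * R) \<subseteq> U"
    "\<And>y w. y \<in> cball x (4 * R) \<Longrightarrow> norm (w - e) \<le> 1 / 2 \<Longrightarrow> m \<le> w \<bullet> grad pd \<psi> y"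
proof -
  have U: "open U" "x \<in> U" "smooth_on U \<psi>" "grad pd \<psi> x \<noteq> 0" using assms by (auto simp: boundary_chart_def)
  define a where "a = grad pd \<psi> x"
  have a: "norm a > 0" using U by (simp add: a_def)
  define e where "e = a /\<^sub>R norm a"
  have e: "norm e = 1" "a = norm a *\<^sub>R e" using a by (auto simp: e_def)
  have "continuous_on U (grad pd \<psi>)"
    using U(3) by (intro continuous_on_grad smooth_on_continuous smooth_on_pd)
  then obtain d where d: "d > 0" "\<And>y. y \<in> U \<Longrightarrow> dist y x < d \<Longrightarrow> dist (grad pd \<psi> y) a < norm a / 4"
    using U(2) a unfolding continuous_on_iff a_def by (metis zero_less_divide_iff zero_less_numeral)
  obtain d' where d': "d' > 0" "cball x d' \<subseteq> U" using U open_contains_cball by blast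
  define R where "R = min (d / 8) (d' / 4)"
  have R: "R > 0" "4 * R < d" "4 * R \<le> d'" using d d' by (auto simp: R_def)
  show thesis
  \<comment> \<open>1/8 = 1/2 - 3/8: w has inner product at least |a| / 2 with a, norm at most 3/2,
    and the gradient differs from a by at most |a| / 4.\<close>
  proof (rule that[of R "norm a / 8" e])
    show "cball x (4 * R) \<subseteq> U" using R d'(2) by auto
    fix y w :: "real^3" assume y: "y \<in> cball x (4 * R)" and w: "norm (w - e) \<le> 1 / 2"
    have g: "norm (grad pd \<psi> y - a) \<le> norm a / 4"
    proof -
      have "y \<in> U" using y R d'(2) by auto
      moreover have "dist y x < d" using y R by (simp add: dist_commute)
      ultimately show ?thesis using d(2) by (fastforce simp: dist_norm)
    qed
    have nw: "norm w \<le> 3 / 2" using norm_triangle_ineq[of "w - e" e] w e by simp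
    have "1 - w \<bullet> e = (e - w) \<bullet> e" using e(1) by (simp add: inner_diff_left dot_square_norm)
    also have "\<dots> \<le> norm (e - w) * norm e" by (rule norm_cauchy_schwarz)
    finally have we: "w \<bullet> e \<ge> 1 / 2" using w e(1) by (simp add: norm_minus_commute)
    have "w \<bullet> a = norm a * (w \<bullet> e)" by (subst e(2)) simp
    then have wa: "w \<bullet> a \<ge> norm a / 2" using mult_left_mono[OF we, of "norm a"] by simp
    have "- (w \<bullet> (grad pd \<psi> y - a)) \<le> norm w * norm (grad pd \<psi> y - a)"
      using Cauchy_Schwarz_ineq2[of w "grad pd \<psi> y - a"] by simp
    also have "\<dots> \<le> 3 / 2 * (norm a / 4)" using g nw by (intro mult_mono) auto
    finally show "norm a / 8 \<le> w \<bullet> grad pd \<psi> y"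
      using wa by (simp add: inner_diff_right)
  qed (use R a e in auto)
qed

lemma chart_increase:
  assumes "boundary_chart \<Omega> x U \<psi>" "cball x r \<subseteq> U"
    and m: "\<And>y. y \<in> cball x r \<Longrightarrow> m \<le> w \<bullet> grad pd \<psi> y"
    and "y \<in> cball x r" "y + t *\<^sub>R w \<in> cball x r" "t \<ge> 0"
  shows "\<psi> (y + t *\<^sub>R w) \<ge> \<psi> y + m * t"
proof (cases "t = 0")
  case False
  then have t: "t > 0" using assms by simp
  have U: "open U" "smooth_on U \<psi>" using assms(1) by (auto simp: boundary_chart_def)
  have seg: "y + s *\<^sub>R w \<in> cball x r" if "0 \<le> s" "s \<le> t" for s
  proof -
    have "y + s *\<^sub>R w = (1 - s / t) *\<^sub>R y + (s / t) *\<^sub>R (y + t *\<^sub>R w)"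
      using t by (simp add: algebra_simps)
    then show ?thesis
      using convexD_alt[OF convex_cball assms(4,5), of "s / t"] that t by simp
  qed
  obtain s where s: "0 < s" "s < t" "\<psi> (y + t *\<^sub>R w) - \<psi> y = t * (w \<bullet> grad pd \<psi> (y + s *\<^sub>R w))"
    using mvt_segment[OF t, of \<psi> y w] seg assms(2) U smooth_on_differentiable by (metis subsetD)
  have "m \<le> w \<bullet> grad pd \<psi> (y + s *\<^sub>R w)" using s seg m by simp
  then have "m * t \<le> \<psi> (y + t *\<^sub>R w) - \<psi> y"
    unfolding s(3) mult.commute[of m t] by (rule mult_left_mono) (use t in simp)
  then show ?thesis by simp
qed simp

lemma chart_zero:
  assumes "boundary_chart \<Omega> x U \<psi>" "open \<Omega>" "y \<in> frontier \<Omega>" "y \<in> U"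
  shows "\<psi> y = 0"
proof -
  have U: "open U" "smooth_on U \<psi>" "\<Omega> \<inter> U = {y \<in> U. \<psi> y < 0}" using assms(1) by (auto simp: boundary_chart_def)
  have "y \<notin> \<Omega>" using assms(2,3) by (simp add: frontier_def interior_open)
  then have 1: "\<psi> y \<ge> 0" using U(3) assms(4) by force
  have "\<psi> y \<le> 0"
  proof (rule ccontr)
    assume "\<not> \<psi> y \<le> 0"
    then have p: "\<psi> y > 0" by simp
    have "open {z \<in> U. \<psi> z > 0}"
      using continuous_open_preimage[OF smooth_on_continuous[OF U(2)] U(1) open_greaterThan[of 0]]
      by (simp add: vimage_def Int_def conj_commute)
    moreover have "y \<in> closure \<Omega>" using assms(3) by (simp add: frontier_def)
    ultimately have "{z \<in> U. \<psi> z > 0} \<inter> \<Omega> \<noteq> {}"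
      using p assms(4) open_Int_closure_eq_empty[of "{z \<in> U. \<psi> z > 0}" \<Omega>] by blast
    then show False using U(3) by force
  qed
  with 1 show ?thesis by simp
qed

text \<open>Near x the domain is star-shaped with respect to every point of one common ball; at the
  boundary this ball lies further inside, along the inward normal. \<open>s0 > 1\<close> makes the
  scale s = 1 admissible in \<open>star_kernel\<close>.\<close>

lemma star_neighbourhood:
  assumes \<Omega>: "smooth_bounded_domain \<Omega>" and x: "x \<in> closure \<Omega>"
  obtains r h s0 c where "r > 0" "h > 0" "s0 > 1"
    "\<And>y z s. y \<in> \<Omega> \<Longrightarrow> y \<in> ball x r \<Longrightarrow> z \<in> cball c h \<Longrightarrow> 0 < s \<Longrightarrow> s < s0 \<Longrightarrow> y + s *\<^sub>R (z - y) \<in> \<Omega>"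
proof -
  have op: "open \<Omega>" and bd: "bounded \<Omega>" using \<Omega> by (auto simp: smooth_bounded_domain_def)
  have weak: "\<exists>r c h. r > 0 \<and> h > 0 \<and> (\<forall>y z s. y \<in> \<Omega> \<longrightarrow> y \<in> ball x r \<longrightarrow> z \<in> cball c h \<longrightarrow> 0 < s \<longrightarrow> s \<le> 1 \<longrightarrow> y + s *\<^sub>R (z - y) \<in> \<Omega>)"
  proof (cases "x \<in> \<Omega>")
    case True
    then obtain r where r: "r > 0" "cball x r \<subseteq> \<Omega>" using op open_contains_cball by blast
    have "y + s *\<^sub>R (z - y) \<in> \<Omega>" if "y \<in> ball x r" "z \<in> cball x r" "0 < s" "s \<le> 1" for y z s
    proof -
      have "y + s *\<^sub>R (z - y) = (1 - s) *\<^sub>R y + s *\<^sub>R z" by (simp add: algebra_simps)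
      moreover have "(1 - s) *\<^sub>R y + s *\<^sub>R z \<in> cball x r"
        using that by (intro convexD_alt[OF convex_cball]) auto
      ultimately show ?thesis using r by auto
    qed
    then show ?thesis using r by blast
  next
    case False
    then have "x \<in> frontier \<Omega>" using x op by (simp add: frontier_def interior_open)
    then obtain U \<psi> where ch: "boundary_chart \<Omega> x U \<psi>" using \<Omega> unfolding smooth_bounded_domain_def by blast
    obtain R m e where R: "R > 0" "m > 0" "norm e = 1" "cball x (4 * R) \<subseteq> U"
      "\<And>y w. y \<in> cball x (4 * R) \<Longrightarrow> norm (w - e) \<le> 1 / 2 \<Longrightarrow> m \<le> w \<bullet> grad pd \<psi> y"
      by (rule chart_local[OF ch]) (rule that)
    have eq: "\<Omega> \<inter> U = {y \<in> U. \<psi> y < 0}" using ch by (auto simp: boundary_chart_def)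
    \<comment> \<open>For z near c and y near x, (y - z) / (2R) is within 1/2 of e, so \<psi>
      increases from z to y; as it is negative at y, the whole segment stays in \<Omega>.\<close>
    define c where "c = x - (2 * R) *\<^sub>R e"
    have "y + s *\<^sub>R (z - y) \<in> \<Omega>" if y: "y \<in> \<Omega>" "y \<in> ball x (R / 2)" and z: "z \<in> cball c (R / 2)" and s: "0 < s" "s \<le> 1" for y z s
    proof -
      define w where "w = (1 / (2 * R)) *\<^sub>R (y - z)"
      have "w - e = (1 / (2 * R)) *\<^sub>R ((y - x) + (c - z))"
        using R(1) by (simp add: w_def c_def algebra_simps)
      then have "norm (w - e) = (1 / (2 * R)) * norm ((y - x) + (c - z))" using R(1) by simp
      also have "\<dots> \<le> (1 / (2 * R)) * (R / 2 + R / 2)"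
      proof (intro mult_left_mono order_trans[OF norm_triangle_ineq] add_mono)
        show "norm (y - x) \<le> R / 2" using y(2) by (simp add: dist_norm norm_minus_commute)
        show "norm (c - z) \<le> R / 2" using z by (simp add: dist_norm)
      qed (use R in auto)
      also have "\<dots> = 1 / 2" using R(1) by simp
      finally have w: "norm (w - e) \<le> 1 / 2" .
      define p where "p = y + s *\<^sub>R (z - y)"
      have yb: "y \<in> cball x (4 * R)" using y(2) R(1) by auto
      have zb: "z \<in> cball x (4 * R)"
      proof -
        have "dist x c = 2 * R" using R(1,3) by (simp add: c_def dist_norm)
        then show ?thesis using z R(1) dist_triangle[of x z c] by (simp add: mem_cball)
      qed
      have pb: "p \<in> cball x (4 * R)"
      proof -
        have "p = (1 - s) *\<^sub>R y + s *\<^sub>R z" by (simp add: p_def algebra_simps)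
        then show ?thesis using convexD_alt[OF convex_cball yb zb] s by simp
      qed
      have yp: "p + (2 * R * s) *\<^sub>R w = y"
        using R(1) by (simp add: p_def w_def algebra_simps)
      have "\<psi> (p + (2 * R * s) *\<^sub>R w) \<ge> \<psi> p + m * (2 * R * s)"
        using R s pb yb w by (intro chart_increase[OF ch R(4)]) (auto simp: yp)
      then have "\<psi> y \<ge> \<psi> p + m * (2 * R * s)" by (simp only: yp)
      moreover have "m * (2 * R * s) > 0" using R s by simp
      moreover have "\<psi> y < 0" using y yb R(4) eq by blast
      ultimately have "\<psi> p < 0" by linarith
      then show ?thesis using pb R(4) eq unfolding p_def by blast
    qed
    then show ?thesis using R(1) by (intro exI[of _ "R / 2"] exI[of _ c]) auto
  qed
  then obtain r c h where w: "r > 0" "h > 0" and st: "\<And>y z s. y \<in> \<Omega> \<Longrightarrow> y \<in> ball x r \<Longrightarrow> z \<in> cball c h \<Longrightarrow> 0 < s \<Longrightarrow> s \<le> 1 \<Longrightarrow> y + s *\<^sub>R (z - y) \<in> \<Omega>"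
    by metis
  obtain y0 where y0: "y0 \<in> \<Omega>" "y0 \<in> ball x r"
    using x w(1) by (metis closure_approachable dist_commute mem_ball)
  have cb: "cball c h \<subseteq> \<Omega>" using st[OF y0, of _ 1] by auto
  obtain D where D: "D > 0" "\<And>y. y \<in> \<Omega> \<Longrightarrow> dist c y \<le> D"
  proof -
    from bounded_subset_ballD[OF bd, of c] obtain D where "0 < D" "\<Omega> \<subseteq> ball c D" by auto
    then show ?thesis by (intro that[of D]) (auto dest!: subsetD simp: less_imp_le)
  qed
  \<comment> \<open>The distance between z and y is at most D + h, so exceeding s = 1 by h / (2 (D +
    h)) moves the point by at most h/2 beyond z. It stays in \<open>cball c h\<close> when z is
    taken from the ball of half the radius.\<close>
  define s0 where "s0 = 1 + h / (2 * (D + h))"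
  have s0: "s0 > 1" using w D by (simp add: s0_def)
  show thesis
  proof (rule that[of r "h / 2" s0 c])
    fix y z s assume y: "y \<in> \<Omega>" "y \<in> ball x r" and z: "z \<in> cball c (h / 2)" and s: "0 < s" "s < s0"
    show "y + s *\<^sub>R (z - y) \<in> \<Omega>"
    proof (cases "s \<le> 1")
      case True
      then show ?thesis using st[OF y _ s(1), of z] z w by auto
    next
      case False
      have "dist c z \<le> h / 2" using z by simp
      have "dist z y \<le> D + h"
        using D(2)[OF y(1)] z w dist_triangle[of z y c] by (simp add: dist_commute)
      then have "(s - 1) * dist z y \<le> (h / (2 * (D + h))) * (D + h)"
        using False s D w by (intro mult_mono) (auto simp: s0_def)
      also have "\<dots> = h / 2" using D w by (simp add: field_simps)
      finally have "norm ((s - 1) *\<^sub>R (z - y)) \<le> h / 2" using False by (simp add: dist_norm)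
      moreover have "y + s *\<^sub>R (z - y) = z + (s - 1) *\<^sub>R (z - y)" by (simp add: algebra_simps)
      ultimately have "dist z (y + s *\<^sub>R (z - y)) \<le> h / 2" by (simp add: dist_norm norm_minus_commute)
      then have "y + s *\<^sub>R (z - y) \<in> cball c h"
        using z dist_triangle[of c "y + s *\<^sub>R (z - y)" z] by simp
      then show ?thesis using cb by blast
    qed
  qed (use w s0 in auto)
qed

lemma bump_integral_pos:
  assumes "r > 0"
  shows "integral\<^sup>L lebesgue (bump a r) > 0"
proof -
  have c: "continuous_on UNIV (bump a r)" by (rule smooth_on_continuous[OF smooth_bump])
  obtain l u where lu: "cball a r \<subseteq> cbox l u"
    using bounded_subset_cbox_symmetric[OF bounded_cball] by blast
  have z: "bump a r x = 0" if "x \<notin> cbox l u" for x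
  proof (rule bump_props(4)[OF assms], rule ccontr)
    assume "\<not> r \<le> norm (x - a)"
    then have "x \<in> cball a r" by (simp add: dist_norm norm_minus_commute)
    then show False using that lu by blast
  qed
  have e: "integral\<^sup>L lebesgue (bump a r) = integral (cbox l u) (bump a r)"
    by (rule integral_eq_cbox[OF c z])
  have "integral\<^sup>L lebesgue (bump a r) \<ge> 0" by (intro Bochner_Integration.integral_nonneg bump_props)
  moreover have "integral\<^sup>L lebesgue (bump a r) \<noteq> 0"
  proof
    assume 0: "integral\<^sup>L lebesgue (bump a r) = 0"
    have ne: "box l u \<noteq> {}"
    proof -
      have "ball a r \<subseteq> cbox l u" using lu ball_subset_cball by blast
      then have "ball a r \<subseteq> interior (cbox l u)" by (intro interior_maximal) auto
      then have "a \<in> box l u" using assms by auto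
      then show ?thesis by blast
    qed
    have "bump a r a = 0"
    proof (rule has_integral_0_cbox_imp_0[OF continuous_on_subset[OF c] _ _ ne])
      show "(bump a r has_integral 0) (cbox l u)"
        using 0 e integrable_continuous[OF continuous_on_subset[OF c], of l u] by (metis integrable_integral subset_UNIV)
    qed (use lu assms bump_props in auto)
    moreover have "bump a r a > 0" using assms by (intro bump_props(3)) simp
    ultimately show False by simp
  qed
  ultimately show ?thesis by simp
qed

text \<open>Serves properties that can be joined over a finite subcover: estimates, whose constants
  are combined, and boundary barriers, which are added.\<close>

lemma compact_local_to_global:
  assumes "compact K" "\<And>x. x \<in> K \<Longrightarrow> \<exists>U. open U \<and> x \<in> U \<and> Q U" "Q {}"
    and "\<And>U V. Q U \<Longrightarrow> Q V \<Longrightarrow> Q (U \<union> V)" "\<And>U V. V \<subseteq> U \<Longrightarrow> Q U \<Longrightarrow> Q V"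
  shows "Q K"
proof -
  obtain F where F: "\<And>x. x \<in> K \<Longrightarrow> open (F x) \<and> x \<in> F x \<and> Q (F x)" using assms(2) by metis
  obtain C where C: "C \<subseteq> K" "finite C" "K \<subseteq> \<Union>(F ` C)"
    using compactE_image[OF assms(1), of K F] F by blast
  have "Q (\<Union>(F ` C'))" if "finite C'" "C' \<subseteq> K" for C'
    using that by (induction C') (auto intro!: assms(3,4) simp: F)
  then show ?thesis using assms(5)[OF C(3)] C by blast
qed

section \<open>Morrey inequalities up to the boundary\<close>

definition good_fun :: "(real^3) set \<Rightarrow> real \<Rightarrow> real \<Rightarrow> (real^3 \<Rightarrow> real) \<Rightarrow> bool" where
  "good_fun \<Omega> p N v \<longleftrightarrow> continuous_on \<Omega> v \<and> weak_grad_bound \<Omega> p N v \<and> N > 0"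

text \<open>One normalised bump on the common ball of \<open>star_neighbourhood\<close> is the
  kernel for all y near x, which makes the constants uniform in y. The first estimate compares the
  value with the average, the second bounds the average by the L1 norm.\<close>

lemma morrey_local:
  assumes \<Omega>: "smooth_bounded_domain \<Omega>" and x: "x \<in> closure \<Omega>" and p: "p > 3"
  obtains r C Z \<zeta> where "r > 0" "C \<ge> 0" "Z \<ge> 0"
    "\<And>v N y s. good_fun \<Omega> p N v \<Longrightarrow> y \<in> \<Omega> \<Longrightarrow> y \<in> ball x r \<Longrightarrow> 0 < s \<Longrightarrow> s \<le> 1 \<Longrightarrow>
      \<bar>avg \<zeta> y v s - v y\<bar> \<le> C * N * s powr (1 - 3 / p)"
    "\<And>v y s. continuous_on \<Omega> v \<Longrightarrow> integrable (lebesgue_on \<Omega>) v \<Longrightarrow> y \<in> \<Omega> \<Longrightarrow> y \<in> ball x r \<Longrightarrow> 0 < s \<Longrightarrow> s \<le> 1 \<Longrightarrow>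
      \<bar>avg \<zeta> y v s\<bar> \<le> Z / s ^ 3 * (LINT w|lebesgue_on \<Omega>. \<bar>v w\<bar>)"
proof -
  have op: "open \<Omega>" and bd: "bounded \<Omega>" using \<Omega> by (auto simp: smooth_bounded_domain_def)
  obtain r h s0 c where w: "r > 0" "h > 0" "s0 > 1"
    and st: "\<And>y z s. y \<in> \<Omega> \<Longrightarrow> y \<in> ball x r \<Longrightarrow> z \<in> cball c h \<Longrightarrow> 0 < s \<Longrightarrow> s < s0 \<Longrightarrow> y + s *\<^sub>R (z - y) \<in> \<Omega>"
    by (rule star_neighbourhood[OF \<Omega> x]) (rule that)
  obtain D where D: "D > 0" "\<And>y. y \<in> \<Omega> \<Longrightarrow> dist c y \<le> D"
  proof -
    from bounded_subset_ballD[OF bd, of c] obtain D where "0 < D" "\<Omega> \<subseteq> ball c D" by auto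
    then show ?thesis by (intro that[of D]) (auto dest!: subsetD simp: less_imp_le)
  qed
  define I where "I = integral\<^sup>L lebesgue (bump c h)"
  have I: "I > 0" unfolding I_def by (rule bump_integral_pos[OF w(2)])
  define \<zeta> where "\<zeta> z = (1 / I) * bump c h z" for z
  have Z: "\<bar>\<zeta> z\<bar> \<le> 1 / I" for z
    using bump_props(1,2)[of c h z] I by (simp add: \<zeta>_def abs_mult divide_right_mono)
  have sk: "star_kernel \<Omega> y s0 (cball c h) \<zeta>" if "y \<in> \<Omega>" "y \<in> ball x r" for y
    unfolding star_kernel_def
  proof (intro conjI allI impI ballI)
    show "smooth_on UNIV \<zeta>" unfolding \<zeta>_def[abs_def] by (rule smooth_on_mult[OF open_UNIV smooth_on_const smooth_bump])
    show "\<zeta> z = 0" if "z \<notin> cball c h" for z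
      using that w(2) bump_props(4)[of h z c] by (simp add: \<zeta>_def dist_norm norm_minus_commute)
  qed (use st that in auto)
  have sub: "cball c h \<subseteq> cball y (D + h)" if "y \<in> \<Omega>" for y
  proof
    fix z assume "z \<in> cball c h"
    then show "z \<in> cball y (D + h)" using D(2)[OF that] dist_triangle[of y z c] by (simp add: dist_commute)
  qed
  have one: "integral\<^sup>L lebesgue \<zeta> = 1" using I by (simp add: \<zeta>_def[abs_def] I_def)
  have DR: "D + h > 0" using D w by simp
  show thesis
  proof (rule that[of r "morrey_const p (D + h) (1 / I) / (1 - 3 / p)" "1 / I" \<zeta>])
    show "0 \<le> morrey_const p (D + h) (1 / I) / (1 - 3 / p)"
      using DR I p by (intro divide_nonneg_nonneg morrey_const_nonneg) auto
    fix v N y s assume "good_fun \<Omega> p N v" and y: "y \<in> \<Omega>" "y \<in> ball x r" and s: "0 < s" "s \<le> (1::real)"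
    then show "\<bar>avg \<zeta> y v s - v y\<bar> \<le> morrey_const p (D + h) (1 / I) / (1 - 3 / p) * N * s powr (1 - 3 / p)"
      using morrey_pointwise[OF op _ y(1) _ p _ sk[OF y] sub[OF y(1)] DR Z s(1), of v N] w(3) one by (simp add: good_fun_def)
  next
    fix v :: "real^3 \<Rightarrow> real" and y s assume v: "continuous_on \<Omega> v" "integrable (lebesgue_on \<Omega>) v" and y: "y \<in> \<Omega>" "y \<in> ball x r" and s: "0 < s" "s \<le> (1::real)"
    note kb = ker_bound[OF sk[OF y] s(1) _ sub[OF y(1)] Z]
    have s': "s < s0" using s w by simp
    have "avg \<zeta> y v s = (LINT w|lebesgue_on \<Omega>. v w * ker \<zeta> y s w)"
      unfolding avg_def by (rule integral_lebesgue_on_support[OF open_sets_lebesgue[OF op], symmetric]) (use kb(1)[OF s'] in auto)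
    moreover have "\<bar>LINT w|lebesgue_on \<Omega>. v w * ker \<zeta> y s w\<bar> \<le> (LINT w|lebesgue_on \<Omega>. 1 / I / s ^ 3 * \<bar>v w\<bar>)"
    proof -
      have b: "\<bar>v w * ker \<zeta> y s w\<bar> \<le> 1 / I / s ^ 3 * \<bar>v w\<bar>" for w
        using mult_right_mono[OF kb(2)[OF s'], of "\<bar>v w\<bar>" w] by (simp add: abs_mult mult.commute)
      have i1: "integrable (lebesgue_on \<Omega>) (\<lambda>w. 1 / I / s ^ 3 * \<bar>v w\<bar>)" using v(2) by (intro integrable_mult_right integrable_abs)
      have "ker \<zeta> y s \<in> borel_measurable lebesgue"
        using sk[OF y] by (intro continuous_imp_lebesgue_measurable smooth_on_continuous smooth_ker) (simp add: star_kernel_def)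
      then have "(\<lambda>w. v w * ker \<zeta> y s w) \<in> borel_measurable (lebesgue_on \<Omega>)"
        by (intro borel_measurable_times borel_measurable_integrable[OF v(2)] measurable_restrict_space1)
      then have "integrable (lebesgue_on \<Omega>) (\<lambda>w. v w * ker \<zeta> y s w)"
        by (rule Bochner_Integration.integrable_bound[OF i1]) (rule AE_I2, unfold real_norm_def, rule order_trans[OF b abs_ge_self])
      then show ?thesis using b i1 by (intro order_trans[OF integral_abs_bound] integral_mono integrable_abs) auto
    qed
    ultimately show "\<bar>avg \<zeta> y v s\<bar> \<le> 1 / I / s ^ 3 * (LINT w|lebesgue_on \<Omega>. \<bar>v w\<bar>)" by simp
  qed (use w I in auto)
qed

theorem morrey_interpolation:
  assumes \<Omega>: "smooth_bounded_domain \<Omega>" and p: "p > 3"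
  obtains C where "C > 0"
    "\<And>v N y s. good_fun \<Omega> p N v \<Longrightarrow> integrable (lebesgue_on \<Omega>) v \<Longrightarrow> y \<in> \<Omega> \<Longrightarrow> 0 < s \<Longrightarrow> s \<le> 1 \<Longrightarrow>
      \<bar>v y\<bar> \<le> C * N * s powr (1 - 3 / p) + C / s ^ 3 * (LINT w|lebesgue_on \<Omega>. \<bar>v w\<bar>)"
proof -
  define Q where "Q U \<longleftrightarrow> (\<exists>C>0. \<forall>v N y s. good_fun \<Omega> p N v \<longrightarrow> integrable (lebesgue_on \<Omega>) v \<longrightarrow> y \<in> \<Omega> \<longrightarrow> y \<in> U \<longrightarrow> 0 < s \<longrightarrow> s \<le> 1 \<longrightarrow>
      \<bar>v y\<bar> \<le> C * N * s powr (1 - 3 / p) + C / s ^ 3 * (LINT w|lebesgue_on \<Omega>. \<bar>v w\<bar>))" for U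
  have mono: "C * N * s powr (1 - 3 / p) + C / s ^ 3 * (LINT w|lebesgue_on \<Omega>. \<bar>v w\<bar>) \<le>
     C' * N * s powr (1 - 3 / p) + C' / s ^ 3 * (LINT w|lebesgue_on \<Omega>. \<bar>v w\<bar>)" if "C \<le> C'" "N > 0" "0 < s"
    for C C' N s :: real and v :: "real^3 \<Rightarrow> real"
    using that by (intro add_mono mult_right_mono divide_right_mono Bochner_Integration.integral_nonneg) auto
  have "Q (closure \<Omega>)"
  proof (rule compact_local_to_global)
    show "compact (closure \<Omega>)" using \<Omega> by (simp add: smooth_bounded_domain_def)
    fix x assume x: "x \<in> closure \<Omega>"
    obtain r C Z \<zeta> where m: "r > 0" "C \<ge> 0" "Z \<ge> 0"
      "\<And>v N y s. good_fun \<Omega> p N v \<Longrightarrow> y \<in> \<Omega> \<Longrightarrow> y \<in> ball x r \<Longrightarrow> 0 < s \<Longrightarrow> s \<le> 1 \<Longrightarrow>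
        \<bar>avg \<zeta> y v s - v y\<bar> \<le> C * N * s powr (1 - 3 / p)"
      "\<And>v y s. continuous_on \<Omega> v \<Longrightarrow> integrable (lebesgue_on \<Omega>) v \<Longrightarrow> y \<in> \<Omega> \<Longrightarrow> y \<in> ball x r \<Longrightarrow> 0 < s \<Longrightarrow> s \<le> 1 \<Longrightarrow>
        \<bar>avg \<zeta> y v s\<bar> \<le> Z / s ^ 3 * (LINT w|lebesgue_on \<Omega>. \<bar>v w\<bar>)"
      by (rule morrey_local[OF \<Omega> x p]) (rule that)
    have "Q (ball x r)" unfolding Q_def
    proof (intro exI[of _ "C + Z + 1"] conjI allI impI)
      fix v N y s assume a: "good_fun \<Omega> p N v" "integrable (lebesgue_on \<Omega>) v" "y \<in> \<Omega>" "y \<in> ball x r" "0 < s" "s \<le> (1::real)"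
      have N: "N > 0" "continuous_on \<Omega> v" using a by (auto simp: good_fun_def)
      have "\<bar>v y\<bar> \<le> C * N * s powr (1 - 3 / p) + Z / s ^ 3 * (LINT w|lebesgue_on \<Omega>. \<bar>v w\<bar>)"
        using m(4)[OF a(1,3-6)] m(5)[OF N(2) a(2-6)] by linarith
      also have "\<dots> \<le> (C + Z + 1) * N * s powr (1 - 3 / p) + (C + Z + 1) / s ^ 3 * (LINT w|lebesgue_on \<Omega>. \<bar>v w\<bar>)"
        using m(2,3) N a(5) by (intro add_mono mult_right_mono divide_right_mono Bochner_Integration.integral_nonneg) auto
      finally show "\<bar>v y\<bar> \<le> (C + Z + 1) * N * s powr (1 - 3 / p) + (C + Z + 1) / s ^ 3 * (LINT w|lebesgue_on \<Omega>. \<bar>v w\<bar>)" .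
    qed (use m in auto)
    then show "\<exists>U. open U \<and> x \<in> U \<and> Q U" using m(1) by (intro exI[of _ "ball x r"]) auto
  next
    show "Q {}" unfolding Q_def by (intro exI[of _ 1]) auto
    fix U V
    show "Q V" if "V \<subseteq> U" "Q U" using that unfolding Q_def by blast
    assume "Q U" "Q V"
    then obtain C C' where C: "C > 0" "C' > 0"
      "\<And>v N y s. good_fun \<Omega> p N v \<Longrightarrow> integrable (lebesgue_on \<Omega>) v \<Longrightarrow> y \<in> \<Omega> \<Longrightarrow> y \<in> U \<Longrightarrow> 0 < s \<Longrightarrow> s \<le> 1 \<Longrightarrow>
        \<bar>v y\<bar> \<le> C * N * s powr (1 - 3 / p) + C / s ^ 3 * (LINT w|lebesgue_on \<Omega>. \<bar>v w\<bar>)"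
      "\<And>v N y s. good_fun \<Omega> p N v \<Longrightarrow> integrable (lebesgue_on \<Omega>) v \<Longrightarrow> y \<in> \<Omega> \<Longrightarrow> y \<in> V \<Longrightarrow> 0 < s \<Longrightarrow> s \<le> 1 \<Longrightarrow>
        \<bar>v y\<bar> \<le> C' * N * s powr (1 - 3 / p) + C' / s ^ 3 * (LINT w|lebesgue_on \<Omega>. \<bar>v w\<bar>)"
      unfolding Q_def by metis
    show "Q (U \<union> V)" unfolding Q_def
    proof (intro exI[of _ "max C C'"] conjI allI impI)
      fix v N y s assume a: "good_fun \<Omega> p N v" "integrable (lebesgue_on \<Omega>) v" "y \<in> \<Omega>" "y \<in> U \<union> V" "0 < s" "s \<le> (1::real)"
      have N: "N > 0" using a by (auto simp: good_fun_def)
      show "\<bar>v y\<bar> \<le> max C C' * N * s powr (1 - 3 / p) + max C C' / s ^ 3 * (LINT w|lebesgue_on \<Omega>. \<bar>v w\<bar>)"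
        using C(3)[OF a(1-3) _ a(5,6)] C(4)[OF a(1-3) _ a(5,6)] a(4)
          mono[of C "max C C'" N s v, OF _ N a(5)] mono[of C' "max C C'" N s v, OF _ N a(5)] by fastforce
    qed (use C in auto)
  qed
  then obtain C where "C > 0" "\<And>v N y s. good_fun \<Omega> p N v \<Longrightarrow> integrable (lebesgue_on \<Omega>) v \<Longrightarrow> y \<in> \<Omega> \<Longrightarrow> y \<in> closure \<Omega> \<Longrightarrow> 0 < s \<Longrightarrow> s \<le> 1 \<Longrightarrow>
      \<bar>v y\<bar> \<le> C * N * s powr (1 - 3 / p) + C / s ^ 3 * (LINT w|lebesgue_on \<Omega>. \<bar>v w\<bar>)"
    unfolding Q_def by metis
  then show thesis using that[of C] closure_subset[of \<Omega>] by blast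
qed

text \<open>At scale 1 the averages about nearby points y and y' are the same number, so v(y) and
  v(y') differ by O(N). Connectedness joins any two points, with constants depending on them;
  comparing with one point \<open>p0\<close> and compactness of the closure make them
  uniform.\<close>

theorem morrey_oscillation:
  assumes \<Omega>: "smooth_bounded_domain \<Omega>" and p: "p > 3"
  obtains C where "C > 0"
    "\<And>v N x y. good_fun \<Omega> p N v \<Longrightarrow> x \<in> \<Omega> \<Longrightarrow> y \<in> \<Omega> \<Longrightarrow> \<bar>v x - v y\<bar> \<le> C * N"
proof -
  have op: "open \<Omega>" and con: "connected \<Omega>" and ne: "\<Omega> \<noteq> {}" using \<Omega> by (auto simp: smooth_bounded_domain_def)
  have loc: "\<exists>r>0. \<exists>C\<ge>0. \<forall>v N y y'. good_fun \<Omega> p N v \<longrightarrow> y \<in> \<Omega> \<inter> ball x r \<longrightarrow> y' \<in> \<Omega> \<inter> ball x r \<longrightarrow> \<bar>v y - v y'\<bar> \<le> C * N"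
    if x: "x \<in> closure \<Omega>" for x
  proof -
    obtain r C Z \<zeta> where m: "r > 0" "C \<ge> 0" "Z \<ge> 0"
      "\<And>v N y s. good_fun \<Omega> p N v \<Longrightarrow> y \<in> \<Omega> \<Longrightarrow> y \<in> ball x r \<Longrightarrow> 0 < s \<Longrightarrow> s \<le> 1 \<Longrightarrow>
        \<bar>avg \<zeta> y v s - v y\<bar> \<le> C * N * s powr (1 - 3 / p)"
      "\<And>v y s. continuous_on \<Omega> v \<Longrightarrow> integrable (lebesgue_on \<Omega>) v \<Longrightarrow> y \<in> \<Omega> \<Longrightarrow> y \<in> ball x r \<Longrightarrow> 0 < s \<Longrightarrow> s \<le> 1 \<Longrightarrow>
        \<bar>avg \<zeta> y v s\<bar> \<le> Z / s ^ 3 * (LINT w|lebesgue_on \<Omega>. \<bar>v w\<bar>)"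
      by (rule morrey_local[OF \<Omega> x p]) (rule that)
    have "\<bar>v y - v y'\<bar> \<le> (2 * C) * N" if "good_fun \<Omega> p N v" "y \<in> \<Omega> \<inter> ball x r" "y' \<in> \<Omega> \<inter> ball x r" for v N y y'
    proof -
      have "avg \<zeta> y v 1 = avg \<zeta> y' v 1" by (simp add: avg_def ker_def)
      then show ?thesis using m(4)[OF that(1), of y 1] m(4)[OF that(1), of y' 1] that(2,3) by auto
    qed
    then show ?thesis using m by (intro exI[of _ r] conjI exI[of _ "2 * C"]) auto
  qed
  define R where "R x y \<longleftrightarrow> (\<exists>C\<ge>0. \<forall>v N. good_fun \<Omega> p N v \<longrightarrow> \<bar>v x - v y\<bar> \<le> C * N)" for x y
  have R: "R a b" if "a \<in> \<Omega>" "b \<in> \<Omega>" for a b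
  proof (rule connected_equivalence_relation[OF con that])
    show "R y x" if "R x y" for x y using that unfolding R_def by (simp add: abs_minus_commute)
    show "R x z" if xy: "R x y" and yz: "R y z" for x y z
    proof -
      obtain C C' where "C \<ge> 0" "C' \<ge> 0" "\<And>v N. good_fun \<Omega> p N v \<Longrightarrow> \<bar>v x - v y\<bar> \<le> C * N" "\<And>v N. good_fun \<Omega> p N v \<Longrightarrow> \<bar>v y - v z\<bar> \<le> C' * N"
        using xy yz unfolding R_def by metis
      note C = this
      have "\<bar>v x - v z\<bar> \<le> (C + C') * N" if "good_fun \<Omega> p N v" for v N
        using C(3)[OF that] C(4)[OF that] by (simp add: distrib_right)
      then show ?thesis unfolding R_def using C(1,2) by (intro exI[of _ "C + C'"]) simp
    qed
    fix a assume a: "a \<in> \<Omega>"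
    then have "a \<in> closure \<Omega>" using closure_subset by blast
    from loc[OF this] obtain r C where r: "r > 0" "C \<ge> 0" "\<And>v N y y'. good_fun \<Omega> p N v \<Longrightarrow> y \<in> \<Omega> \<inter> ball a r \<Longrightarrow> y' \<in> \<Omega> \<inter> ball a r \<Longrightarrow> \<bar>v y - v y'\<bar> \<le> C * N"
      by metis
    show "\<exists>T. openin (top_of_set \<Omega>) T \<and> a \<in> T \<and> (\<forall>x\<in>T. R a x)"
      using r a op by (intro exI[of _ "\<Omega> \<inter> ball a r"]) (auto simp: R_def intro!: openin_open_Int)
  qed
  obtain p0 where p0: "p0 \<in> \<Omega>" using ne by blast
  define Q where "Q U \<longleftrightarrow> (\<exists>C>0. \<forall>v N y. good_fun \<Omega> p N v \<longrightarrow> y \<in> \<Omega> \<longrightarrow> y \<in> U \<longrightarrow> \<bar>v y - v p0\<bar> \<le> C * N)" for U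
  have "Q (closure \<Omega>)"
  proof (rule compact_local_to_global)
    show "compact (closure \<Omega>)" using \<Omega> by (simp add: smooth_bounded_domain_def)
    fix x assume x: "x \<in> closure \<Omega>"
    from loc[OF this] obtain r C where r: "r > 0" "C \<ge> 0" "\<And>v N y y'. good_fun \<Omega> p N v \<Longrightarrow> y \<in> \<Omega> \<inter> ball x r \<Longrightarrow> y' \<in> \<Omega> \<inter> ball x r \<Longrightarrow> \<bar>v y - v y'\<bar> \<le> C * N"
      by metis
    obtain z where z: "z \<in> \<Omega> \<inter> ball x r"
      using x r(1) by (metis IntI closure_approachable dist_commute mem_ball)
    obtain C' where C': "C' \<ge> 0" "\<And>v N. good_fun \<Omega> p N v \<Longrightarrow> \<bar>v z - v p0\<bar> \<le> C' * N"
      using R[of z p0] z p0 unfolding R_def by auto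
    have "Q (ball x r)" unfolding Q_def
    proof (intro exI[of _ "C + C' + 1"] conjI allI impI)
      fix v N y assume a: "good_fun \<Omega> p N v" "y \<in> \<Omega>" "y \<in> ball x r"
      then have "N > 0" by (simp add: good_fun_def)
      then show "\<bar>v y - v p0\<bar> \<le> (C + C' + 1) * N"
        using r(3)[OF a(1) _ z, of y] C'(2)[OF a(1)] a by (auto simp: distrib_right)
    qed (use r C' in auto)
    then show "\<exists>U. open U \<and> x \<in> U \<and> Q U" using r(1) by (intro exI[of _ "ball x r"]) auto
  next
    show "Q {}" unfolding Q_def by (intro exI[of _ 1]) auto
    fix U V
    show "Q V" if "V \<subseteq> U" "Q U" using that unfolding Q_def by blast
    assume "Q U" "Q V"
    then obtain C C' where C: "C > 0" "C' > 0"
      "\<And>v N y. good_fun \<Omega> p N v \<Longrightarrow> y \<in> \<Omega> \<Longrightarrow> y \<in> U \<Longrightarrow> \<bar>v y - v p0\<bar> \<le> C * N"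
      "\<And>v N y. good_fun \<Omega> p N v \<Longrightarrow> y \<in> \<Omega> \<Longrightarrow> y \<in> V \<Longrightarrow> \<bar>v y - v p0\<bar> \<le> C' * N"
      unfolding Q_def by metis
    show "Q (U \<union> V)" unfolding Q_def
    proof (intro exI[of _ "C + C'"] conjI allI impI)
      fix v N y assume a: "good_fun \<Omega> p N v" "y \<in> \<Omega>" "y \<in> U \<union> V"
      then have N: "N > 0" by (simp add: good_fun_def)
      then have "C * N \<le> (C + C') * N" "C' * N \<le> (C + C') * N" using C by auto
      then show "\<bar>v y - v p0\<bar> \<le> (C + C') * N"
        using C(3)[OF a(1,2)] C(4)[OF a(1,2)] a(3) by force
    qed (use C in auto)
  qed
  then obtain C where C0: "C > 0" "\<And>v N y. good_fun \<Omega> p N v \<Longrightarrow> y \<in> \<Omega> \<Longrightarrow> y \<in> closure \<Omega> \<Longrightarrow> \<bar>v y - v p0\<bar> \<le> C * N"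
    unfolding Q_def by metis
  then have C: "C > 0" "\<And>v N y. good_fun \<Omega> p N v \<Longrightarrow> y \<in> \<Omega> \<Longrightarrow> \<bar>v y - v p0\<bar> \<le> C * N"
    using closure_subset[of \<Omega>] by blast+
  show thesis
  proof (rule that[of "2 * C"])
    fix v N x y assume "good_fun \<Omega> p N v" "x \<in> \<Omega>" "y \<in> \<Omega>"
    then show "\<bar>v x - v y\<bar> \<le> 2 * C * N" using C(2)[of N v x] C(2)[of N v y] by auto
  qed (use C in auto)
qed

subsection \<open>Sobolev functions\<close>

lemma Lp_cong_AE:
  fixes g h :: "real^3 \<Rightarrow> 'b::euclidean_space"
  assumes "open \<Omega>" "g \<in> Lp \<Omega> p" "AE x in lebesgue_on \<Omega>. g x = h x"
  shows "h \<in> Lp \<Omega> p" "(LINT x|lebesgue_on \<Omega>. norm (h x) powr p) = (LINT x|lebesgue_on \<Omega>. norm (g x) powr p)"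
proof -
  have O: "\<Omega> \<in> sets lebesgue" by (rule open_sets_lebesgue[OF assms(1)])
  then have O': "\<Omega> \<inter> space lebesgue \<in> sets lebesgue" by simp
  have g: "g \<in> borel_measurable (lebesgue_on \<Omega>)" "integrable (lebesgue_on \<Omega>) (\<lambda>x. norm (g x) powr p)"
    using assms(2) by (auto simp: Lp_def)
  have "AE x in lebesgue. indicator \<Omega> x *\<^sub>R g x = indicator \<Omega> x *\<^sub>R h x"
    using assms(3) unfolding AE_lebesgue_on[OF O] by eventually_elim (auto simp: indicator_def)
  moreover have "(\<lambda>x. indicator \<Omega> x *\<^sub>R g x) \<in> borel_measurable lebesgue"
    using g(1) unfolding borel_measurable_restrict_space_iff[OF O'] .
  ultimately have "(\<lambda>x. indicator \<Omega> x *\<^sub>R h x) \<in> borel_measurable lebesgue"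
    by (rule borel_measurable_AE[rotated])
  then have h: "h \<in> borel_measurable (lebesgue_on \<Omega>)"
    unfolding borel_measurable_restrict_space_iff[OF O'] .
  have m: "(\<lambda>x. norm (g x) powr p) \<in> borel_measurable (lebesgue_on \<Omega>)"
    "(\<lambda>x. norm (h x) powr p) \<in> borel_measurable (lebesgue_on \<Omega>)"
    using g(1) h by measurable
  have ae: "AE x in lebesgue_on \<Omega>. norm (g x) powr p = norm (h x) powr p"
    using assms(3) by eventually_elim simp
  show "h \<in> Lp \<Omega> p"
    using integrable_cong_AE_imp[OF g(2) m(2)] ae h by (auto simp: Lp_def eq_commute)
  show "(LINT x|lebesgue_on \<Omega>. norm (h x) powr p) = (LINT x|lebesgue_on \<Omega>. norm (g x) powr p)"
    by (rule integral_cong_AE[OF m(2,1)]) (use ae in \<open>auto simp: eq_commute\<close>)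
qed

text \<open>\<open>wderiv\<close> is an arbitrary choice; uniqueness almost everywhere transfers the
  integrability of the derivative that \<open>Sob\<close> provides.\<close>

lemma wderiv_Sob:
  fixes f :: "real^3 \<Rightarrow> 'b::euclidean_space"
  assumes "open \<Omega>" "f \<in> Sob \<Omega> k p" "mi_order \<alpha> \<le> k"
  shows "has_weak_deriv \<Omega> \<alpha> f (wderiv \<Omega> \<alpha> f)" "wderiv \<Omega> \<alpha> f \<in> Lp \<Omega> p"
proof -
  obtain g where g: "g \<in> Lp \<Omega> p" "has_weak_deriv \<Omega> \<alpha> f g"
    using assms(2,3) by (auto simp: Sob_def)
  then show w: "has_weak_deriv \<Omega> \<alpha> f (wderiv \<Omega> \<alpha> f)"
    unfolding wderiv_def by (metis someI_ex)
  show "wderiv \<Omega> \<alpha> f \<in> Lp \<Omega> p"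
    by (rule Lp_cong_AE(1)[OF assms(1) g(1) weak_deriv_unique[OF assms(1) g(2) w]])
qed

text \<open>A bound on \<open>sob_norm\<close> without reference to the chosen derivatives, so that
  it passes easily to components.\<close>

definition wd_bound :: "(real^3) set \<Rightarrow> nat \<Rightarrow> real \<Rightarrow> real \<Rightarrow> (real^3 \<Rightarrow> 'b::euclidean_space) \<Rightarrow> bool" where
  "wd_bound \<Omega> k p N f \<longleftrightarrow> (\<forall>\<alpha>. mi_order \<alpha> \<le> k \<longrightarrow> (\<exists>g\<in>Lp \<Omega> p. has_weak_deriv \<Omega> \<alpha> f g \<and>
     (LINT x|lebesgue_on \<Omega>. norm (g x) powr p) \<le> N powr p))"

lemma wderiv_le_sob_norm:
  fixes f :: "real^3 \<Rightarrow> 'b::euclidean_space"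
  assumes "p > 0" "mi_order \<alpha> \<le> k"
  shows "(LINT x|lebesgue_on \<Omega>. norm (wderiv \<Omega> \<alpha> f x) powr p) \<le> sob_norm \<Omega> k p f powr p"
proof -
  let ?S = "\<Sum>\<alpha> | mi_order \<alpha> \<le> k. LINT x|lebesgue_on \<Omega>. norm (wderiv \<Omega> \<alpha> f x) powr p"
  have "(LINT x|lebesgue_on \<Omega>. norm (wderiv \<Omega> \<alpha> f x) powr p) \<le> ?S"
    using finite_mi_order_le[of k] assms(2) by (intro member_le_sum) auto
  also have "?S = sob_norm \<Omega> k p f powr p"
    using assms(1) by (simp add: sob_norm_def powr_powr sum_nonneg)
  finally show ?thesis .
qed

lemma sob_norm_nonneg: "sob_norm \<Omega> k p f \<ge> 0"
  by (simp add: sob_norm_def)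

lemma Sob_wd_bound:
  assumes "open \<Omega>" "f \<in> Sob \<Omega> k p" "p > 0" "sob_norm \<Omega> k p f \<le> N"
  shows "wd_bound \<Omega> k p N f"
  unfolding wd_bound_def
proof (intro allI impI)
  fix \<alpha> assume a: "mi_order \<alpha> \<le> k"
  have "(LINT x|lebesgue_on \<Omega>. norm (wderiv \<Omega> \<alpha> f x) powr p) \<le> sob_norm \<Omega> k p f powr p"
    by (rule wderiv_le_sob_norm[OF assms(3) a])
  also have "\<dots> \<le> N powr p" using assms(3,4) sob_norm_nonneg by (intro powr_mono2) auto
  finally show "\<exists>g\<in>Lp \<Omega> p. has_weak_deriv \<Omega> \<alpha> f g \<and> (LINT x|lebesgue_on \<Omega>. norm (g x) powr p) \<le> N powr p"
    using wderiv_Sob[OF assms(1,2) a] by blast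
qed

lemma wd_bound_mono_order: "wd_bound \<Omega> k p N f \<Longrightarrow> l \<le> k \<Longrightarrow> wd_bound \<Omega> l p N f"
  by (auto simp: wd_bound_def)

lemma wd_bound_inner:
  assumes "open \<Omega>" "wd_bound \<Omega> k p N f" "norm b \<le> 1" "p > 0"
  shows "wd_bound \<Omega> k p N (\<lambda>x. f x \<bullet> b)"
  unfolding wd_bound_def
proof (intro allI impI)
  fix \<alpha> assume "mi_order \<alpha> \<le> k"
  then obtain g where g: "g \<in> Lp \<Omega> p" "has_weak_deriv \<Omega> \<alpha> f g" "(LINT x|lebesgue_on \<Omega>. norm (g x) powr p) \<le> N powr p"
    using assms(2) by (auto simp: wd_bound_def)
  have gm: "g \<in> borel_measurable (lebesgue_on \<Omega>)" and gi: "integrable (lebesgue_on \<Omega>) (\<lambda>x. norm (g x) powr p)"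
    using g(1) by (auto simp: Lp_def)
  have m: "(\<lambda>x. g x \<bullet> b) \<in> borel_measurable (lebesgue_on \<Omega>)" using gm by measurable
  have le: "norm (g x \<bullet> b) powr p \<le> norm (g x) powr p" for x
  proof (rule powr_mono2)
    have "norm (g x \<bullet> b) \<le> norm (g x) * norm b" using Cauchy_Schwarz_ineq2 by simp
    also have "\<dots> \<le> norm (g x) * 1" using assms(3) by (intro mult_left_mono) auto
    finally show "norm (g x \<bullet> b) \<le> norm (g x)" by simp
  qed (use assms in auto)
  have m2: "(\<lambda>x. norm (g x \<bullet> b) powr p) \<in> borel_measurable (lebesgue_on \<Omega>)" using m by measurable
  have i: "integrable (lebesgue_on \<Omega>) (\<lambda>x. norm (g x \<bullet> b) powr p)"
    by (rule Bochner_Integration.integrable_bound[OF gi m2]) (use le in auto)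
  have "(LINT x|lebesgue_on \<Omega>. norm (g x \<bullet> b) powr p) \<le> (LINT x|lebesgue_on \<Omega>. norm (g x) powr p)"
    by (rule integral_mono[OF i gi le])
  then show "\<exists>h\<in>Lp \<Omega> p. has_weak_deriv \<Omega> \<alpha> (\<lambda>x. f x \<bullet> b) h \<and> (LINT x|lebesgue_on \<Omega>. norm (h x) powr p) \<le> N powr p"
    using g(3) m i has_weak_deriv_inner[OF assms(1) g(2)] by (intro bexI[of _ "\<lambda>x. g x \<bullet> b"]) (auto simp: Lp_def)
qed

lemma wd_bound_nth:
  fixes f :: "real^3 \<Rightarrow> real^3"
  assumes "open \<Omega>" "wd_bound \<Omega> k p N f" "p > 0"
  shows "wd_bound \<Omega> k p N (\<lambda>x. f x $ j)"
  using wd_bound_inner[OF assms(1,2), of "axis j 1"] assms(3) by (simp add: inner_axis norm_axis_1)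

lemma wd_bound_weak_grad: "wd_bound \<Omega> k p N f \<Longrightarrow> 1 \<le> k \<Longrightarrow> weak_grad_bound \<Omega> p N f"
  unfolding weak_grad_bound_def
proof
  fix i assume a: "wd_bound \<Omega> k p N f" "1 \<le> k"
  have "mi_order (axis i 1) \<le> k" using a(2) unfolding mi_order_axis .
  with a(1) obtain g where "g\<in>Lp \<Omega> p" "has_weak_deriv \<Omega> (axis i 1) f g" "(LINT x|lebesgue_on \<Omega>. norm (g x) powr p) \<le> N powr p"
    unfolding wd_bound_def by blast
  then show "\<exists>g. has_weak_deriv \<Omega> (axis i 1) f g \<and> g \<in> Lp \<Omega> p \<and> (LINT x|lebesgue_on \<Omega>. \<bar>g x\<bar> powr p) \<le> N powr p"
    by auto
qed

lemma wd_bound_weak_grad_pd: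
  assumes "open \<Omega>" "wd_bound \<Omega> k p N f" "2 \<le> k"
    and "\<And>x. x \<in> \<Omega> \<Longrightarrow> f differentiable (at x)" "\<And>i. continuous_on \<Omega> (pd i f)"
  shows "weak_grad_bound \<Omega> p N (pd i f)"
  unfolding weak_grad_bound_def
proof
  fix j
  have "mi_order (axis i 1 + axis j 1) \<le> k" using assms(3) by (simp add: mi_order_axis2)
  then obtain g where "g\<in>Lp \<Omega> p" "has_weak_deriv \<Omega> (axis i 1 + axis j 1) f g" "(LINT x|lebesgue_on \<Omega>. norm (g x) powr p) \<le> N powr p"
    using assms(2) unfolding wd_bound_def by blast
  then show "\<exists>g. has_weak_deriv \<Omega> (axis j 1) (pd i f) g \<and> g \<in> Lp \<Omega> p \<and> (LINT x|lebesgue_on \<Omega>. \<bar>g x\<bar> powr p) \<le> N powr p"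
    using weak_deriv_pd[OF assms(1,4,5)] by auto
qed

lemma wd_bound_pd:
  assumes "open \<Omega>" "wd_bound \<Omega> k p N f" "1 \<le> k"
    and "\<And>x. x \<in> \<Omega> \<Longrightarrow> f differentiable (at x)" "\<And>i. continuous_on \<Omega> (pd i f)"
  shows "pd i f \<in> Lp \<Omega> p" "(LINT x|lebesgue_on \<Omega>. \<bar>pd i f x :: real\<bar> powr p) \<le> N powr p"
proof -
  obtain g where g: "g\<in>Lp \<Omega> p" "has_weak_deriv \<Omega> (axis i 1) f g" "(LINT x|lebesgue_on \<Omega>. norm (g x) powr p) \<le> N powr p"
  proof -
    have "mi_order (axis i 1) \<le> k" using assms(3) unfolding mi_order_axis .
    then show ?thesis using assms(2) that unfolding wd_bound_def by blast
  qed
  note u = weak_deriv_unique[OF assms(1) g(2) classical_weak_deriv[OF assms(1,4,5)]]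
  show "pd i f \<in> Lp \<Omega> p" "(LINT x|lebesgue_on \<Omega>. \<bar>pd i f x :: real\<bar> powr p) \<le> N powr p"
    using Lp_cong_AE[OF assms(1) g(1) u] g(3) by auto
qed

lemma wd_bound_self:
  fixes f :: "real^3 \<Rightarrow> 'b::euclidean_space"
  assumes "open \<Omega>" "wd_bound \<Omega> k p N f"
  shows "f \<in> Lp \<Omega> p" "(LINT x|lebesgue_on \<Omega>. norm (f x) powr p) \<le> N powr p"
proof -
  obtain g where g: "g\<in>Lp \<Omega> p" "has_weak_deriv \<Omega> 0 f g" "(LINT x|lebesgue_on \<Omega>. norm (g x) powr p) \<le> N powr p"
  proof -
    have "mi_order 0 \<le> k" unfolding mi_order_0 by simp
    then show ?thesis using assms(2) that unfolding wd_bound_def by blast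
  qed
  have "has_weak_deriv \<Omega> 0 f f"
    using g(2) unfolding has_weak_deriv_def by (simp add: pd_multi_0 mi_order_0)
  note u = weak_deriv_unique[OF assms(1) g(2) this]
  show "f \<in> Lp \<Omega> p" "(LINT x|lebesgue_on \<Omega>. norm (f x) powr p) \<le> N powr p"
    using Lp_cong_AE[OF assms(1) g(1) u] g(3) by auto
qed

lemma Lp_integral_le:
  fixes v :: "real^3 \<Rightarrow> real"
  assumes "open \<Omega>" "bounded \<Omega>" "v \<in> Lp \<Omega> p" "p > 1" "(LINT x|lebesgue_on \<Omega>. \<bar>v x\<bar> powr p) \<le> N powr p" "N > 0"
  shows "integrable (lebesgue_on \<Omega>) v" "(LINT x|lebesgue_on \<Omega>. \<bar>v x\<bar>) \<le> 2 * N * measure lebesgue \<Omega> powr (1 - 1 / p)"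
proof -
  have O: "\<Omega> \<in> sets lebesgue" by (rule open_sets_lebesgue[OF assms(1)])
  have lm: "\<Omega> \<in> lmeasurable" using assms(1,2) by (simp add: lmeasurable_open)
  have v: "v \<in> borel_measurable (lebesgue_on \<Omega>)" "integrable (lebesgue_on \<Omega>) (\<lambda>x. \<bar>v x\<bar> powr p)"
    using assms(3) by (auto simp: Lp_def)
  have E: "\<Omega> \<in> sets (lebesgue_on \<Omega>)" "emeasure (lebesgue_on \<Omega>) \<Omega> < \<infinity>" "measure (lebesgue_on \<Omega>) \<Omega> = measure lebesgue \<Omega>"
    using O lm by (auto simp: sets_restrict_space emeasure_restrict_space measure_restrict_space fmeasurable_def)
  note H = int_le_powr[OF assms(4) v E(1,2) assms(5,6)]
  have i: "integrable (lebesgue_on \<Omega>) (\<lambda>x. \<bar>v x\<bar>)"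
    by (rule Bochner_Integration.integrable_cong[OF refl, THEN iffD1, OF _ H(1)]) (auto simp: space_restrict_space)
  then show "integrable (lebesgue_on \<Omega>) v" using v(1) integrable_abs_iff by blast
  have "(LINT x|lebesgue_on \<Omega>. \<bar>v x\<bar>) = (LINT x|lebesgue_on \<Omega>. indicator \<Omega> x * \<bar>v x\<bar>)"
    by (rule Bochner_Integration.integral_cong[OF refl]) (auto simp: space_restrict_space)
  then show "(LINT x|lebesgue_on \<Omega>. \<bar>v x\<bar>) \<le> 2 * N * measure lebesgue \<Omega> powr (1 - 1 / p)"
    using H(2) E(3) by simp
qed

text \<open>The embedding of W1p into bounded functions for p > 3: interpolation at scale 1, with
  the L1 norm bounded by the Lp norm on the bounded domain.\<close>

lemma sup_bound:
  assumes \<Omega>: "smooth_bounded_domain \<Omega>" and p: "p > 3"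
  obtains C where "C > 0"
    "\<And>f N y. continuous_on \<Omega> f \<Longrightarrow> wd_bound \<Omega> 1 p N f \<Longrightarrow> N > 0 \<Longrightarrow> y \<in> \<Omega> \<Longrightarrow> \<bar>f y :: real\<bar> \<le> C * N"
proof -
  have op: "open \<Omega>" and bd: "bounded \<Omega>" using \<Omega> by (auto simp: smooth_bounded_domain_def)
  obtain C where C: "C > 0"
    "\<And>v N y s. good_fun \<Omega> p N v \<Longrightarrow> integrable (lebesgue_on \<Omega>) v \<Longrightarrow> y \<in> \<Omega> \<Longrightarrow> 0 < s \<Longrightarrow> s \<le> 1 \<Longrightarrow>
      \<bar>v y\<bar> \<le> C * N * s powr (1 - 3 / p) + C / s ^ 3 * (LINT w|lebesgue_on \<Omega>. \<bar>v w\<bar>)"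
    by (rule morrey_interpolation[OF \<Omega> p]) (rule that)
  define M where "M = measure lebesgue \<Omega> powr (1 - 1 / p)"
  show thesis
  proof (rule that[of "C + C * 2 * M"])
    show "C + C * 2 * M > 0" using C(1) by (intro add_pos_nonneg) (auto simp: M_def)
    fix f :: "real^3 \<Rightarrow> real" and N y assume f: "continuous_on \<Omega> f" "wd_bound \<Omega> 1 p N f" "N > 0" "y \<in> \<Omega>"
    have g: "good_fun \<Omega> p N f" using f wd_bound_weak_grad[OF f(2)] by (auto simp: good_fun_def)
    note w = wd_bound_self[OF op f(2)]
    have p1: "p > 1" using p by simp
    note L = Lp_integral_le[OF op bd w(1) p1 _ f(3)]
    have "\<bar>f y\<bar> \<le> C * N + C * (LINT w|lebesgue_on \<Omega>. \<bar>f w\<bar>)"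
      using C(2)[OF g L(1) f(4), of 1] w(2) by simp
    also have "\<dots> \<le> C * N + C * (2 * N * M)"
      using L(2) w(2) C(1) by (intro add_left_mono mult_left_mono) (auto simp: M_def)
    finally show "\<bar>f y\<bar> \<le> (C + C * 2 * M) * N" by (simp add: algebra_simps)
  qed
qed

text \<open>The embedding of W2p into C1. The gradient oscillates by O(N) on \<Omega>, and the mean
  value theorem on a segment of length l, on which f is O(N), supplies a point where the partial
  derivative is O(N / l).\<close>

lemma C1_bound:
  assumes \<Omega>: "smooth_bounded_domain \<Omega>" and p: "p > 3"
  obtains C where "C > 0"
    "\<And>f N y. (\<And>x. x \<in> \<Omega> \<Longrightarrow> f differentiable (at x)) \<Longrightarrow> (\<And>i. continuous_on \<Omega> (pd i f)) \<Longrightarrow> wd_bound \<Omega> 2 p N f \<Longrightarrow> N > 0 \<Longrightarrow> y \<in> \<Omega> \<Longrightarrow>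
       \<bar>f y :: real\<bar> \<le> C * N \<and> (\<forall>i. \<bar>pd i f y\<bar> \<le> C * N)"
proof -
  have op: "open \<Omega>" and bd: "bounded \<Omega>" and ne: "\<Omega> \<noteq> {}" using \<Omega> by (auto simp: smooth_bounded_domain_def)
  obtain C where C: "C > 0" "\<And>f N y. continuous_on \<Omega> f \<Longrightarrow> wd_bound \<Omega> 1 p N f \<Longrightarrow> N > 0 \<Longrightarrow> y \<in> \<Omega> \<Longrightarrow> \<bar>f y :: real\<bar> \<le> C * N"
    by (rule sup_bound[OF \<Omega> p]) (rule that)
  obtain C' where C': "C' > 0" "\<And>v N x y. good_fun \<Omega> p N v \<Longrightarrow> x \<in> \<Omega> \<Longrightarrow> y \<in> \<Omega> \<Longrightarrow> \<bar>v x - v y\<bar> \<le> C' * N"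
    by (rule morrey_oscillation[OF \<Omega> p]) (rule that)
  obtain p0 l where l: "l > 0" "cball p0 l \<subseteq> \<Omega>" using ne op open_contains_cball by blast
  show thesis
  proof (rule that[of "C + C' + 2 * C / l"])
    show "C + C' + 2 * C / l > 0" using C C' l by (simp add: add_pos_pos)
    fix f :: "real^3 \<Rightarrow> real" and N y assume d: "\<And>x. x \<in> \<Omega> \<Longrightarrow> f differentiable (at x)" "\<And>i. continuous_on \<Omega> (pd i f)"
      and f: "wd_bound \<Omega> 2 p N f" "N > 0" "y \<in> \<Omega>"
    have cf: "continuous_on \<Omega> f"
      using d(1) by (auto intro!: continuous_at_imp_continuous_on differentiable_imp_continuous_within)
    have s: "\<bar>f z\<bar> \<le> C * N" if "z \<in> \<Omega>" for z
      using C(2)[OF cf wd_bound_mono_order[OF f(1)] f(2) that] by simp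
    have le: "C * N \<le> (C + C' + 2 * C / l) * N" using C C' l f(2) by (intro mult_right_mono) auto
    have "\<bar>pd i f y\<bar> \<le> (C + C' + 2 * C / l) * N" for i
    proof -
      have in\<Omega>: "p0 + t *\<^sub>R axis i 1 \<in> \<Omega>" if "0 \<le> t" "t \<le> l" for t
        using that l by (intro subsetD[OF l(2)]) (simp add: dist_norm norm_axis_1)
      obtain t where t: "0 < t" "t < l" "f (p0 + l *\<^sub>R axis i 1) - f p0 = l * (axis i 1 \<bullet> grad pd f (p0 + t *\<^sub>R axis i 1))"
        using mvt_segment[OF l(1), of f p0 "axis i 1"] d(1) in\<Omega> by blast
      define z where "z = p0 + t *\<^sub>R axis i 1"
      have z: "z \<in> \<Omega>" using in\<Omega> t by (simp add: z_def)
      have "l * pd i f z = f (p0 + l *\<^sub>R axis i 1) - f p0"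
        using t(3) by (simp add: z_def inner_axis_axis inner_axis' grad_def)
      then have "l * \<bar>pd i f z\<bar> = \<bar>f (p0 + l *\<^sub>R axis i 1) - f p0\<bar>" using l by (metis abs_mult abs_of_pos)
      also have "\<dots> \<le> 2 * (C * N)" using s[OF in\<Omega>[of l]] s[OF in\<Omega>[of 0]] l by simp
      finally have 1: "\<bar>pd i f z\<bar> \<le> 2 * C / l * N" using l by (simp add: field_simps)
      have g: "good_fun \<Omega> p N (pd i f)"
        using wd_bound_weak_grad_pd[OF op f(1) _ d] d f(2) by (auto simp: good_fun_def)
      have "\<bar>pd i f y\<bar> \<le> C' * N + 2 * C / l * N" using C'(2)[OF g f(3) z] 1 by simp
      also have "\<dots> \<le> (C + C' + 2 * C / l) * N" using C f(2) by (simp add: algebra_simps)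
      finally show ?thesis .
    qed
    then show "\<bar>f y\<bar> \<le> (C + C' + 2 * C / l) * N \<and> (\<forall>i. \<bar>pd i f y\<bar> \<le> (C + C' + 2 * C / l) * N)"
      using s[OF f(3)] le by auto
  qed
qed

text \<open>Close to a the distance to \<open>f a\<close> is below 1 in the Sobolev norm. The work
  lies in passing from this norm, which uses chosen derivatives of the difference, to the
  derivatives of \<open>f t\<close>.\<close>

lemma C_Sob_bounded_near:
  fixes f :: "real \<Rightarrow> real^3 \<Rightarrow> 'b::euclidean_space"
  assumes "open \<Omega>" "f \<in> C_Sob \<Omega> a b k p" "a < b" "p \<ge> 1"
  obtains t1 N where "a < t1" "t1 \<le> b" "N > 0" "\<And>t. a < t \<Longrightarrow> t < t1 \<Longrightarrow> wd_bound \<Omega> k p N (f t)"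
proof -
  have fS: "\<And>t. t \<in> {a..b} \<Longrightarrow> f t \<in> Sob \<Omega> k p"
    and lim: "((\<lambda>s. sob_norm \<Omega> k p (\<lambda>x. f s x - f a x)) \<longlongrightarrow> 0) (at a within {a..b})"
    using assms(2,3) by (auto simp: C_Sob_def)
  have "eventually (\<lambda>s. sob_norm \<Omega> k p (\<lambda>x. f s x - f a x) < 1) (at a within {a..b})"
    using lim by (rule order_tendstoD) simp
  then obtain d where d: "d > 0" "\<And>s. s \<in> {a..b} \<Longrightarrow> s \<noteq> a \<Longrightarrow> dist s a < d \<Longrightarrow> sob_norm \<Omega> k p (\<lambda>x. f s x - f a x) < 1"
    by (auto simp: eventually_at)
  define A where "A = {\<alpha> :: nat^3. mi_order \<alpha> \<le> k}"
  have A: "finite A" unfolding A_def by (rule finite_mi_order_le)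
  define w where "w \<alpha> = wderiv \<Omega> \<alpha> (f a)" for \<alpha>
  define S where "S = (\<Sum>\<alpha>\<in>A. LINT x|lebesgue_on \<Omega>. norm (w \<alpha> x) powr p)"
  have S: "S \<ge> 0" by (simp add: S_def sum_nonneg)
  \<comment> \<open>From |x + y|^p \<le> 2^p (|x|^p + |y|^p): the difference contributes at most 1
    and the derivatives of \<open>f a\<close> at most S.\<close>
  define N where "N = 2 * (1 + S) powr (1 / p)"
  have Np: "N powr p = 2 powr p * (1 + S)" using S assms(4) by (simp add: N_def powr_mult powr_powr)
  show thesis
  proof (rule that[of "min b (a + d)" N])
    show "N > 0" using S by (simp add: N_def)
    fix t assume t: "a < t" "t < min b (a + d)"
    then have tab: "t \<in> {a..b}" "a \<in> {a..b}" by auto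
    have sn: "sob_norm \<Omega> k p (\<lambda>x. f t x - f a x) < 1" using d(2)[OF tab(1)] t by (simp add: dist_real_def)
    show "wd_bound \<Omega> k p N (f t)" unfolding wd_bound_def
    proof (intro allI impI)
      fix \<alpha> :: "nat^3" assume al: "mi_order \<alpha> \<le> k"
      note wa = wderiv_Sob[OF assms(1) fS[OF tab(2)] al, folded w_def]
      define wt where "wt = wderiv \<Omega> \<alpha> (f t)"
      note wt = wderiv_Sob[OF assms(1) fS[OF tab(1)] al, folded wt_def]
      have hd: "has_weak_deriv \<Omega> \<alpha> (\<lambda>x. f t x - f a x) (\<lambda>x. wt x - w \<alpha> x)"
        by (rule has_weak_deriv_diff[OF assms(1) wt(1) wa(1)])
      \<comment> \<open>The derivative chosen for the difference need not be the difference of the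
        chosen ones; both are weak derivatives, so they agree almost everywhere and have the same
        integrals.\<close>
      then have hd': "has_weak_deriv \<Omega> \<alpha> (\<lambda>x. f t x - f a x) (wderiv \<Omega> \<alpha> (\<lambda>x. f t x - f a x))"
        unfolding wderiv_def by (metis someI_ex)
      define D where "D x = wt x - w \<alpha> x" for x
      have m: "wt \<in> borel_measurable (lebesgue_on \<Omega>)" "w \<alpha> \<in> borel_measurable (lebesgue_on \<Omega>)"
        and i: "integrable (lebesgue_on \<Omega>) (\<lambda>x. norm (wt x) powr p)" "integrable (lebesgue_on \<Omega>) (\<lambda>x. norm (w \<alpha> x) powr p)"
        using wt(2) wa(2) by (auto simp: Lp_def)
      have powadd: "norm (x + y) powr p \<le> 2 powr p * (norm x powr p + norm y powr p)" for x y :: 'b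
      proof -
        have "norm (x + y) powr p \<le> (2 * max (norm x) (norm y)) powr p"
          using norm_triangle_ineq[of x y] assms(4) by (intro powr_mono2) auto
        also have "\<dots> = 2 powr p * (max (norm x) (norm y)) powr p" by (simp add: powr_mult)
        also have "\<dots> \<le> 2 powr p * (norm x powr p + norm y powr p)"
          by (intro mult_left_mono) (auto simp: max_def)
        finally show ?thesis .
      qed
      have mD: "D \<in> borel_measurable (lebesgue_on \<Omega>)" unfolding D_def[abs_def] using m by measurable
      have mD': "(\<lambda>x. norm (D x) powr p) \<in> borel_measurable (lebesgue_on \<Omega>)" using mD by measurable
      have iD: "integrable (lebesgue_on \<Omega>) (\<lambda>x. norm (D x) powr p)"
      proof (rule Bochner_Integration.integrable_bound[OF _ mD'])
        show "integrable (lebesgue_on \<Omega>) (\<lambda>x. 2 powr p * (norm (wt x) powr p + norm (w \<alpha> x) powr p))"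
          using i by (intro integrable_mult_right Bochner_Integration.integrable_add)
        show "AE x in lebesgue_on \<Omega>. norm (norm (D x) powr p) \<le> norm (2 powr p * (norm (wt x) powr p + norm (w \<alpha> x) powr p))"
          using powadd[of "wt x" "- w \<alpha> x" for x] by (intro AE_I2) (simp add: D_def)
      qed
      have "D \<in> Lp \<Omega> p" using mD iD by (simp add: Lp_def)
      from Lp_cong_AE(2)[OF assms(1) this weak_deriv_unique[OF assms(1) hd[folded D_def] hd']]
      have "(LINT x|lebesgue_on \<Omega>. norm (D x) powr p) = (LINT x|lebesgue_on \<Omega>. norm (wderiv \<Omega> \<alpha> (\<lambda>x. f t x - f a x) x) powr p)" by simp
      also have "\<dots> \<le> sob_norm \<Omega> k p (\<lambda>x. f t x - f a x) powr p"
        using assms(4) by (intro wderiv_le_sob_norm al) simp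
      also have "\<dots> \<le> 1 powr p" using sn sob_norm_nonneg assms(4) by (intro powr_mono2) (auto intro: less_imp_le)
      finally have D1: "(LINT x|lebesgue_on \<Omega>. norm (D x) powr p) \<le> 1" by simp
      have "(LINT x|lebesgue_on \<Omega>. norm (wt x) powr p) \<le> (LINT x|lebesgue_on \<Omega>. 2 powr p * (norm (D x) powr p + norm (w \<alpha> x) powr p))"
      proof (rule integral_mono[OF i(1)])
        show "integrable (lebesgue_on \<Omega>) (\<lambda>x. 2 powr p * (norm (D x) powr p + norm (w \<alpha> x) powr p))"
          using i iD by (intro integrable_mult_right Bochner_Integration.integrable_add)
        show "norm (wt x) powr p \<le> 2 powr p * (norm (D x) powr p + norm (w \<alpha> x) powr p)" for x
          using powadd[of "D x" "w \<alpha> x"] by (simp add: D_def)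
      qed
      also have "\<dots> = 2 powr p * ((LINT x|lebesgue_on \<Omega>. norm (D x) powr p) + (LINT x|lebesgue_on \<Omega>. norm (w \<alpha> x) powr p))"
        using i iD by simp
      also have "\<dots> \<le> 2 powr p * (1 + S)"
      proof (intro mult_left_mono add_mono D1)
        show "(LINT x|lebesgue_on \<Omega>. norm (w \<alpha> x) powr p) \<le> S"
          unfolding S_def using al A by (intro member_le_sum) (auto simp: A_def)
      qed simp
      finally show "\<exists>g\<in>Lp \<Omega> p. has_weak_deriv \<Omega> \<alpha> (f t) g \<and> (LINT x|lebesgue_on \<Omega>. norm (g x) powr p) \<le> N powr p"
        using wt Np by (intro bexI[of _ wt]) auto
    qed
  qed (use d assms in auto)
qed

subsection \<open>The outward normal and tangential vector fields\<close>

text \<open>If two charts gave different unit normals n and n', then along n' - n the first defining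
  function would decrease and the second increase, so points x + h (n' - n) with small h would be
  both inside and outside \<Omega>.\<close>

lemma nrml_chart:
  assumes \<Omega>: "open \<Omega>" and x: "x \<in> frontier \<Omega>" and ch: "boundary_chart \<Omega> x U \<psi>"
  shows "nrml \<Omega> x = grad pd \<psi> x /\<^sub>R norm (grad pd \<psi> x)"
  unfolding nrml_def
proof (rule the_equality)
  show "\<exists>U \<psi>'. boundary_chart \<Omega> x U \<psi>' \<and> grad pd \<psi> x /\<^sub>R norm (grad pd \<psi> x) = grad pd \<psi>' x /\<^sub>R norm (grad pd \<psi>' x)"
    using ch by blast
  fix n assume "\<exists>U \<psi>. boundary_chart \<Omega> x U \<psi> \<and> n = grad pd \<psi> x /\<^sub>R norm (grad pd \<psi> x)"
  then obtain U' \<psi>' where ch': "boundary_chart \<Omega> x U' \<psi>'" and n: "n = grad pd \<psi>' x /\<^sub>R norm (grad pd \<psi>' x)" by blast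
  define a b where "a = grad pd \<psi>' x" and "b = grad pd \<psi> x"
  have ab: "a \<noteq> 0" "b \<noteq> 0" using ch ch' by (auto simp: boundary_chart_def a_def b_def)
  define n' where "n' = b /\<^sub>R norm b"
  have u: "norm n = 1" "norm n' = 1" using ab by (auto simp: n n'_def a_def)
  have na: "a = norm a *\<^sub>R n" "b = norm b *\<^sub>R n'" using ab by (auto simp: n n'_def a_def)
  show "n = grad pd \<psi> x /\<^sub>R norm (grad pd \<psi> x)"
  proof (rule ccontr)
    assume "n \<noteq> grad pd \<psi> x /\<^sub>R norm (grad pd \<psi> x)"
    then have ne: "n \<noteq> n'" by (simp add: n'_def b_def)
    define w where "w = n' - n"
    have "0 < (norm (n - n'))\<^sup>2" using ne by simp
    also have "\<dots> = 2 - 2 * (n \<bullet> n')" using u by (simp add: power2_norm_eq_inner inner_diff_left inner_diff_right inner_commute norm_eq_1)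
    finally have lt: "n \<bullet> n' < 1" by simp
    have wa: "w \<bullet> a < 0"
    proof -
      have "w \<bullet> a = norm a * (n' \<bullet> n - n \<bullet> n)" by (subst na(1)) (simp add: w_def inner_diff_left)
      also have "\<dots> < 0" using lt u ab by (intro mult_pos_neg) (auto simp: inner_commute norm_eq_1)
      finally show ?thesis .
    qed
    have wb: "w \<bullet> b > 0"
    proof -
      have "w \<bullet> b = norm b * (n' \<bullet> n' - n \<bullet> n')" by (subst na(2)) (simp add: w_def inner_diff_left)
      also have "\<dots> > 0" using lt u ab by (intro mult_pos_pos) (auto simp: norm_eq_1)
      finally show ?thesis .
    qed
    have U: "open U" "x \<in> U" "smooth_on U \<psi>" "\<Omega> \<inter> U = {y \<in> U. \<psi> y < 0}" using ch by (auto simp: boundary_chart_def)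
    have U': "open U'" "x \<in> U'" "smooth_on U' \<psi>'" "\<Omega> \<inter> U' = {y \<in> U'. \<psi>' y < 0}" using ch' by (auto simp: boundary_chart_def)
    have z: "\<psi> x = 0" "\<psi>' x = 0" using chart_zero[OF ch \<Omega> x] chart_zero[OF ch' \<Omega> x] U U' by auto
    have d1: "((\<lambda>s. \<psi>' (x + s *\<^sub>R w)) has_real_derivative w \<bullet> a) (at 0)"
      using has_derivative_line[of \<psi>' x 0 w UNIV] smooth_on_differentiable[OF U'(3,2)] by (simp add: a_def)
    have d2: "((\<lambda>s. \<psi> (x + s *\<^sub>R w)) has_real_derivative w \<bullet> b) (at 0)"
      using has_derivative_line[of \<psi> x 0 w UNIV] smooth_on_differentiable[OF U(3,2)] by (simp add: b_def)
    obtain e1 where e1: "e1 > 0" "\<And>h. 0 < h \<Longrightarrow> h < e1 \<Longrightarrow> \<psi>' (x + h *\<^sub>R w) < 0"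
      using DERIV_neg_dec_right[OF d1 wa] z by auto
    obtain e2 where e2: "e2 > 0" "\<And>h. 0 < h \<Longrightarrow> h < e2 \<Longrightarrow> \<psi> (x + h *\<^sub>R w) > 0"
      using DERIV_pos_inc_right[OF d2 wb] z by auto
    have "((\<lambda>h. x + h *\<^sub>R w) \<longlongrightarrow> x + 0 *\<^sub>R w) (at_right 0)" by (intro tendsto_intros)
    then have "eventually (\<lambda>h. x + h *\<^sub>R w \<in> U \<inter> U') (at_right 0)"
      using U U' by (intro topological_tendstoD) auto
    moreover have "eventually (\<lambda>h. 0 < h \<and> h < min e1 e2) (at_right 0)"
      unfolding eventually_at_right_field using e1 e2 by (intro exI[of _ "min e1 e2"]) auto
    ultimately have "eventually (\<lambda>h::real. False) (at_right 0)"
    proof eventually_elim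
      case (elim h)
      then have "x + h *\<^sub>R w \<in> \<Omega> \<inter> U'" unfolding U'(4) using e1(2)[of h] by simp
      moreover have "x + h *\<^sub>R w \<notin> \<Omega> \<inter> U" unfolding U(4) using e2(2)[of h] elim by simp
      ultimately show ?case using elim by simp
    qed
    then show False by (simp add: trivial_limit_at_right_real)
  qed
qed

text \<open>Bounds are asked for inside \<Omega> only and tangency as a limit from inside, since the
  velocity need not be defined sensibly on the boundary.\<close>

definition tangential :: "(real^3) set \<Rightarrow> real \<Rightarrow> (real^3 \<Rightarrow> real^3) \<Rightarrow> bool" where
  "tangential \<Omega> L v \<longleftrightarrow> L > 0 \<and> (\<forall>y\<in>\<Omega>. v differentiable (at y)) \<and>
     (\<forall>y\<in>\<Omega>. \<forall>i k. \<bar>v y $ k\<bar> \<le> L \<and> \<bar>pd i v y $ k\<bar> \<le> L) \<and>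
     (\<forall>x\<in>frontier \<Omega>. ((\<lambda>y. v y \<bullet> nrml \<Omega> x) \<longlongrightarrow> 0) (at x within \<Omega>))"

lemma inner_le_3:
  fixes w g :: "real^3"
  assumes "\<And>i. \<bar>g $ i\<bar> \<le> G"
  shows "\<bar>w \<bullet> g\<bar> \<le> 3 * norm w * G"
proof -
  have "\<bar>w \<bullet> g\<bar> \<le> (\<Sum>i\<in>UNIV. \<bar>w $ i * g $ i\<bar>)" by (simp add: inner_vec_def sum_abs)
  also have "\<dots> \<le> (\<Sum>i\<in>(UNIV::3 set). norm w * G)"
    unfolding abs_mult using assms by (intro sum_mono mult_mono component_le_norm_cart) auto
  finally show ?thesis by simp
qed

lemma norm_le_3:
  fixes w :: "real^3"
  assumes "\<And>i. \<bar>w $ i\<bar> \<le> G"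
  shows "norm w \<le> 3 * G"
proof -
  have "norm w \<le> (\<Sum>i\<in>UNIV. \<bar>w $ i\<bar>)" by (rule norm_le_l1_cart)
  also have "\<dots> \<le> (\<Sum>i\<in>(UNIV::3 set). G)" using assms by (intro sum_mono) auto
  finally show ?thesis by simp
qed

lemma lipschitz_segment:
  fixes f :: "real^3 \<Rightarrow> real"
  assumes "\<And>s. 0 \<le> s \<Longrightarrow> s \<le> 1 \<Longrightarrow> f differentiable (at (x + s *\<^sub>R (y - x)))"
    and "\<And>s i. 0 < s \<Longrightarrow> s < 1 \<Longrightarrow> \<bar>pd i f (x + s *\<^sub>R (y - x))\<bar> \<le> G"
  shows "\<bar>f y - f x\<bar> \<le> 3 * dist x y * G"
proof -
  obtain s where s: "0 < s" "s < 1" "f (x + 1 *\<^sub>R (y - x)) - f x = 1 * ((y - x) \<bullet> grad pd f (x + s *\<^sub>R (y - x)))"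
    using mvt_segment[of 1 f x "y - x"] assms(1) by auto
  have "\<bar>(y - x) \<bullet> grad pd f (x + s *\<^sub>R (y - x))\<bar> \<le> 3 * norm (y - x) * G"
    by (rule inner_le_3) (use assms(2) s in \<open>simp add: grad_def\<close>)
  then show ?thesis using s(3) by (simp add: dist_norm norm_minus_commute)
qed

subsection \<open>A boundary barrier\<close>

definition bdist :: "(real^3) set \<Rightarrow> real^3 \<Rightarrow> real" where
  "bdist \<Omega> y = infdist y (frontier \<Omega>)"

lemma smooth_bounded_domain_frontier:
  assumes "smooth_bounded_domain \<Omega>"
  shows "open \<Omega>" "bounded \<Omega>" "\<Omega> \<noteq> {}" "frontier \<Omega> \<noteq> {}" "closed (frontier \<Omega>)" "frontier \<Omega> \<inter> \<Omega> = {}"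
proof -
  show a: "open \<Omega>" "bounded \<Omega>" "\<Omega> \<noteq> {}" using assms by (auto simp: smooth_bounded_domain_def)
  then have "\<Omega> \<noteq> UNIV" using not_bounded_UNIV by auto
  then show "frontier \<Omega> \<noteq> {}" using a by (simp add: frontier_eq_empty)
  show "closed (frontier \<Omega>)" "frontier \<Omega> \<inter> \<Omega> = {}" using a by (auto simp: frontier_def interior_open)
qed

lemma bdist_ball:
  assumes "smooth_bounded_domain \<Omega>" "y \<in> \<Omega>" "dist y z < bdist \<Omega> y"
  shows "z \<in> \<Omega>"
proof (rule ccontr)
  assume "z \<notin> \<Omega>"
  have "closed_segment y z \<inter> frontier \<Omega> \<noteq> {}"
    using \<open>z \<notin> \<Omega>\<close> assms(2) by (intro connected_Int_frontier) auto
  then obtain f where f: "f \<in> closed_segment y z" "f \<in> frontier \<Omega>" by blast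
  have "bdist \<Omega> y \<le> dist y f" unfolding bdist_def by (rule infdist_le[OF f(2)])
  also have "\<dots> \<le> dist y z" using segment_bound1[OF f(1)] by (simp add: dist_norm norm_minus_commute)
  finally show False using assms(3) by simp
qed

lemma bdist_pos: "smooth_bounded_domain \<Omega> \<Longrightarrow> y \<in> \<Omega> \<Longrightarrow> bdist \<Omega> y > 0"
  using smooth_bounded_domain_frontier[of \<Omega>] in_closed_iff_infdist_zero[of "frontier \<Omega>" y] infdist_nonneg[of y "frontier \<Omega>"]
  unfolding bdist_def by fastforce

lemma bump_lower:
  assumes "0 < r" "r < R"
  obtains m where "m > 0" "\<And>y. y \<in> cball a r \<Longrightarrow> m \<le> bump a R y"
proof -
  have "continuous_on (cball a r) (bump a R)"
    using smooth_on_continuous[OF smooth_bump] continuous_on_subset by blast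
  then obtain x where x: "x \<in> cball a r" "\<And>y. y \<in> cball a r \<Longrightarrow> bump a R x \<le> bump a R y"
    using continuous_attains_inf[of "cball a r" "bump a R"] assms(1) by fastforce
  have "bump a R x > 0" using x(1) assms by (intro bump_props(3)) (simp add: dist_norm norm_minus_commute)
  then show ?thesis using x(2) that by blast
qed

lemma C1c_bump: "r > 0 \<Longrightarrow> C1c (cball a r) (bump a r)"
  using smooth_on_differentiable[OF smooth_bump] smooth_on_continuous[OF smooth_on_pd[OF smooth_bump]]
  by (auto simp: C1c_def dist_norm norm_minus_commute intro!: bump_props(4))

lemma C1c_pd_bounded:
  assumes "C1c K \<phi>"
  obtains B where "B > 0" "\<And>i x. \<bar>pd i \<phi> x\<bar> \<le> B"
proof -
  have "\<exists>B. \<forall>x. \<bar>pd i \<phi> x\<bar> \<le> B" for i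
  proof -
    have "bounded (pd i \<phi> ` K)"
      using assms by (intro compact_imp_bounded compact_continuous_image) (auto simp: C1c_def intro: continuous_on_subset)
    then obtain B where "\<And>x. x \<in> K \<Longrightarrow> \<bar>pd i \<phi> x\<bar> \<le> B" by (auto simp: bounded_iff)
    note B = this
    have "\<bar>pd i \<phi> x\<bar> \<le> max B 0" for x
    proof (cases "x \<in> K")
      case True
      then show ?thesis using B[of x] by simp
    next
      case False
      then show ?thesis using C1c_pd_zero[OF assms, of x i] by simp
    qed
    then show ?thesis by blast
  qed
  then obtain B where B: "\<And>i x. \<bar>pd i \<phi> x\<bar> \<le> B i" by metis
  show ?thesis
  proof (rule that[of "1 + (\<Sum>i\<in>UNIV. \<bar>B i\<bar>)"])
    show "\<bar>pd i \<phi> x\<bar> \<le> 1 + (\<Sum>i\<in>UNIV. \<bar>B i\<bar>)" for i x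
      using B[where i = i and x = x] member_le_sum[of i UNIV "\<lambda>i. \<bar>B i\<bar>"] by simp
  qed (simp add: add_pos_nonneg sum_nonneg)
qed

text \<open>\<open>\<beta>\<close> is comparable to the distance to the boundary, but differentiable, and tangential flows change
  \<open>ln \<beta>\<close> at a bounded rate only.\<close>
definition barrier_on :: "(real^3) set \<Rightarrow> (real^3) set \<Rightarrow> (real^3 \<Rightarrow> real) \<Rightarrow> real \<Rightarrow> real \<Rightarrow> bool" where
  "barrier_on \<Omega> V \<beta> c C \<longleftrightarrow> c > 0 \<and> C \<ge> 0 \<and> (\<forall>y. \<beta> differentiable (at y)) \<and> (\<forall>i. continuous_on UNIV (pd i \<beta>)) \<and>
     (\<forall>y\<in>\<Omega>. 0 \<le> \<beta> y \<and> \<beta> y \<le> C * bdist \<Omega> y) \<and> (\<forall>y\<in>\<Omega> \<inter> V. c * bdist \<Omega> y \<le> \<beta> y) \<and>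
     (\<forall>L v y. tangential \<Omega> L v \<longrightarrow> y \<in> \<Omega> \<longrightarrow> \<bar>v y \<bullet> grad pd \<beta> y\<bar> \<le> C * L * bdist \<Omega> y)"

text \<open>The bump is supported where the distance to the boundary is at least r, so on its
  support that distance is comparable to a constant and every bound is trivial up to
  factors.\<close>

lemma barrier_interior:
  assumes \<Omega>: "smooth_bounded_domain \<Omega>" and x: "x \<in> \<Omega>"
  shows "\<exists>r \<beta> c C. r > 0 \<and> barrier_on \<Omega> (ball x r) \<beta> c C"
proof -
  note F = smooth_bounded_domain_frontier[OF \<Omega>]
  obtain R where R: "R > 0" "cball x R \<subseteq> \<Omega>" using F(1) x open_contains_cball by blast
  define r where "r = R / 3"
  have r: "r > 0" "cball x (3 * r) \<subseteq> \<Omega>" using R by (auto simp: r_def)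
  obtain m where m: "m > 0" "\<And>y. y \<in> cball x r \<Longrightarrow> m \<le> bump x (2 * r) y"
    using bump_lower[of r "2 * r" x] r by auto
  have C1: "C1c (cball x (2 * r)) (bump x (2 * r))" using r by (intro C1c_bump) simp
  obtain B where B: "B > 0" "\<And>i y. \<bar>pd i (bump x (2 * r)) y\<bar> \<le> B" by (rule C1c_pd_bounded[OF C1]) (rule that)
  have far: "r \<le> bdist \<Omega> y" if "y \<in> cball x (2 * r)" for y
  proof -
    obtain z where z: "z \<in> frontier \<Omega>" "infdist y (frontier \<Omega>) = dist y z" using infdist_attains_inf[OF F(5,4)] by blast
    have "z \<notin> cball x (3 * r)" using z(1) r(2) F(6) by blast
    then show ?thesis using that z(2) dist_triangle[of x z y] by (simp add: bdist_def)
  qed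
  obtain z0 where z0: "z0 \<in> frontier \<Omega>" using F(4) by blast
  obtain D where D: "D > 0" "\<Omega> \<subseteq> ball z0 D" using bounded_subset_ballD[OF F(2), of z0] by blast
  have bD: "bdist \<Omega> y \<le> D" if "y \<in> \<Omega>" for y
    using infdist_le[OF z0, of y] D that by (auto simp: bdist_def dist_commute dest!: subsetD)
  \<comment> \<open>D bounds the boundary distance from above, which gives m / D. On the support 1
    \<le> \<open>bdist\<close> / r, whence 1 / r; 9 B / r comes from |v| \<le> 3 L and a gradient
    with components at most B.\<close>
  have "barrier_on \<Omega> (ball x r) (bump x (2 * r)) (m / D) (1 / r + 9 * B / r)"
    unfolding barrier_on_def
  proof (intro conjI ballI allI impI)
    show "bump x (2 * r) differentiable at y" "continuous_on UNIV (pd i (bump x (2 * r)))" for y i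
      using C1 by (auto simp: C1c_def)
    fix y
    have bn: "bdist \<Omega> y \<ge> 0" by (simp add: bdist_def infdist_nonneg)
    { assume y: "y \<in> \<Omega>"
      show "0 \<le> bump x (2 * r) y" by (rule bump_props(1))
      show "bump x (2 * r) y \<le> (1 / r + 9 * B / r) * bdist \<Omega> y"
      proof (cases "y \<in> cball x (2 * r)")
        case True
        have "1 \<le> 1 / r * bdist \<Omega> y" using far[OF True] r by simp
        with bump_props(2)[of x "2 * r" y] have "bump x (2 * r) y \<le> 1 / r * bdist \<Omega> y" by (rule order_trans)
        also have "\<dots> \<le> (1 / r + 9 * B / r) * bdist \<Omega> y" using bn B r by (intro mult_right_mono) auto
        finally show ?thesis .
      next
        case False
        then have "bump x (2 * r) y = 0" using C1 by (simp add: C1c_def)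
        then show ?thesis using bn B r by simp
      qed }
    { assume y: "y \<in> \<Omega> \<inter> ball x r"
      have "m / D * bdist \<Omega> y \<le> m / D * D" using bD y m D by (intro mult_left_mono) auto
      also have "\<dots> \<le> bump x (2 * r) y" using m(2)[of y] y D by simp
      finally show "m / D * bdist \<Omega> y \<le> bump x (2 * r) y" . }
    fix L v assume v: "tangential \<Omega> L v" and y: "y \<in> \<Omega>"
    have L: "L > 0" using v by (simp add: tangential_def)
    show "\<bar>v y \<bullet> grad pd (bump x (2 * r)) y\<bar> \<le> (1 / r + 9 * B / r) * L * bdist \<Omega> y"
    proof (cases "y \<in> cball x (2 * r)")
      case True
      have nv: "norm (v y) \<le> 3 * L" using v y by (intro norm_le_3) (auto simp: tangential_def)
      have "\<bar>v y \<bullet> grad pd (bump x (2 * r)) y\<bar> \<le> 3 * norm (v y) * B"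
        by (rule inner_le_3) (simp add: grad_def B)
      also have "\<dots> \<le> 3 * (3 * L) * B" using nv B by (intro mult_right_mono mult_left_mono) auto
      also have "\<dots> = 9 * B / r * L * r" using r by simp
      also have "\<dots> \<le> 9 * B / r * L * bdist \<Omega> y" using far[OF True] B r L by (intro mult_left_mono) auto
      also have "\<dots> \<le> (1 / r + 9 * B / r) * L * bdist \<Omega> y" using bn L r by (intro mult_right_mono) auto
      finally show ?thesis .
    next
      case False
      then have "grad pd (bump x (2 * r)) y = 0" using C1c_pd_zero[OF C1] by (simp add: grad_def vec_eq_iff)
      then show ?thesis using bn B r L by simp
    qed
  qed (use m D B r in auto)
  then show ?thesis using r(1) by blast
qed

lemma bounded_on_cball:
  fixes f :: "real^3 \<Rightarrow> real"
  assumes "continuous_on U f" "cball x r \<subseteq> U"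
  shows "\<exists>B. \<forall>y\<in>cball x r. \<bar>f y\<bar> \<le> B"
proof -
  have "bounded (f ` cball x r)"
    using assms by (intro compact_imp_bounded compact_continuous_image) (auto intro: continuous_on_subset)
  then show ?thesis by (auto simp: bounded_iff)
qed

text \<open>The barrier is - \<psi> times a bump. At the boundary point y' nearest to y the gradient
  of \<psi> is normal, so its product with v tends to 0 there; v and that gradient are Lipschitz
  along the segment from y' to y, hence at y the product is O(L \<open>bdist\<close>).\<close>

lemma barrier_boundary:
  assumes \<Omega>: "smooth_bounded_domain \<Omega>" and x: "x \<in> frontier \<Omega>"
  shows "\<exists>r \<beta> c C. r > 0 \<and> barrier_on \<Omega> (ball x r) \<beta> c C"
proof -
  note F = smooth_bounded_domain_frontier[OF \<Omega>]
  obtain U \<psi> where ch: "boundary_chart \<Omega> x U \<psi>" using \<Omega> x unfolding smooth_bounded_domain_def by blast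
  obtain R m e where R: "R > 0" "m > 0" "norm e = 1" "cball x (4 * R) \<subseteq> U"
    "\<And>y w. y \<in> cball x (4 * R) \<Longrightarrow> norm (w - e) \<le> 1 / 2 \<Longrightarrow> m \<le> w \<bullet> grad pd \<psi> y"
    by (rule chart_local[OF ch]) (rule that)
  have U: "open U" "x \<in> U" "smooth_on U \<psi>" "\<Omega> \<inter> U = {y \<in> U. \<psi> y < 0}" "\<And>y. y \<in> U \<Longrightarrow> grad pd \<psi> y \<noteq> 0" using ch by (auto simp: boundary_chart_def)
  have RU: "cball x R \<subseteq> U" "cball x (2 * R) \<subseteq> U"
    using R(1) by (auto intro!: order_trans[OF subset_cball R(4)])
  have d\<psi>: "\<psi> differentiable at y" "pd i \<psi> differentiable at y" if "y \<in> U" for y i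
    using U(3) that by (auto intro: smooth_on_differentiable smooth_on_pd)
  have c\<psi>: "continuous_on U (pd i \<psi>)" "continuous_on U (pd j (pd i \<psi>))" for i j
    using U(3) by (auto intro!: smooth_on_continuous smooth_on_pd)
  obtain G where G: "G > 0" "\<And>y i. y \<in> cball x (2 * R) \<Longrightarrow> \<bar>pd i \<psi> y\<bar> \<le> G" "\<And>y i j. y \<in> cball x (2 * R) \<Longrightarrow> \<bar>pd j (pd i \<psi>) y\<bar> \<le> G"
  proof -
    obtain B1 where B1: "\<And>i y. y \<in> cball x (2 * R) \<Longrightarrow> \<bar>pd i \<psi> y\<bar> \<le> B1 i"
      using bounded_on_cball[OF c\<psi>(1) RU(2)] by metis
    have "\<forall>p. \<exists>B. \<forall>y\<in>cball x (2 * R). \<bar>pd (snd p) (pd (fst p) \<psi>) y\<bar> \<le> B"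
      using bounded_on_cball[OF c\<psi>(2) RU(2)] by blast
    then obtain B2' where "\<forall>p. \<forall>y\<in>cball x (2 * R). \<bar>pd (snd p) (pd (fst p) \<psi>) y\<bar> \<le> B2' p"
      by (rule choice[THEN exE]) blast
    define B2 where "B2 i j = B2' (i, j)" for i j
    have B2: "\<bar>pd j (pd i \<psi>) y\<bar> \<le> B2 i j" if "y \<in> cball x (2 * R)" for i j y
      using \<open>\<forall>p. \<forall>y\<in>cball x (2 * R). \<bar>pd (snd p) (pd (fst p) \<psi>) y\<bar> \<le> B2' p\<close>[rule_format, of y "(i, j)"] that by (simp add: B2_def)
    define G where "G = 1 + (\<Sum>i\<in>UNIV. \<bar>B1 i\<bar>) + (\<Sum>p\<in>UNIV. \<bar>B2 (fst p) (snd p)\<bar>)"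
    have s: "(\<Sum>i\<in>UNIV. \<bar>B1 i\<bar>) \<ge> 0" "(\<Sum>p\<in>UNIV. \<bar>B2 (fst p) (snd p)\<bar>) \<ge> 0" by (auto intro: sum_nonneg)
    have "\<bar>B1 i\<bar> \<le> (\<Sum>i\<in>UNIV. \<bar>B1 i\<bar>)" for i by (rule member_le_sum) auto
    then have "\<bar>B1 i\<bar> \<le> G" for i unfolding G_def using s by (meson add_increasing2 add_increasing zero_le_one)
    moreover have "\<bar>B2 i j\<bar> \<le> G" for i j
    proof -
      have "\<bar>B2 (fst (i, j)) (snd (i, j))\<bar> \<le> (\<Sum>p\<in>UNIV. \<bar>B2 (fst p) (snd p)\<bar>)"
        by (rule member_le_sum) auto
      then show ?thesis unfolding G_def fst_conv snd_conv using s(1) by linarith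
    qed
    ultimately have "\<bar>pd i \<psi> y\<bar> \<le> G" "\<bar>pd j (pd i \<psi>) y\<bar> \<le> G" if "y \<in> cball x (2 * R)" for y i j
      using B1[OF that] B2[OF that] by (meson abs_ge_self order_trans)+
    moreover have "G > 0" unfolding G_def using s by linarith
    ultimately show ?thesis using that by blast
  qed
  have Cb: "C1c (cball x R) (bump x R)" using R by (intro C1c_bump)
  obtain B where B: "B > 0" "\<And>i y. \<bar>pd i (bump x R) y\<bar> \<le> B" by (rule C1c_pd_bounded[OF Cb]) (rule that)
  define \<beta> where "\<beta> y = bump x R y * (- \<psi> y)" for y
  have dm: "(\<lambda>y. - \<psi> y) differentiable at y" if "y \<in> U" for y using d\<psi>(1)[OF that] by simp
  have pm: "pd i (\<lambda>y. - \<psi> y) y = - pd i \<psi> y" if "y \<in> U" for y i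
    using pd_bounded_linear[OF bounded_linear_minus[OF bounded_linear_ident] d\<psi>(1)[OF that]] .
  have cm: "continuous_on U (pd i (\<lambda>y. - \<psi> y))" for i
    using continuous_on_cong[of U U "pd i (\<lambda>y. - \<psi> y)" "\<lambda>y. - pd i \<psi> y"] pm continuous_on_minus[OF c\<psi>(1)] by simp
  note Cm = C1c_mult[OF U(1) Cb RU(1) dm cm, folded \<beta>_def]
  have C\<beta>: "C1c (cball x R) \<beta>" using Cm(1) by (simp add: \<beta>_def[abs_def])
  have g\<beta>: "grad pd \<beta> y = bump x R y *\<^sub>R (- grad pd \<psi> y) + (- \<psi> y) *\<^sub>R grad pd (bump x R) y" if "y \<in> U" for y
    using Cm(2)[where x = y] pm[OF that] by (simp add: grad_def vec_eq_iff \<beta>_def[abs_def])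
  have bn: "bdist \<Omega> y \<ge> 0" for y by (simp add: bdist_def infdist_nonneg)
  \<comment> \<open>The nearest boundary point may lie outside \<open>cball x R\<close> but not
    outside the ball of twice the radius; the segment from it to y lies in \<Omega> because all its
    other points are closer to y than the boundary is.\<close>
  have near: "\<exists>y'. y' \<in> frontier \<Omega> \<and> dist y' y = bdist \<Omega> y \<and> bdist \<Omega> y \<le> R \<and>
      (\<forall>s\<in>{0..1}. y' + s *\<^sub>R (y - y') \<in> cball x (2 * R)) \<and> (\<forall>s\<in>{0<..1}. y' + s *\<^sub>R (y - y') \<in> \<Omega>)"
    if y: "y \<in> \<Omega>" "y \<in> cball x R" for y
  proof -
    obtain y' where y': "y' \<in> frontier \<Omega>" "infdist y (frontier \<Omega>) = dist y y'" using infdist_attains_inf[OF F(5,4)] by blast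
    have dR: "bdist \<Omega> y \<le> R" using infdist_le[OF x, of y] y(2) by (simp add: bdist_def dist_commute)
    have yy: "y' \<in> cball x (2 * R)" using dist_triangle[of x y' y] y(2) dR y'(2) by (simp add: bdist_def)
    have y2: "y \<in> cball x (2 * R)" using y(2) R(1) by auto
    have "y' + s *\<^sub>R (y - y') \<in> cball x (2 * R)" if "s \<in> {0..1}" for s
    proof -
      have "y' + s *\<^sub>R (y - y') = (1 - s) *\<^sub>R y' + s *\<^sub>R y" by (simp add: algebra_simps)
      then show ?thesis using convexD_alt[OF convex_cball yy y2] that by simp
    qed
    moreover have "y' + s *\<^sub>R (y - y') \<in> \<Omega>" if "s \<in> {0<..1}" for s
    proof (rule bdist_ball[OF \<Omega> y(1)])
      have "y - (y' + s *\<^sub>R (y - y')) = (1 - s) *\<^sub>R (y - y')" by (simp add: algebra_simps)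
      then have "dist y (y' + s *\<^sub>R (y - y')) = (1 - s) * bdist \<Omega> y"
        using that y'(2) by (simp add: dist_norm bdist_def)
      also have "\<dots> < bdist \<Omega> y" using that bdist_pos[OF \<Omega> y(1)] by simp
      finally show "dist y (y' + s *\<^sub>R (y - y')) < bdist \<Omega> y" .
    qed
    ultimately show ?thesis using y' dR by (intro exI[of _ y']) (auto simp: bdist_def dist_commute)
  qed
  have \<psi>d: "\<bar>\<psi> y\<bar> \<le> 3 * G * bdist \<Omega> y" if y: "y \<in> \<Omega>" "y \<in> cball x R" for y
  proof -
    obtain y' where y': "y' \<in> frontier \<Omega>" "dist y' y = bdist \<Omega> y" "\<forall>s\<in>{0..1}. y' + s *\<^sub>R (y - y') \<in> cball x (2 * R)"
      using near[OF y] by blast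
    have "y' \<in> cball x (2 * R)" using y'(3)[rule_format, of 0] by simp
    then have "\<psi> y' = 0" using chart_zero[OF ch F(1) y'(1)] RU by blast
    moreover have "\<bar>\<psi> y - \<psi> y'\<bar> \<le> 3 * dist y' y * G"
      using y'(3) RU by (intro lipschitz_segment d\<psi>(1) G(2)) auto
    ultimately show ?thesis using y'(2) by (simp add: mult_ac)
  qed
  have v\<psi>: "\<bar>v y \<bullet> grad pd \<psi> y\<bar> \<le> 108 * G * L * bdist \<Omega> y" if y: "y \<in> \<Omega>" "y \<in> cball x R" and v: "tangential \<Omega> L v" for y L v
  proof -
    have L: "L > 0" using v by (simp add: tangential_def)
    obtain y' where y': "y' \<in> frontier \<Omega>" "dist y' y = bdist \<Omega> y" "\<forall>s\<in>{0..1}. y' + s *\<^sub>R (y - y') \<in> cball x (2 * R)"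
       "\<forall>s\<in>{0<..1}. y' + s *\<^sub>R (y - y') \<in> \<Omega>"
      using near[OF y] by blast
    \<comment> \<open>v is controlled inside \<Omega> only, so y' is approached along the segment,
      with s tending to 0.\<close>
    define z where "z s = y' + s *\<^sub>R (y - y')" for s
    have y'U: "y' \<in> U" using y'(3)[rule_format, of 0] RU by auto
    have "boundary_chart \<Omega> y' U \<psi>" using ch y'U by (simp add: boundary_chart_def)
    from nrml_chart[OF F(1) y'(1) this]
    have gn: "grad pd \<psi> y' = norm (grad pd \<psi> y') *\<^sub>R nrml \<Omega> y'" using U(5)[OF y'U] by simp
    have "((\<lambda>w. v w \<bullet> nrml \<Omega> y') \<longlongrightarrow> 0) (at y' within \<Omega>)" using v y'(1) by (simp add: tangential_def)
    moreover have "filterlim z (at y' within \<Omega>) (at_right 0)"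
      unfolding filterlim_at
    proof
      have "(z \<longlongrightarrow> y' + 0 *\<^sub>R (y - y')) (at_right 0)" unfolding z_def[abs_def] by (intro tendsto_intros)
      then show "(z \<longlongrightarrow> y') (at_right 0)" by simp
      have ny: "y \<noteq> y'" using y(1) y'(1) F(6) by blast
      show "eventually (\<lambda>s. z s \<in> \<Omega> \<and> z s \<noteq> y') (at_right 0)"
        unfolding eventually_at_right_field using y'(4) ny by (intro exI[of _ 1]) (auto simp: z_def)
    qed
    ultimately have "((\<lambda>s. v (z s) \<bullet> nrml \<Omega> y') \<longlongrightarrow> 0) (at_right 0)" by (rule filterlim_compose)
    from tendsto_mult[OF tendsto_const[of "norm (grad pd \<psi> y')"] this]
    have lim: "((\<lambda>s. v (z s) \<bullet> grad pd \<psi> y') \<longlongrightarrow> 0) (at_right 0)" by (subst gn) simp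
    \<comment> \<open>Change v first, then the gradient: the two errors are at most 27 G L
      \<open>bdist\<close> each, which 108 covers generously, and the remaining term tends to 0 with
      s.\<close>
    have bound: "\<bar>v y \<bullet> grad pd \<psi> y\<bar> \<le> 108 * G * L * bdist \<Omega> y + \<bar>v (z s) \<bullet> grad pd \<psi> y'\<bar>" if s: "0 < s" "s < 1" for s
    proof -
      have zs: "z s \<in> \<Omega>" using y'(4) s by (simp add: z_def)
      have seg: "z s + t *\<^sub>R (y - z s) \<in> \<Omega>" if "0 \<le> t" "t \<le> 1" for t
      proof -
        have "z s + t *\<^sub>R (y - z s) = y' + (s + t * (1 - s)) *\<^sub>R (y - y')" by (simp add: z_def algebra_simps)
        moreover have "t * (1 - s) \<le> 1 - s" "0 \<le> t * (1 - s)" using s that mult_left_le_one_le[of "1 - s" t] by auto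
        then have "s + t * (1 - s) \<in> {0<..1}" using s unfolding greaterThanAtMost_iff by linarith
        ultimately show ?thesis using y'(4) by simp
      qed
      have dz: "dist (z s) y \<le> bdist \<Omega> y"
      proof -
        have "z s - y = (1 - s) *\<^sub>R (y' - y)" by (simp add: z_def algebra_simps)
        then have "dist (z s) y = (1 - s) * bdist \<Omega> y" using s y'(2) by (simp add: dist_norm)
        then show ?thesis using s bn by (simp add: mult_left_le_one_le)
      qed
      have "\<bar>v y $ k - v (z s) $ k\<bar> \<le> 3 * bdist \<Omega> y * L" for k
      proof -
        have "\<bar>v y $ k - v (z s) $ k\<bar> \<le> 3 * dist (z s) y * L"
        proof (rule lipschitz_segment)
          fix t :: real
          show "(\<lambda>y. v y $ k) differentiable at (z s + t *\<^sub>R (y - z s))" if "0 \<le> t" "t \<le> 1"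
            using v seg[OF that] by (intro differentiable_nth) (auto simp: tangential_def)
          show "\<bar>pd i (\<lambda>y. v y $ k) (z s + t *\<^sub>R (y - z s))\<bar> \<le> L" if "0 < t" "t < 1" for i
            using v seg[of t] that by (subst pd_nth) (auto simp: tangential_def)
        qed
        also have "\<dots> \<le> 3 * bdist \<Omega> y * L" using dz L by (intro mult_right_mono mult_left_mono) auto
        finally show ?thesis .
      qed
      then have 1: "norm (v y - v (z s)) \<le> 3 * (3 * bdist \<Omega> y * L)" by (intro norm_le_3) simp
      have 2: "\<bar>grad pd \<psi> y $ i - grad pd \<psi> y' $ i\<bar> \<le> 3 * bdist \<Omega> y * G" for i
        unfolding grad_def vec_lambda_beta y'(2)[symmetric]
        using y'(3) RU by (intro lipschitz_segment d\<psi>(2) G(3)) auto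
      have nz: "norm (v (z s)) \<le> 3 * L" using v zs by (intro norm_le_3) (auto simp: tangential_def)
      have y2: "y \<in> cball x (2 * R)" using y(2) R(1) by auto
      have "v y \<bullet> grad pd \<psi> y = (v y - v (z s)) \<bullet> grad pd \<psi> y + v (z s) \<bullet> (grad pd \<psi> y - grad pd \<psi> y') + v (z s) \<bullet> grad pd \<psi> y'"
        by (simp add: inner_diff_left inner_diff_right)
      moreover have "\<bar>(v y - v (z s)) \<bullet> grad pd \<psi> y\<bar> \<le> 3 * norm (v y - v (z s)) * G"
        by (rule inner_le_3) (simp add: grad_def G(2)[OF y2])
      moreover have "3 * norm (v y - v (z s)) * G \<le> 3 * (3 * (3 * bdist \<Omega> y * L)) * G" using 1 G(1) by (intro mult_right_mono mult_left_mono) auto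
      moreover have "\<bar>v (z s) \<bullet> (grad pd \<psi> y - grad pd \<psi> y')\<bar> \<le> 3 * norm (v (z s)) * (3 * bdist \<Omega> y * G)"
        by (rule inner_le_3) (simp add: 2)
      moreover have "3 * norm (v (z s)) * (3 * bdist \<Omega> y * G) \<le> 3 * (3 * L) * (3 * bdist \<Omega> y * G)" using nz G(1) bn by (intro mult_right_mono mult_left_mono mult_nonneg_nonneg) auto
      moreover have "3 * (3 * (3 * bdist \<Omega> y * L)) * G + 3 * (3 * L) * (3 * bdist \<Omega> y * G) \<le> 108 * G * L * bdist \<Omega> y"
        using G(1) L bn by simp
      ultimately show ?thesis by linarith
    qed
    have "((\<lambda>s. 108 * G * L * bdist \<Omega> y + \<bar>v (z s) \<bullet> grad pd \<psi> y'\<bar>) \<longlongrightarrow> 108 * G * L * bdist \<Omega> y + \<bar>0\<bar>) (at_right 0)"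
      by (intro tendsto_intros lim)
    then have "\<bar>v y \<bullet> grad pd \<psi> y\<bar> \<le> 108 * G * L * bdist \<Omega> y + \<bar>0\<bar>"
      by (rule tendsto_lowerbound) (use bound in \<open>auto simp: eventually_at_right_field intro!: exI[of _ 1]\<close>)
    then show ?thesis by simp
  qed
  have inR: "\<psi> y < 0" if "y \<in> \<Omega>" "y \<in> U" for y using that U(4) by blast
  obtain m0 where m0: "m0 > 0" "\<And>y. y \<in> cball x (R / 2) \<Longrightarrow> m0 \<le> bump x R y"
    using bump_lower[of "R / 2" R x] R(1) by auto
  \<comment> \<open>3 G bounds \<psi> by the distance, 27 G B is 3 G times the 9 B from the gradient
    of the bump, and 108 G comes from the gradient of \<psi>.\<close>
  define C where "C = 3 * G + 27 * G * B + 108 * G"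
  have C: "C \<ge> 3 * G" "C \<ge> 27 * G * B + 108 * G" "C \<ge> 0" using G(1) B(1) by (auto simp: C_def)
  have "barrier_on \<Omega> (ball x (R / 2)) \<beta> (m0 * m) C"
    unfolding barrier_on_def
  proof (intro conjI ballI allI impI)
    show "\<beta> differentiable at y" "continuous_on UNIV (pd i \<beta>)" for y i using C\<beta> by (auto simp: C1c_def)
    show "m0 * m > 0" "C \<ge> 0" using m0 R C by auto
    fix y
    { assume y: "y \<in> \<Omega>"
      show "0 \<le> \<beta> y"
      proof (cases "y \<in> cball x R")
        case True
        then have "\<psi> y < 0" using inR[OF y] RU(1) by blast
        then show ?thesis unfolding \<beta>_def using bump_props(1)[of x R y] by (intro mult_nonneg_nonneg) auto
      next
        case False
        then have "\<beta> y = 0" using C\<beta> by (simp add: C1c_def)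
        then show ?thesis by simp
      qed
      show "\<beta> y \<le> C * bdist \<Omega> y"
      proof (cases "y \<in> cball x R")
        case True
        have "\<psi> y < 0" using inR[OF y] RU(1) True by blast
        then have "\<beta> y \<le> 1 * \<bar>\<psi> y\<bar>" unfolding \<beta>_def using bump_props(1,2)[of x R y] by (intro mult_mono) auto
        also have "\<dots> \<le> 3 * G * bdist \<Omega> y" using \<psi>d[OF y True] by simp
        also have "\<dots> \<le> C * bdist \<Omega> y" using C bn by (intro mult_right_mono)
        finally show ?thesis .
      next
        case False
        then have "\<beta> y = 0" using C\<beta> by (simp add: C1c_def)
        then show ?thesis using C bn by simp
      qed }
    { assume y: "y \<in> \<Omega> \<inter> ball x (R / 2)"
      then have yR: "y \<in> \<Omega>" "y \<in> cball x (R / 2)" "y \<in> cball x R" "y \<in> cball x (4 * R)" using R(1) by auto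
      have yU: "y \<in> U" using yR RU by blast
      have n: "\<psi> y < 0" by (rule inR[OF yR(1) yU])
      \<comment> \<open>Over the distance t in direction e the function \<psi> rises to at least 0,
        so the path leaves \<Omega>; hence the distance of y to the boundary is at most t.\<close>
      define t where "t = - \<psi> y / m"
      have t: "t > 0" using n R(2) unfolding t_def by (intro divide_pos_pos) auto
      have "bdist \<Omega> y \<le> t"
      proof (cases "t \<ge> R")
        case True
        have "bdist \<Omega> y \<le> R" using infdist_le[OF x, of y] yR(3) by (simp add: bdist_def dist_commute)
        then show ?thesis using True by simp
      next
        case False
        have q: "y + t *\<^sub>R e \<in> cball x (4 * R)"
        proof -
          have "dist x (y + t *\<^sub>R e) \<le> dist x y + dist y (y + t *\<^sub>R e)" by (rule dist_triangle)
          also have "dist y (y + t *\<^sub>R e) = t" using t R(3) by (simp add: dist_norm)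
          finally show ?thesis using yR(3) False R(1) by simp
        qed
        have "\<psi> (y + t *\<^sub>R e) \<ge> \<psi> y + m * t"
          using q yR t R(3) by (intro chart_increase[OF ch R(4) R(5)]) auto
        then have "\<psi> (y + t *\<^sub>R e) \<ge> 0" using R(2) by (simp add: t_def)
        then have "y + t *\<^sub>R e \<notin> \<Omega>" using inR q R(4) by force
        then have "\<not> dist y (y + t *\<^sub>R e) < bdist \<Omega> y" using bdist_ball[OF \<Omega> yR(1)] by blast
        then show ?thesis using t R(3) by (simp add: dist_norm)
      qed
      then have "m * bdist \<Omega> y \<le> m * t" using R(2) by simp
      then have "m * bdist \<Omega> y \<le> - \<psi> y" using R(2) by (simp add: t_def)
      then have "m0 * (m * bdist \<Omega> y) \<le> bump x R y * (- \<psi> y)"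
        using m0(1) m0(2)[OF yR(2)] bn[of y] R(2) by (intro mult_mono) auto
      then show "m0 * m * bdist \<Omega> y \<le> \<beta> y" by (simp add: \<beta>_def mult.assoc) }
    fix L v assume v: "tangential \<Omega> L v" and y: "y \<in> \<Omega>"
    have L: "L > 0" using v by (simp add: tangential_def)
    show "\<bar>v y \<bullet> grad pd \<beta> y\<bar> \<le> C * L * bdist \<Omega> y"
    proof (cases "y \<in> cball x R")
      case True
      then have yU: "y \<in> U" using RU by blast
      have nv: "norm (v y) \<le> 3 * L" using v y by (intro norm_le_3) (auto simp: tangential_def)
      have "\<bar>v y \<bullet> grad pd (bump x R) y\<bar> \<le> 3 * norm (v y) * B" by (rule inner_le_3) (simp add: grad_def B)
      also have "\<dots> \<le> 3 * (3 * L) * B" using nv B by (intro mult_right_mono mult_left_mono) auto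
      finally have 1: "\<bar>v y \<bullet> grad pd (bump x R) y\<bar> \<le> 9 * L * B" by simp
      have "v y \<bullet> grad pd \<beta> y = - (bump x R y * (v y \<bullet> grad pd \<psi> y)) - \<psi> y * (v y \<bullet> grad pd (bump x R) y)"
        unfolding g\<beta>[OF yU] by (simp add: inner_add_right inner_diff_right)
      then have "\<bar>v y \<bullet> grad pd \<beta> y\<bar> \<le> \<bar>bump x R y * (v y \<bullet> grad pd \<psi> y)\<bar> + \<bar>\<psi> y * (v y \<bullet> grad pd (bump x R) y)\<bar>" by linarith
      also have "\<dots> \<le> 1 * (108 * G * L * bdist \<Omega> y) + (3 * G * bdist \<Omega> y) * (9 * L * B)"
        unfolding abs_mult using bump_props(1,2)[of x R y] v\<psi>[OF y True v] \<psi>d[OF y True] 1 bn G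
        by (intro add_mono mult_mono) auto
      also have "\<dots> = (27 * G * B + 108 * G) * (L * bdist \<Omega> y)" by (simp add: algebra_simps)
      also have "\<dots> \<le> C * (L * bdist \<Omega> y)" using C L bn by (intro mult_right_mono) auto
      finally show ?thesis by (simp add: mult.assoc)
    next
      case False
      then have "grad pd \<beta> y = 0" using C1c_pd_zero[OF C\<beta>] by (simp add: grad_def vec_eq_iff)
      then show ?thesis using bn C L by simp
    qed
  qed
  then show ?thesis using R(1) by (intro exI[of _ "R / 2"]) auto
qed

text \<open>Barriers may be added: upper bounds and flow bounds add up, and since each summand is
  nonnegative, the lower bound of one survives on its own set.\<close>

theorem boundary_barrier:
  assumes \<Omega>: "smooth_bounded_domain \<Omega>"
  obtains \<Psi> c C where "barrier_on \<Omega> UNIV \<Psi> c C"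
proof -
  define Q where "Q V \<longleftrightarrow> (\<exists>\<Psi> c C. barrier_on \<Omega> V \<Psi> c C)" for V
  have "Q (closure \<Omega>)"
  proof (rule compact_local_to_global)
    show "compact (closure \<Omega>)" using \<Omega> by (simp add: smooth_bounded_domain_def)
    show "\<exists>U. open U \<and> x \<in> U \<and> Q U" if x: "x \<in> closure \<Omega>" for x
    proof -
      have "\<exists>r \<beta> c C. r > 0 \<and> barrier_on \<Omega> (ball x r) \<beta> c C"
        using barrier_interior[OF \<Omega>, of x] barrier_boundary[OF \<Omega>, of x] x by (cases "x \<in> \<Omega>") (auto simp: frontier_def interior_open smooth_bounded_domain_frontier(1)[OF \<Omega>])
      then obtain r where "r > 0" "Q (ball x r)" unfolding Q_def by blast
      then show ?thesis by (intro exI[of _ "ball x r"]) auto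
    qed
    have "barrier_on \<Omega> {} (\<lambda>x. 0) 1 0"
    proof -
      have "pd i (\<lambda>x. 0::real) = (\<lambda>x. 0)" for i by (rule ext) simp
      then show ?thesis by (simp add: barrier_on_def grad_def[abs_def] inner_vec_def)
    qed
    then show "Q {}" unfolding Q_def by blast
    show "Q V" if "V \<subseteq> U" "Q U" for U V
    proof -
      from that obtain \<Psi> c C where "barrier_on \<Omega> U \<Psi> c C" unfolding Q_def by blast
      then have "barrier_on \<Omega> V \<Psi> c C" using that(1) by (auto simp: barrier_on_def)
      then show ?thesis unfolding Q_def by blast
    qed
    fix U V assume "Q U" "Q V"
    then obtain \<Psi> c C \<Psi>' c' C' where b: "barrier_on \<Omega> U \<Psi> c C" "barrier_on \<Omega> V \<Psi>' c' C'" unfolding Q_def by blast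
    have d: "\<And>y. \<Psi> differentiable at y" "\<And>y. \<Psi>' differentiable at y" using b by (auto simp: barrier_on_def)
    have p: "pd i (\<lambda>x. \<Psi> x + \<Psi>' x) = (\<lambda>x. pd i \<Psi> x + pd i \<Psi>' x)" for i by (rule ext, rule pd_add[OF d])
    have g: "grad pd (\<lambda>x. \<Psi> x + \<Psi>' x) y = grad pd \<Psi> y + grad pd \<Psi>' y" for y
      by (simp add: grad_def p vec_eq_iff)
    have bn: "bdist \<Omega> y \<ge> 0" for y by (simp add: bdist_def infdist_nonneg)
    have "barrier_on \<Omega> (U \<union> V) (\<lambda>x. \<Psi> x + \<Psi>' x) (min c c') (C + C')"
      unfolding barrier_on_def
    proof (intro conjI ballI allI impI)
      show "(\<lambda>x. \<Psi> x + \<Psi>' x) differentiable at y" for y using d by simp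
      show "continuous_on UNIV (pd i (\<lambda>x. \<Psi> x + \<Psi>' x))" for i
        unfolding p using b by (intro continuous_on_add) (auto simp: barrier_on_def)
      show "0 < min c c'" "0 \<le> C + C'" using b by (auto simp: barrier_on_def)
      show "0 \<le> \<Psi> y + \<Psi>' y" "\<Psi> y + \<Psi>' y \<le> (C + C') * bdist \<Omega> y" if "y \<in> \<Omega>" for y
        using b that by (auto simp: barrier_on_def distrib_right intro!: add_mono)
      show "min c c' * bdist \<Omega> y \<le> \<Psi> y + \<Psi>' y" if y: "y \<in> \<Omega> \<inter> (U \<union> V)" for y
      proof -
        have "min c c' * bdist \<Omega> y \<le> c * bdist \<Omega> y" "min c c' * bdist \<Omega> y \<le> c' * bdist \<Omega> y" using bn by (auto intro!: mult_right_mono)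
        moreover have "0 \<le> \<Psi> y" "0 \<le> \<Psi>' y" using b y by (auto simp: barrier_on_def)
        moreover have "c * bdist \<Omega> y \<le> \<Psi> y \<or> c' * bdist \<Omega> y \<le> \<Psi>' y" using b y by (auto simp: barrier_on_def)
        ultimately show ?thesis by linarith
      qed
      show "\<bar>v y \<bullet> grad pd (\<lambda>x. \<Psi> x + \<Psi>' x) y\<bar> \<le> (C + C') * L * bdist \<Omega> y" if "tangential \<Omega> L v" "y \<in> \<Omega>" for L v y
      proof -
        have "\<bar>v y \<bullet> grad pd \<Psi> y\<bar> \<le> C * L * bdist \<Omega> y" "\<bar>v y \<bullet> grad pd \<Psi>' y\<bar> \<le> C' * L * bdist \<Omega> y"
          using b that unfolding barrier_on_def by blast+
        then show ?thesis unfolding g inner_add_right by (simp add: distrib_right)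
      qed
    qed
    then show "Q (U \<union> V)" unfolding Q_def by blast
  qed
  then obtain \<Psi> c C where "barrier_on \<Omega> (closure \<Omega>) \<Psi> c C" unfolding Q_def by blast
  then have "barrier_on \<Omega> UNIV \<Psi> c C" using closure_subset[of \<Omega>] unfolding barrier_on_def by (simp add: Int_absorb2)
  then show thesis by (rule that)
qed

subsection \<open>A minimum principle\<close>

text \<open>Let \<tau> be the last time at which W is somewhere at most W s x0; it exists by
  compactness. At a minimiser W still decreases in time, so \<tau> < T would not be last. The
  minimum itself need not be differentiable in time.\<close>

lemma min_principle:
  fixes W W' :: "real \<Rightarrow> 'a::metric_space \<Rightarrow> real"
  assumes K: "compact K" "s \<le> T" and cont: "continuous_on ({s..T} \<times> K) (\<lambda>(t, x). W t x)"
    and d: "\<And>t x. t \<in> {s..T} \<Longrightarrow> x \<in> K \<Longrightarrow> ((\<lambda>t. W t x) has_real_derivative W' t x) (at t within {s..T})"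
    and m: "\<And>t x. t \<in> {s..T} \<Longrightarrow> x \<in> K \<Longrightarrow> (\<And>y. y \<in> K \<Longrightarrow> W t x \<le> W t y) \<Longrightarrow> W' t x < 0"
    and x0: "x0 \<in> K"
  shows "\<exists>y\<in>K. W T y \<le> W s x0"
proof -
  define S where "S = {p \<in> {s..T} \<times> K. W (fst p) (snd p) \<le> W s x0}"
  have "closedin (top_of_set ({s..T} \<times> K)) S"
    using continuous_closedin_preimage[OF cont, of "{..W s x0}"] by (simp add: S_def vimage_def split_beta Int_def conj_commute)
  then have "compact S" by (rule closedin_compact[rotated]) (intro compact_Times K compact_Icc)
  then have A: "compact (fst ` S)" by (intro compact_continuous_image continuous_intros)
  have sA: "s \<in> fst ` S" using x0 K(2) by (force simp: S_def image_iff)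
  obtain \<tau> where \<tau>: "\<tau> \<in> fst ` S" "\<And>t. t \<in> fst ` S \<Longrightarrow> t \<le> \<tau>"
    using compact_attains_sup[OF A] sA by blast
  obtain y where y: "y \<in> K" "W \<tau> y \<le> W s x0" "\<tau> \<in> {s..T}" using \<tau>(1) by (auto simp: S_def)
  have "\<tau> = T"
  proof (rule ccontr)
    assume "\<tau> \<noteq> T"
    then have lt: "\<tau> < T" using y(3) by simp
    have "continuous_on K (W \<tau>)"
    proof -
      have "Pair \<tau> ` K \<subseteq> {s..T} \<times> K" using y(3) by blast
      from continuous_on_compose2[OF cont continuous_on_Pair1 this] show ?thesis by simp
    qed
    then obtain x where x: "x \<in> K" "\<And>z. z \<in> K \<Longrightarrow> W \<tau> x \<le> W \<tau> z"
      using continuous_attains_inf[OF K(1)] y(1) by blast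
    obtain e where e: "e > 0" "\<And>h. 0 < h \<Longrightarrow> \<tau> + h \<in> {s..T} \<Longrightarrow> h < e \<Longrightarrow> W (\<tau> + h) x < W \<tau> x"
      using has_real_derivative_neg_dec_right[OF d[OF y(3) x(1)] m[OF y(3) x]] by blast
    define h where "h = min (e / 2) (T - \<tau>)"
    have h: "h > 0" "h < e" "\<tau> + h \<in> {s..T}" using e lt y(3) by (auto simp: h_def)
    have "W (\<tau> + h) x \<le> W s x0" using e(2)[OF h(1,3,2)] x(2)[OF y(1)] y(2) by linarith
    then have "(\<tau> + h, x) \<in> S" using h x by (simp add: S_def)
    then have "\<tau> + h \<le> \<tau>" using \<tau>(2) by force
    then show False using h by simp
  qed
  then show ?thesis using y by blast
qed

text \<open>Multiplying by exp (- A) removes the linear rate, and subtracting (c + e)(t - s) with e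
  > 0 makes the decrease strict. Neither changes the minimisers in x, so the hypothesis on W applies
  to those of V.\<close>

lemma min_gronwall:
  fixes W W' :: "real \<Rightarrow> 'a::metric_space \<Rightarrow> real"
  assumes K: "compact K" "s \<le> T" and cont: "continuous_on ({s..T} \<times> K) (\<lambda>(t, x). W t x)"
    and d: "\<And>t x. t \<in> {s..T} \<Longrightarrow> x \<in> K \<Longrightarrow> ((\<lambda>t. W t x) has_real_derivative W' t x) (at t within {s..T})"
    and a: "continuous_on {s..T} a" "\<And>t. t \<in> {s..T} \<Longrightarrow> 0 \<le> a t" and c: "c \<ge> 0"
    and m: "\<And>t x. t \<in> {s..T} \<Longrightarrow> x \<in> K \<Longrightarrow> (\<And>y. y \<in> K \<Longrightarrow> W t x \<le> W t y) \<Longrightarrow> W' t x \<le> a t * W t x + c"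
    and x0: "x0 \<in> K" and e: "e > 0"
  shows "\<exists>y\<in>K. W T y \<le> exp (integral {s..T} a) * (W s x0 + (c + e) * (T - s))"
proof -
  define A where "A t = integral {s..t} a" for t
  have dA: "(A has_real_derivative a t) (at t within {s..T})" if "t \<in> {s..T}" for t
    unfolding A_def[abs_def] has_real_derivative_iff_has_vector_derivative
    by (rule integral_has_vector_derivative[OF a(1) that])
  have A0: "A t \<ge> 0" if "t \<in> {s..T}" for t
    unfolding A_def using that a by (intro integral_nonneg integrable_continuous_real) (auto intro: continuous_on_subset)
  have cA: "continuous_on {s..T} A"
    using dA by (meson DERIV_continuous continuous_on_eq_continuous_within)
  define V where "V t x = exp (- A t) * W t x - (c + e) * (t - s)" for t x
  have "\<exists>y\<in>K. V T y \<le> V s x0"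
  proof (rule min_principle[OF K _ _ _ x0])
    have 1: "continuous_on ({s..T} \<times> K) (\<lambda>p. A (fst p))"
      by (rule continuous_on_compose2[OF cA]) (auto intro!: continuous_intros)
    show "continuous_on ({s..T} \<times> K) (\<lambda>(t, x). V t x)"
      using cont unfolding V_def split_beta by (intro continuous_intros 1)
    fix t x assume t: "t \<in> {s..T}" and x: "x \<in> K"
    show "((\<lambda>t. V t x) has_real_derivative (- a t * exp (- A t)) * W t x + exp (- A t) * W' t x - (c + e)) (at t within {s..T})"
      unfolding V_def using dA[OF t] d[OF t x] by (auto intro!: derivative_eq_intros)
    assume mi: "\<And>y. y \<in> K \<Longrightarrow> V t x \<le> V t y"
    have "W t x \<le> W t y" if "y \<in> K" for y using mi[OF that] by (simp add: V_def)
    then have "W' t x \<le> a t * W t x + c" by (rule m[OF t x])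
    then have "exp (- A t) * (W' t x - a t * W t x) \<le> exp (- A t) * c" by (intro mult_left_mono) auto
    also have "\<dots> \<le> 1 * c" using A0[OF t] c by (intro mult_right_mono) auto
    finally show "(- a t * exp (- A t)) * W t x + exp (- A t) * W' t x - (c + e) < 0"
      using e by (simp add: algebra_simps)
  qed
  then obtain y where y: "y \<in> K" "exp (- A T) * W T y - (c + e) * (T - s) \<le> W s x0"
    by (auto simp: V_def A_def)
  have "W T y = exp (A T) * (exp (- A T) * W T y)" by (simp add: exp_minus)
  also have "\<dots> \<le> exp (A T) * (W s x0 + (c + e) * (T - s))" using y(2) by (intro mult_left_mono) auto
  finally show ?thesis using y(1) by (auto simp: A_def)
qed

subsection \<open>The continuity equation\<close>

text \<open>The values of f outside \<Omega> are discarded. This is made for functions of the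
  boundary barrier, about whose sign and size nothing is known out there.\<close>

lemma C1c_extend:
  assumes \<Omega>: "open \<Omega>" "compact K" "K \<subseteq> \<Omega>" and f: "\<And>x. x \<in> \<Omega> \<Longrightarrow> f differentiable (at x)" "\<And>i. continuous_on \<Omega> (pd i f)"
    and z: "\<And>x. x \<in> \<Omega> \<Longrightarrow> x \<notin> K \<Longrightarrow> f x = 0"
  shows "C1c K (\<lambda>x. if x \<in> \<Omega> then f x else 0)" "x \<in> \<Omega> \<Longrightarrow> pd i (\<lambda>x. if x \<in> \<Omega> then f x else 0) x = pd i f x"
proof -
  define g where "g x = (if x \<in> \<Omega> then f x else 0)" for x
  have g0: "g x = 0" if "x \<notin> K" for x using that z by (simp add: g_def)
  have ok: "open (- K)" using \<Omega>(2) by (simp add: compact_imp_closed open_Compl)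
  have dg: "g differentiable at x" for x
  proof (cases "x \<in> \<Omega>")
    case True
    have "(g has_derivative frechet_derivative f (at x)) (at x)"
      by (rule has_derivative_transform_within_open[OF has_derivative_pd[OF f(1)[OF True]] \<Omega>(1) True]) (simp add: g_def)
    then show ?thesis by (auto simp: differentiable_def)
  next
    case False
    have "(g has_derivative (\<lambda>_. 0)) (at x)"
      by (rule has_derivative_transform_within_open[OF has_derivative_const ok]) (use False \<Omega>(3) g0 in auto)
    then show ?thesis by (auto simp: differentiable_def)
  qed
  have pg: "pd i g x = pd i f x" if "x \<in> \<Omega>" for i x
    by (rule pd_cong[OF \<Omega>(1) that]) (simp add: g_def)
  have pg0: "pd i g x = 0" if "x \<notin> K" for i x
    using pd_cong[OF ok, of x g "\<lambda>_. 0" i] that g0 by auto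
  have "continuous_on \<Omega> (pd i g)" for i
    using continuous_on_cong[of \<Omega> \<Omega> "pd i g" "pd i f"] pg f(2) by simp
  then have "continuous_on UNIV (pd i g)" for i
    by (rule continuous_on_zero_extension1[OF \<Omega>]) (rule pg0)
  then have "C1c K g" using dg g0 \<Omega>(2) by (simp add: C1c_def)
  then show "C1c K (\<lambda>x. if x \<in> \<Omega> then f x else 0)" by (simp add: g_def[abs_def])
  show "x \<in> \<Omega> \<Longrightarrow> pd i (\<lambda>x. if x \<in> \<Omega> then f x else 0) x = pd i f x"
    using pg by (simp add: g_def[abs_def])
qed

lemma lin_at_top:
  fixes a :: real
  assumes "a > 0"
  shows "filterlim (\<lambda>n. real n * a - 1) at_top sequentially"
  using filterlim_tendsto_add_at_top[OF tendsto_const[of "-1"]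
      filterlim_at_top_mult_tendsto_pos[OF tendsto_const assms filterlim_real_sequentially]] by simp

locale continuity_flow =
  fixes \<Omega> :: "(real^3) set" and \<rho> :: "real \<Rightarrow> real^3 \<Rightarrow> real" and u :: "real \<Rightarrow> real^3 \<Rightarrow> real^3" and B :: real
  assumes dom: "smooth_bounded_domain \<Omega>"
    and rho_C1: "C1_tx \<Omega> \<rho>" and u_C1: "C1_tx \<Omega> u"
    and cont_eq: "\<And>t x. t > 0 \<Longrightarrow> x \<in> \<Omega> \<Longrightarrow> Dt \<rho> t x + divg pd (\<lambda>y. \<rho> t y *\<^sub>R u t y) x = 0"
    and rho_bounds: "\<And>t x. t > 0 \<Longrightarrow> x \<in> \<Omega> \<Longrightarrow> 0 \<le> \<rho> t x \<and> \<rho> t x \<le> B"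
begin

lemma \<Omega>_open: "open \<Omega>" and \<Omega>_bounded: "bounded \<Omega>"
  using smooth_bounded_domain_frontier[OF dom] by auto

lemma cont_tx_slice: "cont_tx \<Omega> f \<Longrightarrow> t > 0 \<Longrightarrow> continuous_on \<Omega> (f t)"
  unfolding cont_tx_def using continuous_on_compose2[OF _ continuous_on_Pair1[of \<Omega> t]] by fastforce

lemma rho_diff: "t > 0 \<Longrightarrow> x \<in> \<Omega> \<Longrightarrow> \<rho> t differentiable (at x)"
  and u_diff: "t > 0 \<Longrightarrow> x \<in> \<Omega> \<Longrightarrow> u t differentiable (at x)"
  and rho_cont: "t > 0 \<Longrightarrow> continuous_on \<Omega> (\<rho> t)"
  and u_cont: "t > 0 \<Longrightarrow> continuous_on \<Omega> (u t)"
  using rho_C1 u_C1 cont_tx_slice by (auto simp: C1_tx_def)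

lemma rho_pd_cont: "t > 0 \<Longrightarrow> continuous_on \<Omega> (pd i (\<rho> t))"
  using rho_C1 cont_tx_slice[where f = "\<lambda>t. pd i (\<rho> t)"] by (simp add: C1_tx_def)

lemma u_pd_cont: "t > 0 \<Longrightarrow> continuous_on \<Omega> (pd i (u t))"
  using u_C1 cont_tx_slice[where f = "\<lambda>t. pd i (u t)"] by (simp add: C1_tx_def)

lemma rho_time_deriv:
  assumes "t > 0" "x \<in> \<Omega>"
  shows "((\<lambda>s. \<rho> s x) has_real_derivative Dt \<rho> t x) (at t within S)"
proof -
  have "(\<lambda>s. \<rho> s x) differentiable (at t)" using rho_C1 assms by (simp add: C1_tx_def)
  then have "((\<lambda>s. \<rho> s x) has_vector_derivative Dt \<rho> t x) (at t)"
    unfolding Dt_def by (rule vector_derivative_works[THEN iffD1])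
  then show ?thesis
    using has_vector_derivative_at_within by (auto simp: has_real_derivative_iff_has_vector_derivative)
qed

lemma pd_flux:
  assumes "t > 0" "x \<in> \<Omega>"
  shows "pd i (\<lambda>y. \<rho> t y * u t y $ i) x = pd i (\<lambda>y. \<rho> t y *\<^sub>R u t y) x $ i"
    "pd i (\<lambda>y. \<rho> t y * u t y $ i) x = \<rho> t x * pd i (u t) x $ i + pd i (\<rho> t) x * u t x $ i"
    "(\<lambda>y. \<rho> t y * u t y $ i) differentiable (at x)"
proof -
  have d: "\<rho> t differentiable (at x)" "u t differentiable (at x)" using rho_diff u_diff assms by auto
  have "(\<lambda>y. \<rho> t y *\<^sub>R u t y) differentiable (at x)" using d by (intro differentiable_scaleR)
  from pd_nth[OF this, of i i] show "pd i (\<lambda>y. \<rho> t y * u t y $ i) x = pd i (\<lambda>y. \<rho> t y *\<^sub>R u t y) x $ i" by simp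
  show "pd i (\<lambda>y. \<rho> t y * u t y $ i) x = \<rho> t x * pd i (u t) x $ i + pd i (\<rho> t) x * u t x $ i"
    using pd_mult[OF d(1) differentiable_nth[OF d(2)], of i i] pd_nth[OF d(2), of i i] by simp
  show "(\<lambda>y. \<rho> t y * u t y $ i) differentiable (at x)"
    using d differentiable_nth by (intro differentiable_mult) auto
qed

lemma Dt_rho:
  assumes "t > 0" "x \<in> \<Omega>"
  shows "Dt \<rho> t x = - (u t x \<bullet> grad pd (\<rho> t) x) - \<rho> t x * divg pd (u t) x"
    "Dt \<rho> t x = - (\<Sum>i\<in>UNIV. pd i (\<lambda>y. \<rho> t y * u t y $ i) x)"
proof -
  show 1: "Dt \<rho> t x = - (\<Sum>i\<in>UNIV. pd i (\<lambda>y. \<rho> t y * u t y $ i) x)"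
    using cont_eq[OF assms] pd_flux(1)[OF assms] by (simp add: divg_def)
  show "Dt \<rho> t x = - (u t x \<bullet> grad pd (\<rho> t) x) - \<rho> t x * divg pd (u t) x"
    unfolding 1 pd_flux(2)[OF assms] grad_inner divg_def sum.distrib by (simp add: sum_distrib_left mult.commute)
qed

lemma divg_bound:
  assumes "tangential \<Omega> L (u t)" "x \<in> \<Omega>"
  shows "\<bar>divg pd (u t) x\<bar> \<le> 3 * L"
proof -
  have "\<bar>divg pd (u t) x\<bar> \<le> (\<Sum>i\<in>(UNIV::3 set). L)"
    unfolding divg_def using assms by (intro order_trans[OF sum_abs] sum_mono) (auto simp: tangential_def)
  then show ?thesis by simp
qed

lemma rho_joint: "0 < s \<Longrightarrow> K \<subseteq> \<Omega> \<Longrightarrow> continuous_on ({s..T} \<times> K) (\<lambda>p. \<rho> (fst p) (snd p))"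
  using rho_C1 unfolding C1_tx_def cont_tx_def split_beta by (auto intro: continuous_on_subset)

text \<open>The minimum principle is applied to \<open>\<rho> + \<delta> \<beta>\<close> with \<open>\<beta> = ln P - ln \<Psi>\<close>, which keeps minimizers away from the
  boundary; no particle paths are needed.\<close>
theorem vacuum_persists:
  assumes \<tau>: "0 < \<tau>" "\<tau> \<le> T" and tan: "\<And>t. t \<in> {\<tau>..T} \<Longrightarrow> tangential \<Omega> L (u t)"
    and x0: "x0 \<in> \<Omega>" "\<rho> \<tau> x0 = 0" and e: "e > 0"
  shows "\<exists>y\<in>\<Omega>. \<rho> T y < e"
proof -
  obtain \<Psi> c C where b: "barrier_on \<Omega> UNIV \<Psi> c C" by (rule boundary_barrier[OF dom])
  note F = smooth_bounded_domain_frontier[OF dom]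
  have L: "L > 0" using tan[of T] \<tau> by (simp add: tangential_def)
  have cC: "c > 0" "C \<ge> 0" and d\<Psi>: "\<And>y. \<Psi> differentiable at y"
    and \<Psi>: "\<And>y. y \<in> \<Omega> \<Longrightarrow> \<Psi> y \<le> C * bdist \<Omega> y" "\<And>y. y \<in> \<Omega> \<Longrightarrow> c * bdist \<Omega> y \<le> \<Psi> y"
    and u\<Psi>: "\<And>L v y. tangential \<Omega> L v \<Longrightarrow> y \<in> \<Omega> \<Longrightarrow> \<bar>v y \<bullet> grad pd \<Psi> y\<bar> \<le> C * L * bdist \<Omega> y"
    using b unfolding barrier_on_def by blast+
  have bp: "bdist \<Omega> y > 0" if "y \<in> \<Omega>" for y by (rule bdist_pos[OF dom that])
  have \<Psi>p: "\<Psi> y > 0" if "y \<in> \<Omega>" for y using \<Psi>(2)[OF that] mult_pos_pos[OF cC(1) bp[OF that]] by linarith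
  obtain z0 where z0: "z0 \<in> frontier \<Omega>" using F(4) by blast
  obtain D where D: "D > 0" "\<Omega> \<subseteq> ball z0 D" using bounded_subset_ballD[OF F(2), of z0] by blast
  have bD: "bdist \<Omega> y \<le> D" if "y \<in> \<Omega>" for y
    using infdist_le[OF z0, of y] D that by (auto simp: bdist_def dist_commute dest!: subsetD)
  have C: "C > 0"
  proof (rule ccontr)
    assume "\<not> C > 0"
    then have "C = 0" using cC by simp
    then show False using \<Psi>(1)[OF x0(1)] \<Psi>p[OF x0(1)] by simp
  qed
  define P where "P = C * D"
  have P: "\<Psi> y \<le> P" "P > 0" if "y \<in> \<Omega>" for y
    using order_trans[OF \<Psi>(1)[OF that] mult_left_mono[OF bD[OF that] cC(2)]] C D by (simp_all add: P_def)
  \<comment> \<open>Nonnegative, because P bounds \<Psi>, and infinite at the boundary. Tangential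
    fields change it at the bounded rate C L / c, since the boundary distance cancels in the
    quotient.\<close>
  define \<beta> where "\<beta> y = ln P - ln (\<Psi> y)" for y
  have \<beta>0: "\<beta> y \<ge> 0" if "y \<in> \<Omega>" for y using P[OF that] \<Psi>p[OF that] by (simp add: \<beta>_def)
  have \<beta>d: "\<beta> differentiable (at y)" "grad pd \<beta> y = - (1 / \<Psi> y) *\<^sub>R grad pd \<Psi> y" if y: "y \<in> \<Omega>" for y
  proof -
    have H: "((\<lambda>t. ln P - ln t) has_real_derivative - (1 / \<Psi> y)) (at (\<Psi> y))"
      using \<Psi>p[OF y] by (auto intro!: derivative_eq_intros)
    show "\<beta> differentiable (at y)" unfolding \<beta>_def[abs_def] by (rule pd_compose(1)[OF d\<Psi> H])
    show "grad pd \<beta> y = - (1 / \<Psi> y) *\<^sub>R grad pd \<Psi> y"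
      unfolding \<beta>_def[abs_def] grad_def pd_compose(2)[OF d\<Psi> H] by (simp add: vec_eq_iff)
  qed
  have c\<beta>: "continuous_on \<Omega> \<beta>"
    using \<beta>d(1) by (auto intro!: continuous_at_imp_continuous_on differentiable_imp_continuous_within)
  have u\<beta>: "\<bar>u t y \<bullet> grad pd \<beta> y\<bar> \<le> C * L / c" if t: "t \<in> {\<tau>..T}" and y: "y \<in> \<Omega>" for t y
  proof -
    have "\<bar>u t y \<bullet> grad pd \<beta> y\<bar> = \<bar>u t y \<bullet> grad pd \<Psi> y\<bar> / \<Psi> y"
      unfolding \<beta>d(2)[OF y] using \<Psi>p[OF y] by (simp add: abs_mult)
    also have "\<dots> \<le> (C * L * bdist \<Omega> y) / (c * bdist \<Omega> y)"
      using u\<Psi>[OF tan[OF t] y] \<Psi>(2)[OF y] bp[OF y] cC L \<Psi>p[OF y] by (intro frac_le) auto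
    also have "\<dots> = C * L / c" using bp[OF y] by simp
    finally show ?thesis .
  qed
  define E where "E = exp (3 * L * (T - \<tau>))"
  define M where "M = \<beta> x0 + (C * L / c + 1) * (T - \<tau>) + 1"
  have M: "M > 0" using \<beta>0[OF x0(1)] \<tau> C L cC by (auto simp: M_def intro!: add_nonneg_pos mult_nonneg_nonneg add_nonneg_nonneg)
  \<comment> \<open>E is the Gronwall factor and \<delta> M bounds the initial value plus the
    accumulated error, so the final bound E \<delta> M equals e / 2.\<close>
  define \<delta> where "\<delta> = e / (2 * E * M)"
  have \<delta>: "\<delta> > 0" using e M by (simp add: \<delta>_def E_def)
  \<comment> \<open>Closer to the boundary than \<eta>, the penalty alone exceeds |B| + \<delta>
    \<beta>(x0), which is at least the value of W at x0 at every time.\<close>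
  define \<eta> where "\<eta> = min (bdist \<Omega> x0) (P / C * exp (- (\<beta> x0 + (\<bar>B\<bar> + 1) / \<delta>)))"
  have \<eta>: "\<eta> > 0" using bp[OF x0(1)] P(2)[OF x0(1)] C by (simp add: \<eta>_def)
  have far: "\<delta> * \<beta> y > \<bar>B\<bar> + \<delta> * \<beta> x0" if y: "y \<in> \<Omega>" "bdist \<Omega> y \<le> \<eta>" for y
  proof -
    have "\<Psi> y \<le> C * (P / C * exp (- (\<beta> x0 + (\<bar>B\<bar> + 1) / \<delta>)))"
      using \<Psi>(1)[OF y(1)] y(2) C by (intro order_trans[OF \<Psi>(1)[OF y(1)]] mult_left_mono) (auto simp: \<eta>_def)
    then have "\<Psi> y \<le> P * exp (- (\<beta> x0 + (\<bar>B\<bar> + 1) / \<delta>))" using C by simp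
    then have "ln (\<Psi> y) \<le> ln (P * exp (- (\<beta> x0 + (\<bar>B\<bar> + 1) / \<delta>)))" using \<Psi>p[OF y(1)] by (subst ln_le_cancel_iff) (auto simp: P(2)[OF y(1)])
    then have "\<beta> y \<ge> \<beta> x0 + (\<bar>B\<bar> + 1) / \<delta>" using P(2)[OF y(1)] by (simp add: \<beta>_def ln_mult)
    then have "\<delta> * \<beta> y \<ge> \<delta> * (\<beta> x0 + (\<bar>B\<bar> + 1) / \<delta>)" using \<delta> by (intro mult_left_mono) auto
    also have "\<delta> * (\<beta> x0 + (\<bar>B\<bar> + 1) / \<delta>) = \<delta> * \<beta> x0 + \<bar>B\<bar> + 1" using \<delta> by (simp add: field_simps)
    finally show ?thesis by simp
  qed
  define K where "K = {y \<in> closure \<Omega>. \<eta> \<le> bdist \<Omega> y}"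
  have K\<Omega>: "K \<subseteq> \<Omega>"
  proof
    fix y assume "y \<in> K"
    then have y: "y \<in> closure \<Omega>" "bdist \<Omega> y > 0" using \<eta> by (auto simp: K_def)
    then have "y \<notin> frontier \<Omega>" using infdist_le[of y "frontier \<Omega>" y] by (auto simp: bdist_def)
    then show "y \<in> \<Omega>" using y(1) F(1) by (simp add: frontier_def interior_open)
  qed
  have cK: "compact K"
  proof -
    have "closed {y. \<eta> \<le> bdist \<Omega> y}" unfolding bdist_def by (intro closed_Collect_le continuous_intros)
    then have "compact (closure \<Omega> \<inter> {y. \<eta> \<le> bdist \<Omega> y})" using F(2) by (intro compact_Int_closed) auto
    then show ?thesis by (simp add: K_def Int_def)
  qed
  have xK: "x0 \<in> K" using x0 closure_subset by (auto simp: K_def \<eta>_def)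
  define W where "W t y = \<rho> t y + \<delta> * \<beta> y" for t y
  have "\<exists>y\<in>K. W T y \<le> exp (integral {\<tau>..T} (\<lambda>_. 3 * L)) * (W \<tau> x0 + (\<delta> * (C * L / c) + \<delta>) * (T - \<tau>))"
  proof (rule min_gronwall[OF cK \<tau>(2) _ _ _ _ _ _ xK \<delta>])
    show "continuous_on ({\<tau>..T} \<times> K) (\<lambda>(t, x). W t x)"
      unfolding W_def split_beta using K\<Omega>
      by (intro continuous_on_add continuous_on_mult rho_joint[OF \<tau>(1)] continuous_on_const continuous_on_compose2[OF c\<beta>] continuous_on_snd continuous_on_id) auto
    show "continuous_on {\<tau>..T} (\<lambda>_. 3 * L)" "0 \<le> 3 * L" "0 \<le> \<delta> * (C * L / c)" using L \<delta> C cC by auto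
    fix t x assume t: "t \<in> {\<tau>..T}" and x: "x \<in> K"
    then have t0: "t > 0" and x\<Omega>: "x \<in> \<Omega>" using \<tau> K\<Omega> by auto
    show "((\<lambda>t. W t x) has_real_derivative Dt \<rho> t x) (at t within {\<tau>..T})"
      unfolding W_def using rho_time_deriv[OF t0 x\<Omega>] by (auto intro!: derivative_eq_intros)
    assume mi: "\<And>y. y \<in> K \<Longrightarrow> W t x \<le> W t y"
    \<comment> \<open>A minimiser on K is thus off the part of K nearest to the boundary; it is a
      minimum over the open set S as well, and the gradient vanishes.\<close>
    have "\<not> bdist \<Omega> x \<le> \<eta>"
    proof
      assume "bdist \<Omega> x \<le> \<eta>"
      from far[OF x\<Omega> this] mi[OF xK] rho_bounds[OF t0 x\<Omega>] rho_bounds[OF t0 x0(1)] show False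
        by (simp add: W_def)
    qed
    then have gt: "bdist \<Omega> x > \<eta>" by simp
    define S where "S = \<Omega> \<inter> {y. \<eta> < bdist \<Omega> y}"
    have oS: "open S" unfolding S_def bdist_def by (intro open_Int F(1) open_Collect_less continuous_intros)
    have xS: "x \<in> S" using gt x\<Omega> by (simp add: S_def)
    have SK: "S \<subseteq> K" using closure_subset[of \<Omega>] by (auto simp: S_def K_def)
    have dW: "W t differentiable (at x)" unfolding W_def[abs_def] using rho_diff[OF t0 x\<Omega>] \<beta>d(1)[OF x\<Omega>] by simp
    have "frechet_derivative (W t) (at x) = (\<lambda>v. 0)"
      by (rule differential_zero_maxmin[OF xS oS has_derivative_pd[OF dW]]) (use mi SK in blast)
    then have "pd i (W t) x = 0" for i by (simp add: pd_def)
    moreover have "pd i (W t) x = pd i (\<rho> t) x + \<delta> * pd i \<beta> x" for i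
    proof -
      have "(\<lambda>y. \<delta> * \<beta> y) differentiable (at x)" using \<beta>d(1)[OF x\<Omega>] by simp
      from pd_add[OF rho_diff[OF t0 x\<Omega>] this, of i] pd_cmult[OF \<beta>d(1)[OF x\<Omega>], where c = \<delta> and i = i]
      show ?thesis unfolding W_def[abs_def] by simp
    qed
    ultimately have "pd i (\<rho> t) x = - \<delta> * pd i \<beta> x" for i by (simp add: eq_neg_iff_add_eq_0)
    \<comment> \<open>This replaces the uncontrolled transport term by \<delta> times u dotted with
      the gradient of \<beta>, which is at most \<delta> C L / c.\<close>
    then have gr: "grad pd (\<rho> t) x = - \<delta> *\<^sub>R grad pd \<beta> x" by (simp add: grad_def vec_eq_iff)
    have "Dt \<rho> t x = \<delta> * (u t x \<bullet> grad pd \<beta> x) - \<rho> t x * divg pd (u t) x"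
      unfolding Dt_rho(1)[OF t0 x\<Omega>] gr by simp
    moreover have "\<delta> * (u t x \<bullet> grad pd \<beta> x) \<le> \<delta> * (C * L / c)" using u\<beta>[OF t x\<Omega>] \<delta> by (intro mult_left_mono) auto
    moreover have "- (\<rho> t x * divg pd (u t) x) \<le> \<rho> t x * (3 * L)"
      using mult_left_mono[of "- divg pd (u t) x" "3 * L" "\<rho> t x"] divg_bound[OF tan[OF t] x\<Omega>] rho_bounds[OF t0 x\<Omega>] by simp
    moreover have "\<rho> t x * (3 * L) \<le> 3 * L * W t x"
      using L \<delta> \<beta>0[OF x\<Omega>] by (simp add: W_def algebra_simps)
    ultimately show "Dt \<rho> t x \<le> 3 * L * W t x + \<delta> * (C * L / c)" by linarith
  qed
  then obtain y where y: "y \<in> K" "W T y \<le> exp (integral {\<tau>..T} (\<lambda>_. 3 * L)) * (W \<tau> x0 + (\<delta> * (C * L / c) + \<delta>) * (T - \<tau>))" by blast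
  have "\<rho> T y \<le> W T y" using \<beta>0 y(1) K\<Omega> \<delta> by (auto simp: W_def)
  also have "\<dots> \<le> E * (\<delta> * (\<beta> x0 + (C * L / c + 1) * (T - \<tau>)))"
    using y(2) \<tau> x0(2) by (simp add: W_def E_def algebra_simps)
  also have "\<dots> \<le> E * (\<delta> * M)" using \<delta> by (intro mult_left_mono) (auto simp: M_def E_def)
  also have "\<dots> = e / 2" using M by (simp add: \<delta>_def E_def)
  also have "\<dots> < e" using e by simp
  finally show ?thesis using y(1) K\<Omega> by blast
qed

text \<open>The equation is tested with cutoffs \<open>bump1 (n \<Psi> - 1)\<close>. Their gradients
  are large near the boundary, but tangency makes the flux at most a constant times
  \<open>G (n \<Psi> - 1)\<close>, which is bounded and tends to 0 pointwise. No boundary integral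
  has to be defined.\<close>

theorem mass_conserved:
  assumes \<tau>: "0 < \<tau>" "\<tau> \<le> T" and tan: "\<And>t. t \<in> {\<tau>..T} \<Longrightarrow> tangential \<Omega> L (u t)"
  shows "(LINT x|lebesgue_on \<Omega>. \<rho> T x) = (LINT x|lebesgue_on \<Omega>. \<rho> \<tau> x)"
proof -
  obtain \<Psi> c C where b: "barrier_on \<Omega> UNIV \<Psi> c C" by (rule boundary_barrier[OF dom])
  note F = smooth_bounded_domain_frontier[OF dom]
  have L: "L > 0" using tan[of T] \<tau> by (simp add: tangential_def)
  have cC: "c > 0" "C \<ge> 0" and d\<Psi>: "\<And>y. \<Psi> differentiable at y" and c\<Psi>: "\<And>i. continuous_on UNIV (pd i \<Psi>)"
    and \<Psi>: "\<And>y. y \<in> \<Omega> \<Longrightarrow> \<Psi> y \<le> C * bdist \<Omega> y" "\<And>y. y \<in> \<Omega> \<Longrightarrow> c * bdist \<Omega> y \<le> \<Psi> y"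
    and u\<Psi>: "\<And>L v y. tangential \<Omega> L v \<Longrightarrow> y \<in> \<Omega> \<Longrightarrow> \<bar>v y \<bullet> grad pd \<Psi> y\<bar> \<le> C * L * bdist \<Omega> y"
    using b unfolding barrier_on_def by blast+
  have c\<Psi>0: "continuous_on UNIV \<Psi>"
    using d\<Psi> by (auto intro!: continuous_at_imp_continuous_on differentiable_imp_continuous_within)
  have bp: "bdist \<Omega> y > 0" if "y \<in> \<Omega>" for y by (rule bdist_pos[OF dom that])
  have \<Psi>p: "\<Psi> y > 0" if "y \<in> \<Omega>" for y using \<Psi>(2)[OF that] mult_pos_pos[OF cC(1) bp[OF that]] by linarith
  have O: "\<Omega> \<in> sets lebesgue" by (rule open_sets_lebesgue[OF F(1)])
  have fin: "finite_measure (lebesgue_on \<Omega>)"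
    using F(1,2) by (intro finite_measure_lebesgue_on lmeasurable_open)
  define h' where "h' = expinv (pCons 0 (pCons 0 (1 - pderiv 1)))"
  have dh: "(bump1 has_real_derivative h' s) (at s)" for s
    unfolding bump1_def h'_def by (rule expinv_derivative)
  have h'c: "continuous_on UNIV h'"
    unfolding h'_def using expinv_derivative by (meson DERIV_continuous continuous_at_imp_continuous_on)
  have h'v: "h' s = (if s > 0 then exp (- (1 / s)) * (1 / s)\<^sup>2 else 0)" for s
    by (simp add: h'_def expinv_def power2_eq_square)
  \<comment> \<open>With s = n \<Psi> - 1 the factor n \<Psi> is s + 1, and u dotted with the
    gradient of \<Psi> is at most (C L / c) \<Psi>.\<close>
  define G where "G s = h' s * (s + 1)" for s
  have G0: "G s \<ge> 0" for s by (auto simp: G_def h'v)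
  have G3: "G s \<le> 3" for s
  proof (cases "s > 0")
    case True
    define r where "r = 1 / s"
    have r: "r > 0" "s = 1 / r" using True by (auto simp: r_def)
    have "r * s = 1" using r by simp
    then have rs: "r\<^sup>2 * (s + 1) = r + r\<^sup>2" by (simp add: power2_eq_square distrib_left mult.assoc)
    have "G s = exp (- r) * (r\<^sup>2 * (s + 1))" using True by (simp add: G_def h'v r_def)
    then have "G s = exp (- r) * (r + r\<^sup>2)" unfolding rs .
    also have "\<dots> \<le> exp (- r) * (3 * exp r)"
    proof (rule mult_left_mono)
      have "1 + r + r\<^sup>2 / 2 \<le> exp r" using exp_lower_Taylor_quadratic[of r] r by simp
      moreover have "0 < r" "0 \<le> r\<^sup>2" using r by auto
      ultimately show "r + r\<^sup>2 \<le> 3 * exp r" by linarith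
    qed simp
    also have "\<dots> = 3" by (simp add: exp_minus)
    finally show ?thesis .
  qed (auto simp: G_def h'v)
  have Glim: "(\<lambda>n. G (real n * a - 1)) \<longlonglongrightarrow> 0" if a: "a > 0" for a
  proof (rule tendsto_sandwich[of "\<lambda>_. 0"])
    have f: "filterlim (\<lambda>n. real n * a - 1) at_top sequentially"
      by (rule lin_at_top[OF a])
    have "((\<lambda>s. inverse s + (inverse s)\<^sup>2) \<longlongrightarrow> 0 + 0\<^sup>2) (at_top::real filter)"
      by (intro tendsto_add tendsto_power tendsto_inverse_0_at_top filterlim_ident)
    then have 1: "((\<lambda>s. 1 / s + (1 / s)\<^sup>2) \<longlongrightarrow> 0) (at_top::real filter)" by (simp add: inverse_eq_divide)
    show "(\<lambda>n. 1 / (real n * a - 1) + (1 / (real n * a - 1))\<^sup>2) \<longlonglongrightarrow> 0"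
      by (rule filterlim_compose[OF 1 f])
    have "eventually (\<lambda>n. real n * a - 1 > 0) sequentially" using f unfolding filterlim_at_top_dense by blast
    then show "eventually (\<lambda>n. G (real n * a - 1) \<le> 1 / (real n * a - 1) + (1 / (real n * a - 1))\<^sup>2) sequentially"
    proof eventually_elim
      case (elim n)
      define s where "s = real n * a - 1"
      have s: "s > 0" using elim by (simp add: s_def)
      have "G s = exp (- (1 / s)) * ((1 / s)\<^sup>2 * (s + 1))" using s by (simp add: G_def h'v)
      also have "\<dots> \<le> 1 * ((1 / s)\<^sup>2 * (s + 1))" using s by (intro mult_right_mono) auto
      also have "\<dots> = 1 / s + (1 / s)\<^sup>2" using s by (simp add: power2_eq_square field_simps)
      finally show ?case by (simp add: s_def)
    qed
  qed (use G0 in auto)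
  define f where "f n y = bump1 (real n * \<Psi> y - 1)" for n y
  define \<omega> where "\<omega> n y = (if y \<in> \<Omega> then f n y else 0)" for n y
  have dn: "(\<lambda>y. real n * \<Psi> y - 1) differentiable at y" for n y using d\<Psi> by simp
  have pn: "pd i (\<lambda>y. real n * \<Psi> y - 1) y = real n * pd i \<Psi> y" for n y i
    using pd_diff[of "\<lambda>y. real n * \<Psi> y" y "\<lambda>_. 1" i] pd_cmult[OF d\<Psi>, where c = "real n" and i = i and x = y] d\<Psi> by simp
  have df: "f n differentiable (at y)" for n y
    using pd_compose(1)[OF dn dh, of n y] by (simp add: f_def[abs_def])
  have pf: "pd i (f n) y = h' (real n * \<Psi> y - 1) * (real n * pd i \<Psi> y)" for n y i
    using pd_compose(2)[OF dn dh, of i n y] by (simp add: f_def[abs_def] pn)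
  have cpf: "continuous_on \<Omega> (pd i (f n))" for i n
    unfolding pf[abs_def]
    by (intro continuous_intros continuous_on_compose2[OF h'c] continuous_on_subset[OF c\<Psi>] continuous_on_subset[OF c\<Psi>0]) auto
  \<comment> \<open>The cutoff needs n \<Psi> > 1, hence a boundary distance above 1 / (n (C + 1)).
    C + 1 in place of C keeps the denominator positive when C = 0.\<close>
  define K where "K n = {y \<in> closure \<Omega>. 1 / (real n * (C + 1)) \<le> bdist \<Omega> y}" for n
  have K\<Omega>: "K n \<subseteq> \<Omega>" if "n > 0" for n
  proof
    fix y assume yK: "y \<in> K n"
    have p: "1 / (real n * (C + 1)) > 0" using that cC by simp
    from yK have y: "y \<in> closure \<Omega>" and le: "1 / (real n * (C + 1)) \<le> bdist \<Omega> y" by (simp_all add: K_def)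
    have "bdist \<Omega> y > 0" by (rule less_le_trans[OF p le])
    then have "y \<notin> frontier \<Omega>" using infdist_le[of y "frontier \<Omega>" y] by (auto simp: bdist_def)
    then show "y \<in> \<Omega>" using y(1) F(1) by (simp add: frontier_def interior_open)
  qed
  have cK: "compact (K n)" for n
  proof -
    have "closed {y. 1 / (real n * (C + 1)) \<le> bdist \<Omega> y}" unfolding bdist_def by (intro closed_Collect_le continuous_intros)
    then have "compact (closure \<Omega> \<inter> {y. 1 / (real n * (C + 1)) \<le> bdist \<Omega> y})" using F(2) by (intro compact_Int_closed) auto
    then show ?thesis by (simp add: K_def Int_def)
  qed
  have fz: "f n y = 0" if "n > 0" "y \<in> \<Omega>" "y \<notin> K n" for n y
  proof -
    have "bdist \<Omega> y < 1 / (real n * (C + 1))" using that closure_subset by (auto simp: K_def)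
    moreover have "real n * (C + 1) > 0" using that(1) cC by simp
    ultimately have "bdist \<Omega> y * (real n * (C + 1)) < 1" by (simp only: pos_less_divide_eq)
    then have "real n * ((C + 1) * bdist \<Omega> y) < 1" by (simp add: mult_ac)
    moreover have "\<Psi> y \<le> (C + 1) * bdist \<Omega> y" using \<Psi>(1)[OF that(2)] bp[OF that(2)] by (simp add: distrib_right)
    then have "real n * \<Psi> y \<le> real n * ((C + 1) * bdist \<Omega> y)" by (intro mult_left_mono) auto
    ultimately show ?thesis unfolding f_def by (intro bump1_simps(1)) linarith
  qed
  have C1: "C1c (K n) (\<omega> n)" and p\<omega>: "\<And>y i. y \<in> \<Omega> \<Longrightarrow> pd i (\<omega> n) y = pd i (f n) y" if n: "n > 0" for n
    using C1c_extend[OF F(1) cK K\<Omega>[OF n] df cpf fz[OF n]] unfolding \<omega>_def[abs_def] by blast+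
  define I where "I n = (LINT y|lebesgue_on \<Omega>. G (real n * \<Psi> y - 1))" for n
  have Gc: "continuous_on \<Omega> (\<lambda>y. G (real n * \<Psi> y - 1))" for n
    unfolding G_def by (intro continuous_intros continuous_on_compose2[OF h'c] continuous_on_subset[OF c\<Psi>0]) auto
  have Gm: "(\<lambda>y. G (real n * \<Psi> y - 1)) \<in> borel_measurable (lebesgue_on \<Omega>)" for n
    by (rule continuous_imp_measurable_on_sets_lebesgue[OF Gc O])
  have ic: "integrable (lebesgue_on \<Omega>) (\<lambda>y. k)" for k :: real
    by (rule finite_measure.integrable_const[OF fin])
  have Gi: "integrable (lebesgue_on \<Omega>) (\<lambda>y. G (real n * \<Psi> y - 1))" for n
    by (rule Bochner_Integration.integrable_bound[OF ic[of 3] Gm]) (use G0 G3 in \<open>auto simp: abs_of_nonneg\<close>)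
  have Ilim: "I \<longlonglongrightarrow> 0"
  proof -
    have "(\<lambda>n. LINT y|lebesgue_on \<Omega>. G (real n * \<Psi> y - 1)) \<longlonglongrightarrow> (LINT y|lebesgue_on \<Omega>. 0)"
    proof (rule integral_dominated_convergence[OF _ Gm ic[of 3]])
      show "AE x in lebesgue_on \<Omega>. (\<lambda>n. G (real n * \<Psi> x - 1)) \<longlonglongrightarrow> 0"
        using Glim \<Psi>p by (intro AE_I2) (auto simp: space_restrict_space)
    qed (use G0 G3 in \<open>auto simp: abs_of_nonneg\<close>)
    then show ?thesis by (simp add: I_def[abs_def])
  qed
  define m where "m n t = (LINT x|lebesgue. \<rho> t x * \<omega> n x)" for n t
  define BB where "BB = \<bar>B\<bar>"
  \<comment> \<open>The time derivative of the truncated mass is bounded by a multiple of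
    \<open>I n\<close> uniformly on the interval, so the mean value inequality compares the two
    endpoints before n tends to infinity.\<close>
  have main: "\<bar>m n T - m n \<tau>\<bar> \<le> BB * (C * L / c) * I n * \<bar>T - \<tau>\<bar>" if n: "n > 0" for n
  proof -
    have \<omega>z: "\<omega> n x = 0" if "x \<notin> K n" for x using C1[OF n] that by (simp add: C1c_def)
    have c\<omega>: "continuous_on UNIV (\<omega> n)" by (rule C1c_continuous[OF C1[OF n]])
    have dm: "(m n has_real_derivative (LINT x|lebesgue. Dt \<rho> t x * \<omega> n x)) (at t within {\<tau>..T})" if t: "t \<in> {\<tau>..T}" for t
      unfolding m_def[abs_def]
    proof (rule leibniz_compact_support[OF _ _ _ cK])
      fix t x assume t: "t \<in> {\<tau>..T}"
      then have t0: "t > 0" using \<tau> by simp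
      show "((\<lambda>t. \<rho> t x * \<omega> n x) has_real_derivative Dt \<rho> t x * \<omega> n x) (at t within {\<tau>..T})"
      proof (cases "x \<in> \<Omega>")
        case True
        show ?thesis by (rule DERIV_cmult_right[OF rho_time_deriv[OF t0 True]])
      qed (simp add: \<omega>_def)
      show "continuous_on UNIV (\<lambda>x. \<rho> t x * \<omega> n x)"
        by (rule continuous_on_zero_extension1[OF F(1) cK K\<Omega>[OF n]])
           (auto simp: \<omega>z intro!: continuous_on_mult rho_cont[OF t0] continuous_on_subset[OF c\<omega>])
      show "x \<notin> K n \<Longrightarrow> \<rho> t x * \<omega> n x = 0" "x \<notin> K n \<Longrightarrow> Dt \<rho> t x * \<omega> n x = 0" by (simp_all add: \<omega>z)
    next
      have "continuous_on ({\<tau>..T} \<times> \<Omega>) (\<lambda>p. Dt \<rho> (fst p) (snd p))"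
        using rho_C1 \<tau>(1) unfolding C1_tx_def cont_tx_def split_beta by (auto intro: continuous_on_subset)
      then show "continuous_on ({\<tau>..T} \<times> UNIV) (\<lambda>(t, x). Dt \<rho> t x * \<omega> n x)"
        by (intro continuous_on_zero_extension[OF F(1) cK K\<Omega>[OF n]])
           (auto simp: \<omega>z split_beta intro!: continuous_on_mult continuous_on_compose2[OF c\<omega>] continuous_intros)
    qed (use t in auto)
    have bd: "\<bar>LINT x|lebesgue. Dt \<rho> t x * \<omega> n x\<bar> \<le> BB * (C * L / c) * I n" if t: "t \<in> {\<tau>..T}" for t
    proof -
      have t0: "t > 0" using t \<tau> by simp
      have cfl: "continuous_on \<Omega> (pd i (\<lambda>y. \<rho> t y * u t y $ j))" for i j
      proof -
        have "continuous_on \<Omega> (\<lambda>x. \<rho> t x * pd i (u t) x $ j + pd i (\<rho> t) x * u t x $ j)"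
          by (intro continuous_intros rho_cont u_cont u_pd_cont rho_pd_cont t0)
        moreover have "pd i (\<lambda>y. \<rho> t y * u t y $ j) x = \<rho> t x * pd i (u t) x $ j + pd i (\<rho> t) x * u t x $ j" if "x \<in> \<Omega>" for x
          using pd_mult[OF rho_diff[OF t0 that] differentiable_nth[OF u_diff[OF t0 that]], of i j] pd_nth[OF u_diff[OF t0 that], of i j] by simp
        ultimately show ?thesis using continuous_on_cong[of \<Omega> \<Omega>] by (metis (mono_tags, lifting))
      qed
      have ip: "integrable lebesgue (\<lambda>x. \<omega> n x * pd i (\<lambda>y. \<rho> t y * u t y $ i) x)" for i
        by (rule integrable_compact_support(1)[OF _ cK[of n]], rule continuous_on_zero_extension1[OF F(1) cK K\<Omega>[OF n]])
           (auto simp: \<omega>z intro!: continuous_on_mult cfl continuous_on_subset[OF c\<omega>])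
      have cp\<omega>: "continuous_on UNIV (pd i (\<omega> n))" for i using C1[OF n] by (simp add: C1c_def)
      have pz: "pd i (\<omega> n) x = 0" if "x \<notin> K n" for x i by (rule C1c_pd_zero[OF C1[OF n] that])
      have pzO: "pd i (\<omega> n) x = 0" if "x \<notin> \<Omega>" for x i using pz K\<Omega>[OF n] that by blast
      have ip2: "integrable lebesgue (\<lambda>x. pd i (\<omega> n) x * (\<rho> t x * u t x $ i))" for i
        by (rule integrable_compact_support(1)[OF _ cK[of n]], rule continuous_on_zero_extension1[OF F(1) cK K\<Omega>[OF n]])
           (auto simp: pz intro!: continuous_intros rho_cont[OF t0] u_cont[OF t0] continuous_on_subset[OF cp\<omega>])
      have "(LINT x|lebesgue. Dt \<rho> t x * \<omega> n x) = (LINT x|lebesgue. - (\<Sum>i\<in>UNIV. \<omega> n x * pd i (\<lambda>y. \<rho> t y * u t y $ i) x))"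
      proof (rule Bochner_Integration.integral_cong[OF refl])
        fix x
        show "Dt \<rho> t x * \<omega> n x = - (\<Sum>i\<in>UNIV. \<omega> n x * pd i (\<lambda>y. \<rho> t y * u t y $ i) x)"
          using Dt_rho(2)[OF t0, of x] by (cases "x \<in> \<Omega>") (auto simp: \<omega>_def sum_distrib_left mult.commute)
      qed
      also have "\<dots> = - (\<Sum>i\<in>UNIV. LINT x|lebesgue. \<omega> n x * pd i (\<lambda>y. \<rho> t y * u t y $ i) x)"
        by (simp add: Bochner_Integration.integral_sum[OF ip])
      also have "\<dots> = (\<Sum>i\<in>UNIV. LINT x|lebesgue. pd i (\<omega> n) x * (\<rho> t x * u t x $ i))"
        using integral_by_parts[OF F(1) C1[OF n] K\<Omega>[OF n] pd_flux(3)[OF t0] cfl] by (simp add: sum_negf)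
      also have "\<dots> = (LINT x|lebesgue. (\<Sum>i\<in>UNIV. pd i (\<omega> n) x * (\<rho> t x * u t x $ i)))"
        by (simp add: Bochner_Integration.integral_sum[OF ip2])
      also have "\<dots> = (LINT x|lebesgue_on \<Omega>. (\<Sum>i\<in>UNIV. pd i (\<omega> n) x * (\<rho> t x * u t x $ i)))"
        by (rule integral_lebesgue_on_support[OF O, symmetric]) (simp add: pzO)
      finally have eq: "(LINT x|lebesgue. Dt \<rho> t x * \<omega> n x) = (LINT x|lebesgue_on \<Omega>. (\<Sum>i\<in>UNIV. pd i (\<omega> n) x * (\<rho> t x * u t x $ i)))" .
      have pw: "\<bar>\<Sum>i\<in>UNIV. pd i (\<omega> n) x * (\<rho> t x * u t x $ i)\<bar> \<le> BB * (C * L / c) * G (real n * \<Psi> x - 1)" if x: "x \<in> \<Omega>" for x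
      proof -
        define s where "s = real n * \<Psi> x - 1"
        have "(\<Sum>i\<in>UNIV. pd i (\<omega> n) x * (\<rho> t x * u t x $ i)) = \<rho> t x * h' s * real n * (u t x \<bullet> grad pd \<Psi> x)"
          by (simp add: p\<omega>[OF n x] pf grad_inner sum_distrib_left s_def mult_ac)
        then have "\<bar>\<Sum>i\<in>UNIV. pd i (\<omega> n) x * (\<rho> t x * u t x $ i)\<bar> = \<rho> t x * (h' s * real n * \<bar>u t x \<bullet> grad pd \<Psi> x\<bar>)"
          using rho_bounds[OF t0 x] by (simp add: abs_mult h'v)
        also have "\<dots> \<le> BB * (h' s * real n * ((C * L / c) * \<Psi> x))"
        proof (intro mult_mono mult_nonneg_nonneg)
          show "\<rho> t x \<le> BB" using rho_bounds[OF t0 x] by (simp add: BB_def)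
          have "\<bar>u t x \<bullet> grad pd \<Psi> x\<bar> \<le> C * L * bdist \<Omega> x" by (rule u\<Psi>[OF tan[OF t] x])
          also have "\<dots> = (C * L / c) * (c * bdist \<Omega> x)" using cC by simp
          also have "\<dots> \<le> (C * L / c) * \<Psi> x" using \<Psi>(2)[OF x] cC L by (intro mult_left_mono) auto
          finally show "\<bar>u t x \<bullet> grad pd \<Psi> x\<bar> \<le> (C * L / c) * \<Psi> x" .
        qed (auto simp: h'v BB_def)
        also have "h' s * real n * ((C * L / c) * \<Psi> x) = (C * L / c) * G s" by (simp add: G_def s_def)
        finally show ?thesis by (simp add: s_def mult.assoc)
      qed
      have i2: "integrable (lebesgue_on \<Omega>) (\<lambda>x. \<Sum>i\<in>UNIV. pd i (\<omega> n) x * (\<rho> t x * u t x $ i))"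
        by (intro Bochner_Integration.integrable_sum integrable_lebesgue_on_support[OF O, THEN iffD2] ip2) (simp add: pzO)
      have "\<bar>LINT x|lebesgue. Dt \<rho> t x * \<omega> n x\<bar> \<le> (LINT x|lebesgue_on \<Omega>. BB * (C * L / c) * G (real n * \<Psi> x - 1))"
        unfolding eq
        by (rule order_trans[OF integral_abs_bound], rule integral_mono_AE)
           (use pw i2 Gi in \<open>auto simp: space_restrict_space intro!: AE_I2\<close>)
      then show ?thesis by (simp add: I_def)
    qed
    have "norm (m n T - m n \<tau>) \<le> (BB * (C * L / c) * I n) * norm (T - \<tau>)"
      by (rule field_differentiable_bound[OF convex_real_interval(5) dm]) (use bd \<tau> in auto)
    then show ?thesis by simp
  qed
  have mlim: "(\<lambda>n. m n t) \<longlonglongrightarrow> (LINT x|lebesgue_on \<Omega>. \<rho> t x)" if t0: "t > 0" for t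
  proof -
    have "m n t = (LINT x|lebesgue_on \<Omega>. \<rho> t x * \<omega> n x)" for n
      unfolding m_def by (rule integral_lebesgue_on_support[OF O, symmetric]) (simp add: \<omega>_def)
    moreover have "(\<lambda>n. LINT x|lebesgue_on \<Omega>. \<rho> t x * \<omega> n x) \<longlonglongrightarrow> (LINT x|lebesgue_on \<Omega>. \<rho> t x)"
    proof (rule integral_dominated_convergence[OF _ _ ic[of BB]])
      show "\<rho> t \<in> borel_measurable (lebesgue_on \<Omega>)"
        by (rule continuous_imp_measurable_on_sets_lebesgue[OF rho_cont[OF t0] O])
      have "continuous_on \<Omega> (f n)" for n
        using df by (auto intro!: continuous_at_imp_continuous_on differentiable_imp_continuous_within)
      then have "continuous_on \<Omega> (\<lambda>x. \<rho> t x * \<omega> n x)" for n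
        using continuous_on_cong[of \<Omega> \<Omega> "\<lambda>x. \<rho> t x * \<omega> n x" "\<lambda>x. \<rho> t x * f n x"] continuous_on_mult[OF rho_cont[OF t0]] by (simp add: \<omega>_def)
      then show "(\<lambda>x. \<rho> t x * \<omega> n x) \<in> borel_measurable (lebesgue_on \<Omega>)" for n
        by (rule continuous_imp_measurable_on_sets_lebesgue[OF _ O])
      show "AE x in lebesgue_on \<Omega>. norm (\<rho> t x * \<omega> n x) \<le> BB" for n
      proof (rule AE_I2)
        fix x assume "x \<in> space (lebesgue_on \<Omega>)"
        then have x: "x \<in> \<Omega>" by (simp add: space_restrict_space)
        have "norm (\<rho> t x * \<omega> n x) \<le> BB * 1"
          unfolding norm_mult using rho_bounds[OF t0 x] bump1_simps(3,4) by (intro mult_mono) (auto simp: \<omega>_def f_def BB_def)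
        then show "norm (\<rho> t x * \<omega> n x) \<le> BB" by simp
      qed
      show "AE x in lebesgue_on \<Omega>. (\<lambda>n. \<rho> t x * \<omega> n x) \<longlonglongrightarrow> \<rho> t x"
      proof (rule AE_I2)
        fix x assume "x \<in> space (lebesgue_on \<Omega>)"
        then have x: "x \<in> \<Omega>" by (simp add: space_restrict_space)
        have fl: "filterlim (\<lambda>n. real n * \<Psi> x - 1) at_top sequentially" by (rule lin_at_top[OF \<Psi>p[OF x]])
        have "((\<lambda>s. exp (- (inverse s))) \<longlongrightarrow> exp (- 0)) (at_top::real filter)"
          by (intro tendsto_exp tendsto_minus tendsto_inverse_0_at_top filterlim_ident)
        then have "((\<lambda>s. exp (- (1 / s))) \<longlongrightarrow> 1) (at_top::real filter)" by (simp add: inverse_eq_divide)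
        from filterlim_compose[OF this fl] have "(\<lambda>n. exp (- (1 / (real n * \<Psi> x - 1)))) \<longlonglongrightarrow> 1" .
        moreover have "eventually (\<lambda>n. real n * \<Psi> x - 1 > 0) sequentially" using fl unfolding filterlim_at_top_dense by blast
        then have "eventually (\<lambda>n. exp (- (1 / (real n * \<Psi> x - 1))) = \<omega> n x) sequentially"
          by eventually_elim (simp add: \<omega>_def x f_def bump1_def expinv_def)
        ultimately have "(\<lambda>n. \<omega> n x) \<longlonglongrightarrow> 1" by (rule Lim_transform_eventually)
        from tendsto_mult[OF tendsto_const this] show "(\<lambda>n. \<rho> t x * \<omega> n x) \<longlonglongrightarrow> \<rho> t x" by simp
      qed
    qed
    ultimately show ?thesis by simp
  qed
  have "(\<lambda>n. m n T - m n \<tau>) \<longlonglongrightarrow> 0"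
  proof (rule tendsto_0_le[where K = 1])
    have "(\<lambda>n. BB * (C * L / c) * I n * \<bar>T - \<tau>\<bar>) \<longlonglongrightarrow> BB * (C * L / c) * 0 * \<bar>T - \<tau>\<bar>"
      by (intro tendsto_intros Ilim)
    then show "(\<lambda>n. BB * (C * L / c) * I n * \<bar>T - \<tau>\<bar>) \<longlonglongrightarrow> 0" by simp
    show "eventually (\<lambda>n. norm (m n T - m n \<tau>) \<le> norm (BB * (C * L / c) * I n * \<bar>T - \<tau>\<bar>) * 1) sequentially"
      using eventually_gt_at_top[of 0]
    proof eventually_elim
      case (elim n)
      show ?case unfolding real_norm_def mult_1_right by (rule order_trans[OF main[OF elim] abs_ge_self])
    qed
  qed
  moreover have "(\<lambda>n. m n T - m n \<tau>) \<longlonglongrightarrow> (LINT x|lebesgue_on \<Omega>. \<rho> T x) - (LINT x|lebesgue_on \<Omega>. \<rho> \<tau> x)"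
    using \<tau> by (intro tendsto_diff mlim) auto
  ultimately have "(LINT x|lebesgue_on \<Omega>. \<rho> T x) - (LINT x|lebesgue_on \<Omega>. \<rho> \<tau> x) = 0" by (rule LIMSEQ_unique[rotated])
  then show ?thesis by simp
qed

end

subsection \<open>Interior bound for the effective viscous flux\<close>

lemma Lp_dominated:
  fixes g h :: "real^3 \<Rightarrow> real"
  assumes "g \<in> Lp \<Omega> p" "(LINT x|lebesgue_on \<Omega>. \<bar>g x\<bar> powr p) \<le> N powr p" "p > 0" "k \<ge> 0" "N \<ge> 0"
    and "h \<in> borel_measurable (lebesgue_on \<Omega>)" "\<And>x. x \<in> \<Omega> \<Longrightarrow> \<bar>h x\<bar> \<le> k * \<bar>g x\<bar>"
  shows "h \<in> Lp \<Omega> p" "(LINT x|lebesgue_on \<Omega>. \<bar>h x\<bar> powr p) \<le> (k * N) powr p"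
proof -
  have g: "integrable (lebesgue_on \<Omega>) (\<lambda>x. k powr p * \<bar>g x\<bar> powr p)" using assms(1) by (auto simp: Lp_def)
  have m: "(\<lambda>x. \<bar>h x\<bar> powr p) \<in> borel_measurable (lebesgue_on \<Omega>)" using assms(6) by measurable
  have le: "\<bar>h x\<bar> powr p \<le> k powr p * \<bar>g x\<bar> powr p" if "x \<in> \<Omega>" for x
  proof -
    have "\<bar>h x\<bar> powr p \<le> (k * \<bar>g x\<bar>) powr p" using assms(3,7) that by (intro powr_mono2) auto
    also have "\<dots> = k powr p * \<bar>g x\<bar> powr p" using assms(4) by (simp add: powr_mult)
    finally show ?thesis .
  qed
  have i: "integrable (lebesgue_on \<Omega>) (\<lambda>x. \<bar>h x\<bar> powr p)"
    by (rule Bochner_Integration.integrable_bound[OF g m]) (use le in \<open>auto simp: space_restrict_space intro!: AE_I2\<close>)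
  show "h \<in> Lp \<Omega> p" using i assms(6) by (simp add: Lp_def)
  have "(LINT x|lebesgue_on \<Omega>. \<bar>h x\<bar> powr p) \<le> (LINT x|lebesgue_on \<Omega>. k powr p * \<bar>g x\<bar> powr p)"
    by (rule integral_mono_AE[OF i g]) (use le in \<open>auto simp: space_restrict_space intro!: AE_I2\<close>)
  also have "\<dots> = k powr p * (LINT x|lebesgue_on \<Omega>. \<bar>g x\<bar> powr p)" by simp
  also have "\<dots> \<le> k powr p * N powr p" using assms(2) by (intro mult_left_mono) auto
  finally show "(LINT x|lebesgue_on \<Omega>. \<bar>h x\<bar> powr p) \<le> (k * N) powr p" using assms(4,5) by (simp add: powr_mult)
qed

lemma avg_L1_bound:
  assumes "open \<Omega>" "star_kernel \<Omega> y s0 S \<zeta>" "0 < s" "s < s0" "\<And>z. \<bar>\<zeta> z\<bar> \<le> Z" and v: "integrable (lebesgue_on \<Omega>) v"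
  shows "\<bar>avg \<zeta> y v s\<bar> \<le> Z / s ^ 3 * (LINT w|lebesgue_on \<Omega>. \<bar>v w\<bar>)"
    "avg \<zeta> y v s = (LINT w|lebesgue_on \<Omega>. v w * ker \<zeta> y s w)"
    "integrable (lebesgue_on \<Omega>) (\<lambda>w. v w * ker \<zeta> y s w)"
proof -
  have "bounded S" using assms(2) by (simp add: star_kernel_def compact_imp_bounded)
  from bounded_subset_ballD[OF this, of y] obtain R where "0 < R" "S \<subseteq> ball y R" by blast
  then have "S \<subseteq> cball y R" using ball_subset_cball[of y R] by blast
  note kb = ker_bound[OF assms(2,3,4) this assms(5)]
  show av: "avg \<zeta> y v s = (LINT w|lebesgue_on \<Omega>. v w * ker \<zeta> y s w)"
    unfolding avg_def by (rule integral_lebesgue_on_support[OF open_sets_lebesgue[OF assms(1)], symmetric]) (use kb(1) in auto)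
  have b: "\<bar>v w * ker \<zeta> y s w\<bar> \<le> Z / s ^ 3 * \<bar>v w\<bar>" for w
    using mult_right_mono[OF kb(2), of "\<bar>v w\<bar>" w] by (simp add: abs_mult mult.commute)
  have i1: "integrable (lebesgue_on \<Omega>) (\<lambda>w. Z / s ^ 3 * \<bar>v w\<bar>)" using v by (intro integrable_mult_right integrable_abs)
  have "ker \<zeta> y s \<in> borel_measurable lebesgue"
    using assms(2) by (intro continuous_imp_lebesgue_measurable smooth_on_continuous smooth_ker) (simp add: star_kernel_def)
  then have "(\<lambda>w. v w * ker \<zeta> y s w) \<in> borel_measurable (lebesgue_on \<Omega>)"
    by (intro borel_measurable_times borel_measurable_integrable[OF v] measurable_restrict_space1)
  then show i2: "integrable (lebesgue_on \<Omega>) (\<lambda>w. v w * ker \<zeta> y s w)"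
    by (rule Bochner_Integration.integrable_bound[OF i1]) (rule AE_I2, unfold real_norm_def, rule order_trans[OF b abs_ge_self])
  have "\<bar>LINT w|lebesgue_on \<Omega>. v w * ker \<zeta> y s w\<bar> \<le> (LINT w|lebesgue_on \<Omega>. Z / s ^ 3 * \<bar>v w\<bar>)"
    by (rule order_trans[OF integral_abs_bound], rule integral_mono[OF integrable_abs[OF i2] i1]) (rule b)
  then show "\<bar>avg \<zeta> y v s\<bar> \<le> Z / s ^ 3 * (LINT w|lebesgue_on \<Omega>. \<bar>v w\<bar>)" unfolding av by simp
qed

text \<open>\<open>\<nabla>div v - \<Delta>v = curl curl v\<close> is divergence free; hence testing the momentum equation with a gradient
  sees the effective viscous flux \<open>(2\<mu> + \<lambda>) div v - P\<close> only.\<close>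
lemma div_curl_zero:
  fixes v :: "real^3 \<Rightarrow> real^3"
  assumes \<Omega>: "open \<Omega>" and \<phi>: "\<phi> \<in> test_fun \<Omega>"
    and v: "\<And>x. x \<in> \<Omega> \<Longrightarrow> v differentiable (at x)" "\<And>i. continuous_on \<Omega> (pd i v)"
      "\<And>x i. x \<in> \<Omega> \<Longrightarrow> pd i v differentiable (at x)" "\<And>i j. continuous_on \<Omega> (pd j (pd i v))"
  shows "(\<Sum>i\<in>UNIV. LINT x|lebesgue_on \<Omega>. pd i \<phi> x * (pd i (divg pd v) x - lap pd v x $ i)) = 0"
    "\<And>x. x \<in> \<Omega> \<Longrightarrow> pd i (divg pd v) x = (\<Sum>j\<in>UNIV. pd i (pd j v) x $ j)"
    "\<And>x. x \<in> \<Omega> \<Longrightarrow> divg pd v differentiable (at x)"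
proof -
  have O: "\<Omega> \<in> sets lebesgue" by (rule open_sets_lebesgue[OF \<Omega>])
  have vc: "pd i (\<lambda>x. v x $ k) x = pd i v x $ k" if "x \<in> \<Omega>" for i k x by (rule pd_nth[OF v(1)[OF that]])
  have dvc: "(\<lambda>x. v x $ k) differentiable (at x)" if "x \<in> \<Omega>" for k x by (rule differentiable_nth[OF v(1)[OF that]])
  have cvc: "continuous_on \<Omega> (pd i (\<lambda>x. v x $ k))" for i k
    using continuous_on_cong[of \<Omega> \<Omega> "pd i (\<lambda>x. v x $ k)" "\<lambda>x. pd i v x $ k"] vc continuous_on_component[OF v(2)] by simp
  have pc: "pd j (\<lambda>x. pd i v x $ k) x = pd j (pd i v) x $ k" if "x \<in> \<Omega>" for i j k x by (rule pd_nth[OF v(3)[OF that]])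
  have dpc: "(\<lambda>x. pd i v x $ k) differentiable (at x)" if "x \<in> \<Omega>" for i k x by (rule differentiable_nth[OF v(3)[OF that]])
  have cpc: "continuous_on \<Omega> (pd j (\<lambda>x. pd i v x $ k))" for i j k
    using continuous_on_cong[of \<Omega> \<Omega> "pd j (\<lambda>x. pd i v x $ k)" "\<lambda>x. pd j (pd i v) x $ k"] pc continuous_on_component[OF v(4)] by simp
  show dv: "pd i (divg pd v) x = (\<Sum>j\<in>UNIV. pd i (pd j v) x $ j)" if "x \<in> \<Omega>" for i x
  proof -
    have "pd i (divg pd v) x = (\<Sum>j\<in>UNIV. pd i (\<lambda>x. pd j v x $ j) x)"
      unfolding divg_def[abs_def] by (rule pd_sum) (auto intro: dpc that)
    then show ?thesis using pc[OF that] by simp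
  qed
  show "divg pd v differentiable (at x)" if "x \<in> \<Omega>" for x
    unfolding divg_def[abs_def] by (rule differentiable_sum) (auto intro: dpc that)
  have sm: "smooth_on UNIV \<phi>" by (rule test_fun_smooth[OF \<phi>])
  \<comment> \<open>v is only C2, so both derivatives are moved to the test function, where symmetry
    of second derivatives is at hand.\<close>
  have ibp2: "(LINT x|lebesgue_on \<Omega>. \<psi> x * pd i (pd j v) x $ k) = (LINT x|lebesgue. pd j (pd i \<psi>) x * v x $ k)"
    "integrable (lebesgue_on \<Omega>) (\<lambda>x. \<psi> x * pd i (pd j v) x $ k)"
    if \<psi>: "\<psi> \<in> test_fun \<Omega>" for \<psi> i j k
  proof -
    obtain K1 where K1: "C1c K1 \<psi>" "K1 \<subseteq> \<Omega>" using \<psi> by (rule test_fun_obtain)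
    obtain K2 where K2: "C1c K2 (pd i \<psi>)" "K2 \<subseteq> \<Omega>" using test_fun_pd[OF \<psi>] by (rule test_fun_obtain)
    have "(LINT x|lebesgue_on \<Omega>. \<psi> x * pd i (pd j v) x $ k) = (LINT x|lebesgue_on \<Omega>. \<psi> x * pd i (\<lambda>x. pd j v x $ k) x)"
      by (rule Bochner_Integration.integral_cong[OF refl]) (simp add: pc space_restrict_space)
    also have "\<dots> = (LINT x|lebesgue. \<psi> x * pd i (\<lambda>x. pd j v x $ k) x)"
      by (rule integral_lebesgue_on_support[OF O]) (use K1 in \<open>auto simp: C1c_def\<close>)
    also have "\<dots> = - (LINT x|lebesgue. pd i \<psi> x * pd j v x $ k)"
      using integral_by_parts[OF \<Omega> K1 dpc cpc, of i j k] by simp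
    also have "(LINT x|lebesgue. pd i \<psi> x * pd j v x $ k) = (LINT x|lebesgue. pd i \<psi> x * pd j (\<lambda>x. v x $ k) x)"
    proof (rule Bochner_Integration.integral_cong[OF refl])
      fix x show "pd i \<psi> x * pd j v x $ k = pd i \<psi> x * pd j (\<lambda>x. v x $ k) x"
        using vc[of x j k] K2 by (cases "x \<in> \<Omega>") (auto simp: C1c_def subset_iff)
    qed
    also have "\<dots> = - (LINT x|lebesgue. pd j (pd i \<psi>) x * v x $ k)"
      using integral_by_parts[OF \<Omega> K2 dvc cvc, of j k] by simp
    finally show "(LINT x|lebesgue_on \<Omega>. \<psi> x * pd i (pd j v) x $ k) = (LINT x|lebesgue. pd j (pd i \<psi>) x * v x $ k)" by simp
    have "loc_integrable \<Omega> (\<lambda>x. pd i (pd j v) x $ k)"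
      by (rule loc_integrable_continuous) (rule continuous_on_component[OF v(4)])
    from integrable_test_fun[OF \<Omega> this \<psi>] show "integrable (lebesgue_on \<Omega>) (\<lambda>x. \<psi> x * pd i (pd j v) x $ k)" by simp
  qed
  have tp: "pd i \<phi> \<in> test_fun \<Omega>" for i by (rule test_fun_pd[OF \<phi>])
  \<comment> \<open>Commuting the three derivatives of \<phi> makes the double sum from the gradient
    of the divergence and the one from the Laplacian agree after exchanging i and j.\<close>
  have pc3: "pd j (pd j (pd i \<phi>)) = pd i (pd j (pd j \<phi>))" for i j
    using pd_commute[OF sm, of i j] pd_commute[OF smooth_on_pd[OF sm, of j], of i j] by simp
  have "(\<Sum>i\<in>UNIV. LINT x|lebesgue_on \<Omega>. pd i \<phi> x * (pd i (divg pd v) x - lap pd v x $ i)) =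
     (\<Sum>i\<in>UNIV. (\<Sum>j\<in>UNIV. LINT x|lebesgue_on \<Omega>. pd i \<phi> x * pd i (pd j v) x $ j) - (\<Sum>j\<in>UNIV. LINT x|lebesgue_on \<Omega>. pd i \<phi> x * pd j (pd j v) x $ i))"
  proof (rule sum.cong[OF refl])
    fix i
    have "(LINT x|lebesgue_on \<Omega>. pd i \<phi> x * (pd i (divg pd v) x - lap pd v x $ i)) =
      (LINT x|lebesgue_on \<Omega>. (\<Sum>j\<in>UNIV. pd i \<phi> x * pd i (pd j v) x $ j) - (\<Sum>j\<in>UNIV. pd i \<phi> x * pd j (pd j v) x $ i))"
      by (rule Bochner_Integration.integral_cong[OF refl])
         (simp add: dv space_restrict_space lap_def right_diff_distrib sum_distrib_left)
    also have "\<dots> = (\<Sum>j\<in>UNIV. LINT x|lebesgue_on \<Omega>. pd i \<phi> x * pd i (pd j v) x $ j) - (\<Sum>j\<in>UNIV. LINT x|lebesgue_on \<Omega>. pd i \<phi> x * pd j (pd j v) x $ i)"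
      using ibp2(2)[OF tp] by (subst Bochner_Integration.integral_diff) (auto intro!: Bochner_Integration.integrable_sum simp: Bochner_Integration.integral_sum)
    finally show "(LINT x|lebesgue_on \<Omega>. pd i \<phi> x * (pd i (divg pd v) x - lap pd v x $ i)) = \<dots>" .
  qed
  also have "\<dots> = (\<Sum>i\<in>UNIV. \<Sum>j\<in>UNIV. LINT x|lebesgue. pd j (pd i (pd i \<phi>)) x * v x $ j) - (\<Sum>i\<in>UNIV. \<Sum>j\<in>UNIV. LINT x|lebesgue. pd j (pd j (pd i \<phi>)) x * v x $ i)"
    unfolding ibp2(1)[OF tp] sum_subtractf ..
  also have "(\<Sum>i\<in>UNIV. \<Sum>j\<in>UNIV. LINT x|lebesgue. pd j (pd j (pd i \<phi>)) x * v x $ i) = (\<Sum>j\<in>UNIV. \<Sum>i\<in>UNIV. LINT x|lebesgue. pd j (pd j (pd i \<phi>)) x * v x $ i)"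
    by (rule sum.swap)
  also have "\<dots> = (\<Sum>j\<in>UNIV. \<Sum>i\<in>UNIV. LINT x|lebesgue. pd i (pd j (pd j \<phi>)) x * v x $ i)"
    by (intro sum.cong refl Bochner_Integration.integral_cong) (metis pc3)
  finally show "(\<Sum>i\<in>UNIV. LINT x|lebesgue_on \<Omega>. pd i \<phi> x * (pd i (divg pd v) x - lap pd v x $ i)) = 0" by simp
qed

section \<open>A kernel for which \<open>xi\<close> is a gradient\<close>

text \<open>The derivative of \<open>bump1\<close>, as given by
  \<open>expinv_derivative\<close>.\<close>

definition cut' :: "real \<Rightarrow> real" where
  "cut' = expinv (pCons 0 (pCons 0 (1 - pderiv 1)))"

lemma cut'_eq: "cut' s = (if s > 0 then exp (- (1 / s)) * (1 / s)\<^sup>2 else 0)"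
  by (simp add: cut'_def expinv_def power2_eq_square)

lemma cut'_bounds: "0 \<le> cut' s" "cut' s \<le> 2"
proof -
  show "0 \<le> cut' s" by (simp add: cut'_eq)
  show "cut' s \<le> 2"
  proof (cases "s > 0")
    case True
    have "1 + 1 / s + (1 / s)\<^sup>2 / 2 \<le> exp (1 / s)" using exp_lower_Taylor_quadratic[of "1 / s"] True by simp
    moreover have "0 < 1 / s" using True by simp
    ultimately have "(1 / s)\<^sup>2 \<le> 2 * exp (1 / s)" by linarith
    then have "exp (- (1 / s)) * (1 / s)\<^sup>2 \<le> exp (- (1 / s)) * (2 * exp (1 / s))" by (intro mult_left_mono) auto
    also have "\<dots> = 2" by (simp add: exp_minus)
    finally show ?thesis using True by (simp add: cut'_eq)
  qed (simp add: cut'_eq)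
qed

text \<open>Chosen such that (z - x) \<open>ball_kernel\<close> is -1/2 times the gradient of
  \<open>bump x 1\<close>. The field \<open>xi\<close> of this kernel is then a gradient of a test
  function, and such fields do not see the divergence-free part of the momentum equation.\<close>

definition ball_kernel :: "real^3 \<Rightarrow> real^3 \<Rightarrow> real" where
  "ball_kernel x z = cut' (1 - (norm (z - x))\<^sup>2)"

lemma pd_bump: "pd i (bump x 1) z = - 2 * (z $ i - x $ i) * ball_kernel x z"
proof -
  have d: "(\<lambda>z. 1 - (norm (z - x))\<^sup>2) differentiable at z"
    by (rule smooth_on_differentiable[OF smooth_on_normsq]) simp
  have "((\<lambda>z. 1 - (norm (z - x))\<^sup>2) has_derivative (\<lambda>h. - 2 * ((z - x) \<bullet> h))) (at z)"
    unfolding power2_norm_eq_inner by (auto intro!: derivative_eq_intros simp: inner_commute)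
  from pd_eqI[OF this] have p: "pd i (\<lambda>z. 1 - (norm (z - x))\<^sup>2) z = - 2 * (z $ i - x $ i)"
    by (simp add: inner_axis)
  have "(bump1 has_real_derivative cut' (1 - (norm (z - x))\<^sup>2)) (at (1 - (norm (z - x))\<^sup>2))"
    unfolding bump1_def cut'_def by (rule expinv_derivative)
  from pd_compose(2)[OF d this, of i] show ?thesis
    by (simp add: p bump_def[abs_def] ball_kernel_def)
qed

lemma smooth_ball_kernel: "smooth_on UNIV (ball_kernel x)"
  unfolding ball_kernel_def[abs_def] cut'_def by (rule smooth_on_compose_real[OF smooth_real_expinv smooth_on_normsq])

lemma ball_kernel_zero: "z \<notin> cball x 1 \<Longrightarrow> ball_kernel x z = 0"
proof -
  assume "z \<notin> cball x 1"
  then have "1 < norm (z - x)" by (simp add: dist_norm norm_minus_commute)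
  then have "1 < (norm (z - x))\<^sup>2" by (simp add: one_less_power)
  then show ?thesis by (simp add: ball_kernel_def cut'_eq)
qed

lemma ball_kernel_integral:
  obtains I where "I > 0" "\<And>x. integral\<^sup>L lebesgue (ball_kernel x) = I"
proof (rule that[of "integral\<^sup>L lebesgue (ball_kernel 0)"])
  have c: "continuous_on UNIV (ball_kernel x)" for x by (rule smooth_on_continuous[OF smooth_ball_kernel])
  show "integral\<^sup>L lebesgue (ball_kernel x) = integral\<^sup>L lebesgue (ball_kernel 0)" for x
    using integral_affine[OF c, of 1 x x] by (simp add: ball_kernel_def[abs_def])
  have i: "integrable lebesgue (ball_kernel 0)" "integrable lebesgue (bump 0 1)"
    using integrable_compact_support(1)[OF c compact_cball ball_kernel_zero] C1c_bump[of 1 0]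
      integrable_compact_support(1)[OF smooth_on_continuous[OF smooth_bump], of "cball 0 1" 0 1] by (auto simp: C1c_def)
  \<comment> \<open>Positivity by comparison: for s in (0, 1] the factor (1/s)^2 in
    \<open>cut'\<close> is at least 1, so the kernel dominates the bump.\<close>
  have "integral\<^sup>L lebesgue (bump 0 1) \<le> integral\<^sup>L lebesgue (ball_kernel 0)"
  proof (rule integral_mono[OF i(2,1)])
    fix z :: "real^3"
    show "bump 0 1 z \<le> ball_kernel 0 z"
    proof (cases "norm z < 1")
      case True
      define s where "s = 1 - (norm z)\<^sup>2"
      have s: "0 < s" "s \<le> 1" using True by (auto simp: s_def abs_square_less_1)
      then have "1 \<le> (1 / s)\<^sup>2" by (intro one_le_power) auto
      then have "exp (- (1 / s)) * 1 \<le> exp (- (1 / s)) * (1 / s)\<^sup>2" by (intro mult_left_mono) auto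
      then show ?thesis using s by (simp add: bump_def ball_kernel_def cut'_eq bump1_def expinv_def s_def)
    next
      case False
      then show ?thesis using bump_props(4)[of 1 z 0] cut'_bounds(1) by (simp add: ball_kernel_def)
    qed
  qed
  then show "integral\<^sup>L lebesgue (ball_kernel 0) > 0" using bump_integral_pos[of 1 0] by simp
qed

text \<open>Averages of the flux at scale \<open>s\<close> satisfy \<open>A'(s) = O(s powr (-3/5))\<close>. The borderline term \<open>\<sigma> a\<close>, with \<open>a\<close> merely
  in \<open>H\<^sup>1\<close>, is handled by freezing the Lipschitz factor \<open>\<sigma>\<close> at \<open>x\<close>. The pressure is nonnegative, so only
  a lower bound for the divergence results, which is the one that keeps vacuum from filling up.\<close>
lemma flux_estimate:
  assumes dom: "smooth_bounded_domain \<Omega>" and r: "0 < r" "r \<le> 1 / 2" "cball x0 (2 * r) \<subseteq> \<Omega>"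
    and pos: "B > 0" "\<Lambda> > 0" "U > 0" "N5 > 0" "Pb \<ge> 0" "\<mu> > 0" "2 * \<mu> + lam > 0"
  obtains C where "C > 0"
    "\<And>\<sigma> v a Pf N2 x. (\<And>x. x \<in> \<Omega> \<Longrightarrow> v differentiable (at x)) \<Longrightarrow> (\<And>i. continuous_on \<Omega> (pd i v)) \<Longrightarrow>
      (\<And>x i. x \<in> \<Omega> \<Longrightarrow> pd i v differentiable (at x)) \<Longrightarrow> (\<And>i j. continuous_on \<Omega> (pd j (pd i v))) \<Longrightarrow>
      (\<And>x. x \<in> \<Omega> \<Longrightarrow> Pf differentiable (at x)) \<Longrightarrow> (\<And>i. continuous_on \<Omega> (pd i Pf)) \<Longrightarrow>
      continuous_on \<Omega> a \<Longrightarrow> continuous_on \<Omega> \<sigma> \<Longrightarrow> (\<And>x. x \<in> \<Omega> \<Longrightarrow> 0 \<le> \<sigma> x \<and> \<sigma> x \<le> B) \<Longrightarrow>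
      (\<And>x. x \<in> \<Omega> \<Longrightarrow> \<sigma> x *\<^sub>R (a x + adv v v x) = \<mu> *\<^sub>R lap pd v x + (\<mu> + lam) *\<^sub>R grad pd (divg pd v) x - grad pd Pf x) \<Longrightarrow>
      (\<And>x. x \<in> \<Omega> \<Longrightarrow> 0 \<le> Pf x) \<Longrightarrow> integrable (lebesgue_on \<Omega>) Pf \<Longrightarrow> (LINT x|lebesgue_on \<Omega>. \<bar>Pf x\<bar>) \<le> Pb \<Longrightarrow>
      (\<And>y z. y \<in> cball x0 (2 * r) \<Longrightarrow> z \<in> cball x0 (2 * r) \<Longrightarrow> \<bar>\<sigma> y - \<sigma> z\<bar> \<le> \<Lambda> * dist y z) \<Longrightarrow>
      (\<And>x k. x \<in> \<Omega> \<Longrightarrow> \<bar>v x $ k\<bar> \<le> U) \<Longrightarrow> wd_bound \<Omega> 1 5 N5 v \<Longrightarrow> wd_bound \<Omega> 1 2 N2 a \<Longrightarrow> N2 \<ge> 1 \<Longrightarrow> x \<in> cball x0 r \<Longrightarrow>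
      - C * N2 \<le> divg pd v x"
proof -
  note F = smooth_bounded_domain_frontier[OF dom]
  have op: "open \<Omega>" by (rule F(1))
  have O: "\<Omega> \<in> sets lebesgue" by (rule open_sets_lebesgue[OF op])
  obtain I where I: "I > 0" "\<And>x. integral\<^sup>L lebesgue (ball_kernel x) = I" by (rule ball_kernel_integral) (rule that)
  define V where "V = measure lebesgue \<Omega> powr (1 / 2)"
  define V5 where "V5 = measure lebesgue \<Omega> powr (1 - 1 / 5)"
  \<comment> \<open>The reference scale. At b the average of the flux is controlled by L1 norms;
    from there it is followed down to 0.\<close>
  define b where "b = r / 2"
  have b: "0 < b" "b < r" "b \<le> 1" using r by (auto simp: b_def)
  define M2 where "M2 = morrey_const 2 1 2"
  define M5 where "M5 = morrey_const 5 1 2"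
  have M: "M2 \<ge> 0" "M5 \<ge> 0" by (auto simp: M2_def M5_def intro!: morrey_const_nonneg)
  \<comment> \<open>Three components, each with the term frozen at x (the average of a at scale b
    plus its growth), the term from the variation of \<sigma>, and three convective products. The
    kernel lives in a unit ball and is bounded by 2, whence \<open>morrey_const\<close> with
    arguments 1 and 2.\<close>
  define E where "E = 3 * (B * (2 / b ^ 3 * (2 * V) + 2 * M2) + M2 / 3 * \<Lambda> + 3 * (M5 / 3 * (B * U * N5)))"
  have VV: "V \<ge> 0" "V5 \<ge> 0" by (auto simp: V_def V5_def)
  have E: "E \<ge> 0" using pos M VV b by (auto simp: E_def intro!: add_nonneg_nonneg mult_nonneg_nonneg divide_nonneg_nonneg)
  \<comment> \<open>The bounds for divergence and pressure at scale b, plus 5/2 E: the primitive of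
    s^(-3/5) is 5/2 s^(2/5), and b \<le> 1.\<close>
  define C0 where "C0 = (2 * \<mu> + lam) * (2 / b ^ 3 * (3 * (2 * N5 * V5))) + 2 / b ^ 3 * Pb + 5 / 2 * E"
  have C0: "C0 \<ge> 0" using pos VV b E by (auto simp: C0_def intro!: add_nonneg_nonneg mult_nonneg_nonneg)
  show thesis
  proof (rule that[of "C0 / (I * (2 * \<mu> + lam)) + 1"])
    show "C0 / (I * (2 * \<mu> + lam)) + 1 > 0" using C0 I pos by (intro add_nonneg_pos divide_nonneg_pos) auto
    fix \<sigma> :: "real^3 \<Rightarrow> real" and v a :: "real^3 \<Rightarrow> real^3" and Pf :: "real^3 \<Rightarrow> real" and N2 :: real and x
    assume v: "\<And>x. x \<in> \<Omega> \<Longrightarrow> v differentiable (at x)" "\<And>i. continuous_on \<Omega> (pd i v)"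
      "\<And>x i. x \<in> \<Omega> \<Longrightarrow> pd i v differentiable (at x)" "\<And>i j. continuous_on \<Omega> (pd j (pd i v))"
      and P: "\<And>x. x \<in> \<Omega> \<Longrightarrow> Pf differentiable (at x)" "\<And>i. continuous_on \<Omega> (pd i Pf)"
      and ca: "continuous_on \<Omega> a" and c\<sigma>: "continuous_on \<Omega> \<sigma>" and \<sigma>B: "\<And>x. x \<in> \<Omega> \<Longrightarrow> 0 \<le> \<sigma> x \<and> \<sigma> x \<le> B"
      and mom: "\<And>x. x \<in> \<Omega> \<Longrightarrow> \<sigma> x *\<^sub>R (a x + adv v v x) = \<mu> *\<^sub>R lap pd v x + (\<mu> + lam) *\<^sub>R grad pd (divg pd v) x - grad pd Pf x"
      and P0: "\<And>x. x \<in> \<Omega> \<Longrightarrow> 0 \<le> Pf x" and Pi: "integrable (lebesgue_on \<Omega>) Pf" "(LINT x|lebesgue_on \<Omega>. \<bar>Pf x\<bar>) \<le> Pb"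
      and lip: "\<And>y z. y \<in> cball x0 (2 * r) \<Longrightarrow> z \<in> cball x0 (2 * r) \<Longrightarrow> \<bar>\<sigma> y - \<sigma> z\<bar> \<le> \<Lambda> * dist y z"
      and vU: "\<And>x k. x \<in> \<Omega> \<Longrightarrow> \<bar>v x $ k\<bar> \<le> U" and v5: "wd_bound \<Omega> 1 5 N5 v" and a2: "wd_bound \<Omega> 1 2 N2 a" and N2: "N2 \<ge> 1" and x: "x \<in> cball x0 r"
    have cv: "continuous_on \<Omega> v"
      using v(1) by (auto intro!: continuous_at_imp_continuous_on differentiable_imp_continuous_within)
    have x\<Omega>: "x \<in> \<Omega>" using x r by (intro subsetD[OF r(3)]) auto
    have sc: "x + s *\<^sub>R (z - x) \<in> cball x0 (2 * r)" if "z \<in> cball x 1" "0 < s" "s < r" for z s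
    proof -
      have "dist x (x + s *\<^sub>R (z - x)) = s * norm (z - x)" using that by (simp add: dist_norm)
      also have "\<dots> \<le> s * 1" using that by (intro mult_left_mono) (simp_all add: dist_norm norm_minus_commute)
      finally have "dist x (x + s *\<^sub>R (z - x)) \<le> r" using that by linarith
      then show ?thesis using x dist_triangle[of x0 "x + s *\<^sub>R (z - x)" x] by simp
    qed
    define \<zeta> where "\<zeta> = ball_kernel x"
    have \<zeta>2: "\<bar>\<zeta> z\<bar> \<le> 2" for z using cut'_bounds by (simp add: \<zeta>_def ball_kernel_def)
    have sk: "star_kernel \<Omega> x r (cball x 1) \<zeta>"
      unfolding star_kernel_def \<zeta>_def using smooth_ball_kernel ball_kernel_zero subsetD[OF r(3) sc] compact_cball by blast
    \<comment> \<open>\<open>xi\<close> for \<zeta> is an ordinary dilated kernel for \<kappa>, so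
      its pairing with a is an average to which \<open>avg_bound_p2\<close> applies.\<close>
    define \<kappa> where "\<kappa> i z = (z $ i + - (x $ i)) * \<zeta> z" for i z
    have \<kappa>2: "\<bar>\<kappa> i z\<bar> \<le> 2" for i z
    proof (cases "z \<in> cball x 1")
      case True
      have "\<bar>z $ i + - (x $ i)\<bar> \<le> 1" using component_le_norm_cart[of "z - x" i] True by (simp add: dist_norm norm_minus_commute)
      then have "\<bar>z $ i + - (x $ i)\<bar> * \<bar>\<zeta> z\<bar> \<le> 1 * 2" using \<zeta>2[of z] by (intro mult_mono) auto
      then show ?thesis by (simp add: \<kappa>_def abs_mult)
    next
      case False
      then show ?thesis using ball_kernel_zero by (simp add: \<kappa>_def \<zeta>_def)
    qed
    have sk\<kappa>: "star_kernel \<Omega> x r (cball x 1) (\<kappa> i)" for i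
    proof -
      have "smooth_on UNIV (\<kappa> i)" unfolding \<kappa>_def[abs_def]
        by (intro smooth_on_mult smooth_on_add smooth_on_nth smooth_on_const open_UNIV) (use sk in \<open>simp add: star_kernel_def\<close>)
      then show ?thesis using sk unfolding star_kernel_def by (auto simp: \<kappa>_def)
    qed
    have xi\<kappa>: "xi \<zeta> x i s w = ker (\<kappa> i) x s w" for i s w
      by (simp add: xi_def ker_def \<kappa>_def)
    have skb: "star_kernel \<Omega> x r (cball x 1) (bump x 1)"
      using sk C1c_bump[of 1 x] smooth_bump by (auto simp: star_kernel_def C1c_def)
    define Fl where "Fl y = (2 * \<mu> + lam) * divg pd v y - Pf y" for y
    have \<phi>0: "xi (bump x 1) x i s \<in> test_fun \<Omega>" if "0 < s" "s < r" for i s by (rule xi_test_fun[OF skb that])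
    obtain \<phi>t where \<phi>t: "\<phi>t \<in> test_fun \<Omega>" using \<phi>0[OF b(1,2)] by blast
    have dd1: "pd i (divg pd v) y = (\<Sum>j\<in>UNIV. pd i (pd j v) y $ j)" if "y \<in> \<Omega>" for i y
      by (rule div_curl_zero(2)[OF op \<phi>t v that])
    have dd2: "divg pd v differentiable (at y)" if "y \<in> \<Omega>" for y
      by (rule div_curl_zero(3)[OF op \<phi>t v that])
    have dF: "Fl differentiable (at y)" if "y \<in> \<Omega>" for y
      unfolding Fl_def[abs_def] using dd2[OF that] P(1)[OF that] by simp
    have pF: "pd i Fl y = (2 * \<mu> + lam) * pd i (divg pd v) y - pd i Pf y" if "y \<in> \<Omega>" for i y
    proof -
      have "(\<lambda>y. (2 * \<mu> + lam) * divg pd v y) differentiable (at y)" using dd2[OF that] by simp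
      from pd_diff[OF this P(1)[OF that], of i] pd_cmult[OF dd2[OF that], where c = "2 * \<mu> + lam" and i = i]
      show ?thesis by (simp add: Fl_def[abs_def])
    qed
    have cdv: "continuous_on \<Omega> (pd i (divg pd v))" for i
    proof -
      have "continuous_on \<Omega> (\<lambda>x. \<Sum>j\<in>UNIV. pd i (pd j v) x $ j)" by (intro continuous_intros v(4))
      then show ?thesis using continuous_on_cong[of \<Omega> \<Omega> "pd i (divg pd v)" "\<lambda>x. \<Sum>j\<in>UNIV. pd i (pd j v) x $ j"] dd1 by simp
    qed
    have cpF: "continuous_on \<Omega> (pd i Fl)" for i
    proof -
      have "continuous_on \<Omega> (\<lambda>y. (2 * \<mu> + lam) * pd i (divg pd v) y - pd i Pf y)" by (intro continuous_intros cdv P(2))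
      then show ?thesis using continuous_on_cong[of \<Omega> \<Omega> "pd i Fl" "\<lambda>y. (2 * \<mu> + lam) * pd i (divg pd v) y - pd i Pf y"] pF by simp
    qed
    have cF: "continuous_on \<Omega> Fl"
      using dF by (auto intro!: continuous_at_imp_continuous_on differentiable_imp_continuous_within)
    define f where "f y = \<sigma> y *\<^sub>R (a y + adv v v y)" for y
    have adv: "adv v v y $ i = (\<Sum>j\<in>UNIV. v y $ j * pd j v y $ i)" for y i by (simp add: adv_def)
    \<comment> \<open>The momentum equation with \<mu> times (gradient of the divergence minus
      Laplacian) split off; that part disappears when paired with the gradient
      \<open>xi\<close>.\<close>
    have key: "pd i Fl y = f y $ i + \<mu> * (pd i (divg pd v) y - lap pd v y $ i)" if "y \<in> \<Omega>" for i y
      unfolding f_def mom[OF that] pF[OF that] by (simp add: grad_def algebra_simps)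
    define A where "A = avg \<zeta> x Fl"
    have dA: "(A has_real_derivative (\<Sum>i\<in>UNIV. LINT w|lebesgue_on \<Omega>. xi \<zeta> x i s w * pd i Fl w)) (at s)" if "0 < s" "s < r" for s
      unfolding A_def by (rule avg_derivative[OF op cF classical_weak_deriv[OF op dF cpF] sk that])
    have li: "loc_integrable \<Omega> (\<lambda>w. f w $ i)" for i
    proof (rule loc_integrable_continuous)
      have "continuous_on \<Omega> (\<lambda>y. \<sigma> y * (a y $ i + (\<Sum>j\<in>UNIV. v y $ j * pd j v y $ i)))"
        by (intro continuous_intros c\<sigma> ca cv v(2))
      then show "continuous_on \<Omega> (\<lambda>w. f w $ i)" by (simp add: f_def adv)
    qed
    have lc: "loc_integrable \<Omega> (\<lambda>w. pd i (divg pd v) w - lap pd v w $ i)" for i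
      by (rule loc_integrable_continuous) (auto simp: lap_def intro!: continuous_intros cdv v(4))
    have A': "(\<Sum>i\<in>UNIV. LINT w|lebesgue_on \<Omega>. xi \<zeta> x i s w * pd i Fl w) = (\<Sum>i\<in>UNIV. LINT w|lebesgue_on \<Omega>. xi \<zeta> x i s w * f w $ i)" if s: "0 < s" "s < r" for s
    proof -
      \<comment> \<open>The chain rule gives the factor 1/s and \<open>pd_bump\<close> the factor
        -2; the prefactor -s/2 cancels both, so the partial derivatives of \<phi> are exactly
        \<open>xi\<close>.\<close>
      define \<phi> where "\<phi> w = (- s / 2) * ker (bump x 1) x s w" for w
      have s\<phi>: "smooth_on UNIV \<phi>" unfolding \<phi>_def[abs_def] by (intro smooth_on_mult open_UNIV smooth_on_const smooth_ker smooth_bump)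
      note ssup = scaled_support[OF skb s(1) s(2)]
      have t\<phi>: "\<phi> \<in> test_fun \<Omega>"
      proof (rule test_funI[OF s\<phi> ssup(1,2)])
        fix w assume "w \<notin> (\<lambda>(r, z). x + r *\<^sub>R (z - x)) ` ({s..s} \<times> cball x 1)"
        from ssup(3)[OF _ this, of s] show "\<phi> w = 0" using skb by (auto simp: \<phi>_def ker_def star_kernel_def)
      qed
      have p\<phi>: "pd i \<phi> w = xi \<zeta> x i s w" for i w
      proof -
        let ?z = "(x - (1 / s) *\<^sub>R x) + (1 / s) *\<^sub>R w"
        have db: "bump x 1 differentiable at z" for z by (rule smooth_on_differentiable[OF smooth_bump]) simp
        have m: "\<phi> = (\<lambda>w. (- 1 / (2 * s\<^sup>2)) * bump x 1 ((x - (1 / s) *\<^sub>R x) + (1 / s) *\<^sub>R w))"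
          unfolding \<phi>_def[abs_def] ker_def affine_arg using s(1) by (auto simp: fun_eq_iff power2_eq_square power3_eq_cube)
        have d: "(\<lambda>w. bump x 1 ((x - (1 / s) *\<^sub>R x) + (1 / s) *\<^sub>R w)) differentiable at w" by (rule pd_affine(1)[OF db])
        have alg: "(- 1 / (2 * s\<^sup>2)) * ((1 / s) * (- 2 * d * k)) = d * k / s ^ 3" for d k
          using s(1) by (simp add: field_simps power2_eq_square power3_eq_cube)
        from m d have "pd i \<phi> w = (- 1 / (2 * s\<^sup>2)) * ((1 / s) * pd i (bump x 1) ?z)"
          using pd_cmult[OF d, where i = i and c = "- 1 / (2 * s\<^sup>2)"] pd_affine(2)[OF db, where i = i and x = w and a = "x - (1 / s) *\<^sub>R x" and c = "1 / s"] by simp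
        also have "\<dots> = (?z $ i - x $ i) * \<zeta> ?z / s ^ 3"
          unfolding pd_bump \<zeta>_def by (rule alg)
        also have "\<dots> = xi \<zeta> x i s w"
          unfolding xi_def ker_def affine_arg by (simp add: diff_divide_distrib)
        finally show ?thesis .
      qed
      have z: "(\<Sum>i\<in>UNIV. LINT w|lebesgue_on \<Omega>. xi \<zeta> x i s w * (pd i (divg pd v) w - lap pd v w $ i)) = 0"
        unfolding p\<phi>[symmetric] by (rule div_curl_zero(1)[OF op t\<phi> v])
      have i1: "integrable (lebesgue_on \<Omega>) (\<lambda>w. xi \<zeta> x i s w * f w $ i)" for i
        using integrable_test_fun[OF op li xi_test_fun[OF sk s]] by simp
      have i2: "integrable (lebesgue_on \<Omega>) (\<lambda>w. xi \<zeta> x i s w * (pd i (divg pd v) w - lap pd v w $ i))" for i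
        using integrable_test_fun[OF op lc xi_test_fun[OF sk s]] by simp
      have "(LINT w|lebesgue_on \<Omega>. xi \<zeta> x i s w * pd i Fl w) = (LINT w|lebesgue_on \<Omega>. xi \<zeta> x i s w * f w $ i) + \<mu> * (LINT w|lebesgue_on \<Omega>. xi \<zeta> x i s w * (pd i (divg pd v) w - lap pd v w $ i))" for i
      proof -
        have "(LINT w|lebesgue_on \<Omega>. xi \<zeta> x i s w * pd i Fl w) = (LINT w|lebesgue_on \<Omega>. xi \<zeta> x i s w * f w $ i + \<mu> * (xi \<zeta> x i s w * (pd i (divg pd v) w - lap pd v w $ i)))"
          by (rule Bochner_Integration.integral_cong[OF refl]) (simp add: space_restrict_space key algebra_simps)
        then show ?thesis using i1 i2 by simp
      qed
      then show ?thesis using z by (simp add: sum.distrib sum_distrib_left[symmetric])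
    qed
    have ai: "wd_bound \<Omega> 1 2 N2 (\<lambda>y. a y $ i)" "continuous_on \<Omega> (\<lambda>y. a y $ i)" for i
      using wd_bound_nth[OF op a2] continuous_on_component[OF ca] by auto
    have vi: "wd_bound \<Omega> 1 5 N5 (\<lambda>y. v y $ i)" for i using wd_bound_nth[OF op v5] by auto
    have vid: "pd j v y $ i = pd j (\<lambda>y. v y $ i) y" if "y \<in> \<Omega>" for i j y using pd_nth[OF v(1)[OF that], of j i] by simp
    have civ: "continuous_on \<Omega> (pd j (\<lambda>y. v y $ i))" for i j
      using continuous_on_cong[of \<Omega> \<Omega> "pd j (\<lambda>y. v y $ i)" "\<lambda>y. pd j v y $ i"] vid continuous_on_component[OF v(2)] by simp
    have pv5: "pd j (\<lambda>y. v y $ i) \<in> Lp \<Omega> 5" for i j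
      by (rule wd_bound_pd(1)[OF op vi le_refl differentiable_nth[OF v(1)] civ])
    have pv5': "(LINT x|lebesgue_on \<Omega>. \<bar>pd j (\<lambda>y. v y $ i) x\<bar> powr 5) \<le> N5 powr 5" for i j
      by (rule wd_bound_pd(2)[OF op vi le_refl differentiable_nth[OF v(1)] civ])
    \<comment> \<open>\<sigma> and v are bounded and the derivatives of v lie in L5, so p = 5 gives
      the integrable rate s^(-3/5).\<close>
    have T2: "\<bar>LINT w|lebesgue_on \<Omega>. xi \<zeta> x i s w * (\<sigma> w * v w $ j * pd j v w $ i)\<bar> \<le> M5 / 3 * (B * U * N5) * s powr (- (3 / 5))" if s: "0 < s" "s < r" for s i j
    proof -
      have m: "(\<lambda>w. \<sigma> w * v w $ j * pd j v w $ i) \<in> borel_measurable (lebesgue_on \<Omega>)"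
        by (rule continuous_imp_measurable_on_sets_lebesgue[OF _ O]) (intro continuous_intros c\<sigma> cv v(2))
      have le: "\<bar>\<sigma> w * v w $ j * pd j v w $ i\<bar> \<le> (B * U) * \<bar>pd j (\<lambda>y. v y $ i) w\<bar>" if "w \<in> \<Omega>" for w
        unfolding abs_mult vid[OF that, symmetric] using \<sigma>B[OF that] vU[OF that] pos by (intro mult_right_mono mult_mono) auto
      have L: "(\<lambda>w. \<sigma> w * v w $ j * pd j v w $ i) \<in> Lp \<Omega> 5"
         "(LINT w|lebesgue_on \<Omega>. \<bar>\<sigma> w * v w $ j * pd j v w $ i\<bar> powr 5) \<le> (B * U * N5) powr 5"
        using Lp_dominated[OF pv5[of j i] pv5'[of j i] _ _ _ m le] pos by auto
      have R1: "(1::real) > 0" "(5::real) > 1" "B * U * N5 > 0" using pos by auto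
      show ?thesis unfolding M5_def
        by (rule xi_integral_bound[OF op sk s subset_refl R1(1) \<zeta>2 R1(2,3) L])
    qed
    have T1: "\<bar>LINT w|lebesgue_on \<Omega>. xi \<zeta> x i s w * (\<sigma> w * a w $ i)\<bar> \<le> (B * (2 / b ^ 3 * (2 * V) + 2 * M2) + M2 / 3 * \<Lambda>) * N2 * s powr (- (1 / 2))" if s: "0 < s" "s \<le> b" for s i
    proof -
      have sr: "s < r" using s b by simp
      have N20: "N2 > 0" using N2 by simp
      \<comment> \<open>Restricting the increment of \<sigma> to the support of the kernel makes the
        bound \<Lambda> s valid everywhere.\<close>
      define k where "k w = indicator (cball x s) w * (\<sigma> w - \<sigma> x)" for w
      have kz: "xi \<zeta> x i s w * (\<sigma> w * a w $ i) = \<sigma> x * (a w $ i * ker (\<kappa> i) x s w) + xi \<zeta> x i s w * (k w * a w $ i)" for w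
      proof (cases "w \<in> cball x s")
        case True
        then show ?thesis by (simp add: k_def xi\<kappa> algebra_simps)
      next
        case False
        then have "ker (\<kappa> i) x s w = 0" using ker_bound(1)[OF sk\<kappa> s(1) sr subset_refl \<kappa>2, of w] by simp
        then show ?thesis by (simp add: xi\<kappa>)
      qed
      note ws = wd_bound_self[OF op ai(1)]
      note LI = Lp_integral_le[OF op F(2) ws(1) _ _ N20]
      have ia: "integrable (lebesgue_on \<Omega>) (\<lambda>y. a y $ i)" and ia1: "(LINT y|lebesgue_on \<Omega>. \<bar>a y $ i\<bar>) \<le> 2 * N2 * V"
        using LI[of i] ws(2)[of i] by (auto simp: V_def)
      note AV = avg_L1_bound[OF op sk\<kappa>[of i] _ _ \<kappa>2 ia]
      have bz: "\<bar>avg (\<kappa> i) x (\<lambda>y. a y $ i) b\<bar> \<le> 2 / b ^ 3 * (2 * N2 * V)"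
        using AV(1)[OF b(1,2)] ia1 b(1) by (meson divide_nonneg_pos mult_left_mono order_trans zero_le_numeral zero_less_power)
      have "\<bar>avg (\<kappa> i) x (\<lambda>y. a y $ i) s\<bar> \<le> \<bar>avg (\<kappa> i) x (\<lambda>y. a y $ i) b\<bar> + 2 * morrey_const 2 1 2 * N2 * s powr (- (1 / 2))"
        by (rule avg_bound_p2[OF op ai(2) wd_bound_weak_grad[OF ai(1)] N20 sk\<kappa> subset_refl _ \<kappa>2 s b(2)]) auto
      then have av: "\<bar>avg (\<kappa> i) x (\<lambda>y. a y $ i) s\<bar> \<le> (2 / b ^ 3 * (2 * V) + 2 * M2) * N2 * s powr (- (1 / 2))"
      proof -
        have "1 \<le> s powr (- (1 / 2))" using s b powr_mono2'[of "- (1 / 2)" s 1] by simp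
        then have "2 / b ^ 3 * (2 * N2 * V) * 1 \<le> 2 / b ^ 3 * (2 * N2 * V) * s powr (- (1 / 2))"
          using b N2 VV by (intro mult_left_mono) auto
        then show ?thesis using \<open>\<bar>avg (\<kappa> i) x (\<lambda>y. a y $ i) s\<bar> \<le> _\<close> bz by (simp add: algebra_simps M2_def)
      qed
      have mk: "(\<lambda>w. k w * a w $ i) \<in> borel_measurable (lebesgue_on \<Omega>)"
        unfolding k_def
      proof (intro borel_measurable_times)
        show "indicator (cball x s) \<in> borel_measurable (lebesgue_on \<Omega>)"
          by (intro measurable_restrict_space1 borel_measurable_indicator) auto
        show "(\<lambda>w. \<sigma> w - \<sigma> x) \<in> borel_measurable (lebesgue_on \<Omega>)"
          by (rule continuous_imp_measurable_on_sets_lebesgue[OF _ O]) (intro continuous_intros c\<sigma>)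
        show "(\<lambda>w. a w $ i) \<in> borel_measurable (lebesgue_on \<Omega>)"
          by (rule continuous_imp_measurable_on_sets_lebesgue[OF ai(2) O])
      qed
      have kle: "\<bar>k w\<bar> \<le> \<Lambda> * s" for w
      proof (cases "w \<in> cball x s")
        case True
        have "w \<in> cball x0 (2 * r)" "x \<in> cball x0 (2 * r)" using True x sr r dist_triangle[of x0 w x] by auto
        from lip[OF this] have "\<bar>\<sigma> w - \<sigma> x\<bar> \<le> \<Lambda> * dist w x" .
        also have "\<dots> \<le> \<Lambda> * s" using True pos by (intro mult_left_mono) (auto simp: dist_commute)
        finally show ?thesis using True by (simp add: k_def)
      qed (use pos s in \<open>simp add: k_def\<close>)
      have le: "\<bar>k w * a w $ i\<bar> \<le> (\<Lambda> * s) * \<bar>a w $ i\<bar>" if "w \<in> \<Omega>" for w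
        unfolding abs_mult using kle by (intro mult_right_mono) auto
      have L: "(\<lambda>w. k w * a w $ i) \<in> Lp \<Omega> 2" "(LINT w|lebesgue_on \<Omega>. \<bar>k w * a w $ i\<bar> powr 2) \<le> (\<Lambda> * s * N2) powr 2"
        using Lp_dominated[OF ws(1)[of i] _ _ _ _ mk le] ws(2)[of i] pos s N20 by auto
      have R1: "(1::real) > 0" "(2::real) > 1" "\<Lambda> * s * N2 > 0" using pos s N20 by auto
      have k2: "\<bar>LINT w|lebesgue_on \<Omega>. xi \<zeta> x i s w * (k w * a w $ i)\<bar> \<le> M2 / 3 * (\<Lambda> * s * N2) * s powr (- (3 / 2))"
        unfolding M2_def by (rule xi_integral_bound[OF op sk s(1) sr subset_refl R1(1) \<zeta>2 R1(2,3) L])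
      also have "\<dots> = M2 / 3 * \<Lambda> * N2 * (s powr 1 * s powr (- (3 / 2)))" using s by simp
      also have "s powr 1 * s powr (- (3 / 2)) = s powr (- (1 / 2))" unfolding powr_add[symmetric] by simp
      finally have k3: "\<bar>LINT w|lebesgue_on \<Omega>. xi \<zeta> x i s w * (k w * a w $ i)\<bar> \<le> M2 / 3 * \<Lambda> * N2 * s powr (- (1 / 2))" .
      have ik: "integrable (lebesgue_on \<Omega>) (\<lambda>w. xi \<zeta> x i s w * (k w * a w $ i))"
      proof -
        have "integrable (lebesgue_on \<Omega>) (\<lambda>w. xi \<zeta> x i s w * (\<sigma> w * a w $ i))"
          using integrable_test_fun[OF op loc_integrable_continuous xi_test_fun[OF sk s(1) sr], of "\<lambda>w. \<sigma> w * a w $ i" i]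
            continuous_on_mult[OF c\<sigma> ai(2)] by simp
        from Bochner_Integration.integrable_diff[OF this integrable_mult_right[OF AV(3)[OF s(1) sr], of "\<sigma> x"]]
        show ?thesis by (simp add: kz)
      qed
      have "(LINT w|lebesgue_on \<Omega>. xi \<zeta> x i s w * (\<sigma> w * a w $ i)) = \<sigma> x * avg (\<kappa> i) x (\<lambda>y. a y $ i) s + (LINT w|lebesgue_on \<Omega>. xi \<zeta> x i s w * (k w * a w $ i))"
        unfolding kz AV(2)[OF s(1) sr] using AV(3)[OF s(1) sr] ik by simp
      moreover have "\<bar>\<sigma> x * avg (\<kappa> i) x (\<lambda>y. a y $ i) s\<bar> \<le> B * ((2 / b ^ 3 * (2 * V) + 2 * M2) * N2 * s powr (- (1 / 2)))"
        unfolding abs_mult using \<sigma>B[OF x\<Omega>] av by (intro mult_mono) auto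
      ultimately show ?thesis using k3 by (simp add: algebra_simps)
    qed
    have bound: "\<bar>\<Sum>i\<in>UNIV. LINT w|lebesgue_on \<Omega>. xi \<zeta> x i s w * pd i Fl w\<bar> \<le> E * N2 * s powr (- (3 / 5))" if s: "0 < s" "s \<le> b" for s
    proof -
      have sr: "s < r" using s b by simp
      have pm: "s powr (- (1 / 2)) \<le> s powr (- (3 / 5))" using s b by (intro powr_mono') auto
      have one: "\<bar>LINT w|lebesgue_on \<Omega>. xi \<zeta> x i s w * f w $ i\<bar> \<le> E / 3 * N2 * s powr (- (3 / 5))" for i
      proof -
        have c2: "continuous_on \<Omega> (\<lambda>w. \<sigma> w * v w $ j * pd j v w $ i)" for j
          by (intro continuous_intros c\<sigma> cv v(2))
        have ii: "integrable (lebesgue_on \<Omega>) (\<lambda>w. xi \<zeta> x i s w * (\<sigma> w * a w $ i))"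
          "integrable (lebesgue_on \<Omega>) (\<lambda>w. xi \<zeta> x i s w * (\<sigma> w * v w $ j * pd j v w $ i))" for j
          using integrable_test_fun[OF op loc_integrable_continuous[OF continuous_on_mult[OF c\<sigma> ai(2)]] xi_test_fun[OF sk s(1) sr]]
            integrable_test_fun[OF op loc_integrable_continuous[OF c2] xi_test_fun[OF sk s(1) sr]] by simp_all
        have "(LINT w|lebesgue_on \<Omega>. xi \<zeta> x i s w * f w $ i) =
          (LINT w|lebesgue_on \<Omega>. xi \<zeta> x i s w * (\<sigma> w * a w $ i) + (\<Sum>j\<in>UNIV. xi \<zeta> x i s w * (\<sigma> w * v w $ j * pd j v w $ i)))"
          by (rule Bochner_Integration.integral_cong[OF refl]) (simp add: f_def adv distrib_left sum_distrib_left mult.assoc)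
        also have "\<dots> = (LINT w|lebesgue_on \<Omega>. xi \<zeta> x i s w * (\<sigma> w * a w $ i)) + (\<Sum>j\<in>UNIV. LINT w|lebesgue_on \<Omega>. xi \<zeta> x i s w * (\<sigma> w * v w $ j * pd j v w $ i))"
          using ii by (subst Bochner_Integration.integral_add) (auto intro!: Bochner_Integration.integrable_sum simp: Bochner_Integration.integral_sum)
        finally have eq: "(LINT w|lebesgue_on \<Omega>. xi \<zeta> x i s w * f w $ i) = \<dots>" .
        let ?E1 = "B * (2 / b ^ 3 * (2 * V) + 2 * M2) + M2 / 3 * \<Lambda>" and ?E2 = "M5 / 3 * (B * U * N5)"
        have E1: "?E1 \<ge> 0" and E2: "?E2 \<ge> 0"
          using pos M VV b by (auto intro!: add_nonneg_nonneg mult_nonneg_nonneg divide_nonneg_nonneg)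
        have "\<bar>LINT w|lebesgue_on \<Omega>. xi \<zeta> x i s w * (\<sigma> w * a w $ i)\<bar> \<le> ?E1 * N2 * s powr (- (3 / 5))"
          using T1[OF s, of i] mult_left_mono[OF pm, of "?E1 * N2"] E1 N2 by (smt (verit) mult_nonneg_nonneg)
        moreover have "\<bar>\<Sum>j\<in>UNIV. LINT w|lebesgue_on \<Omega>. xi \<zeta> x i s w * (\<sigma> w * v w $ j * pd j v w $ i)\<bar> \<le> 3 * ?E2 * N2 * s powr (- (3 / 5))"
        proof -
          have "\<bar>\<Sum>j\<in>UNIV. LINT w|lebesgue_on \<Omega>. xi \<zeta> x i s w * (\<sigma> w * v w $ j * pd j v w $ i)\<bar> \<le> (\<Sum>j\<in>(UNIV::3 set). ?E2 * s powr (- (3 / 5)))"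
            by (rule order_trans[OF sum_abs]) (rule sum_mono, rule T2[OF s(1) sr])
          also have "\<dots> = (3 * ?E2) * 1 * s powr (- (3 / 5))" by simp
          also have "\<dots> \<le> (3 * ?E2) * N2 * s powr (- (3 / 5))"
            using N2 E2 by (intro mult_right_mono mult_left_mono) auto
          finally show ?thesis .
        qed
        moreover have "E / 3 * N2 * s powr (- (3 / 5)) = ?E1 * N2 * s powr (- (3 / 5)) + 3 * ?E2 * N2 * s powr (- (3 / 5))"
          by (simp add: E_def algebra_simps)
        ultimately show ?thesis unfolding eq by linarith
      qed
      have "\<bar>\<Sum>i\<in>UNIV. LINT w|lebesgue_on \<Omega>. xi \<zeta> x i s w * f w $ i\<bar> \<le> (\<Sum>i\<in>(UNIV::3 set). E / 3 * N2 * s powr (- (3 / 5)))"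
        by (rule order_trans[OF sum_abs]) (rule sum_mono, rule one)
      then show ?thesis unfolding A'[OF s(1) sr] by simp
    qed
    \<comment> \<open>The derivative of A is integrated from s to b and s tends to 0, where A tends
      to the value of the flux at x times the kernel mass I.\<close>
    have close: "\<bar>A b - Fl x * I\<bar> \<le> 5 / 2 * (E * N2)"
    proof (rule tendsto_upperbound)
      have "(A \<longlongrightarrow> Fl x * integral\<^sup>L lebesgue \<zeta>) (at_right 0)"
        unfolding A_def by (rule avg_tendsto[OF op cF x\<Omega> sk r(1)])
      then have "(A \<longlongrightarrow> Fl x * I) (at_right 0)" by (simp add: \<zeta>_def I(2))
      then show "((\<lambda>s. \<bar>A b - A s\<bar>) \<longlongrightarrow> \<bar>A b - Fl x * I\<bar>) (at_right 0)" by (intro tendsto_intros)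
      show "eventually (\<lambda>s. \<bar>A b - A s\<bar> \<le> 5 / 2 * (E * N2)) (at_right 0)"
        unfolding eventually_at_right_field
      proof (intro exI[of _ b] conjI allI impI b(1))
        fix s assume s: "0 < s" "s < b"
        have dphi: "((\<lambda>s. 5 / 2 * (E * N2) * s powr (2 / 5)) has_vector_derivative E * N2 * q powr (- (3 / 5))) (at q)" if "0 < q" for q
        proof -
          have "((\<lambda>s. s powr (2 / 5)) has_real_derivative (2 / 5) * q powr (2 / 5 - 1)) (at q)"
            by (rule has_real_derivative_powr[OF that])
          from DERIV_cmult[OF this, of "5 / 2 * (E * N2)"] show ?thesis
            by (simp add: has_real_derivative_iff_has_vector_derivative[symmetric] mult.assoc)
        qed
        have dAv: "(A has_vector_derivative (\<Sum>i\<in>UNIV. LINT w|lebesgue_on \<Omega>. xi \<zeta> x i q w * pd i Fl w)) (at q)" if "0 < q" "q < r" for q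
          using dA[OF that] by (simp add: has_real_derivative_iff_has_vector_derivative)
        have "norm (A b - A s) \<le> 5 / 2 * (E * N2) * b powr (2 / 5) - 5 / 2 * (E * N2) * s powr (2 / 5)"
        proof (rule differentiable_bound_general[OF s(2)])
          show "continuous_on {s..b} A"
            by (intro continuous_at_imp_continuous_on ballI has_vector_derivative_continuous[OF dAv]) (use s b in auto)
          show "continuous_on {s..b} (\<lambda>s. 5 / 2 * (E * N2) * s powr (2 / 5))"
            by (intro continuous_at_imp_continuous_on ballI has_vector_derivative_continuous[OF dphi]) (use s b in auto)
          fix q assume q: "s < q" "q < b"
          show "(A has_vector_derivative (\<Sum>i\<in>UNIV. LINT w|lebesgue_on \<Omega>. xi \<zeta> x i q w * pd i Fl w)) (at q)"
            using dAv[of q] q s b by simp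
          show "((\<lambda>s. 5 / 2 * (E * N2) * s powr (2 / 5)) has_vector_derivative E * N2 * q powr (- (3 / 5))) (at q)"
            using dphi[of q] q s by simp
          show "norm (\<Sum>i\<in>UNIV. LINT w|lebesgue_on \<Omega>. xi \<zeta> x i q w * pd i Fl w) \<le> E * N2 * q powr (- (3 / 5))"
            using bound[of q] q s by simp
        qed
        also have "\<dots> \<le> 5 / 2 * (E * N2) * 1"
        proof -
          have "b powr (2 / 5) \<le> 1" using b powr_mono2[of "2 / 5" b 1] by simp
          then have "5 / 2 * (E * N2) * b powr (2 / 5) \<le> 5 / 2 * (E * N2) * 1" using E N2 by (intro mult_left_mono) auto
          moreover have "0 \<le> 5 / 2 * (E * N2) * s powr (2 / 5)" using E N2 by (intro mult_nonneg_nonneg) auto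
          ultimately show ?thesis by linarith
        qed
        finally show "\<bar>A b - A s\<bar> \<le> 5 / 2 * (E * N2)" by simp
      qed
    qed simp
    have Ab: "A b \<ge> - ((2 * \<mu> + lam) * (2 / b ^ 3 * (3 * (2 * N5 * V5))) + 2 / b ^ 3 * Pb)"
    proof -
      have idv: "integrable (lebesgue_on \<Omega>) (pd j (\<lambda>y. v y $ j))" and idv1: "(LINT y|lebesgue_on \<Omega>. \<bar>pd j (\<lambda>y. v y $ j) y\<bar>) \<le> 2 * N5 * V5" for j
        using Lp_integral_le[OF op F(2) pv5[of j j] _ _ pos(4)] pv5'[of j j] by (auto simp: V5_def)
      have dve: "divg pd v y = (\<Sum>j\<in>UNIV. pd j (\<lambda>y. v y $ j) y)" if "y \<in> \<Omega>" for y
        unfolding divg_def by (rule sum.cong) (auto simp: vid[OF that])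
      have id0: "integrable (lebesgue_on \<Omega>) (\<lambda>y. \<Sum>j\<in>UNIV. pd j (\<lambda>y. v y $ j) y)"
        using idv by (intro Bochner_Integration.integrable_sum)
      have idd: "integrable (lebesgue_on \<Omega>) (divg pd v)"
        by (rule Bochner_Integration.integrable_cong[OF refl, THEN iffD2, OF _ id0]) (simp add: dve space_restrict_space)
      have "(LINT y|lebesgue_on \<Omega>. \<bar>divg pd v y\<bar>) \<le> (LINT y|lebesgue_on \<Omega>. (\<Sum>j\<in>UNIV. \<bar>pd j (\<lambda>y. v y $ j) y\<bar>))"
        by (rule integral_mono_AE) (use idd idv in \<open>auto simp: space_restrict_space dve sum_abs intro!: AE_I2\<close>)
      also have "\<dots> = (\<Sum>j\<in>UNIV. LINT y|lebesgue_on \<Omega>. \<bar>pd j (\<lambda>y. v y $ j) y\<bar>)"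
        using idv by (intro Bochner_Integration.integral_sum) auto
      also have "\<dots> \<le> (\<Sum>j\<in>(UNIV::3 set). 2 * N5 * V5)" by (rule sum_mono) (rule idv1)
      finally have nd: "(LINT y|lebesgue_on \<Omega>. \<bar>divg pd v y\<bar>) \<le> 3 * (2 * N5 * V5)" by simp
      note AD = avg_L1_bound[OF op sk b(1,2) \<zeta>2 idd] and AP = avg_L1_bound[OF op sk b(1,2) \<zeta>2 Pi(1)]
      have "A b = (2 * \<mu> + lam) * avg \<zeta> x (divg pd v) b - avg \<zeta> x Pf b"
      proof -
        have iF: "integrable (lebesgue_on \<Omega>) Fl" unfolding Fl_def[abs_def] using idd Pi(1) by auto
        have "A b = (LINT w|lebesgue_on \<Omega>. (2 * \<mu> + lam) * (divg pd v w * ker \<zeta> x b w) - Pf w * ker \<zeta> x b w)"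
          unfolding A_def avg_L1_bound(2)[OF op sk b(1,2) \<zeta>2 iF] Fl_def by (simp add: algebra_simps)
        also have "\<dots> = (2 * \<mu> + lam) * avg \<zeta> x (divg pd v) b - avg \<zeta> x Pf b"
          unfolding AD(2) AP(2) using AD(3) AP(3) by simp
        finally show ?thesis .
      qed
      moreover have "\<bar>avg \<zeta> x (divg pd v) b\<bar> \<le> 2 / b ^ 3 * (3 * (2 * N5 * V5))"
        using b by (intro order_trans[OF AD(1)] mult_left_mono nd) auto
      then have "(2 * \<mu> + lam) * \<bar>avg \<zeta> x (divg pd v) b\<bar> \<le> (2 * \<mu> + lam) * (2 / b ^ 3 * (3 * (2 * N5 * V5)))"
        using pos by (intro mult_left_mono) auto
      then have "(2 * \<mu> + lam) * avg \<zeta> x (divg pd v) b \<ge> - ((2 * \<mu> + lam) * (2 / b ^ 3 * (3 * (2 * N5 * V5))))"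
        using abs_mult[of "2 * \<mu> + lam" "avg \<zeta> x (divg pd v) b"] pos(7) by linarith
      moreover have "\<bar>avg \<zeta> x Pf b\<bar> \<le> 2 / b ^ 3 * Pb"
        using b by (intro order_trans[OF AP(1)] mult_left_mono Pi(2)) auto
      ultimately show ?thesis by linarith
    qed
    \<comment> \<open>\<open>N2 \<ge> 1\<close> absorbs the contributions that do not involve
      a.\<close>
    have FI: "Fl x * I \<ge> - (C0 * N2)"
    proof -
      define c where "c = (2 * \<mu> + lam) * (2 / b ^ 3 * (3 * (2 * N5 * V5))) + 2 / b ^ 3 * Pb"
      have "0 \<le> c" unfolding c_def using pos VV b by (auto intro!: add_nonneg_nonneg mult_nonneg_nonneg)
      then have "c * 1 \<le> c * N2" using N2 by (intro mult_left_mono)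
      moreover have "C0 * N2 = c * N2 + 5 / 2 * (E * N2)" by (simp add: C0_def c_def algebra_simps)
      moreover have "A b \<ge> - c" using Ab by (simp add: c_def)
      ultimately show ?thesis using close by linarith
    qed
    have "(2 * \<mu> + lam) * divg pd v x \<ge> Fl x" using P0[OF x\<Omega>] by (simp add: Fl_def)
    then have "(2 * \<mu> + lam) * divg pd v x * I \<ge> Fl x * I" using I(1) by (intro mult_right_mono) auto
    with FI have "- (C0 * N2) \<le> divg pd v x * (I * (2 * \<mu> + lam))" by (simp add: mult_ac)
    then have "- (C0 * N2) / (I * (2 * \<mu> + lam)) \<le> divg pd v x" using I(1) pos by (subst pos_divide_le_eq) auto
    moreover have "- (C0 / (I * (2 * \<mu> + lam)) + 1) * N2 \<le> - (C0 * N2) / (I * (2 * \<mu> + lam))"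
      using N2 by (simp add: algebra_simps)
    ultimately show "- (C0 / (I * (2 * \<mu> + lam)) + 1) * N2 \<le> divg pd v x" by linarith
  qed
qed

section \<open>Lp norms and constants on the domain\<close>

lemma Lp_norm_powr: "p > 0 \<Longrightarrow> Lp_norm \<Omega> p f powr p = (LINT x|lebesgue_on \<Omega>. norm (f x) powr p)"
  by (simp add: Lp_norm_def powr_powr)

lemma measure_domain_pos:
  assumes "smooth_bounded_domain \<Omega>"
  shows "measure lebesgue \<Omega> > 0"
proof -
  note F = smooth_bounded_domain_frontier[OF assms]
  have "\<not> negligible \<Omega>" using open_not_negligible F(1,3) by blast
  then show ?thesis using negligible_iff_measure[of \<Omega>] lmeasurable_open[OF F(2,1)] zero_less_measure_iff[of lebesgue \<Omega>] by auto
qed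

lemma integral_const_domain:
  assumes "smooth_bounded_domain \<Omega>"
  shows "integrable (lebesgue_on \<Omega>) (\<lambda>x. k :: real)" "(LINT x|lebesgue_on \<Omega>. k) = k * measure lebesgue \<Omega>"
proof -
  note F = smooth_bounded_domain_frontier[OF assms]
  have O: "\<Omega> \<in> sets lebesgue" by (rule open_sets_lebesgue[OF F(1)])
  have "finite_measure (lebesgue_on \<Omega>)"
    using F(1,2) by (intro finite_measure_lebesgue_on lmeasurable_open)
  then show "integrable (lebesgue_on \<Omega>) (\<lambda>x. k :: real)" by (rule finite_measure.integrable_const)
  show "(LINT x|lebesgue_on \<Omega>. k) = k * measure lebesgue \<Omega>"
    using O by (simp add: measure_restrict_space space_restrict_space)
qed

subsection \<open>Growth of the density gradient\<close>

text \<open>At a near-vacuum point \<open>\<bar>f - 1\<bar>\<close> is almost 1, although its mean decays; interpolate at the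
  scale \<open>s = exp (- \<alpha> t / 6)\<close>. For bounded \<open>t\<close> the oscillation of \<open>f\<close>, whose mean is 1, suffices.\<close>
theorem gradient_growth:
  assumes dom: "smooth_bounded_domain \<Omega>" and p: "p > 3" and \<alpha>: "\<alpha> > 0" and C1: "C1 > 0"
  obtains C where "C > 0"
    "\<And>f t. (\<And>x. x \<in> \<Omega> \<Longrightarrow> f differentiable (at x)) \<Longrightarrow> (\<And>i. continuous_on \<Omega> (pd i f)) \<Longrightarrow> grad pd f \<in> Lp \<Omega> p \<Longrightarrow>
      integrable (lebesgue_on \<Omega>) (\<lambda>x. f x - 1) \<Longrightarrow> (LINT x|lebesgue_on \<Omega>. \<bar>f x - 1\<bar>) \<le> C1 * exp (- \<alpha> * t) \<Longrightarrow>
      (LINT x|lebesgue_on \<Omega>. f x) = measure lebesgue \<Omega> \<Longrightarrow> (\<And>e. e > 0 \<Longrightarrow> \<exists>y\<in>\<Omega>. f y < e) \<Longrightarrow> t \<ge> 0 \<Longrightarrow>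
      C * exp (C * t) \<le> Lp_norm \<Omega> p (grad pd f)"
proof -
  note F = smooth_bounded_domain_frontier[OF dom]
  have O: "\<Omega> \<in> sets lebesgue" by (rule open_sets_lebesgue[OF F(1)])
  obtain A where A: "A > 0"
    "\<And>v N y s. good_fun \<Omega> p N v \<Longrightarrow> integrable (lebesgue_on \<Omega>) v \<Longrightarrow> y \<in> \<Omega> \<Longrightarrow> 0 < s \<Longrightarrow> s \<le> 1 \<Longrightarrow>
      \<bar>v y\<bar> \<le> A * N * s powr (1 - 3 / p) + A / s ^ 3 * (LINT w|lebesgue_on \<Omega>. \<bar>v w\<bar>)"
    by (rule morrey_interpolation[OF dom p]) (rule that)
  obtain A' where A': "A' > 0"
    "\<And>v N x y. good_fun \<Omega> p N v \<Longrightarrow> x \<in> \<Omega> \<Longrightarrow> y \<in> \<Omega> \<Longrightarrow> \<bar>v x - v y\<bar> \<le> A' * N"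
    by (rule morrey_oscillation[OF dom p]) (rule that)
  define \<beta> where "\<beta> = 1 - 3 / p"
  have \<beta>: "\<beta> > 0" using p by (simp add: \<beta>_def)
  \<comment> \<open>With s = exp (- \<alpha> t / 6) one has s^\<beta> = exp (- k t), and s^3 = exp
    (- \<alpha> t / 2) costs only half of the decay of the L1 norm.\<close>
  define k where "k = \<alpha> * \<beta> / 6"
  have k: "k > 0" using \<alpha> \<beta> by (simp add: k_def)
  \<comment> \<open>From this time on the L1 term A C1 exp (- \<alpha> t / 2) is at most
    1/4.\<close>
  define T0 where "T0 = max 0 (2 / \<alpha> * ln (4 * A * C1))"
  define D where "D = min (1 / (4 * A)) (exp (- k * T0) / (2 * A'))"
  have D: "D > 0" using A(1) A'(1) by (simp add: D_def)
  \<comment> \<open>One constant serves as prefactor and as rate, as the statement demands.\<close>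
  define C where "C = min D k"
  have C: "C > 0" using D k by (simp add: C_def)
  show thesis
  proof (rule that[OF C])
    fix f :: "real^3 \<Rightarrow> real" and t :: real
    assume d: "\<And>x. x \<in> \<Omega> \<Longrightarrow> f differentiable (at x)" and cp: "\<And>i. continuous_on \<Omega> (pd i f)" and Lp: "grad pd f \<in> Lp \<Omega> p"
      and int: "integrable (lebesgue_on \<Omega>) (\<lambda>x. f x - 1)" and J: "(LINT x|lebesgue_on \<Omega>. \<bar>f x - 1\<bar>) \<le> C1 * exp (- \<alpha> * t)"
      and mean: "(LINT x|lebesgue_on \<Omega>. f x) = measure lebesgue \<Omega>" and inf: "\<And>e. e > 0 \<Longrightarrow> \<exists>y\<in>\<Omega>. f y < e" and t: "t \<ge> 0"
    define g where "g x = f x - 1" for x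
    have dg: "g differentiable (at x)" and pg: "pd i g x = pd i f x" if "x \<in> \<Omega>" for x i
      using d[OF that] pd_diff[of f x "\<lambda>_. 1" i] by (auto simp: g_def[abs_def])
    have cpg: "continuous_on \<Omega> (pd i g)" for i
      using cp[of i] continuous_on_cong[of \<Omega> \<Omega> "pd i g" "pd i f"] pg by simp
    have cg: "continuous_on \<Omega> g"
      using dg by (auto intro!: continuous_at_imp_continuous_on differentiable_imp_continuous_within)
    have le: "\<bar>pd i g x\<bar> powr p \<le> norm (grad pd f x) powr p" if "x \<in> \<Omega>" for x i
      using pg[OF that, of i] component_le_norm_cart[of "grad pd f x" i] p by (intro powr_mono2) (auto simp: grad_def)
    have ig: "integrable (lebesgue_on \<Omega>) (\<lambda>x. norm (grad pd f x) powr p)" using Lp by (simp add: Lp_def)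
    have mg: "pd i g \<in> borel_measurable (lebesgue_on \<Omega>)" for i
      by (rule continuous_imp_measurable_on_sets_lebesgue[OF cpg O])
    have ip: "integrable (lebesgue_on \<Omega>) (\<lambda>x. \<bar>pd i g x\<bar> powr p)" for i
      by (rule Bochner_Integration.integrable_bound[OF ig]) (use mg le in \<open>auto simp: space_restrict_space intro!: AE_I2\<close>)
    \<comment> \<open>Any N above the norm is used instead of the norm itself, because
      \<open>good_fun\<close> asks for N > 0; the norm is recovered at the end by letting N decrease
      to it.\<close>
    have main: "D * exp (k * t) \<le> N" if N: "Lp_norm \<Omega> p (grad pd f) < N" for N
    proof -
      have N0: "Lp_norm \<Omega> p (grad pd f) \<ge> 0" by (simp add: Lp_norm_def)
      have lN: "(LINT x|lebesgue_on \<Omega>. \<bar>pd i g x\<bar> powr p) \<le> N powr p" for i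
      proof -
        have "(LINT x|lebesgue_on \<Omega>. \<bar>pd i g x\<bar> powr p) \<le> (LINT x|lebesgue_on \<Omega>. norm (grad pd f x) powr p)"
          by (rule integral_mono_AE) (use ip ig le in \<open>auto simp: space_restrict_space intro!: AE_I2\<close>)
        also have "\<dots> = Lp_norm \<Omega> p (grad pd f) powr p" using p by (simp add: Lp_norm_powr)
        also have "\<dots> \<le> N powr p" using N N0 p by (intro powr_mono2) auto
        finally show ?thesis .
      qed
      have "weak_grad_bound \<Omega> p N g"
        unfolding weak_grad_bound_def
      proof
        fix i
        show "\<exists>h. has_weak_deriv \<Omega> (axis i 1) g h \<and> h \<in> Lp \<Omega> p \<and> (LINT x|lebesgue_on \<Omega>. \<bar>h x\<bar> powr p) \<le> N powr p"
          using classical_weak_deriv[OF F(1) dg cpg, of i] ip[of i] mg[of i] lN[of i] unfolding Lp_def by (intro exI[of _ "pd i g"]) simp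
      qed
      then have good: "good_fun \<Omega> p N g" using N N0 cg by (simp add: good_fun_def)
      obtain y where y: "y \<in> \<Omega>" "f y < 1 / 4" using inf[of "1 / 4"] by auto
      show ?thesis
      proof (cases "t \<ge> T0")
        case True
        define s where "s = exp (- \<alpha> * t / 6)"
        have s: "0 < s" "s \<le> 1" using \<alpha> t by (auto simp: s_def)
        have s3: "s ^ 3 = exp (- \<alpha> * t / 2)" by (simp add: s_def exp_of_nat_mult[symmetric])
        have "4 * A * C1 > 0" using A(1) C1 by simp
        moreover have "ln (4 * A * C1) \<le> \<alpha> * t / 2"
          using True \<alpha> by (simp add: T0_def field_simps)
        ultimately have e1: "4 * A * C1 \<le> exp (\<alpha> * t / 2)" by (metis exp_le_cancel_iff exp_ln)
        have sb: "s powr \<beta> = exp (- (k * t))" by (simp add: s_def k_def powr_def)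
        have "A / s ^ 3 * (LINT w|lebesgue_on \<Omega>. \<bar>g w\<bar>) \<le> A / s ^ 3 * (C1 * exp (- \<alpha> * t))"
          using J A(1) s by (intro mult_left_mono) (auto simp: g_def)
        also have "\<dots> = A * C1 * exp (- (\<alpha> * t / 2))"
          unfolding s3 by (simp add: field_simps exp_add[symmetric] exp_diff[symmetric])
        also have "\<dots> \<le> 1 / 4" using e1 by (simp add: exp_minus field_simps)
        finally have "A / s ^ 3 * (LINT w|lebesgue_on \<Omega>. \<bar>g w\<bar>) \<le> 1 / 4" .
        moreover have "\<bar>g y\<bar> \<le> A * N * s powr \<beta> + A / s ^ 3 * (LINT w|lebesgue_on \<Omega>. \<bar>g w\<bar>)"
          unfolding \<beta>_def by (rule A(2)[OF good _ y(1) s]) (use int in \<open>simp add: g_def[abs_def]\<close>)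
        moreover have "\<bar>g y\<bar> \<ge> 3 / 4" using y(2) by (simp add: g_def)
        ultimately have "1 / 4 \<le> A * N * exp (- (k * t))" unfolding sb by linarith
        then have "1 / 4 * exp (k * t) \<le> A * N * exp (- (k * t)) * exp (k * t)" by (intro mult_right_mono) auto
        also have "\<dots> = A * N" by (simp add: mult.assoc exp_add[symmetric])
        finally have "1 / (4 * A) * exp (k * t) \<le> N" using A(1) by (simp add: field_simps)
        moreover have "D * exp (k * t) \<le> 1 / (4 * A) * exp (k * t)" by (intro mult_right_mono) (auto simp: D_def)
        ultimately show ?thesis by linarith
      next
        case False
        \<comment> \<open>A function of mean 1 cannot stay below 3/4. Together with a value below
          1/4 this gives oscillation at least 1/2.\<close>
        have "\<exists>x\<in>\<Omega>. f x \<ge> 3 / 4"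
        proof (rule ccontr)
          assume "\<not> ?thesis"
          then have lt: "f x \<le> 3 / 4" if "x \<in> \<Omega>" for x using that by force
          have "integrable (lebesgue_on \<Omega>) (\<lambda>x. (f x - 1) + 1)"
            by (rule Bochner_Integration.integrable_add[OF int integral_const_domain(1)[OF dom]])
          then have i: "integrable (lebesgue_on \<Omega>) f" by simp
          have "(LINT x|lebesgue_on \<Omega>. f x) \<le> (LINT x|lebesgue_on \<Omega>. 3 / 4)"
            by (rule integral_mono_AE[OF i integral_const_domain(1)[OF dom]]) (use lt in \<open>auto simp: space_restrict_space intro!: AE_I2\<close>)
          then have "(LINT x|lebesgue_on \<Omega>. f x) \<le> 3 / 4 * measure lebesgue \<Omega>" unfolding integral_const_domain(2)[OF dom] .
          then show False using mean measure_domain_pos[OF dom] by linarith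
        qed
        then obtain x where x: "x \<in> \<Omega>" "f x \<ge> 3 / 4" by blast
        have "1 / 2 \<le> A' * N" using A'(2)[OF good x(1) y(1)] x(2) y(2) by (simp add: g_def)
        then have n: "1 / (2 * A') \<le> N" using A'(1) by (simp add: field_simps)
        have "k * t \<le> k * T0" using False k by (intro mult_left_mono) auto
        then have el: "exp (- k * T0) * exp (k * t) \<le> 1" by (simp add: exp_add[symmetric])
        have "D * exp (k * t) \<le> exp (- k * T0) / (2 * A') * exp (k * t)" by (intro mult_right_mono) (auto simp: D_def)
        also have "\<dots> = (exp (- k * T0) * exp (k * t)) * (1 / (2 * A'))" by simp
        also have "\<dots> \<le> 1 * (1 / (2 * A'))" using A'(1) by (intro mult_right_mono el) simp
        finally show ?thesis using n by linarith
      qed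
    qed
    have "C * t \<le> k * t" using t by (intro mult_right_mono) (auto simp: C_def)
    then have "C * exp (C * t) \<le> D * exp (k * t)" using D by (intro mult_mono) (auto simp: C_def)
    also have "\<dots> \<le> Lp_norm \<Omega> p (grad pd f)" by (rule dense_ge) (rule main)
    finally show "C * exp (C * t) \<le> Lp_norm \<Omega> p (grad pd f)" .
  qed
qed

section \<open>Auxiliary facts on limits and suprema in time\<close>

text \<open>Violation would occur on a nonempty open set, which is not negligible. This turns
  regularity for almost every time into bounds for every time.\<close>

lemma AE_le_imp_le:
  fixes g :: "real \<Rightarrow> real"
  assumes g: "continuous_on {a<..<b} g" and ae: "AE t in lebesgue_on {a<..<b}. g t \<le> c" and t: "t \<in> {a<..<b}"
  shows "g t \<le> c"
proof (rule ccontr)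
  assume n: "\<not> g t \<le> c"
  define S where "S = {a<..<b} \<inter> g -` {c<..}"
  have oS: "open S" unfolding S_def using g by (intro continuous_open_preimage) auto
  have tS: "t \<in> S" using n t by (auto simp: S_def)
  have "AE t in lebesgue. t \<in> {a<..<b} \<longrightarrow> g t \<le> c"
    using ae by (subst (asm) AE_lebesgue_on) auto
  then have "AE t in lebesgue. t \<notin> S" by eventually_elim (auto simp: S_def)
  moreover have "S \<in> sets lebesgue" using oS by auto
  ultimately have "negligible S" using AE_iff_null_sets negligible_iff_null_sets by blast
  then show False using open_not_negligible[OF oS] tS by blast
qed

lemma attains_initially_L1:
  fixes f :: "real \<Rightarrow> real^3 \<Rightarrow> real"
  assumes \<Omega>: "open \<Omega>" "bounded \<Omega>" and f: "attains_initially \<Omega> f f0"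
  shows "eventually (\<lambda>t. integrable (lebesgue_on \<Omega>) (\<lambda>x. f t x - f0 x)) (at_right 0)"
    "((\<lambda>t. LINT x|lebesgue_on \<Omega>. \<bar>f t x - f0 x\<bar>) \<longlongrightarrow> 0) (at_right 0)"
proof -
  define V where "V = measure lebesgue \<Omega> powr (1 - 1 / 2)"
  have V: "V \<ge> 0" by (simp add: V_def)
  have ev: "eventually (\<lambda>t. integrable (lebesgue_on \<Omega>) (\<lambda>x. f t x - f0 x) \<and> (LINT x|lebesgue_on \<Omega>. \<bar>f t x - f0 x\<bar>) < e) (at_right 0)" if e: "e > 0" for e
  proof -
    define N where "N = e / (2 * V + 1)"
    have N: "N > 0" using e V by (simp add: N_def)
    have "2 * N * V < N * (2 * V + 1)" using N by (simp add: algebra_simps)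
    also have "\<dots> = e" using V by (simp add: N_def)
    finally have NV: "2 * N * V < e" .
    have "eventually (\<lambda>t. dist (Lp_norm \<Omega> 2 (\<lambda>x. f t x - f0 x)) 0 < N) (at_right 0)"
      using f N unfolding attains_initially_def by (intro tendstoD) auto
    moreover have "eventually (\<lambda>t. (\<lambda>x. f t x - f0 x) \<in> Lp \<Omega> 2) (at_right 0)"
      using f unfolding attains_initially_def by blast
    ultimately show ?thesis
    proof eventually_elim
      case (elim t)
      let ?g = "\<lambda>x. f t x - f0 x"
      have "(LINT x|lebesgue_on \<Omega>. \<bar>?g x\<bar> powr 2) = Lp_norm \<Omega> 2 ?g powr 2" using Lp_norm_powr[of 2 \<Omega> ?g] by simp
      also have "\<dots> \<le> N powr 2" using elim(1) by (intro powr_mono2) (auto simp: Lp_norm_def)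
      finally have "(LINT x|lebesgue_on \<Omega>. \<bar>?g x\<bar> powr 2) \<le> N powr 2" .
      from Lp_integral_le[OF \<Omega> elim(2) _ this N] NV show ?case by (auto simp: V_def)
    qed
  qed
  show "eventually (\<lambda>t. integrable (lebesgue_on \<Omega>) (\<lambda>x. f t x - f0 x)) (at_right 0)"
    using ev[of 1] by (auto elim: eventually_mono)
  show "((\<lambda>t. LINT x|lebesgue_on \<Omega>. \<bar>f t x - f0 x\<bar>) \<longlongrightarrow> 0) (at_right 0)"
  proof (rule tendstoI)
    fix e :: real assume "e > 0"
    from ev[OF this] show "eventually (\<lambda>t. dist (LINT x|lebesgue_on \<Omega>. \<bar>f t x - f0 x\<bar>) 0 < e) (at_right 0)"
      by eventually_elim simp
  qed
qed

text \<open>Uniform continuity on the compact product makes the maximum over K continuous in t for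
  any choice of maximisers. It supplies the continuous rate that \<open>min_gronwall\<close> asks
  for.\<close>

lemma continuous_on_SUP:
  fixes F :: "'a::metric_space \<Rightarrow> 'b::metric_space \<Rightarrow> real"
  assumes S: "compact S" and K: "compact K" "K \<noteq> {}" and F: "continuous_on (S \<times> K) (\<lambda>(t, x). F t x)"
  obtains h where "continuous_on S h" "\<And>t x. t \<in> S \<Longrightarrow> x \<in> K \<Longrightarrow> F t x \<le> h t" "\<And>t. t \<in> S \<Longrightarrow> \<exists>x\<in>K. h t = F t x"
proof -
  have c: "continuous_on K (F t)" if "t \<in> S" for t
    using continuous_on_compose2[OF F continuous_on_Pair1[of K t]] that by fastforce
  have "\<exists>x\<in>K. \<forall>y\<in>K. F t y \<le> F t x" if "t \<in> S" for t
    by (rule continuous_attains_sup[OF K c[OF that]])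
  then obtain m where m: "\<And>t. t \<in> S \<Longrightarrow> m t \<in> K" "\<And>t y. t \<in> S \<Longrightarrow> y \<in> K \<Longrightarrow> F t y \<le> F t (m t)" by metis
  have uc: "uniformly_continuous_on (S \<times> K) (\<lambda>(t, x). F t x)"
    using F compact_Times[OF S K(1)] by (rule compact_uniformly_continuous)
  have "uniformly_continuous_on S (\<lambda>t. F t (m t))"
    unfolding uniformly_continuous_on_def
  proof (intro allI impI)
    fix e :: real assume "e > 0"
    with uc obtain d where d: "d > 0" "\<And>z z'. z \<in> S \<times> K \<Longrightarrow> z' \<in> S \<times> K \<Longrightarrow> dist z' z < d \<Longrightarrow> dist (case z' of (t, x) \<Rightarrow> F t x) (case z of (t, x) \<Rightarrow> F t x) < e"
      unfolding uniformly_continuous_on_def by blast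
    show "\<exists>d>0. \<forall>t\<in>S. \<forall>t'\<in>S. dist t' t < d \<longrightarrow> dist (F t' (m t')) (F t (m t)) < e"
    proof (intro exI[of _ d] conjI ballI impI d(1))
      fix t t' assume t: "t \<in> S" "t' \<in> S" "dist t' t < d"
      have "\<bar>F t' x - F t x\<bar> < e" if "x \<in> K" for x
        using d(2)[of "(t, x)" "(t', x)"] t that by (simp add: dist_Pair_Pair dist_real_def)
      from this[OF m(1)[OF t(1)]] this[OF m(1)[OF t(2)]] m(2)[OF t(1) m(1)[OF t(2)]] m(2)[OF t(2) m(1)[OF t(1)]]
      show "dist (F t' (m t')) (F t (m t)) < e" by (simp add: dist_real_def)
    qed
  qed
  then have "continuous_on S (\<lambda>t. F t (m t))" by (rule uniformly_continuous_imp_continuous)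
  from that[OF this m(2)] m(1) show thesis by blast
qed

lemma bump1_mono: "a \<le> b \<Longrightarrow> bump1 a \<le> bump1 b"
proof (rule DERIV_nonneg_imp_nondecreasing[of a b bump1])
  fix z :: real
  have "(bump1 has_real_derivative cut' z) (at z)"
    unfolding bump1_def cut'_def by (rule expinv_derivative)
  then show "\<exists>y. (bump1 has_real_derivative y) (at z) \<and> 0 \<le> y" using cut'_bounds(1) by blast
qed

subsection \<open>Global classical solutions\<close>

locale ns_solution = continuity_flow \<Omega> \<rho> u "2 * \<rho>hat"
  for \<Omega> :: "(real^3) set" and \<rho> :: "real \<Rightarrow> real^3 \<Rightarrow> real" and u :: "real \<Rightarrow> real^3 \<Rightarrow> real^3" and \<rho>hat :: real +
  fixes \<mu> lam \<kappa> R \<gamma> M \<theta>hat q :: real and \<rho>0 \<theta>0 :: "real^3 \<Rightarrow> real" and u0 :: "real^3 \<Rightarrow> real^3" and \<theta> :: "real \<Rightarrow> real^3 \<Rightarrow> real"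
  assumes params: "\<mu> > 0" "2 * \<mu> + 3 * lam \<ge> 0" "R > 0" "\<rho>hat > 2" "q > 3"
    and data: "admissible_data \<mu> lam R \<Omega> M \<rho>hat \<theta>hat q \<rho>0 u0 \<theta>0"
    and sol: "global_classical_solution \<mu> lam \<kappa> R \<gamma> \<Omega> \<rho>hat q \<rho>0 u0 \<theta>0 \<rho> u \<theta>"
begin

lemma regularity:
  assumes "0 < \<tau>" "\<tau> < T" "1 \<le> p" "p < 6"
  shows "\<rho> \<in> C_Sob \<Omega> 0 T 2 q" "u \<in> C_Sob \<Omega> 0 T 1 p" "u \<in> Linf_Sob \<Omega> \<tau> T 3 q" "Dt u \<in> L2_Sob \<Omega> 0 T 1 2"
  using sol assms unfolding global_classical_solution_def NS_regularity_def by blast+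

lemma domain_measurable: "\<Omega> \<in> sets lebesgue"
  by (rule open_sets_lebesgue[OF \<Omega>_open])

lemma initial_L1:
  "eventually (\<lambda>t. integrable (lebesgue_on \<Omega>) (\<lambda>x. \<rho> t x - \<rho>0 x)) (at_right 0)"
  "((\<lambda>t. LINT x|lebesgue_on \<Omega>. \<bar>\<rho> t x - \<rho>0 x\<bar>) \<longlongrightarrow> 0) (at_right 0)"
  "eventually (\<lambda>t. integrable (lebesgue_on \<Omega>) (\<lambda>x. \<rho> t x * \<theta> t x - \<rho>0 x * \<theta>0 x)) (at_right 0)"
  "((\<lambda>t. LINT x|lebesgue_on \<Omega>. \<bar>\<rho> t x * \<theta> t x - \<rho>0 x * \<theta>0 x\<bar>) \<longlongrightarrow> 0) (at_right 0)"
proof -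
  have "attains_initially \<Omega> \<rho> \<rho>0" "attains_initially \<Omega> (\<lambda>t x. \<rho> t x * \<theta> t x) (\<lambda>x. \<rho>0 x * \<theta>0 x)"
    using sol unfolding global_classical_solution_def NS_initial_def by blast+
  then show "eventually (\<lambda>t. integrable (lebesgue_on \<Omega>) (\<lambda>x. \<rho> t x - \<rho>0 x)) (at_right 0)"
    "((\<lambda>t. LINT x|lebesgue_on \<Omega>. \<bar>\<rho> t x - \<rho>0 x\<bar>) \<longlongrightarrow> 0) (at_right 0)"
    "eventually (\<lambda>t. integrable (lebesgue_on \<Omega>) (\<lambda>x. \<rho> t x * \<theta> t x - \<rho>0 x * \<theta>0 x)) (at_right 0)"
    "((\<lambda>t. LINT x|lebesgue_on \<Omega>. \<bar>\<rho> t x * \<theta> t x - \<rho>0 x * \<theta>0 x\<bar>) \<longlongrightarrow> 0) (at_right 0)"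
    using attains_initially_L1[OF \<Omega>_open \<Omega>_bounded] by blast+
qed

text \<open>\<rho>(t) is in W2q with q > 3, so its gradient is bounded and lies in every Lp, also
  for p > q. Without membership a lower bound on \<open>Lp_norm\<close> would be void, as the
  integral of a non-integrable function is 0.\<close>

lemma grad_rho_Lp:
  assumes t: "t > 0" and p: "p > 0"
  shows "grad pd (\<rho> t) \<in> Lp \<Omega> p"
proof -
  obtain C where C: "C > 0" "\<And>f N y. (\<And>x. x \<in> \<Omega> \<Longrightarrow> f differentiable (at x)) \<Longrightarrow> (\<And>i. continuous_on \<Omega> (pd i f)) \<Longrightarrow> wd_bound \<Omega> 2 q N f \<Longrightarrow> N > 0 \<Longrightarrow> y \<in> \<Omega> \<Longrightarrow>
       \<bar>f y :: real\<bar> \<le> C * N \<and> (\<forall>i. \<bar>pd i f y\<bar> \<le> C * N)" by (rule C1_bound[OF dom params(5)]) (rule that; blast)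
  define N where "N = sob_norm \<Omega> 2 q (\<rho> t) + 1"
  have N: "N > 0" using sob_norm_nonneg[of \<Omega> 2 q "\<rho> t"] by (simp add: N_def)
  have "\<rho> t \<in> Sob \<Omega> 2 q" using regularity(1)[of "t / 2" t 1] t by (simp add: C_Sob_def)
  then have wd: "wd_bound \<Omega> 2 q N (\<rho> t)" using params(5) by (intro Sob_wd_bound[OF \<Omega>_open]) (auto simp: N_def)
  have le: "norm (grad pd (\<rho> t) x) \<le> 3 * (C * N)" if "x \<in> \<Omega>" for x
    using C(2)[OF rho_diff[OF t] rho_pd_cont[OF t] wd N that] by (intro norm_le_3) (simp add: grad_def)
  have "continuous_on \<Omega> (grad pd (\<rho> t))"
    unfolding grad_def[abs_def] by (intro continuous_on_vec_lambda rho_pd_cont[OF t])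
  then have m: "grad pd (\<rho> t) \<in> borel_measurable (lebesgue_on \<Omega>)"
    by (rule continuous_imp_measurable_on_sets_lebesgue[OF _ domain_measurable])
  have "integrable (lebesgue_on \<Omega>) (\<lambda>x. norm (grad pd (\<rho> t) x) powr p)"
  proof (rule Bochner_Integration.integrable_bound[OF integral_const_domain(1)[OF dom, of "(3 * (C * N)) powr p"]])
    show "(\<lambda>x. norm (grad pd (\<rho> t) x) powr p) \<in> borel_measurable (lebesgue_on \<Omega>)" using m by measurable
    show "AE x in lebesgue_on \<Omega>. norm (norm (grad pd (\<rho> t) x) powr p) \<le> norm ((3 * (C * N)) powr p)"
      using le p by (intro AE_I2) (auto simp: space_restrict_space intro!: powr_mono2)
  qed
  with m show ?thesis by (simp add: Lp_def)
qed

lemma cont_tx_time: "cont_tx \<Omega> f \<Longrightarrow> y \<in> \<Omega> \<Longrightarrow> S \<subseteq> {0<..} \<Longrightarrow> continuous_on S (\<lambda>t. f t y)"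
  unfolding cont_tx_def using continuous_on_compose2[of "{0<..} \<times> \<Omega>" "\<lambda>(t, x). f t x" S "\<lambda>t. (t, y)"]
  by (fastforce intro!: continuous_on_Pair continuous_on_id continuous_on_const)

text \<open>The W3q bound holds for almost every time only; for fixed y the velocity and its
  derivatives are continuous in t, so the resulting C1 bound holds at every time.\<close>

lemma tangential_ex:
  assumes "0 < \<tau>" "\<tau> \<le> T"
  shows "\<exists>L. \<forall>t\<in>{\<tau>..T}. tangential \<Omega> L (u t)"
proof -
  obtain C where C: "C > 0" "\<And>f N y. (\<And>x. x \<in> \<Omega> \<Longrightarrow> f differentiable (at x)) \<Longrightarrow> (\<And>i. continuous_on \<Omega> (pd i f)) \<Longrightarrow> wd_bound \<Omega> 2 q N f \<Longrightarrow> N > 0 \<Longrightarrow> y \<in> \<Omega> \<Longrightarrow>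
       \<bar>f y :: real\<bar> \<le> C * N \<and> (\<forall>i. \<bar>pd i f y\<bar> \<le> C * N)" by (rule C1_bound[OF dom params(5)]) (rule that; blast)
  \<comment> \<open>A larger open interval, so that every time in {\<tau>..T} is an interior
    one.\<close>
  let ?I = "{\<tau> / 2<..<T + 1}"
  have "u \<in> Linf_Sob \<Omega> (\<tau> / 2) (T + 1) 3 q" using regularity(3)[of "\<tau> / 2" "T + 1" 1] assms by simp
  then obtain Bd where ae: "AE t in lebesgue_on ?I. u t \<in> Sob \<Omega> 3 q \<and> sob_norm \<Omega> 3 q (u t) \<le> Bd"
    unfolding Linf_Sob_def by blast
  define N where "N = max 1 Bd"
  have N: "N > 0" "Bd \<le> N" by (auto simp: N_def)
  define L where "L = C * N"
  have good: "\<bar>u t y $ k\<bar> \<le> L \<and> \<bar>pd i (u t) y $ k\<bar> \<le> L"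
    if t: "t > 0" and S: "u t \<in> Sob \<Omega> 3 q" "sob_norm \<Omega> 3 q (u t) \<le> Bd" and y: "y \<in> \<Omega>" for t y i k
  proof -
    have "wd_bound \<Omega> 3 q N (u t)" using S N params(5) by (intro Sob_wd_bound[OF \<Omega>_open]) auto
    then have "wd_bound \<Omega> 2 q N (u t)" by (rule wd_bound_mono_order) simp
    then have wd: "wd_bound \<Omega> 2 q N (\<lambda>x. u t x $ k)" using params(5) by (intro wd_bound_nth[OF \<Omega>_open]) auto
    have pe: "pd i (\<lambda>x. u t x $ k) x = pd i (u t) x $ k" if "x \<in> \<Omega>" for x i by (rule pd_nth[OF u_diff[OF t that]])
    have "continuous_on \<Omega> (pd i (\<lambda>x. u t x $ k))" for i
      using continuous_on_cong[of \<Omega> \<Omega> "pd i (\<lambda>x. u t x $ k)" "\<lambda>x. pd i (u t) x $ k"] pe continuous_on_component[OF u_pd_cont[OF t]] by simp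
    from C(2)[OF differentiable_nth[OF u_diff[OF t]] this wd N(1) y] pe[OF y] show ?thesis by (simp add: L_def)
  qed
  have all: "\<bar>u t y $ k\<bar> \<le> L" "\<bar>pd i (u t) y $ k\<bar> \<le> L" if t: "t \<in> ?I" and y: "y \<in> \<Omega>" for t y i k
  proof -
    have I: "?I \<subseteq> {0<..}" using assms by auto
    have ae2: "AE t in lebesgue_on ?I. \<bar>u t y $ k\<bar> \<le> L \<and> \<bar>pd i (u t) y $ k\<bar> \<le> L"
      using ae AE_space
    proof eventually_elim
      case (elim t)
      then show ?case using I by (intro good y) (auto simp: space_restrict_space)
    qed
    have c: "continuous_on ?I (\<lambda>t. u t y)" "continuous_on ?I (\<lambda>t. pd i (u t) y)"
      using u_C1 unfolding C1_tx_def by (auto intro!: cont_tx_time y I)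
    show "\<bar>u t y $ k\<bar> \<le> L"
      by (rule AE_le_imp_le[OF _ _ t]) (use ae2 in \<open>auto intro!: continuous_intros c elim: eventually_mono\<close>)
    show "\<bar>pd i (u t) y $ k\<bar> \<le> L"
      by (rule AE_le_imp_le[OF _ _ t]) (use ae2 in \<open>auto intro!: continuous_intros c elim: eventually_mono\<close>)
  qed
  have "tangential \<Omega> L (u t)" if "t \<in> {\<tau>..T}" for t
  proof -
    have t: "t > 0" "t \<in> ?I" using that assms by auto
    have "\<forall>x\<in>frontier \<Omega>. ((\<lambda>y. u t y \<bullet> nrml \<Omega> x) \<longlongrightarrow> 0) (at x within \<Omega>)"
      using sol t(1) unfolding global_classical_solution_def NS_boundary_def by blast
    then show ?thesis unfolding tangential_def using u_diff[OF t(1)] all[OF t(2)] C(1) N by (simp add: L_def)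
  qed
  then show ?thesis by blast
qed

lemma initial_mass: "integrable (lebesgue_on \<Omega>) \<rho>0" "(LINT x|lebesgue_on \<Omega>. \<rho>0 x) = measure lebesgue \<Omega>"
proof -
  have "(LINT x|lebesgue_on \<Omega>. \<rho>0 x) / measure lebesgue \<Omega> = 1" using data unfolding admissible_data_def by blast
  then show eq: "(LINT x|lebesgue_on \<Omega>. \<rho>0 x) = measure lebesgue \<Omega>"
    using measure_domain_pos[OF dom] by (simp add: field_simps)
  \<comment> \<open>A non-integrable function has integral 0 by convention, whereas this one has the
    positive integral \<open>measure lebesgue \<Omega>\<close>.\<close>
  show "integrable (lebesgue_on \<Omega>) \<rho>0"
    using not_integrable_integral_eq[of "lebesgue_on \<Omega>" \<rho>0] eq measure_domain_pos[OF dom] by force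
qed

text \<open>Mass is conserved on [s, t] for every s > 0, with a velocity bound that may deteriorate
  with s; attainment of the initial density in L1 closes the gap as s tends to 0.\<close>

lemma mass_eq:
  assumes t: "t > 0"
  shows "(LINT x|lebesgue_on \<Omega>. \<rho> t x) = measure lebesgue \<Omega>"
proof -
  have "eventually (\<lambda>s. s < t) (at_right (0::real))" using t eventually_at_right_field by blast
  then have "eventually (\<lambda>s. \<bar>(LINT x|lebesgue_on \<Omega>. \<rho> t x) - measure lebesgue \<Omega>\<bar> \<le> (LINT x|lebesgue_on \<Omega>. \<bar>\<rho> s x - \<rho>0 x\<bar>)) (at_right 0)"
    using initial_L1(1) eventually_at_right_less[of 0]
  proof eventually_elim
    case (elim s)
    obtain L where "\<forall>r\<in>{s..t}. tangential \<Omega> L (u r)" using tangential_ex[of s t] elim by auto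
    then have L: "\<And>r. r \<in> {s..t} \<Longrightarrow> tangential \<Omega> L (u r)" by blast
    have eq: "(LINT x|lebesgue_on \<Omega>. \<rho> t x) = (LINT x|lebesgue_on \<Omega>. \<rho> s x)"
      using elim by (intro mass_conserved[OF _ _ L]) auto
    have "integrable (lebesgue_on \<Omega>) (\<lambda>x. (\<rho> s x - \<rho>0 x) + \<rho>0 x)"
      by (rule Bochner_Integration.integrable_add[OF elim(2) initial_mass(1)])
    then have "(LINT x|lebesgue_on \<Omega>. \<rho> s x) - measure lebesgue \<Omega> = (LINT x|lebesgue_on \<Omega>. \<rho> s x - \<rho>0 x)"
      using initial_mass by (subst Bochner_Integration.integral_diff) auto
    then show ?case unfolding eq using integral_abs_bound[of "lebesgue_on \<Omega>" "\<lambda>x. \<rho> s x - \<rho>0 x"] by simp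
  qed
  from tendsto_lowerbound[OF initial_L1(2) this] show ?thesis by simp
qed

text \<open>Unlike the velocity, the density is continuous with values in W2q up to t = 0, so its
  gradient is bounded uniformly near 0. Balls inside \<Omega> provide the segments for the mean
  value theorem.\<close>

lemma rho_lipschitz_near_0:
  obtains t1 \<Lambda> where "t1 > 0" "\<Lambda> > 0"
    "\<And>t x r y z. 0 < t \<Longrightarrow> t < t1 \<Longrightarrow> cball x r \<subseteq> \<Omega> \<Longrightarrow> y \<in> cball x r \<Longrightarrow> z \<in> cball x r \<Longrightarrow> \<bar>\<rho> t y - \<rho> t z\<bar> \<le> \<Lambda> * dist y z"
proof -
  obtain C where C: "C > 0" "\<And>f N y. (\<And>x. x \<in> \<Omega> \<Longrightarrow> f differentiable (at x)) \<Longrightarrow> (\<And>i. continuous_on \<Omega> (pd i f)) \<Longrightarrow> wd_bound \<Omega> 2 q N f \<Longrightarrow> N > 0 \<Longrightarrow> y \<in> \<Omega> \<Longrightarrow>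
       \<bar>f y :: real\<bar> \<le> C * N \<and> (\<forall>i. \<bar>pd i f y\<bar> \<le> C * N)" by (rule C1_bound[OF dom params(5)]) (rule that; blast)
  have "\<rho> \<in> C_Sob \<Omega> 0 1 2 q" by (rule regularity(1)[of "1 / 2" 1 1]) auto
  then obtain t1 N where t1: "0 < t1" and N: "N > 0" and wd: "\<And>t. 0 < t \<Longrightarrow> t < t1 \<Longrightarrow> wd_bound \<Omega> 2 q N (\<rho> t)"
    using params(5) C_Sob_bounded_near[OF \<Omega>_open, of \<rho> 0 1 2 q] by (metis less_eq_real_def less_trans one_less_numeral_iff semiring_norm(77) zero_less_one)
  show thesis
  proof (rule that[OF t1, of "3 * (C * N)"])
    show "3 * (C * N) > 0" using C N by simp
    fix t x r y z assume t: "0 < t" "t < t1" and xr: "cball x r \<subseteq> \<Omega>" and yz: "y \<in> cball x r" "z \<in> cball x r"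
    have seg: "z + s *\<^sub>R (y - z) \<in> \<Omega>" if "0 \<le> s" "s \<le> 1" for s
    proof -
      have "(1 - s) *\<^sub>R z + s *\<^sub>R y \<in> cball x r" using yz that by (intro convexD_alt convex_cball) auto
      moreover have "(1 - s) *\<^sub>R z + s *\<^sub>R y = z + s *\<^sub>R (y - z)" by (simp add: algebra_simps)
      ultimately show ?thesis using xr by auto
    qed
    have "\<bar>\<rho> t y - \<rho> t z\<bar> \<le> 3 * dist z y * (C * N)"
    proof (rule lipschitz_segment)
      show "\<rho> t differentiable (at (z + s *\<^sub>R (y - z)))" if "0 \<le> s" "s \<le> 1" for s
        by (rule rho_diff[OF t(1) seg[OF that]])
      show "\<bar>pd i (\<rho> t) (z + s *\<^sub>R (y - z))\<bar> \<le> C * N" if "0 < s" "s < 1" for s i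
        using C(2)[OF rho_diff[OF t(1)] rho_pd_cont[OF t(1)] wd[OF t] N seg[of s]] that by simp
    qed
    then show "\<bar>\<rho> t y - \<rho> t z\<bar> \<le> 3 * (C * N) * dist y z" by (simp add: dist_commute mult_ac)
  qed
qed

text \<open>The exponent 5 is between 3, where the embedding into bounded functions begins, and 6,
  where the continuity in W1p ends.\<close>

lemma u_bounds_near_0:
  obtains t2 U N where "t2 > 0" "U > 0" "N > 0" "\<And>t. 0 < t \<Longrightarrow> t < t2 \<Longrightarrow> wd_bound \<Omega> 1 5 N (u t)"
    "\<And>t y k. 0 < t \<Longrightarrow> t < t2 \<Longrightarrow> y \<in> \<Omega> \<Longrightarrow> \<bar>u t y $ k\<bar> \<le> U"
proof -
  obtain C where C: "C > 0" "\<And>f N y. continuous_on \<Omega> f \<Longrightarrow> wd_bound \<Omega> 1 5 N f \<Longrightarrow> N > 0 \<Longrightarrow> y \<in> \<Omega> \<Longrightarrow> \<bar>f y :: real\<bar> \<le> C * N"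
    by (rule sup_bound[OF dom, of 5]) (simp, rule that)
  have "u \<in> C_Sob \<Omega> 0 1 1 5" by (rule regularity(2)[of "1 / 2" 1 5]) auto
  then obtain t2 N where t2: "0 < t2" and N: "N > 0" and wd: "\<And>t. 0 < t \<Longrightarrow> t < t2 \<Longrightarrow> wd_bound \<Omega> 1 5 N (u t)"
    using C_Sob_bounded_near[OF \<Omega>_open, of u 0 1 1 5] by (metis one_le_numeral zero_less_one)
  show thesis
  proof (rule that[OF t2 _ N wd, of "C * N"])
    show "C * N > 0" using C N by simp
    fix t y k assume t: "0 < t" "t < t2" and y: "y \<in> \<Omega>"
    show "\<bar>u t y $ k\<bar> \<le> C * N"
      by (rule C(2)[OF continuous_on_component[OF u_cont[OF t(1)]] wd_bound_nth[OF \<Omega>_open wd[OF t]] N y]) simp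
  qed
qed

text \<open>The temperature alone has no prescribed initial value, but \<rho>\<theta> tends in L1 to
  \<open>\<rho>0 \<theta>0\<close>, which is bounded; for small t their L1 distance is below
  1.\<close>

lemma pressure_near_0:
  obtains Pb where "Pb \<ge> 0"
    "eventually (\<lambda>t. integrable (lebesgue_on \<Omega>) (\<lambda>y. R * \<rho> t y * \<theta> t y) \<and> (LINT y|lebesgue_on \<Omega>. \<bar>R * \<rho> t y * \<theta> t y\<bar>) \<le> Pb) (at_right 0)"
proof -
  have adm: "continuous_on \<Omega> \<rho>0" "\<theta>0 \<in> H1_neumann \<Omega>" "\<And>x. x \<in> \<Omega> \<Longrightarrow> 0 \<le> \<rho>0 x" "bdd_above (\<rho>0 ` \<Omega>)" "(SUP x\<in>\<Omega>. \<rho>0 x) < \<rho>hat"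
     and ae: "AE x in lebesgue_on \<Omega>. 0 \<le> \<theta>0 x \<and> \<theta>0 x \<le> \<theta>hat"
    using data by (simp_all add: admissible_data_def)
  have \<rho>0le: "\<rho>0 x \<le> \<rho>hat" if "x \<in> \<Omega>" for x using cSUP_upper[OF that adm(4)] adm(5) by simp
  have m: "\<rho>0 \<in> borel_measurable (lebesgue_on \<Omega>)" "\<theta>0 \<in> borel_measurable (lebesgue_on \<Omega>)"
    using continuous_imp_measurable_on_sets_lebesgue[OF adm(1) domain_measurable] adm(2) by (auto simp: H1_neumann_def Sob_def Lp_def)
  have i0: "integrable (lebesgue_on \<Omega>) (\<lambda>x. \<rho>0 x * \<theta>0 x)"
  proof (rule Bochner_Integration.integrable_bound[OF integral_const_domain(1)[OF dom, of "\<rho>hat * \<theta>hat"]])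
    show "(\<lambda>x. \<rho>0 x * \<theta>0 x) \<in> borel_measurable (lebesgue_on \<Omega>)" using m by measurable
    show "AE x in lebesgue_on \<Omega>. norm (\<rho>0 x * \<theta>0 x) \<le> norm (\<rho>hat * \<theta>hat)"
      using ae AE_space
    proof eventually_elim
      case (elim x)
      then have x: "x \<in> \<Omega>" by (simp add: space_restrict_space)
      have "\<rho>0 x * \<theta>0 x \<le> \<rho>hat * \<theta>hat" using \<rho>0le[OF x] adm(3)[OF x] elim(1) params(4) by (intro mult_mono) auto
      moreover have "0 \<le> \<rho>0 x * \<theta>0 x" using adm(3)[OF x] elim(1) by simp
      ultimately show ?case by simp
    qed
  qed
  define J where "J = (LINT x|lebesgue_on \<Omega>. \<bar>\<rho>0 x * \<theta>0 x\<bar>)"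
  have J: "J \<ge> 0" by (simp add: J_def)
  show thesis
  proof (rule that[of "R * (1 + J)"])
    show "R * (1 + J) \<ge> 0" using params(3) J by simp
    have "eventually (\<lambda>t. (LINT x|lebesgue_on \<Omega>. \<bar>\<rho> t x * \<theta> t x - \<rho>0 x * \<theta>0 x\<bar>) < 1) (at_right 0)"
      by (rule order_tendstoD(2)[OF initial_L1(4)]) simp
    then show "eventually (\<lambda>t. integrable (lebesgue_on \<Omega>) (\<lambda>y. R * \<rho> t y * \<theta> t y) \<and> (LINT y|lebesgue_on \<Omega>. \<bar>R * \<rho> t y * \<theta> t y\<bar>) \<le> R * (1 + J)) (at_right 0)"
      using initial_L1(3)
    proof eventually_elim
      case (elim t)
      let ?h = "\<lambda>x. \<rho> t x * \<theta> t x - \<rho>0 x * \<theta>0 x"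
      have "integrable (lebesgue_on \<Omega>) (\<lambda>x. R * (?h x + \<rho>0 x * \<theta>0 x))"
        by (intro integrable_mult_right Bochner_Integration.integrable_add elim(2) i0)
      then have i: "integrable (lebesgue_on \<Omega>) (\<lambda>y. R * \<rho> t y * \<theta> t y)" by (simp add: mult.assoc)
      have "(LINT y|lebesgue_on \<Omega>. \<bar>R * \<rho> t y * \<theta> t y\<bar>) \<le> (LINT y|lebesgue_on \<Omega>. R * (\<bar>?h y\<bar> + \<bar>\<rho>0 y * \<theta>0 y\<bar>))"
      proof (rule integral_mono_AE)
        show "integrable (lebesgue_on \<Omega>) (\<lambda>y. \<bar>R * \<rho> t y * \<theta> t y\<bar>)" using i by (rule integrable_abs)
        show "integrable (lebesgue_on \<Omega>) (\<lambda>y. R * (\<bar>?h y\<bar> + \<bar>\<rho>0 y * \<theta>0 y\<bar>))"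
          by (intro integrable_mult_right Bochner_Integration.integrable_add integrable_abs elim(2) i0)
        have "\<bar>R * \<rho> t y * \<theta> t y\<bar> \<le> R * (\<bar>?h y\<bar> + \<bar>\<rho>0 y * \<theta>0 y\<bar>)" for y
        proof -
          have "\<bar>R * \<rho> t y * \<theta> t y\<bar> = R * \<bar>\<rho> t y * \<theta> t y\<bar>" using params(3) by (simp add: abs_mult)
          also have "\<dots> \<le> R * (\<bar>?h y\<bar> + \<bar>\<rho>0 y * \<theta>0 y\<bar>)" using params(3) by (intro mult_left_mono) auto
          finally show ?thesis .
        qed
        then show "AE y in lebesgue_on \<Omega>. \<bar>R * \<rho> t y * \<theta> t y\<bar> \<le> R * (\<bar>?h y\<bar> + \<bar>\<rho>0 y * \<theta>0 y\<bar>)" by simp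
      qed
      also have "\<dots> = R * ((LINT y|lebesgue_on \<Omega>. \<bar>?h y\<bar>) + J)"
        unfolding J_def using elim(2) i0 by (simp add: Bochner_Integration.integral_add integrable_abs)
      also have "\<dots> \<le> R * (1 + J)" using elim(1) params(3) by (intro mult_left_mono) auto
      finally show ?case using i by blast
    qed
  qed
qed

text \<open>The initial density is attained in an integral sense only. If \<rho>(s, x0) were at
  least e, the uniform Lipschitz bound and continuity of \<rho>0 would keep the difference of the
  densities at least e/2 on a fixed ball, against convergence in L1.\<close>

lemma rho_at_initial_vacuum:
  assumes x0: "x0 \<in> \<Omega>" "\<rho>0 x0 = 0" and e: "e > 0"
  shows "eventually (\<lambda>s. \<rho> s x0 < e) (at_right 0)"
proof -
  obtain t1 \<Lambda> where t1: "t1 > 0" "\<Lambda> > 0"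
    and lip: "\<And>t x r y z. 0 < t \<Longrightarrow> t < t1 \<Longrightarrow> cball x r \<subseteq> \<Omega> \<Longrightarrow> y \<in> cball x r \<Longrightarrow> z \<in> cball x r \<Longrightarrow> \<bar>\<rho> t y - \<rho> t z\<bar> \<le> \<Lambda> * dist y z"
    by (rule rho_lipschitz_near_0) (rule that)
  have c: "continuous_on \<Omega> \<rho>0" using data unfolding admissible_data_def by blast
  obtain d1 where d1: "d1 > 0" "\<And>y. y \<in> \<Omega> \<Longrightarrow> dist y x0 < d1 \<Longrightarrow> dist (\<rho>0 y) (\<rho>0 x0) < e / 4"
    using c x0(1) e unfolding continuous_on_iff by (metis divide_pos_pos zero_less_numeral)
  obtain d2 where d2: "d2 > 0" "cball x0 d2 \<subseteq> \<Omega>" using \<Omega>_open x0(1) open_contains_cball by blast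
  define d where "d = min (min (d1 / 2) d2) (e / (4 * \<Lambda>))"
  have d: "d > 0" "d < d1" "d \<le> d2" "\<Lambda> * d \<le> e / 4"
  proof -
    show "d > 0" "d < d1" "d \<le> d2" using d1 d2 e t1 by (auto simp: d_def min_less_iff_disj)
    have "\<Lambda> * d \<le> \<Lambda> * (e / (4 * \<Lambda>))" using t1 by (intro mult_left_mono) (auto simp: d_def)
    then show "\<Lambda> * d \<le> e / 4" using t1 by simp
  qed
  have dO: "cball x0 d \<subseteq> \<Omega>" using d(3) d2(2) by (meson order_trans subset_cball)
  define V where "V = measure lebesgue (cball x0 d)"
  have V: "V > 0" using content_cball_pos[OF d(1), of x0] by (simp add: V_def)
  have "eventually (\<lambda>s. (LINT x|lebesgue_on \<Omega>. \<bar>\<rho> s x - \<rho>0 x\<bar>) < V * (e / 2)) (at_right 0)"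
    by (rule order_tendstoD(2)[OF initial_L1(2)]) (use V e in simp)
  moreover have "eventually (\<lambda>s. s < t1) (at_right (0::real))" using t1 eventually_at_right_field by blast
  ultimately show ?thesis using initial_L1(1) eventually_at_right_less[of 0]
  proof eventually_elim
    case (elim s)
    have pw: "indicator (cball x0 d) w * (\<rho> s x0 - e / 2) \<le> \<bar>\<rho> s w - \<rho>0 w\<bar>" for w
    proof (cases "w \<in> cball x0 d")
      case True
      have "\<bar>\<rho> s x0 - \<rho> s w\<bar> \<le> \<Lambda> * dist x0 w" using True d elim by (intro lip[OF _ _ dO]) auto
      also have "\<dots> \<le> \<Lambda> * d" using True t1 by (intro mult_left_mono) auto
      finally have "\<bar>\<rho> s x0 - \<rho> s w\<bar> \<le> e / 4" using d(4) by linarith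
      moreover have "\<bar>\<rho>0 w\<bar> < e / 4"
        using d1(2)[of w] subsetD[OF dO True] True d(2) x0(2) by (auto simp: dist_commute)
      ultimately have "\<rho> s x0 - e / 2 \<le> \<bar>\<rho> s w - \<rho>0 w\<bar>" by linarith
      then show ?thesis using True by simp
    qed simp
    have z: "w \<notin> \<Omega> \<Longrightarrow> indicator (cball x0 d) w * (\<rho> s x0 - e / 2) = 0" for w
      using dO by (auto simp: indicator_def)
    have ib: "integrable lebesgue (\<lambda>w. indicator (cball x0 d) w * (\<rho> s x0 - e / 2))"
      using lmeasurable_cball[of x0 d] by (intro integrable_mult_left) (simp add: lmeasurable_iff_integrable)
    have "V * (\<rho> s x0 - e / 2) = (LINT w|lebesgue_on \<Omega>. indicator (cball x0 d) w * (\<rho> s x0 - e / 2))"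
      by (subst integral_lebesgue_on_support[OF domain_measurable z]) (simp_all add: V_def)
    also have "\<dots> \<le> (LINT w|lebesgue_on \<Omega>. \<bar>\<rho> s w - \<rho>0 w\<bar>)"
    proof (rule integral_mono_AE)
      show "integrable (lebesgue_on \<Omega>) (\<lambda>w. indicator (cball x0 d) w * (\<rho> s x0 - e / 2))"
        using ib integrable_lebesgue_on_support[OF domain_measurable z] by simp
    qed (use pw elim(3) in \<open>auto intro!: integrable_abs\<close>)
    also have "\<dots> < V * (e / 2)" by (rule elim(1))
    finally show ?case using V by simp
  qed
qed

text \<open>\<open>flux_estimate\<close> at a fixed time, with the time derivative of u as the field
  a: all other data are bounded uniformly near t = 0, so the rate is linear in the H1 norm of that
  derivative, which is finite for almost every time.\<close>

lemma divg_lower_near_0: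
  assumes r: "0 < r" "r \<le> 1 / 2" "cball x0 (2 * r) \<subseteq> \<Omega>"
  obtains t0 C where "0 < t0" "t0 \<le> 1" "C > 0"
    "AE t in lebesgue_on {0<..<t0}. \<forall>x\<in>cball x0 r. - C * (1 + sob_norm \<Omega> 1 2 (Dt u t)) \<le> divg pd (u t) x"
proof -
  obtain t1 \<Lambda> where t1: "t1 > 0" "\<Lambda> > 0"
    and lip: "\<And>t x r y z. 0 < t \<Longrightarrow> t < t1 \<Longrightarrow> cball x r \<subseteq> \<Omega> \<Longrightarrow> y \<in> cball x r \<Longrightarrow> z \<in> cball x r \<Longrightarrow> \<bar>\<rho> t y - \<rho> t z\<bar> \<le> \<Lambda> * dist y z"
    by (rule rho_lipschitz_near_0) (rule that)
  obtain t2 U N5 where t2: "t2 > 0" and U: "U > 0" "N5 > 0" and wd5: "\<And>t. 0 < t \<Longrightarrow> t < t2 \<Longrightarrow> wd_bound \<Omega> 1 5 N5 (u t)"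
    and uU: "\<And>t y k. 0 < t \<Longrightarrow> t < t2 \<Longrightarrow> y \<in> \<Omega> \<Longrightarrow> \<bar>u t y $ k\<bar> \<le> U"
    by (rule u_bounds_near_0) (rule that)
  obtain Pb where Pb: "Pb \<ge> 0"
    and ev: "eventually (\<lambda>t. integrable (lebesgue_on \<Omega>) (\<lambda>y. R * \<rho> t y * \<theta> t y) \<and> (LINT y|lebesgue_on \<Omega>. \<bar>R * \<rho> t y * \<theta> t y\<bar>) \<le> Pb) (at_right 0)"
    by (rule pressure_near_0) (rule that)
  obtain t3 where t3: "t3 > 0" and Pi: "\<And>t. 0 < t \<Longrightarrow> t < t3 \<Longrightarrow> integrable (lebesgue_on \<Omega>) (\<lambda>y. R * \<rho> t y * \<theta> t y)"
      "\<And>t. 0 < t \<Longrightarrow> t < t3 \<Longrightarrow> (LINT y|lebesgue_on \<Omega>. \<bar>R * \<rho> t y * \<theta> t y\<bar>) \<le> Pb"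
    using ev unfolding eventually_at_right_field by auto
  \<comment> \<open>3 lam \<ge> - 2 \<mu> gives 2 \<mu> + lam \<ge> 4 \<mu> / 3.\<close>
  have lam: "2 * \<mu> + lam > 0" using params(1,2) by linarith
  have B: "2 * \<rho>hat > 0" using params(4) by simp
  obtain C where C: "C > 0"
    "\<And>\<sigma> v a Pf N2 x. (\<And>x. x \<in> \<Omega> \<Longrightarrow> v differentiable (at x)) \<Longrightarrow> (\<And>i. continuous_on \<Omega> (pd i v)) \<Longrightarrow>
      (\<And>x i. x \<in> \<Omega> \<Longrightarrow> pd i v differentiable (at x)) \<Longrightarrow> (\<And>i j. continuous_on \<Omega> (pd j (pd i v))) \<Longrightarrow>
      (\<And>x. x \<in> \<Omega> \<Longrightarrow> Pf differentiable (at x)) \<Longrightarrow> (\<And>i. continuous_on \<Omega> (pd i Pf)) \<Longrightarrow>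
      continuous_on \<Omega> a \<Longrightarrow> continuous_on \<Omega> \<sigma> \<Longrightarrow> (\<And>x. x \<in> \<Omega> \<Longrightarrow> 0 \<le> \<sigma> x \<and> \<sigma> x \<le> 2 * \<rho>hat) \<Longrightarrow>
      (\<And>x. x \<in> \<Omega> \<Longrightarrow> \<sigma> x *\<^sub>R (a x + adv v v x) = \<mu> *\<^sub>R lap pd v x + (\<mu> + lam) *\<^sub>R grad pd (divg pd v) x - grad pd Pf x) \<Longrightarrow>
      (\<And>x. x \<in> \<Omega> \<Longrightarrow> 0 \<le> Pf x) \<Longrightarrow> integrable (lebesgue_on \<Omega>) Pf \<Longrightarrow> (LINT x|lebesgue_on \<Omega>. \<bar>Pf x\<bar>) \<le> Pb \<Longrightarrow>
      (\<And>y z. y \<in> cball x0 (2 * r) \<Longrightarrow> z \<in> cball x0 (2 * r) \<Longrightarrow> \<bar>\<sigma> y - \<sigma> z\<bar> \<le> \<Lambda> * dist y z) \<Longrightarrow>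
      (\<And>x k. x \<in> \<Omega> \<Longrightarrow> \<bar>v x $ k\<bar> \<le> U) \<Longrightarrow> wd_bound \<Omega> 1 5 N5 v \<Longrightarrow> wd_bound \<Omega> 1 2 N2 a \<Longrightarrow> N2 \<ge> 1 \<Longrightarrow> x \<in> cball x0 r \<Longrightarrow>
      - C * N2 \<le> divg pd v x"
    by (rule flux_estimate[OF dom r B t1(2) U Pb params(1) lam]) (rule that; blast)
  define t0 where "t0 = min (min t1 t2) (min t3 1)"
  have t0: "t0 > 0" "t0 \<le> 1" "t0 \<le> t1" "t0 \<le> t2" "t0 \<le> t3" using t1 t2 t3 by (auto simp: t0_def)
  have "AE t in lebesgue_on {0<..<1}. Dt u t \<in> Sob \<Omega> 1 2"
    using regularity(4)[of "1 / 2" 1 1] by (simp add: L2_Sob_def)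
  then have ae: "AE t in lebesgue. t \<in> {0<..<1} \<longrightarrow> Dt u t \<in> Sob \<Omega> 1 2"
    by (subst (asm) AE_lebesgue_on) auto
  have main: "- C * (1 + sob_norm \<Omega> 1 2 (Dt u t)) \<le> divg pd (u t) x"
    if t: "0 < t" "t < t0" and S: "Dt u t \<in> Sob \<Omega> 1 2" and x: "x \<in> cball x0 r" for t x
  proof -
    have tt: "t < t1" "t < t2" "t < t3" using t t0 by auto
    have C12: "C12_tx \<Omega> u" "C12_tx \<Omega> \<theta>" using sol unfolding global_classical_solution_def by blast+
    have \<theta>d: "\<theta> t differentiable (at y)" if "y \<in> \<Omega>" for y using C12(2) that t(1) unfolding C12_tx_def C1_tx_def by blast
    have c\<theta>: "continuous_on \<Omega> (\<theta> t)" "\<And>i. continuous_on \<Omega> (pd i (\<theta> t))"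
      using C12(2) cont_tx_slice[OF _ t(1)] unfolding C12_tx_def C1_tx_def by blast+
    have R\<rho>: "(\<lambda>y. R * \<rho> t y) differentiable (at y)" "pd i (\<lambda>y. R * \<rho> t y) y = R * pd i (\<rho> t) y" if "y \<in> \<Omega>" for y i
      using rho_diff[OF t(1) that] pd_cmult[OF rho_diff[OF t(1) that], where c = R and i = i] by auto
    have pP: "pd i (\<lambda>y. R * \<rho> t y * \<theta> t y) y = (R * \<rho> t y) * pd i (\<theta> t) y + (R * pd i (\<rho> t) y) * \<theta> t y" if "y \<in> \<Omega>" for y i
      using pd_mult[OF R\<rho>(1)[OF that] \<theta>d[OF that], of i] R\<rho>(2)[OF that, of i] by simp
    show ?thesis
    proof (rule C(2)[where \<sigma> = "\<rho> t" and a = "Dt u t" and Pf = "\<lambda>y. R * \<rho> t y * \<theta> t y", OF _ _ _ _ _ _ _ _ _ _ _ _ _ _ _ _ _ _ x])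
      show "u t differentiable (at y)" if "y \<in> \<Omega>" for y by (rule u_diff[OF t(1) that])
      show "continuous_on \<Omega> (pd i (u t))" for i by (rule u_pd_cont[OF t(1)])
      show "pd i (u t) differentiable (at y)" if "y \<in> \<Omega>" for y i using C12(1) that t(1) unfolding C12_tx_def by blast
      show "continuous_on \<Omega> (pd j (pd i (u t)))" for i j using C12(1) cont_tx_slice[OF _ t(1)] unfolding C12_tx_def by blast
      show "(\<lambda>y. R * \<rho> t y * \<theta> t y) differentiable (at y)" if "y \<in> \<Omega>" for y
        using R\<rho>(1)[OF that] \<theta>d[OF that] by (rule differentiable_mult)
      show "continuous_on \<Omega> (pd i (\<lambda>y. R * \<rho> t y * \<theta> t y))" for i
      proof -
        have "continuous_on \<Omega> (\<lambda>y. (R * \<rho> t y) * pd i (\<theta> t) y + (R * pd i (\<rho> t) y) * \<theta> t y)"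
          by (intro continuous_intros rho_cont[OF t(1)] rho_pd_cont[OF t(1)] c\<theta>)
        then show ?thesis using continuous_on_cong[of \<Omega> \<Omega>, OF refl pP] by simp
      qed
      show "continuous_on \<Omega> (Dt u t)" using u_C1 cont_tx_slice[OF _ t(1)] unfolding C1_tx_def by blast
      show "continuous_on \<Omega> (\<rho> t)" by (rule rho_cont[OF t(1)])
      show "0 \<le> \<rho> t y \<and> \<rho> t y \<le> 2 * \<rho>hat" if "y \<in> \<Omega>" for y by (rule rho_bounds[OF t(1) that])
      show "\<rho> t y *\<^sub>R (Dt u t y + adv (u t) (u t) y) = \<mu> *\<^sub>R lap pd (u t) y + (\<mu> + lam) *\<^sub>R grad pd (divg pd (u t)) y - grad pd (\<lambda>y. R * \<rho> t y * \<theta> t y) y" if "y \<in> \<Omega>" for y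
        using sol t(1) that unfolding global_classical_solution_def NS_equations_def by blast
      show "0 \<le> R * \<rho> t y * \<theta> t y" if "y \<in> \<Omega>" for y
      proof -
        have "0 \<le> \<theta> t y" using sol t(1) that unfolding global_classical_solution_def by blast
        then show ?thesis using rho_bounds[OF t(1) that] params(3) by simp
      qed
      show "integrable (lebesgue_on \<Omega>) (\<lambda>y. R * \<rho> t y * \<theta> t y)" "(LINT y|lebesgue_on \<Omega>. \<bar>R * \<rho> t y * \<theta> t y\<bar>) \<le> Pb"
        using Pi t(1) tt(3) by blast+
      show "\<bar>\<rho> t y - \<rho> t z\<bar> \<le> \<Lambda> * dist y z" if "y \<in> cball x0 (2 * r)" "z \<in> cball x0 (2 * r)" for y z
        by (rule lip[OF t(1) tt(1) r(3) that])
      show "\<bar>u t y $ k\<bar> \<le> U" if "y \<in> \<Omega>" for y k by (rule uU[OF t(1) tt(2) that])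
      show "wd_bound \<Omega> 1 5 N5 (u t)" by (rule wd5[OF t(1) tt(2)])
      show "wd_bound \<Omega> 1 2 (1 + sob_norm \<Omega> 1 2 (Dt u t)) (Dt u t)" by (rule Sob_wd_bound[OF \<Omega>_open S]) auto
      show "1 + sob_norm \<Omega> 1 2 (Dt u t) \<ge> 1" using sob_norm_nonneg[of \<Omega> 1 2 "Dt u t"] by simp
    qed
  qed
  have "AE t in lebesgue. t \<in> {0<..<t0} \<longrightarrow> (\<forall>x\<in>cball x0 r. - C * (1 + sob_norm \<Omega> 1 2 (Dt u t)) \<le> divg pd (u t) x)"
    using ae by eventually_elim (use main t0(2) in auto)
  then have "AE t in lebesgue_on {0<..<t0}. \<forall>x\<in>cball x0 r. - C * (1 + sob_norm \<Omega> 1 2 (Dt u t)) \<le> divg pd (u t) x"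
    by (subst AE_lebesgue_on) auto
  from that[OF t0(1,2) C(1) this] show thesis .
qed

text \<open>\<open>u\<close> is not Lipschitz up to \<open>t = 0\<close>, so vacuum is followed by the minimum principle for \<open>\<rho>\<close> plus a bump growing
  away from \<open>x0\<close>, which stays localized at the bounded speed of \<open>u\<close>. The compression rate is integrable in
  time since \<open>u\<^sub>t \<in> L\<^sup>2(H\<^sup>1)\<close>.\<close>
theorem initial_vacuum_transported:
  assumes x0: "x0 \<in> \<Omega>" "\<rho>0 x0 = 0"
  shows "\<exists>\<tau> y. 0 < \<tau> \<and> \<tau> < 1 \<and> y \<in> \<Omega> \<and> \<rho> \<tau> y = 0"
proof -
  obtain e where e: "e > 0" "cball x0 e \<subseteq> \<Omega>" using \<Omega>_open x0(1) open_contains_cball by blast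
  \<comment> \<open>\<open>flux_estimate\<close> asks for a radius at most 1/2 and for the ball of
    twice the radius in \<Omega>.\<close>
  define r where "r = min (1 / 2) (e / 2)"
  have "cball x0 (2 * r) \<subseteq> cball x0 e" by (rule subset_cball) (simp add: r_def)
  then have r: "0 < r" "r \<le> 1 / 2" "cball x0 (2 * r) \<subseteq> \<Omega>" using e by (auto simp: r_def)
  obtain t0 C where t0: "0 < t0" "t0 \<le> 1" and C: "C > 0"
    and ae: "AE t in lebesgue_on {0<..<t0}. \<forall>x\<in>cball x0 r. - C * (1 + sob_norm \<Omega> 1 2 (Dt u t)) \<le> divg pd (u t) x"
    by (rule divg_lower_near_0[OF r]) (rule that)
  obtain t2 U N5 where t2: "t2 > 0" and U: "U > 0" "N5 > 0" and "\<And>t. 0 < t \<Longrightarrow> t < t2 \<Longrightarrow> wd_bound \<Omega> 1 5 N5 (u t)"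
    and uU: "\<And>t y k. 0 < t \<Longrightarrow> t < t2 \<Longrightarrow> y \<in> \<Omega> \<Longrightarrow> \<bar>u t y $ k\<bar> \<le> U"
    by (rule u_bounds_near_0) (rule that)
  \<comment> \<open>The rate at which the bump recedes: the derivative of |x - x0|^2 along u is at
    most 2 times 3 r U on the ball of radius r.\<close>
  define c where "c = 6 * U * r"
  have c: "c > 0" using U r by (simp add: c_def)
  \<comment> \<open>The last bound, c \<tau> \<le> r^2 / 2, keeps the argument of the bump at least
    r^2 / 2 on the sphere of radius r up to time \<tau>.\<close>
  define \<tau> where "\<tau> = min (min (t0 / 2) (t2 / 2)) (min (r\<^sup>2 / (2 * c)) (1 / 2))"
  have \<tau>: "0 < \<tau>" "\<tau> < t0" "\<tau> < t2" "\<tau> < 1" "c * \<tau> \<le> r\<^sup>2 / 2"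
  proof -
    show "0 < \<tau>" "\<tau> < t0" "\<tau> < t2" "\<tau> < 1" using t0 t2 c r by (auto simp: \<tau>_def min_less_iff_disj)
    have "c * \<tau> \<le> c * (r\<^sup>2 / (2 * c))" using c by (intro mult_left_mono) (auto simp: \<tau>_def)
    then show "c * \<tau> \<le> r\<^sup>2 / 2" using c by simp
  qed
  define K where "K = cball x0 r"
  have "K \<subseteq> cball x0 (2 * r)" unfolding K_def by (rule subset_cball) (use r in simp)
  then have K\<Omega>: "K \<subseteq> \<Omega>" using r(3) by blast
  have cK: "compact K" and xK: "x0 \<in> K" and Kne: "K \<noteq> {}" using r(1) by (auto simp: K_def)
  \<comment> \<open>An integrable majorant of the compression rate C (1 + S), S the H1 norm of the
    time derivative of u: S^2 is integrable in time and 1 + S \<le> 2 + S^2.\<close>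
  define G where "G t = C * (2 + (sob_norm \<Omega> 1 2 (Dt u t))\<^sup>2)" for t
  have G0: "G t \<ge> 0" for t using C by (simp add: G_def)
  have iG: "integrable (lebesgue_on {0<..<1}) G"
  proof -
    have "integrable (lebesgue_on {0<..<1::real}) (\<lambda>t. (sob_norm \<Omega> 1 2 (Dt u t))\<^sup>2)"
      using regularity(4)[of "1 / 2" 1 1] by (simp add: L2_Sob_def)
    moreover have "integrable (lebesgue_on {0<..<1::real}) (\<lambda>t. 2 :: real)"
      by (intro finite_measure.integrable_const finite_measure_lebesgue_on) simp
    ultimately show ?thesis unfolding G_def[abs_def] by (intro integrable_mult_right Bochner_Integration.integrable_add)
  qed
  define I where "I = (LINT t|lebesgue_on {0<..<1}. G t)"
  define bb where "bb = bump1 (r\<^sup>2 / 2)"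
  have bb: "bb > 0" using r(1) by (simp add: bb_def bump1_def expinv_def)
  \<comment> \<open>Makes the penalty on the sphere at least 2 \<rho>hat + 1, more than any value of
    the density.\<close>
  define Q where "Q = (2 * \<rho>hat + 1) / bb"
  have Q: "Q > 0" using bb params(4) by (simp add: Q_def)
  define z where "z t x = (norm (x - x0))\<^sup>2 - c * t" for t x
  define W where "W t x = \<rho> t x + Q * bump1 (z t x)" for t x
  have b0: "bump1 s \<ge> 0" for s by (simp add: bump1_def expinv_def)
  have db: "(bump1 has_real_derivative cut' s) (at s)" for s
    unfolding bump1_def cut'_def by (rule expinv_derivative)
  have cb: "continuous_on UNIV bump1" using db by (meson DERIV_continuous continuous_at_imp_continuous_on)
  \<comment> \<open>At x0 the argument of the bump is negative, so the penalty vanishes there and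
    the vacuum point competes undisturbed.\<close>
  have Wc: "W t x0 = \<rho> t x0" if "t > 0" for t
  proof -
    have "z t x0 \<le> 0" using c that by (simp add: z_def)
    then show ?thesis by (simp add: W_def bump1_def expinv_def)
  qed
  have cW: "continuous_on ({s..\<tau>} \<times> K) (\<lambda>p. W (fst p) (snd p))" if "0 < s" for s
    unfolding W_def z_def
    by (intro continuous_on_add continuous_on_mult rho_joint[OF that K\<Omega>] continuous_on_const continuous_on_compose2[OF cb] continuous_intros) auto
  have key: "\<exists>y\<in>K. W \<tau> y \<le> exp I * (2 * \<delta>)" if \<delta>: "\<delta> > 0" for \<delta>
  proof -
    obtain b where b: "b > 0" "\<And>s. 0 < s \<Longrightarrow> s < b \<Longrightarrow> \<rho> s x0 < \<delta>"
      using rho_at_initial_vacuum[OF x0 \<delta>] unfolding eventually_at_right_field by blast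
    \<comment> \<open>The argument starts at a positive time s, where everything is classical and
      \<rho>(s, x0) < \<delta>; the resulting bound must not depend on s.\<close>
    define s where "s = min b \<tau> / 2"
    have s: "0 < s" "s < b" "s < \<tau>" using b(1) \<tau>(1) by (auto simp: s_def)
    have cF: "continuous_on ({s..\<tau>} \<times> K) (\<lambda>(t, x). max 0 (- divg pd (u t) x))"
    proof -
      have "continuous_on ({0<..} \<times> \<Omega>) (\<lambda>p. pd i (u (fst p)) (snd p))" for i
        using u_C1 unfolding C1_tx_def cont_tx_def split_beta by blast
      then have "continuous_on ({s..\<tau>} \<times> K) (\<lambda>p. pd i (u (fst p)) (snd p))" for i
        by (rule continuous_on_subset) (use s K\<Omega> in auto)
      then show ?thesis unfolding split_beta divg_def by (intro continuous_intros)
    qed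
    \<comment> \<open>The H1 norm is merely measurable in time and its bound holds almost
      everywhere, so it cannot serve as the rate. The largest compression over K is continuous on
      [s, \<tau>], and only its integral is compared with that of G.\<close>
    obtain h where h: "continuous_on {s..\<tau>} h" "\<And>t x. t \<in> {s..\<tau>} \<Longrightarrow> x \<in> K \<Longrightarrow> max 0 (- divg pd (u t) x) \<le> h t"
      "\<And>t. t \<in> {s..\<tau>} \<Longrightarrow> \<exists>x\<in>K. h t = max 0 (- divg pd (u t) x)"
      by (rule continuous_on_SUP[OF compact_Icc cK Kne cF]) (rule that)
    have h0: "h t \<ge> 0" if "t \<in> {s..\<tau>}" for t using h(2)[OF that xK] by linarith
    have "\<exists>y\<in>K. W \<tau> y \<le> exp (integral {s..\<tau>} h) * (W s x0 + (0 + \<delta>) * (\<tau> - s))"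
    proof (rule min_gronwall[OF cK _ _ _ h(1) h0 _ _ xK \<delta>])
      show "continuous_on ({s..\<tau>} \<times> K) (\<lambda>(t, x). W t x)" using cW[OF s(1)] by (simp add: split_beta)
      show "s \<le> \<tau>" "(0::real) \<le> 0" using s by auto
      fix t x assume t: "t \<in> {s..\<tau>}" and x: "x \<in> K"
      then have t0': "t > 0" "t < t2" and x\<Omega>: "x \<in> \<Omega>" using s \<tau> K\<Omega> by auto
      have dz: "((\<lambda>t. z t x) has_real_derivative - c) (at t within {s..\<tau>})"
        unfolding z_def by (auto intro!: derivative_eq_intros)
      have "((\<lambda>t. bump1 (z t x)) has_real_derivative cut' (z t x) * (- c)) (at t within {s..\<tau>})"
        by (rule DERIV_chain2[OF db dz])
      from DERIV_add[OF rho_time_deriv[OF t0'(1) x\<Omega>] DERIV_cmult[OF this, of Q]]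
      show "((\<lambda>t. W t x) has_real_derivative Dt \<rho> t x + Q * (cut' (z t x) * (- c))) (at t within {s..\<tau>})"
        unfolding W_def .
      assume mi: "\<And>y. y \<in> K \<Longrightarrow> W t x \<le> W t y"
      have ct: "c * t \<le> r\<^sup>2 / 2" using order_trans[OF mult_left_mono \<tau>(5)] t c by simp
      \<comment> \<open>Minimisers avoid the sphere, where W is larger than at x0; hence the
        gradient of W vanishes at them.\<close>
      have int: "x \<in> ball x0 r"
      proof (rule ccontr)
        assume "x \<notin> ball x0 r"
        then have "r \<le> norm (x - x0)" by (simp add: dist_norm norm_minus_commute)
        then have "r\<^sup>2 \<le> (norm (x - x0))\<^sup>2" using r(1) by (intro power_mono) auto
        then have "r\<^sup>2 / 2 \<le> z t x" using ct by (simp add: z_def)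
        then have "bb \<le> bump1 (z t x)" unfolding bb_def by (rule bump1_mono)
        then have "Q * bb \<le> Q * bump1 (z t x)" using Q by (intro mult_left_mono) auto
        then have "2 * \<rho>hat + 1 \<le> W t x" using bb rho_bounds[OF t0'(1) x\<Omega>] by (simp add: W_def Q_def)
        moreover have "W t x0 \<le> 2 * \<rho>hat" using Wc[OF t0'(1)] rho_bounds[OF t0'(1) x0(1)] by simp
        ultimately show False using mi[OF xK] by linarith
      qed
      have dzx: "((\<lambda>x. z t x) has_derivative (\<lambda>h. 2 * ((x - x0) \<bullet> h))) (at x)"
        unfolding z_def power2_norm_eq_inner by (auto intro!: derivative_eq_intros simp: inner_commute)
      then have zd: "z t differentiable (at x)" unfolding differentiable_def by blast
      from pd_eqI[OF dzx] have pz: "pd i (z t) x = 2 * (x - x0) $ i" for i by (simp add: inner_axis)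
      have bd: "(\<lambda>x. bump1 (z t x)) differentiable (at x)" and pb: "pd i (\<lambda>x. bump1 (z t x)) x = cut' (z t x) * (2 * (x - x0) $ i)" for i
        using pd_compose(1)[OF zd db] pd_compose(2)[OF zd db, of i] pz[of i] by simp_all
      have Qd: "(\<lambda>x. Q * bump1 (z t x)) differentiable (at x)" using bd by simp
      have dW: "W t differentiable (at x)" unfolding W_def[abs_def] using rho_diff[OF t0'(1) x\<Omega>] Qd by simp
      have "frechet_derivative (W t) (at x) = (\<lambda>v. 0)"
        by (rule differential_zero_maxmin[OF int open_ball has_derivative_pd[OF dW]]) (use mi in \<open>auto simp: K_def\<close>)
      then have W0: "pd i (W t) x = 0" for i by (simp add: pd_def)
      have "pd i (W t) x = pd i (\<rho> t) x + Q * (cut' (z t x) * (2 * (x - x0) $ i))" for i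
        using pd_add[OF rho_diff[OF t0'(1) x\<Omega>] Qd, of i] pd_cmult[OF bd, where c = Q and i = i] pb[of i] unfolding W_def[abs_def] by simp
      then have "pd i (\<rho> t) x = - (Q * (cut' (z t x) * (2 * (x - x0) $ i)))" for i using W0[of i] by (simp add: eq_neg_iff_add_eq_0)
      then have "pd i (\<rho> t) x = - (2 * Q * cut' (z t x)) * (x - x0) $ i" for i by (simp add: mult_ac)
      then have gr: "grad pd (\<rho> t) x = - (2 * Q * cut' (z t x)) *\<^sub>R (x - x0)" by (simp add: grad_def vec_eq_iff)
      have Dt: "Dt \<rho> t x = 2 * Q * cut' (z t x) * (u t x \<bullet> (x - x0)) - \<rho> t x * divg pd (u t) x"
        unfolding Dt_rho(1)[OF t0'(1) x\<Omega>] gr by (simp del: vector_minus_component)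
      have "\<bar>(x - x0) \<bullet> u t x\<bar> \<le> 3 * norm (x - x0) * U"
        by (rule inner_le_3) (rule uU[OF t0' x\<Omega>])
      also have "\<dots> \<le> 3 * r * U" using x U(1) by (intro mult_right_mono mult_left_mono) (auto simp: K_def dist_norm norm_minus_commute)
      finally have "u t x \<bullet> (x - x0) \<le> 3 * r * U" by (simp add: inner_commute)
      then have "2 * Q * cut' (z t x) * (u t x \<bullet> (x - x0)) \<le> 2 * Q * cut' (z t x) * (3 * r * U)"
        using Q cut'_bounds(1) by (intro mult_left_mono) auto
      \<comment> \<open>The choice of c balances the transport of the bump against its recession,
        and the two terms with \<open>cut'\<close> cancel in the sign needed.\<close>
      also have "\<dots> = Q * (cut' (z t x) * c)" by (simp add: c_def)
      finally have 1: "2 * Q * cut' (z t x) * (u t x \<bullet> (x - x0)) \<le> Q * (cut' (z t x) * c)" .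
      have "- divg pd (u t) x \<le> h t" using h(2)[OF t x] by linarith
      then have 2: "\<rho> t x * (- divg pd (u t) x) \<le> \<rho> t x * h t" using rho_bounds[OF t0'(1) x\<Omega>] by (intro mult_left_mono) auto
      have "\<rho> t x \<le> W t x" using Q b0 by (simp add: W_def)
      then have 3: "\<rho> t x * h t \<le> W t x * h t" using h0[OF t] by (intro mult_right_mono)
      show "Dt \<rho> t x + Q * (cut' (z t x) * (- c)) \<le> h t * W t x + 0"
        unfolding Dt using 1 2 3 by (simp add: mult.commute[of "h t"])
    qed
    then obtain y where y: "y \<in> K" "W \<tau> y \<le> exp (integral {s..\<tau>} h) * (W s x0 + (0 + \<delta>) * (\<tau> - s))" by blast
    have "integral {s..\<tau>} h \<le> I"
    proof -
      have hi: "integrable (lebesgue_on {s..\<tau>}) h" by (rule continuous_imp_integrable_real[OF h(1)])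
      have "integral {s..\<tau>} h = (LINT t|lebesgue_on {s..\<tau>}. h t)" by (rule lebesgue_integral_eq_integral[symmetric, OF hi]) simp
      also have "\<dots> = (LINT t|lebesgue. indicator {s..\<tau>} t *\<^sub>R h t)" by (rule integral_restrict_space) simp
      also have "\<dots> \<le> (LINT t|lebesgue. indicator {0<..<1} t *\<^sub>R G t)"
      proof (rule integral_mono_AE)
        show "integrable lebesgue (\<lambda>t. indicator {s..\<tau>} t *\<^sub>R h t)" using hi by (subst (asm) integrable_restrict_space) auto
        show "integrable lebesgue (\<lambda>t. indicator {0<..<1} t *\<^sub>R G t)" using iG by (subst (asm) integrable_restrict_space) auto
        have "AE t in lebesgue. t \<in> {0<..<t0} \<longrightarrow> (\<forall>x\<in>cball x0 r. - C * (1 + sob_norm \<Omega> 1 2 (Dt u t)) \<le> divg pd (u t) x)"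
          using ae by (subst (asm) AE_lebesgue_on) auto
        then show "AE t in lebesgue. indicator {s..\<tau>} t *\<^sub>R h t \<le> indicator {0<..<1} t *\<^sub>R G t"
        proof eventually_elim
          case (elim t)
          show ?case
          proof (cases "t \<in> {s..\<tau>}")
            case True
            define S where "S = sob_norm \<Omega> 1 2 (Dt u t)"
            have S: "S \<ge> 0" by (simp add: S_def sob_norm_nonneg)
            obtain x where x: "x \<in> K" "h t = max 0 (- divg pd (u t) x)" using h(3)[OF True] by blast
            have "- divg pd (u t) x \<le> C * (1 + S)" using elim True s \<tau> x(1) by (auto simp: K_def S_def minus_le_iff)
            moreover have "0 \<le> C * (1 + S)" using C S by simp
            moreover have "C * (1 + S) \<le> G t"
            proof -
              have "0 \<le> (S - 1)\<^sup>2" by simp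
              then have "2 * S \<le> 1 + S\<^sup>2" by (simp add: power2_diff)
              moreover have "0 \<le> S\<^sup>2" by simp
              ultimately have "1 + S \<le> 2 + S\<^sup>2" by linarith
              then show ?thesis using C unfolding G_def S_def by (intro mult_left_mono) auto
            qed
            ultimately have "h t \<le> G t" using x(2) by simp
            then show ?thesis using True s \<tau> by simp
          next
            case False
            then show ?thesis using G0 by (auto simp: indicator_def)
          qed
        qed
      qed
      also have "\<dots> = I" unfolding I_def by (rule integral_restrict_space[symmetric]) simp
      finally show ?thesis .
    qed
    then have E: "exp (integral {s..\<tau>} h) \<le> exp I" by simp
    have "\<delta> * (\<tau> - s) \<le> \<delta> * 1" using \<delta> s \<tau> by (intro mult_left_mono) auto
    then have D: "W s x0 + (0 + \<delta>) * (\<tau> - s) \<le> 2 * \<delta>" using Wc[OF s(1)] b(2)[OF s(1,2)] by simp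
    have "W s x0 + (0 + \<delta>) * (\<tau> - s) \<ge> 0" using Wc[OF s(1)] rho_bounds[OF s(1) x0(1)] \<delta> s by simp
    then have "exp (integral {s..\<tau>} h) * (W s x0 + (0 + \<delta>) * (\<tau> - s)) \<le> exp I * (2 * \<delta>)"
      using E D by (intro mult_mono) auto
    then show ?thesis using y by (intro bexI[of _ y]) linarith+
  qed
  \<comment> \<open>K is compact and W is continuous at time \<tau>, so the bounds for all \<delta>
    yield one point with W \<le> 0. Density and penalty are nonnegative, so it is a genuine vacuum
    point.\<close>
  have "continuous_on K (W \<tau>)"
    using continuous_on_compose2[OF cW[OF \<tau>(1)] continuous_on_Pair1[of K \<tau>]] by fastforce
  then obtain y where y: "y \<in> K" "\<And>y'. y' \<in> K \<Longrightarrow> W \<tau> y \<le> W \<tau> y'"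
    using continuous_attains_inf[OF cK Kne] by blast
  have "W \<tau> y \<le> 0"
  proof (rule field_le_epsilon)
    fix e :: real assume e: "e > 0"
    obtain y' where "y' \<in> K" "W \<tau> y' \<le> exp I * (2 * (e / (2 * exp I)))" using key[of "e / (2 * exp I)"] e by auto
    then show "W \<tau> y \<le> 0 + e" using y(2)[of y'] by simp
  qed
  moreover have "0 \<le> Q * bump1 (z \<tau> y)" using Q b0 by simp
  ultimately have "\<rho> \<tau> y = 0" using rho_bounds[OF \<tau>(1) subsetD[OF K\<Omega> y(1)]] by (simp add: W_def)
  then show ?thesis using \<tau> y(1) K\<Omega> by blast
qed

end

section \<open>The exponential lower bound for the density gradient\<close>

text \<open>The constant is fixed before any solution: it comes from \<open>gradient_growth\<close>
  and the decay constants, which do not depend on the data or on q. The vacuum time \<tau> and the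
  velocity bound L do depend on the solution, but they only serve to show that inf \<rho>(t) = 0 and
  do not enter C.\<close>

theorem corollary1p3:
  fixes \<mu> lam \<kappa> R \<gamma> M \<rho>hat \<theta>hat \<epsilon> phat :: real
    and \<Omega> :: "(real^3) set"
  assumes "\<mu> > 0" "2 * \<mu> + 3 * lam \<ge> 0" "\<kappa> > 0" "R > 0" "\<gamma> > 1"
    and "smooth_bounded_domain \<Omega>" "simply_connected \<Omega>" "finite (components (frontier \<Omega>))"
    and "M > 0" "\<rho>hat > 2" "\<theta>hat > 1"
    and "smallness_constant \<mu> lam \<kappa> R \<gamma> \<Omega> M \<rho>hat \<theta>hat \<epsilon>"
    and "phat > 3"
  shows "\<exists>C>0. \<forall>q \<rho>0 u0 \<theta>0 \<rho> u \<theta>.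
    3 < q \<and> q < 6 \<and> admissible_data \<mu> lam R \<Omega> M \<rho>hat \<theta>hat q \<rho>0 u0 \<theta>0 \<and>
    initial_energy R \<gamma> \<Omega> \<rho>0 u0 \<theta>0 \<le> ennreal \<epsilon> \<and>
    (\<exists>x0\<in>\<Omega>. \<rho>0 x0 = 0) \<and>
    global_classical_solution \<mu> lam \<kappa> R \<gamma> \<Omega> \<rho>hat q \<rho>0 u0 \<theta>0 \<rho> u \<theta> \<longrightarrow>
    (\<forall>t\<ge>1. Lp_norm \<Omega> phat (grad pd (\<rho> t)) \<ge> C * exp (C * t))"
proof -
  have dom: "smooth_bounded_domain \<Omega>" by fact
  \<comment> \<open>The decay is taken with p = r = 1, since the interpolation works with the L1
    norm of \<rho> - 1.\<close>
  have "\<exists>C>0. \<exists>\<alpha>0>0. \<forall>q \<rho>0 u0 \<theta>0 \<rho> u \<theta>.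
           3 < q \<and> q < 6 \<and> admissible_data \<mu> lam R \<Omega> M \<rho>hat \<theta>hat q \<rho>0 u0 \<theta>0 \<and>
           initial_energy R \<gamma> \<Omega> \<rho>0 u0 \<theta>0 \<le> ennreal \<epsilon> \<and>
           global_classical_solution \<mu> lam \<kappa> R \<gamma> \<Omega> \<rho>hat q \<rho>0 u0 \<theta>0 \<rho> u \<theta> \<longrightarrow>
           (\<exists>\<theta>inf>0. \<forall>t\<ge>1.
              (\<lambda>x. \<rho> t x - 1) \<in> Lp \<Omega> 1 \<and> u t \<in> Sob \<Omega> 1 1 \<and> (\<lambda>x. \<theta> t x - \<theta>inf) \<in> Sob \<Omega> 2 2 \<and>
              Lp_norm \<Omega> 1 (\<lambda>x. \<rho> t x - 1) + (sob_norm \<Omega> 1 1 (u t))\<^sup>2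
                + (sob_norm \<Omega> 2 2 (\<lambda>x. \<theta> t x - \<theta>inf))\<^sup>2 \<le> C * exp (- \<alpha>0 * t))"
    using assms(12) unfolding smallness_constant_def by (elim conjE allE[of _ 1] impE) auto
  then obtain C1 \<alpha> where C1: "C1 > 0" and \<alpha>: "\<alpha> > 0" and decay: "\<And>q \<rho>0 u0 \<theta>0 \<rho> u \<theta>.
           3 < q \<and> q < 6 \<and> admissible_data \<mu> lam R \<Omega> M \<rho>hat \<theta>hat q \<rho>0 u0 \<theta>0 \<and>
           initial_energy R \<gamma> \<Omega> \<rho>0 u0 \<theta>0 \<le> ennreal \<epsilon> \<and>
           global_classical_solution \<mu> lam \<kappa> R \<gamma> \<Omega> \<rho>hat q \<rho>0 u0 \<theta>0 \<rho> u \<theta> \<Longrightarrow>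
           (\<exists>\<theta>inf>0. \<forall>t\<ge>1.
              (\<lambda>x. \<rho> t x - 1) \<in> Lp \<Omega> 1 \<and> u t \<in> Sob \<Omega> 1 1 \<and> (\<lambda>x. \<theta> t x - \<theta>inf) \<in> Sob \<Omega> 2 2 \<and>
              Lp_norm \<Omega> 1 (\<lambda>x. \<rho> t x - 1) + (sob_norm \<Omega> 1 1 (u t))\<^sup>2
                + (sob_norm \<Omega> 2 2 (\<lambda>x. \<theta> t x - \<theta>inf))\<^sup>2 \<le> C1 * exp (- \<alpha> * t))"
    by metis
  obtain C where C: "C > 0"
    "\<And>f t. (\<And>x. x \<in> \<Omega> \<Longrightarrow> f differentiable (at x)) \<Longrightarrow> (\<And>i. continuous_on \<Omega> (pd i f)) \<Longrightarrow> grad pd f \<in> Lp \<Omega> phat \<Longrightarrow>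
      integrable (lebesgue_on \<Omega>) (\<lambda>x. f x - 1) \<Longrightarrow> (LINT x|lebesgue_on \<Omega>. \<bar>f x - 1\<bar>) \<le> C1 * exp (- \<alpha> * t) \<Longrightarrow>
      (LINT x|lebesgue_on \<Omega>. f x) = measure lebesgue \<Omega> \<Longrightarrow> (\<And>e. e > 0 \<Longrightarrow> \<exists>y\<in>\<Omega>. f y < e) \<Longrightarrow> t \<ge> 0 \<Longrightarrow>
      C * exp (C * t) \<le> Lp_norm \<Omega> phat (grad pd f)"
    by (rule gradient_growth[OF dom assms(13) \<alpha> C1]) (rule that; blast)
  show ?thesis
  proof (intro exI[of _ C] conjI allI impI C(1))
    fix q :: real and \<rho>0 \<theta>0 :: "real^3 \<Rightarrow> real" and u0 :: "real^3 \<Rightarrow> real^3"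
      and \<rho> \<theta> :: "real \<Rightarrow> real^3 \<Rightarrow> real" and u :: "real \<Rightarrow> real^3 \<Rightarrow> real^3" and t :: real
    assume h: "3 < q \<and> q < 6 \<and> admissible_data \<mu> lam R \<Omega> M \<rho>hat \<theta>hat q \<rho>0 u0 \<theta>0 \<and>
      initial_energy R \<gamma> \<Omega> \<rho>0 u0 \<theta>0 \<le> ennreal \<epsilon> \<and> (\<exists>x0\<in>\<Omega>. \<rho>0 x0 = 0) \<and>
      global_classical_solution \<mu> lam \<kappa> R \<gamma> \<Omega> \<rho>hat q \<rho>0 u0 \<theta>0 \<rho> u \<theta>" and t: "1 \<le> t"
    then have sol: "global_classical_solution \<mu> lam \<kappa> R \<gamma> \<Omega> \<rho>hat q \<rho>0 u0 \<theta>0 \<rho> u \<theta>" by blast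
    interpret continuity_flow \<Omega> \<rho> u "2 * \<rho>hat"
    proof
      show "C1_tx \<Omega> \<rho>" "C1_tx \<Omega> u" using sol by (auto simp: global_classical_solution_def C12_tx_def)
      show "Dt \<rho> t x + divg pd (\<lambda>y. \<rho> t y *\<^sub>R u t y) x = 0" if "0 < t" "x \<in> \<Omega>" for t x
        using sol that unfolding global_classical_solution_def NS_equations_def by blast
      show "0 \<le> \<rho> t x \<and> \<rho> t x \<le> 2 * \<rho>hat" if "0 < t" "x \<in> \<Omega>" for t x
        using sol that unfolding global_classical_solution_def by blast
    qed (rule dom)
    interpret ns_solution \<Omega> \<rho> u \<rho>hat \<mu> lam \<kappa> R \<gamma> M \<theta>hat q \<rho>0 \<theta>0 u0 \<theta>
      by unfold_locales (use h assms in auto)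
    obtain x0 where "x0 \<in> \<Omega>" "\<rho>0 x0 = 0" using h by blast
    \<comment> \<open>\<tau> < 1 \<le> t, so one application of \<open>vacuum_persists\<close> on
      [\<tau>, t], away from the irregular initial time, reaches every t considered.\<close>
    then obtain \<tau> y where \<tau>: "0 < \<tau>" "\<tau> < 1" and y: "y \<in> \<Omega>" "\<rho> \<tau> y = 0" using initial_vacuum_transported by blast
    obtain L where L: "\<And>s. s \<in> {\<tau>..t} \<Longrightarrow> tangential \<Omega> L (u s)" using tangential_ex[of \<tau> t] \<tau> t by (meson less_imp_le order_trans)
    have t0: "t > 0" using t by simp
    obtain \<theta>inf where "(\<lambda>x. \<rho> t x - 1) \<in> Lp \<Omega> 1"
      and le: "Lp_norm \<Omega> 1 (\<lambda>x. \<rho> t x - 1) + (sob_norm \<Omega> 1 1 (u t))\<^sup>2 + (sob_norm \<Omega> 2 2 (\<lambda>x. \<theta> t x - \<theta>inf))\<^sup>2 \<le> C1 * exp (- \<alpha> * t)"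
      using decay[of q \<rho>0 u0 \<theta>0 \<rho> u \<theta>] h t by blast
    then have "(\<lambda>x. \<rho> t x - 1) \<in> borel_measurable (lebesgue_on \<Omega>)" "integrable (lebesgue_on \<Omega>) (\<lambda>x. norm (\<rho> t x - 1))"
      by (simp_all add: Lp_def)
    then have int: "integrable (lebesgue_on \<Omega>) (\<lambda>x. \<rho> t x - 1)" using integrable_norm_iff by blast
    have "Lp_norm \<Omega> 1 (\<lambda>x. \<rho> t x - 1) = (LINT x|lebesgue_on \<Omega>. \<bar>\<rho> t x - 1\<bar>)" by (simp add: Lp_norm_def)
    then have J: "(LINT x|lebesgue_on \<Omega>. \<bar>\<rho> t x - 1\<bar>) \<le> C1 * exp (- \<alpha> * t)"
      using le zero_le_power2[of "sob_norm \<Omega> 1 1 (u t)"] zero_le_power2[of "sob_norm \<Omega> 2 2 (\<lambda>x. \<theta> t x - \<theta>inf)"] by linarith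
    show "C * exp (C * t) \<le> Lp_norm \<Omega> phat (grad pd (\<rho> t))"
    proof (rule C(2)[OF _ _ _ int J])
      show "\<rho> t differentiable (at x)" if "x \<in> \<Omega>" for x by (rule rho_diff[OF t0 that])
      show "continuous_on \<Omega> (pd i (\<rho> t))" for i by (rule rho_pd_cont[OF t0])
      show "grad pd (\<rho> t) \<in> Lp \<Omega> phat" using assms(13) by (intro grad_rho_Lp t0) simp
      show "(LINT x|lebesgue_on \<Omega>. \<rho> t x) = measure lebesgue \<Omega>" by (rule mass_eq[OF t0])
      show "\<exists>y\<in>\<Omega>. \<rho> t y < e" if "e > 0" for e
        using \<tau> t by (intro vacuum_persists[OF \<tau>(1) _ L y that]) auto
    qed (use t in simp)
  qed
qed

end
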